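(* Let $\lambda>0$ and $a\in\mathbb{R}$. Suppose that $\lambda\notin\mathcal{N}$ and $a\notin\mathcal{N}_1$, where $$\mathcal{N}=\{j^2\pi^2+k^2\pi^2: j,k\in\mathbb{Z}^+,\ j\neq k\},\qquad \mathcal{N}_1=\{-k^4\pi^4+\lambda k^2\pi^2+j^4\pi^4-\lambda j^2\pi^2: j,k\in\mathbb{Z}^+\}.$$ Then the problem $$ \begin{cases} k_{xxxx}+\lambda k_{xx}-k_{yyyy}-\lambda k_{yy}+ak=a\,\delta(x-y) & \text{in }(0,1)\times(0,1),\\ k(x,0)=k(x,1)=0,\quad k_{yy}(x,0)=k_{yy}(x,1)=0,\quad k_y(x,0)=0 & \text{for }x\in(0,1),\\ k(0,y)=k(1,y)=0,\quad k_{xx}(1,y)=0 & \text{for }y\in(0,1) \end{cases} $$ (with solutions understood in the sense given in the context) has a unique solution in $\mathcal{G}$.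
   Context: $\mathbb{Z}^+=\{1,2,3,\dots\}$; $\delta(x-y)$ is the Dirac measure on the diagonal of $[0,1]\times[0,1]$. Let $\mathcal{E}$ be the set of $\rho\in C^\infty([0,1]\times[0,1])$ with $\rho(0,y)=\rho(1,y)=\rho(x,0)=\rho(x,1)=0$ and $\rho_x(0,y)=\rho_{xx}(0,y)=\rho_{xx}(1,y)=\rho_{yy}(x,1)=0$ for all $x,y\in[0,1]$. Let $\mathcal{G}$ be the set of $k\in H^2((0,1)\times(0,1))\cap H^1_0((0,1)\times(0,1))$ such that $x\mapsto k_{xx}(x,\cdot)$ belongs to $C^0([0,1];L^2(0,1))$, $y\mapsto k_{yy}(\cdot,y)$ belongs to $C^0([0,1];L^2(0,1))$, and $k_{yy}(\cdot,0)=k_{yy}(\cdot,1)=0$ in $L^2(0,1)$. A function $k\in\mathcal{G}$ is called a solution of the problem if for every $\rho\in\mathcal{E}$ $$\int_0^1\int_0^1\big[\rho_{xxxx}+\lambda\rho_{xx}-\rho_{yyyy}-\lambda\rho_{yy}+a\rho\big](x,y)\,k(x,y)\,dx\,dy-\int_0^1a\,\rho(x,x)\,dx=0.$$ *)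

theory Defs
  imports "HOL-Analysis.Analysis"
begin

abbreviation unit_open :: "real set"
  where "unit_open \<equiv> {0<..<1}"

abbreviation open_square :: "(real \<times> real) set"
  where "open_square \<equiv> unit_open \<times> unit_open"

abbreviation closed_square :: "(real \<times> real) set"
  where "closed_square \<equiv> {0..1} \<times> {0..1}"

text \<open>Partial derivatives on the closed unit square, one-sided at its sides. They are meaningful
  at points of the closed square, and depend only on the values of the function there.\<close>

definition Dx :: "(real \<times> real \<Rightarrow> real) \<Rightarrow> real \<times> real \<Rightarrow> real"
  where "Dx f = (\<lambda>(x, y). vector_derivative (\<lambda>t. f (t, y)) (at x within {0..1}))"

definition Dy :: "(real \<times> real \<Rightarrow> real) \<Rightarrow> real \<times> real \<Rightarrow> real"
  where "Dy f = (\<lambda>(x, y). vector_derivative (\<lambda>t. f (x, t)) (at y within {0..1}))"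

primrec C_n :: "nat \<Rightarrow> (real \<times> real \<Rightarrow> real) \<Rightarrow> bool"
  where
    "C_n 0 f \<longleftrightarrow> continuous_on closed_square f"
  | "C_n (Suc n) f \<longleftrightarrow> continuous_on closed_square f \<and>
       (\<forall>x\<in>{0..1}. \<forall>y\<in>{0..1}.
          (\<lambda>t. f (t, y)) differentiable (at x within {0..1}) \<and>
          (\<lambda>t. f (x, t)) differentiable (at y within {0..1})) \<and>
       C_n n (Dx f) \<and> C_n n (Dy f)"

definition C_infinity :: "(real \<times> real \<Rightarrow> real) \<Rightarrow> bool"
  where "C_infinity f \<longleftrightarrow> (\<forall>n. C_n n f)"

definition test_function :: "(real \<times> real \<Rightarrow> real) \<Rightarrow> bool"
  where "test_function \<phi> \<longleftrightarrow> C_infinity \<phi> \<and>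
    (\<exists>K. compact K \<and> K \<subseteq> open_square \<and> (\<forall>p \<in> closed_square - K. \<phi> p = 0))"

text \<open>Elements of \<open>L\<^sup>2(S)\<close> are represented by functions; only their values almost everywhere
  on \<open>S\<close> matter.\<close>

definition L2 :: "'a::euclidean_space set \<Rightarrow> ('a \<Rightarrow> real) set"
  where "L2 S = {f. f \<in> borel_measurable (lebesgue_on S) \<and>
                    integrable (lebesgue_on S) (\<lambda>x. (f x)\<^sup>2)}"

definition L2_norm :: "'a::euclidean_space set \<Rightarrow> ('a \<Rightarrow> real) \<Rightarrow> real"
  where "L2_norm S f = sqrt (\<integral>x. (f x)\<^sup>2 \<partial>lebesgue_on S)"

text \<open>\<open>has_weak_deriv i j k w\<close>: \<open>w \<in> L\<^sup>2\<close> is the weak derivative of \<open>k \<in> L\<^sup>2\<close> on the open unit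
  square, of order \<open>i\<close> in the first and \<open>j\<close> in the second variable.\<close>

definition has_weak_deriv ::
    "nat \<Rightarrow> nat \<Rightarrow> (real \<times> real \<Rightarrow> real) \<Rightarrow> (real \<times> real \<Rightarrow> real) \<Rightarrow> bool"
  where "has_weak_deriv i j k w \<longleftrightarrow> k \<in> L2 open_square \<and> w \<in> L2 open_square \<and>
    (\<forall>\<phi>. test_function \<phi> \<longrightarrow>
       (\<integral>p. k p * (Dx ^^ i) ((Dy ^^ j) \<phi>) p \<partial>lebesgue_on open_square) =
       (-1) ^ (i + j) * (\<integral>p. w p * \<phi> p \<partial>lebesgue_on open_square))"

definition H2 :: "(real \<times> real \<Rightarrow> real) set"
  where "H2 = {k. \<forall>i j. i + j \<le> 2 \<longrightarrow> (\<exists>w. has_weak_deriv i j k w)}"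

text \<open>\<open>H\<^sub>0\<^sup>1\<close> is the closure of the test functions in \<open>H\<^sup>1\<close>.\<close>

definition H1_0 :: "(real \<times> real \<Rightarrow> real) set"
  where "H1_0 = {k. \<exists>kx ky \<phi>. has_weak_deriv 1 0 k kx \<and> has_weak_deriv 0 1 k ky \<and>
    (\<forall>n::nat. test_function (\<phi> n)) \<and>
    (\<lambda>n. L2_norm open_square (\<lambda>p. \<phi> n p - k p)) \<longlonglongrightarrow> 0 \<and>
    (\<lambda>n. L2_norm open_square (\<lambda>p. Dx (\<phi> n) p - kx p)) \<longlonglongrightarrow> 0 \<and>
    (\<lambda>n. L2_norm open_square (\<lambda>p. Dy (\<phi> n) p - ky p)) \<longlonglongrightarrow> 0}"

text \<open>\<open>C\<^sup>0([0,1]; L\<^sup>2(0,1))\<close>\<close>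

definition C0_L2 :: "(real \<Rightarrow> real \<Rightarrow> real) set"
  where "C0_L2 = {g. (\<forall>s\<in>{0..1}. g s \<in> L2 unit_open) \<and>
    (\<forall>s\<in>{0..1}. ((\<lambda>r. L2_norm unit_open (\<lambda>t. g r t - g s t)) \<longlongrightarrow> 0) (at s within {0..1}))}"

text \<open>The weak derivatives \<open>k\<^sub>x\<^sub>x\<close> and \<open>k\<^sub>y\<^sub>y\<close> are only determined almost everywhere, so the continuity
  of \<open>x \<mapsto> k\<^sub>x\<^sub>x(x,\<cdot>)\<close> and \<open>y \<mapsto> k\<^sub>y\<^sub>y(\<cdot>,y)\<close> means agreement for almost every \<open>x\<close> (resp. \<open>y\<close>) with a
  continuous map \<open>g\<close> (resp. \<open>h\<close>) into \<open>L\<^sup>2(0,1)\<close>. That map is unique, and \<open>k\<^sub>y\<^sub>y(\<cdot>,0)\<close> and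
  \<open>k\<^sub>y\<^sub>y(\<cdot>,1)\<close> are its values at the end points.\<close>

definition \<G> :: "(real \<times> real \<Rightarrow> real) set"
  where "\<G> = {k. k \<in> H2 \<inter> H1_0 \<and>
    (\<exists>kxx g. has_weak_deriv 2 0 k kxx \<and> g \<in> C0_L2 \<and>
       (AE x in lebesgue_on unit_open. AE y in lebesgue_on unit_open. g x y = kxx (x, y))) \<and>
    (\<exists>kyy h. has_weak_deriv 0 2 k kyy \<and> h \<in> C0_L2 \<and>
       (AE y in lebesgue_on unit_open. AE x in lebesgue_on unit_open. h y x = kyy (x, y)) \<and>
       (AE x in lebesgue_on unit_open. h 0 x = 0) \<and>
       (AE x in lebesgue_on unit_open. h 1 x = 0))}"

definition \<E> :: "(real \<times> real \<Rightarrow> real) set"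
  where "\<E> = {\<rho>. C_infinity \<rho> \<and>
    (\<forall>x\<in>{0..1}. \<forall>y\<in>{0..1}.
       \<rho> (0, y) = 0 \<and> \<rho> (1, y) = 0 \<and> \<rho> (x, 0) = 0 \<and> \<rho> (x, 1) = 0 \<and>
       Dx \<rho> (0, y) = 0 \<and> (Dx ^^ 2) \<rho> (0, y) = 0 \<and> (Dx ^^ 2) \<rho> (1, y) = 0 \<and>
       (Dy ^^ 2) \<rho> (x, 1) = 0)}"

text \<open>Solutions, in the transposition sense, of
  \<open>k\<^sub>x\<^sub>x\<^sub>x\<^sub>x + \<lambda> k\<^sub>x\<^sub>x - k\<^sub>y\<^sub>y\<^sub>y\<^sub>y - \<lambda> k\<^sub>y\<^sub>y + a k = a \<delta>(x - y)\<close> in the open unit square with the boundary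
  conditions \<open>k(x,0) = k(x,1) = k\<^sub>y\<^sub>y(x,0) = k\<^sub>y\<^sub>y(x,1) = k\<^sub>y(x,0) = 0\<close> and
  \<open>k(0,y) = k(1,y) = k\<^sub>x\<^sub>x(1,y) = 0\<close>.\<close>

definition is_solution :: "real \<Rightarrow> real \<Rightarrow> (real \<times> real \<Rightarrow> real) \<Rightarrow> bool"
  where "is_solution lam a k \<longleftrightarrow> k \<in> \<G> \<and>
    (\<forall>\<rho>\<in>\<E>.
       (\<integral>p. ((Dx ^^ 4) \<rho> p + lam * (Dx ^^ 2) \<rho> p - (Dy ^^ 4) \<rho> p - lam * (Dy ^^ 2) \<rho> p + a * \<rho> p)
              * k p \<partial>lebesgue_on open_square)
       - (\<integral>x. a * \<rho> (x, x) \<partial>lebesgue_on unit_open) = 0)"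

end

theory Submission
  imports Defs "HOL-Computational_Algebra.Polynomial"
begin

text \<open>Expand \<open>k\<close> in the double sine system with frequencies \<open>\<nu>\<^sub>n = n \<pi>\<close>, put \<open>\<beta>\<^sub>n = \<nu>\<^sub>n\<^sup>4 - \<lambda> \<nu>\<^sub>n\<^sup>2\<close>, and allow an
  unknown value of \<open>k\<^sub>x\<^sub>x(0, y)\<close>. The equation then determines \<open>k\<close> up to one unknown \<open>d\<^sub>m\<close> for each \<open>m\<close>:
  the coefficients of \<open>k\<close> are \<open>2 (\<delta>\<^sub>n\<^sub>m + d\<^sub>m n / (m (\<beta>\<^sub>n - \<beta>\<^sub>m + a)))\<close>. The remaining condition
  \<open>k\<^sub>y(x, 0) = 0\<close> is the infinite Cauchy system \<open>\<Sum>m. d\<^sub>m / (\<beta>\<^sub>n - \<beta>\<^sub>m + a) = - 1\<close> for all \<open>n\<close>. It is solved by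
  \<open>d\<^sub>m = - a \<Prod>n \<noteq> m. (1 - a / (\<beta>\<^sub>m - \<beta>\<^sub>n))\<close>, and its bounded solutions are unique; both follow from finite
  partial fraction expansions by dominated convergence. The resulting double series has the required
  regularity. Conversely, the difference of two solutions has coefficients of the form
  \<open>D\<^sub>m n / (m (\<beta>\<^sub>n - \<beta>\<^sub>m + a))\<close>, where \<open>D\<close> solves the Cauchy system up to a common factor on the right.
  That factor is \<open>0\<close> because \<open>D\<^sub>m \<rightarrow> 0\<close> by Bessel's inequality, whereas \<open>d\<^sub>m \<rightarrow> - a \<noteq> 0\<close>.\<close>

section \<open>Weighted sums and partial fractions\<close>

text \<open>The sine system fits k = k_xx = 0 and k = k_yy = 0 on the sides, but the problem leaves
  k_xx free at x = 0 and imposes one condition too many at y = 0. Integrating sine n against k_xxxx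
  leaves \<open>nu n\<close> times a sine coefficient of k_xx(0, y), hence the factor n. The
  condition k_y(x, 0) = 0 weighs the coefficients with m, which the normalisation 1 / m cancels.
  After division by n there remains the pure Cauchy matrix \<open>1 / (x n - y m)\<close> with x n =
  \<beta> n and y m = \<beta> m - a. Such matrices are inverted by rational functions with
  prescribed zeros and poles; the quartic growth of \<beta> makes their products converge. The
  hypothesis on \<lambda> keeps the \<beta> n distinct, the one on a keeps zeros and poles apart.
  Regularity is borderline. For n \<noteq> m the inverse of \<beta> n - \<beta> m has size 1 / (|n -
  m| (n + m)^3), and two derivatives use up almost all of it. The second derivatives are therefore
  built as L^2 series in one variable, uniformly in the other, which also yields the continuity into
  L^2 that \<open>\<G>\<close> demands.\<close>

lemma powr_neg_summable: "e > 1 \<Longrightarrow> summable (\<lambda>k. real (Suc k) powr (- e))"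
  using summable_Suc_iff[of "\<lambda>k. real k powr (- e)"] summable_real_powr_iff[of "- e"] by simp

text \<open>Sums over \<open>n\<close> of \<open>1 / (\<bar>n - m\<bar> (n + m)\<^sup>3)\<close> produce logarithms. Moving a factor \<open>(n + m) powr (1/4)\<close>
  onto \<open>\<bar>n - m\<bar>\<close> avoids them: the weight \<open>dist_wt\<close> is summable uniformly in \<open>m\<close>, and what is lost is only
  the exponent \<open>- 3/4\<close> in \<open>decay\<close>, which is still square summable.\<close>

definition dist_wt :: "nat \<Rightarrow> nat \<Rightarrow> real"
  where "dist_wt n m = (if n = m then 1 else \<bar>real n - real m\<bar> powr (-5/4))"

text \<open>Bounds the sum of \<open>dist_wt n m\<close> over n for every m: the 1 accounts for n =
  m, the factor 2 for the two sides of m.\<close>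

definition dist_wt_sum :: real
  where "dist_wt_sum = 1 + 2 * (\<Sum>k. real (Suc k) powr (-5/4))"

lemma dist_wt_commute: "dist_wt n m = dist_wt m n"
  by (simp add: dist_wt_def abs_minus_commute)

lemma dist_wt_nonneg: "dist_wt n m \<ge> 0"
  by (simp add: dist_wt_def)

lemma sum_powr_le:
  assumes "finite F" "inj_on f F" "e > 1"
  shows "(\<Sum>n\<in>F. real (Suc (f n)) powr (- e)) \<le> (\<Sum>k. real (Suc k) powr (- e))"
proof -
  have "(\<Sum>n\<in>F. real (Suc (f n)) powr (- e)) = (\<Sum>k\<in>f ` F. real (Suc k) powr (- e))"
    using assms by (simp add: sum.reindex)
  also have "\<dots> \<le> (\<Sum>k. real (Suc k) powr (- e))"
    using assms by (intro sum_le_suminf powr_neg_summable) auto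
  finally show ?thesis .
qed

text \<open>On each side of m the distance minus one is injective in n, so both halves are dominated
  by one fixed series, whatever m is.\<close>

lemma sum_dist_wt_le:
  assumes "finite F" shows "(\<Sum>n\<in>F. dist_wt n m) \<le> dist_wt_sum"
proof -
  have "F = (F \<inter> {m}) \<union> (F \<inter> {..<m}) \<union> (F \<inter> {m<..})" by auto
  hence "(\<Sum>n\<in>F. dist_wt n m) = (\<Sum>n\<in>(F \<inter> {m}) \<union> (F \<inter> {..<m}) \<union> (F \<inter> {m<..}). dist_wt n m)" by simp
  also have "\<dots> = (\<Sum>n\<in>F \<inter> {m}. dist_wt n m) + (\<Sum>n\<in>F \<inter> {..<m}. dist_wt n m) + (\<Sum>n\<in>F \<inter> {m<..}. dist_wt n m)"
    using assms by (subst sum.union_disjoint; (subst sum.union_disjoint)?; auto)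
  finally have *: "(\<Sum>n\<in>F. dist_wt n m) = \<dots>" .
  have 1: "(\<Sum>n\<in>F \<inter> {m}. dist_wt n m) \<le> 1"
    by (cases "m \<in> F") (auto simp: dist_wt_def)
  have "(\<Sum>n\<in>F \<inter> {..<m}. dist_wt n m) = (\<Sum>n\<in>F \<inter> {..<m}. real (Suc (m - n - 1)) powr (-(5/4)))"
    by (rule sum.cong) (auto simp: dist_wt_def of_nat_diff)
  also have "\<dots> \<le> (\<Sum>k. real (Suc k) powr (-(5/4)))"
    using assms by (intro sum_powr_le[of _ "\<lambda>n. m - n - 1"]) (auto simp: inj_on_def)
  finally have 2: "(\<Sum>n\<in>F \<inter> {..<m}. dist_wt n m) \<le> (\<Sum>k. real (Suc k) powr (-5/4))" by simp
  have "(\<Sum>n\<in>F \<inter> {m<..}. dist_wt n m) = (\<Sum>n\<in>F \<inter> {m<..}. real (Suc (n - m - 1)) powr (-(5/4)))"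
    by (rule sum.cong) (auto simp: dist_wt_def of_nat_diff)
  also have "\<dots> \<le> (\<Sum>k. real (Suc k) powr (-(5/4)))"
    using assms by (intro sum_powr_le[of _ "\<lambda>n. n - m - 1"]) (auto simp: inj_on_def)
  finally have 3: "(\<Sum>n\<in>F \<inter> {m<..}. dist_wt n m) \<le> (\<Sum>k. real (Suc k) powr (-5/4))" by simp
  show ?thesis using * 1 2 3 by (simp add: dist_wt_sum_def)
qed

lemma dist_wt_sum_ge_1: "dist_wt_sum \<ge> 1"
  using sum_dist_wt_le[of "{0}" 0] by (simp add: dist_wt_def)

lemma finite_sums_bounded_summable_on:
  fixes f :: "'a \<Rightarrow> real"
  assumes "\<And>x. x \<in> A \<Longrightarrow> f x \<ge> 0" "\<And>F. finite F \<Longrightarrow> F \<subseteq> A \<Longrightarrow> sum f F \<le> B"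
  shows "f summable_on A" "infsum f A \<le> B"
proof -
  show "f summable_on A"
    by (rule nonneg_bdd_above_summable_on) (use assms in \<open>auto intro!: bdd_aboveI[of _ B]\<close>)
  then show "infsum f A \<le> B"
    by (rule infsum_le_finite_sums) (use assms in auto)
qed

lemma dist_wt_summable_on: "(\<lambda>n. dist_wt n m) summable_on A" "infsum (\<lambda>n. dist_wt n m) A \<le> dist_wt_sum"
  using finite_sums_bounded_summable_on[of A "\<lambda>n. dist_wt n m" dist_wt_sum] dist_wt_nonneg sum_dist_wt_le by auto

definition decay :: "real \<Rightarrow> real" where "decay s = s powr (-3/4)"

lemma decay_antimono: "0 < s \<Longrightarrow> s \<le> t \<Longrightarrow> decay t \<le> decay s"
  unfolding decay_def by (rule powr_mono2') auto

lemma decay_le_1: "1 \<le> s \<Longrightarrow> decay s \<le> 1"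
  using decay_antimono[of 1 s] by (simp add: decay_def)

text \<open>The distance is at most s, so a quarter power of it can be traded for a quarter power of
  s. The resulting \<open>s powr (-11/4)\<close> is kept as \<open>decay s\<close> over a square,
  because the square is what two derivatives of the kernel consume.\<close>

lemma inverse_gap_le:
  assumes "n \<noteq> m"
  defines "s \<equiv> real (Suc n) + real (Suc m)"
  shows "1 / (\<bar>real n - real m\<bar> * s ^ 3) \<le> dist_wt n m * decay s / s\<^sup>2"
proof -
  define D where "D = \<bar>real n - real m\<bar>"
  have D: "D > 0" "D \<le> s" "s > 0" using assms by (auto simp: D_def s_def)
  have "1 / D = D powr (-5/4) * D powr (1/4)"
    using D by (subst powr_add[symmetric]) (simp add: powr_minus_divide)
  also have "\<dots> \<le> D powr (-5/4) * s powr (1/4)"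
    using D by (intro mult_left_mono powr_mono2) auto
  finally have 1: "1 / D \<le> dist_wt n m * s powr (1/4)"
    using assms by (simp add: dist_wt_def D_def)
  have 2: "s powr (1/4) = decay s * s"
    using D powr_add[of s "-3/4" 1] by (simp add: decay_def)
  have "1 / (D * s ^ 3) = (1 / D) / s ^ 3" by simp
  also have "\<dots> \<le> (dist_wt n m * (decay s * s)) / s ^ 3"
    using 1 2 D by (intro divide_right_mono) auto
  also have "\<dots> = dist_wt n m * decay s / s\<^sup>2" using D by (simp add: power3_eq_cube power2_eq_square)
  finally show ?thesis by (simp add: D_def)
qed

text \<open>Indices start at 0, so index n carries the frequency (n + 1) pi; hence the
  \<open>Suc\<close> in the weights.\<close>

definition nu :: "nat \<Rightarrow> real" where "nu n = real (Suc n) * pi"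

definition beta :: "real \<Rightarrow> nat \<Rightarrow> real"
  where "beta lam n = nu n ^ 4 - lam * (nu n)\<^sup>2"

text \<open>The difference factors as (nu n^2 - nu m^2) (nu n^2 + nu m^2 - lam). As soon as one
  index is large, the last factor is comparable to (n + m)^2 and a is absorbed. Finitely many pairs
  remain, and there the hypothesis gives a positive minimum.\<close>

lemma beta_gap_lower_bound:
  assumes ne: "\<And>n m. n \<noteq> m \<Longrightarrow> beta lam n - beta lam m + a \<noteq> 0"
  obtains c where "c > 0"
    "\<And>n m. n \<noteq> m \<Longrightarrow> c * (\<bar>real n - real m\<bar> * (real (Suc n) + real (Suc m)) ^ 3) \<le> \<bar>beta lam n - beta lam m + a\<bar>"
proof -
  define s where "s = (\<lambda>n m. real (Suc n) + real (Suc m))"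
  define D where "D = (\<lambda>n m. \<bar>real n - real m\<bar>)"
  \<comment> \<open>If one index is at least K, then s exceeds |lam| + |a|, which is enough to
    dominate both parameters.\<close>
  define K where "K = nat \<lceil>\<bar>lam\<bar> + \<bar>a\<bar> + 1\<rceil>"
  have K: "real K \<ge> \<bar>lam\<bar> + \<bar>a\<bar> + 1" unfolding K_def by linarith
  define f where "f = (\<lambda>(n,m). \<bar>beta lam n - beta lam m + a\<bar> / (D n m * s n m ^ 3))"
  define P where "P = {(n,m). n \<noteq> m \<and> n < K \<and> m < K}"
  have "P \<subseteq> {..<K} \<times> {..<K}" by (auto simp: P_def)
  hence finP: "finite P" by (rule finite_subset) auto
  \<comment> \<open>The inserted 1 keeps the set nonempty and gives c \<le> 1, the constant
    available for the far pairs.\<close>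
  define c where "c = Min (insert 1 (f ` P))"
  have Dpos: "D n m \<ge> 1" if "n \<noteq> m" for n m using that by (auto simp: D_def)
  have spos: "s n m > 0" for n m by (simp add: s_def)
  have "f p > 0" if "p \<in> P" for p
    using that Dpos spos ne unfolding f_def P_def by (auto intro!: divide_pos_pos mult_pos_pos simp: less_le_trans[OF zero_less_one])
  hence cpos: "c > 0" using finP by (auto simp: c_def)
  have c1: "c \<le> 1" using finP by (simp add: c_def)
  have "c * (D n m * s n m ^ 3) \<le> \<bar>beta lam n - beta lam m + a\<bar>" if nm: "n \<noteq> m" for n m
  proof (cases "n < K \<and> m < K")
    case True
    hence "c \<le> f (n,m)" using finP nm by (auto simp: c_def P_def intro!: Min_le)
    moreover have "D n m * s n m ^ 3 > 0" using Dpos[OF nm] spos[of n m] by (simp add: zero_less_mult_iff)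
    ultimately show ?thesis by (simp add: f_def pos_le_divide_eq)
  next
    case False
    have sK: "s n m \<ge> \<bar>lam\<bar> + \<bar>a\<bar> + 1" using False K by (auto simp: s_def)
    hence s1: "s n m \<ge> 1" by simp
    have eq: "beta lam n - beta lam m = (real n - real m) * s n m * (pi\<^sup>2 * ((nu n)\<^sup>2 + (nu m)\<^sup>2 - lam))"
      unfolding beta_def nu_def s_def by (simp add: algebra_simps power2_eq_square power4_eq_xxxx)
    have pi9: "pi\<^sup>2 \<ge> 9" using power_mono[of 3 pi 2] pi_gt3 by simp
    have "(nu n)\<^sup>2 + (nu m)\<^sup>2 = pi\<^sup>2 * ((real (Suc n))\<^sup>2 + (real (Suc m))\<^sup>2)"
      by (simp only: nu_def power_mult_distrib distrib_left mult.commute)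
    moreover have "(real (Suc n))\<^sup>2 + (real (Suc m))\<^sup>2 \<ge> (s n m)\<^sup>2 / 2"
    proof -
      have "(u + v)\<^sup>2 / 2 \<le> u\<^sup>2 + v\<^sup>2" for u v :: real
        using sum_squares_bound[of u v] by (simp add: power2_sum field_simps)
      thus ?thesis unfolding s_def .
    qed
    ultimately have "(nu n)\<^sup>2 + (nu m)\<^sup>2 \<ge> pi\<^sup>2 * ((s n m)\<^sup>2 / 2)"
      by (simp del: times_divide_eq_right)
    moreover have "pi\<^sup>2 * ((s n m)\<^sup>2 / 2) \<ge> 9 * ((s n m)\<^sup>2 / 2)"
      using pi9 by (intro mult_right_mono) auto
    moreover have "(s n m)\<^sup>2 \<ge> s n m" using s1 by (simp add: power2_eq_square)
    ultimately have lower: "(nu n)\<^sup>2 + (nu m)\<^sup>2 - lam \<ge> 2 * (s n m)\<^sup>2" using sK by linarith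
    have "2 * (s n m)\<^sup>2 * 1 \<le> ((nu n)\<^sup>2 + (nu m)\<^sup>2 - lam) * pi\<^sup>2"
      using lower pi9 zero_le_power2[of "s n m"] by (intro mult_mono) linarith+
    hence "D n m * s n m * (2 * (s n m)\<^sup>2) \<le> D n m * s n m * (pi\<^sup>2 * ((nu n)\<^sup>2 + (nu m)\<^sup>2 - lam))"
      using Dpos[OF nm] s1 by (intro mult_left_mono) (auto simp: mult.commute)
    moreover have "\<bar>beta lam n - beta lam m\<bar> = D n m * s n m * (pi\<^sup>2 * ((nu n)\<^sup>2 + (nu m)\<^sup>2 - lam))"
    proof -
      have "(nu n)\<^sup>2 + (nu m)\<^sup>2 - lam \<ge> 0" using lower zero_le_power2[of "s n m"] by linarith
      thus ?thesis unfolding eq abs_mult D_def using s1 by simp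
    qed
    ultimately have *: "\<bar>beta lam n - beta lam m\<bar> \<ge> 2 * (D n m * s n m ^ 3)"
      by (simp add: power3_eq_cube power2_eq_square mult_ac)
    have "s n m * 1 \<le> s n m ^ 3"
      using s1 power_increasing[of 1 3 "s n m"] by simp
    hence "1 * s n m \<le> D n m * s n m ^ 3" using Dpos[OF nm] s1 by (intro mult_mono) auto
    hence "\<bar>a\<bar> \<le> D n m * s n m ^ 3" using sK by linarith
    moreover have "c * (D n m * s n m ^ 3) \<le> 1 * (D n m * s n m ^ 3)"
      using c1 Dpos[OF nm] s1 by (intro mult_right_mono) auto
    ultimately show ?thesis using * by linarith
  qed
  thus ?thesis using that cpos unfolding D_def s_def by blast
qed

section \<open>Partial fractions of finite products of linear quotients\<close>

lemma prod_partial_fraction: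
  fixes x y :: "'i \<Rightarrow> 'a::field"
  assumes "finite I" "inj_on y I" "z \<notin> y ` I"
  shows "(\<Prod>n\<in>I. (z - x n) / (z - y n)) =
    1 + (\<Sum>m\<in>I. (y m - x m) * (\<Prod>n\<in>I - {m}. (y m - x n) / (y m - y n)) / (z - y m))"
  using assms
proof (induction I arbitrary: z rule: finite_induct)
  case empty
  then show ?case by simp
next
  case (insert p I)
  define c where "c = (\<lambda>I m. (y m - x m) * (\<Prod>n\<in>I - {m}. (y m - x n) / (y m - y n)))"
  have inj: "inj_on y I" and zI: "z \<notin> y ` I" and zp: "z \<noteq> y p" using insert.prems by auto
  have pI: "y p \<notin> y ` I" using insert.prems insert.hyps by auto
  have 1: "(\<Prod>n\<in>I. (z - x n) / (z - y n)) = 1 + (\<Sum>m\<in>I. c I m / (z - y m))"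
    unfolding c_def using insert.IH[OF inj zI] by simp
  \<comment> \<open>The induction hypothesis evaluated at the new pole gives the residue
    there.\<close>
  have 2: "(\<Prod>n\<in>I. (y p - x n) / (y p - y n)) = 1 + (\<Sum>m\<in>I. c I m / (y p - y m))"
    unfolding c_def using insert.IH[OF inj pI] by simp
  have cp: "c (insert p I) p = (y p - x p) * (1 + (\<Sum>m\<in>I. c I m / (y p - y m)))"
    unfolding 2[symmetric] using insert.hyps by (simp add: c_def)
  have cm: "c (insert p I) m = c I m * (1 + (y p - x p) / (y m - y p))" if "m \<in> I" for m
  proof -
    have "insert p I - {m} = insert p (I - {m})" using that insert.hyps by auto
    moreover have "y m - y p \<noteq> 0" using that pI by (metis eq_iff_diff_eq_0 imageI)
    ultimately show ?thesis unfolding c_def using insert.hyps by (simp add: field_simps)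
  qed
  define \<delta> where "\<delta> = y p - x p"
  have "(\<Prod>n\<in>insert p I. (z - x n) / (z - y n)) = (1 + \<delta> / (z - y p)) * (1 + (\<Sum>m\<in>I. c I m / (z - y m)))"
    using insert.hyps zp by (simp add: 1 \<delta>_def field_simps)
  also have "\<dots> = 1 + \<delta> / (z - y p) + (\<Sum>m\<in>I. c I m / (z - y m) + \<delta> / (z - y p) * (c I m / (z - y m)))"
    by (simp only: sum.distrib sum_distrib_left[symmetric]) (simp add: algebra_simps)
  also have "(\<Sum>m\<in>I. c I m / (z - y m) + \<delta> / (z - y p) * (c I m / (z - y m))) =
     (\<Sum>m\<in>I. c (insert p I) m / (z - y m) + \<delta> / (z - y p) * (c I m / (y p - y m)))"
  proof (rule sum.cong[OF refl])
    fix m assume m: "m \<in> I"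
    have "y m \<noteq> y p" using m pI by (metis imageI)
    hence "z - y m \<noteq> 0" "z - y p \<noteq> 0" "y m - y p \<noteq> 0" "y p - y m \<noteq> 0" using m zI zp by auto
    hence e: "1 / (z - y p) * (1 / (z - y m)) = 1 / (y m - y p) * (1 / (z - y m)) + 1 / (z - y p) * (1 / (y p - y m))"
      by (simp add: divide_simps) (simp add: algebra_simps)
    have "\<delta> / (z - y p) * (c I m / (z - y m)) = \<delta> * c I m * (1 / (z - y p) * (1 / (z - y m)))" by simp
    also have "\<dots> = c I m * (\<delta> / (y m - y p)) / (z - y m) + \<delta> / (z - y p) * (c I m / (y p - y m))"
      unfolding e by (simp add: algebra_simps)
    finally show "c I m / (z - y m) + \<delta> / (z - y p) * (c I m / (z - y m)) =
        c (insert p I) m / (z - y m) + \<delta> / (z - y p) * (c I m / (y p - y m))"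
      unfolding cm[OF m] \<delta>_def[symmetric] by (simp add: algebra_simps add_divide_distrib)
  qed
  also have "1 + \<delta> / (z - y p) + \<dots> = 1 + (\<Sum>m\<in>insert p I. c (insert p I) m / (z - y m))"
    unfolding sum.insert[OF insert.hyps] cp \<delta>_def[symmetric] sum.distrib sum_distrib_left[symmetric]
    by (simp add: algebra_simps add_divide_distrib)
  finally show ?case unfolding c_def .
qed

text \<open>The product has one pole more than zeros and behaves like 1 / z at infinity, so its
  residues sum to 1. With these residues as weights, a combination of equations with a common
  right-hand side keeps that right-hand side.\<close>

lemma prod_partial_fraction_weights:
  fixes p q :: "'i \<Rightarrow> 'a::field"
  assumes "finite J" "l \<notin> J" "inj_on p (insert l J)"
  shows "\<exists>w. (\<Sum>n\<in>insert l J. w n) = 1 \<and> (\<forall>z. z \<notin> p ` insert l J \<longrightarrow>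
    (\<Prod>n\<in>J. (z - q n) / (z - p n)) / (z - p l) = (\<Sum>n\<in>insert l J. w n / (z - p n)))"
  using assms
proof (induction J rule: finite_induct)
  case empty
  then show ?case by (intro exI[of _ "\<lambda>_. 1"]) auto
next
  case (insert r J)
  let ?I = "insert l J"
  from insert obtain w where w: "(\<Sum>n\<in>?I. w n) = 1"
    "\<And>z. z \<notin> p ` ?I \<Longrightarrow> (\<Prod>n\<in>J. (z - q n) / (z - p n)) / (z - p l) = (\<Sum>n\<in>?I. w n / (z - p n))"
    by (auto simp: inj_on_def)
  define e where "e = (\<lambda>n. (p r - q r) / (p n - p r))"
  \<comment> \<open>Each old weight is multiplied by 1 + e n; the new pole receives minus the total
    correction, which keeps the sum equal to 1.\<close>
  define w' where "w' = (\<lambda>n. if n = r then - (\<Sum>n\<in>?I. w n * e n) else w n * (1 + e n))"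
  have rI: "r \<notin> ?I" using insert by auto
  have fin: "finite ?I" using insert by auto
  have w'I: "w' n = w n * (1 + e n)" if "n \<in> ?I" for n using that rI unfolding w'_def by (metis)
  have "(\<Sum>n\<in>insert r ?I. w' n) = w' r + (\<Sum>n\<in>?I. w n * (1 + e n))"
    using rI fin w'I by (subst sum.insert) (auto intro!: sum.cong)
  also have "\<dots> = 1"
    using w(1) by (simp add: w'_def algebra_simps sum.distrib)
  finally have s1: "(\<Sum>n\<in>insert r ?I. w' n) = 1" .
  have "(\<Prod>n\<in>insert r J. (z - q n) / (z - p n)) / (z - p l) = (\<Sum>n\<in>insert r ?I. w' n / (z - p n))"
    if z: "z \<notin> p ` insert r ?I" for z
  proof -
    have zr: "z - p r \<noteq> 0" using z by auto
    have "(\<Prod>n\<in>insert r J. (z - q n) / (z - p n)) / (z - p l) =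
        (z - q r) / (z - p r) * ((\<Prod>n\<in>J. (z - q n) / (z - p n)) / (z - p l))"
      using insert.hyps by simp
    also have "\<dots> = (z - q r) / (z - p r) * (\<Sum>n\<in>?I. w n / (z - p n))"
      using z by (subst w(2)) auto
    also have "\<dots> = (\<Sum>n\<in>?I. w' n / (z - p n) - w n * e n / (z - p r))"
      unfolding sum_distrib_left
    proof (rule sum.cong[OF refl])
      fix n assume n: "n \<in> ?I"
      have pn: "p n - p r \<noteq> 0" "z - p n \<noteq> 0" using n insert.prems rI z by (auto simp: inj_on_def)
      have "(z - q r) / (z - p r) * (1 / (z - p n)) = (1 + e n) / (z - p n) - e n / (z - p r)"
        using pn zr by (simp add: e_def divide_simps) (simp add: algebra_simps)
      hence "w n * ((z - q r) / (z - p r) * (1 / (z - p n))) = w n * ((1 + e n) / (z - p n) - e n / (z - p r))" by simp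
      thus "(z - q r) / (z - p r) * (w n / (z - p n)) = w' n / (z - p n) - w n * e n / (z - p r)"
        unfolding w'I[OF n] by (simp add: algebra_simps)
    qed
    also have "\<dots> = (\<Sum>n\<in>insert r ?I. w' n / (z - p n))"
      using rI fin by (simp add: sum_subtractf w'_def sum_divide_distrib)
    finally show ?thesis .
  qed
  thus ?case using s1 by (intro exI[of _ w']) (simp add: insert_commute)
qed

section \<open>An infinite Cauchy system\<close>

text \<open>The two assumptions are the arithmetic hypotheses of the theorem rewritten for
  \<open>beta\<close>. The second one includes n = m, where it says a \<noteq> 0.\<close>

locale nonresonant =
  fixes lam a :: real
  assumes beta_ne: "n \<noteq> m \<Longrightarrow> beta lam n \<noteq> beta lam m"
    and gap_ne: "beta lam n - beta lam m + a \<noteq> 0"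
begin

lemma a_ne_0: "a \<noteq> 0"
  using gap_ne[of 0 0] by simp

definition gap :: "nat \<Rightarrow> nat \<Rightarrow> real" where "gap n m = beta lam n - beta lam m + a"

text \<open>Dominates the inverse gaps off the diagonal up to a constant. On the diagonal it still
  decays, although the inverse gap there is the constant 1 / a: this entry is used for
  \<open>ker_coeff\<close>, where a cancellation occurs.\<close>

definition gap_wt :: "nat \<Rightarrow> nat \<Rightarrow> real"
  where "gap_wt n m = dist_wt n m * decay (real (Suc n) + real (Suc m)) / (real (Suc n) + real (Suc m))\<^sup>2"

lemma gap_wt_nonneg: "gap_wt n m \<ge> 0"
  by (simp add: gap_wt_def dist_wt_nonneg decay_def)

lemma gap_bound_ex: "\<exists>C>0. \<forall>n m. n \<noteq> m \<longrightarrow>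
    1 / \<bar>gap n m\<bar> \<le> C / (\<bar>real n - real m\<bar> * (real (Suc n) + real (Suc m)) ^ 3) \<and>
    1 / \<bar>beta lam n - beta lam m\<bar> \<le> C / (\<bar>real n - real m\<bar> * (real (Suc n) + real (Suc m)) ^ 3)"
proof -
  define E where "E = (\<lambda>n m. \<bar>real n - real m\<bar> * (real (Suc n) + real (Suc m)) ^ 3)"
  have Epos: "E n m > 0" if "n \<noteq> m" for n m
    using that by (auto simp: E_def intro!: mult_pos_pos zero_less_power)
  obtain c where c: "c > 0" "\<And>n m. n \<noteq> m \<Longrightarrow> c * E n m \<le> \<bar>gap n m\<bar>"
    using beta_gap_lower_bound[of lam a] gap_ne unfolding E_def gap_def by blast
  have "n \<noteq> m \<Longrightarrow> beta lam n - beta lam m + 0 \<noteq> 0" for n m using beta_ne by simp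
  from beta_gap_lower_bound[of lam 0, OF this]
  obtain c' where c': "c' > 0" "\<And>n m. n \<noteq> m \<Longrightarrow> c' * E n m \<le> \<bar>beta lam n - beta lam m\<bar>"
    unfolding E_def by (metis add.right_neutral)
  define C where "C = 1 / c + 1 / c'"
  have C: "C > 0" "1 / c \<le> C" "1 / c' \<le> C" using c(1) c'(1) by (auto simp: C_def add_pos_pos)
  have *: "1 / u \<le> C / e" if "d * e \<le> u" "d > 0" "e > 0" "1 / d \<le> C" for u d e
  proof -
    have "1 / u \<le> 1 / (d * e)" using that by (intro divide_left_mono) (auto intro: mult_pos_pos less_le_trans)
    also have "\<dots> = (1 / d) / e" by simp
    also have "\<dots> \<le> C / e" using that by (intro divide_right_mono) auto
    finally show ?thesis .
  qed
  show ?thesis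
    using *[OF c(2) c(1) Epos C(2)] *[OF c'(2) c'(1) Epos C(3)] C(1) unfolding E_def by blast
qed

definition gap_const :: real where "gap_const = (SOME C. C > 0 \<and> (\<forall>n m. n \<noteq> m \<longrightarrow>
    1 / \<bar>gap n m\<bar> \<le> C / (\<bar>real n - real m\<bar> * (real (Suc n) + real (Suc m)) ^ 3) \<and>
    1 / \<bar>beta lam n - beta lam m\<bar> \<le> C / (\<bar>real n - real m\<bar> * (real (Suc n) + real (Suc m)) ^ 3)))"

lemma gap_const: "gap_const > 0"
  "n \<noteq> m \<Longrightarrow> 1 / \<bar>gap n m\<bar> \<le> gap_const / (\<bar>real n - real m\<bar> * (real (Suc n) + real (Suc m)) ^ 3)"
  "n \<noteq> m \<Longrightarrow> 1 / \<bar>beta lam n - beta lam m\<bar> \<le> gap_const / (\<bar>real n - real m\<bar> * (real (Suc n) + real (Suc m)) ^ 3)"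
  using someI_ex[OF gap_bound_ex] unfolding gap_const_def[symmetric] by auto

lemma gap_inverse_le_gap_wt:
  assumes "n \<noteq> m"
  shows "1 / \<bar>gap n m\<bar> \<le> gap_const * gap_wt n m" "1 / \<bar>beta lam n - beta lam m\<bar> \<le> gap_const * gap_wt n m"
  using gap_const(2)[OF assms] gap_const(3)[OF assms] mult_left_mono[OF inverse_gap_le[OF assms], of gap_const] gap_const(1)
  by (auto simp: gap_wt_def)

lemma gap_wt_commute: "gap_wt n m = gap_wt m n"
  by (simp add: gap_wt_def dist_wt_commute add.commute)

lemma gap_wt_le: "gap_wt n m \<le> dist_wt n m * (decay (real (Suc m)) / (real (Suc m))\<^sup>2)"
proof -
  let ?s = "real (Suc n) + real (Suc m)"
  have "decay ?s / ?s\<^sup>2 \<le> decay (real (Suc m)) / (real (Suc m))\<^sup>2"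
    by (intro frac_le decay_antimono power_mono) (auto simp: decay_def)
  from mult_left_mono[OF this dist_wt_nonneg] show ?thesis by (simp add: gap_wt_def)
qed

lemma decay_over_square_le_1: "decay (real (Suc m)) / (real (Suc m))\<^sup>2 \<le> 1"
proof -
  have "decay (real (Suc m)) / (real (Suc m))\<^sup>2 \<le> decay (real (Suc m)) / 1"
    by (intro divide_left_mono) (auto simp: decay_def)
  also have "\<dots> \<le> 1" using decay_le_1[of "real (Suc m)"] by simp
  finally show ?thesis .
qed

lemma gap_wt_sums:
  shows "(\<lambda>n. gap_wt n m) summable_on A"
    "infsum (\<lambda>n. gap_wt n m) A \<le> dist_wt_sum * (decay (real (Suc m)) / (real (Suc m))\<^sup>2)"
    "finite F \<Longrightarrow> sum (\<lambda>n. gap_wt n m) F \<le> dist_wt_sum * (decay (real (Suc m)) / (real (Suc m))\<^sup>2)"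
proof -
  have *: "sum (\<lambda>n. gap_wt n m) F \<le> dist_wt_sum * (decay (real (Suc m)) / (real (Suc m))\<^sup>2)" if "finite F" for F
  proof -
    have "sum (\<lambda>n. gap_wt n m) F \<le> (\<Sum>n\<in>F. dist_wt n m * (decay (real (Suc m)) / (real (Suc m))\<^sup>2))"
      by (intro sum_mono gap_wt_le)
    also have "\<dots> = sum (\<lambda>n. dist_wt n m) F * (decay (real (Suc m)) / (real (Suc m))\<^sup>2)"
      by (rule sum_distrib_right[symmetric])
    also have "\<dots> \<le> dist_wt_sum * (decay (real (Suc m)) / (real (Suc m))\<^sup>2)"
      using that by (intro mult_right_mono sum_dist_wt_le) (auto simp: decay_def)
    finally show ?thesis .
  qed
  thus "finite F \<Longrightarrow> sum (\<lambda>n. gap_wt n m) F \<le> dist_wt_sum * (decay (real (Suc m)) / (real (Suc m))\<^sup>2)" .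
  show "(\<lambda>n. gap_wt n m) summable_on A"
    "infsum (\<lambda>n. gap_wt n m) A \<le> dist_wt_sum * (decay (real (Suc m)) / (real (Suc m))\<^sup>2)"
    using finite_sums_bounded_summable_on[of A "\<lambda>n. gap_wt n m", OF gap_wt_nonneg *] by auto
qed

lemma gap_wt_summable: "summable (\<lambda>n. gap_wt n m)"
  using gap_wt_sums(1) by (rule summable_on_imp_summable)

text \<open>\<open>1 + cauchy_pert m n\<close> is the quotient of \<beta> m - a - \<beta> n by
  \<beta> m - \<beta> n. The value 0 at n = m makes the omitted factor equal to 1, so that the
  products can run over an initial segment.\<close>

definition cauchy_pert :: "nat \<Rightarrow> nat \<Rightarrow> real"
  where "cauchy_pert m n = (if n = m then 0 else - a / (beta lam m - beta lam n))"

definition cauchy_prodN :: "nat \<Rightarrow> nat \<Rightarrow> real" where "cauchy_prodN N m = (\<Prod>n<N. 1 + cauchy_pert m n)"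

definition cauchy_prod :: "nat \<Rightarrow> real" where "cauchy_prod m = lim (\<lambda>N. cauchy_prodN N m)"

lemma cauchy_pert_bound: "\<bar>cauchy_pert m n\<bar> \<le> \<bar>a\<bar> * gap_const * gap_wt n m"
  using mult_left_mono[OF gap_inverse_le_gap_wt(2)[of n m], of "\<bar>a\<bar>"] gap_const(1) gap_wt_nonneg[of n m]
  by (auto simp: cauchy_pert_def abs_minus_commute)

definition cauchy_bound :: real where "cauchy_bound = \<bar>a\<bar> * gap_const * dist_wt_sum"

lemma cauchy_bound_nonneg: "cauchy_bound \<ge> 0" using gap_const(1) dist_wt_sum_ge_1 by (simp add: cauchy_bound_def)

text \<open>The product deviates from 1 by at most exp t - 1 with t the sum of the |f n|, and exp t
  - 1 \<le> t exp t. Keeping the factor t preserves the decay in m. General f, since the bound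
  serves the products defining \<open>cauchy_wt\<close> as well as those in the uniqueness proof,
  which have gaps in the denominator.\<close>

lemma prod_minus_1_bound:
  fixes f :: "nat \<Rightarrow> real"
  assumes "\<And>n. \<bar>f n\<bar> \<le> \<bar>a\<bar> * gap_const * gap_wt n m" "finite A"
  shows "\<bar>(\<Prod>n\<in>A. 1 + f n) - 1\<bar> \<le> cauchy_bound * exp cauchy_bound * (decay (real (Suc m)) / (real (Suc m))\<^sup>2)"
proof -
  define r where "r = decay (real (Suc m)) / (real (Suc m))\<^sup>2"
  have r: "0 \<le> r" "r \<le> 1" using decay_over_square_le_1[of m] by (auto simp: r_def decay_def)
  have "(\<Sum>n\<in>A. \<bar>f n\<bar>) \<le> (\<Sum>n\<in>A. \<bar>a\<bar> * gap_const * gap_wt n m)" using assms by (intro sum_mono)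
  also have "\<dots> = \<bar>a\<bar> * gap_const * (\<Sum>n\<in>A. gap_wt n m)" by (simp add: sum_distrib_left)
  also have "\<dots> \<le> \<bar>a\<bar> * gap_const * (dist_wt_sum * r)"
    using gap_wt_sums(3)[OF assms(2), of m] gap_const(1) unfolding r_def by (intro mult_left_mono) auto
  finally have t: "(\<Sum>n\<in>A. \<bar>f n\<bar>) \<le> cauchy_bound * r" by (simp add: cauchy_bound_def mult_ac)
  have "\<bar>(\<Prod>n\<in>A. 1 + f n) - 1\<bar> \<le> (\<Prod>n\<in>A. 1 + \<bar>f n\<bar>) - 1"
    using norm_prod_minus1_le_prod_minus1[of f A] by simp
  also have "\<dots> \<le> exp (\<Sum>n\<in>A. \<bar>f n\<bar>) - 1"
    using prod_le_exp_sum[of A "\<lambda>n. \<bar>f n\<bar>"] by simp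
  also have "\<dots> \<le> exp (cauchy_bound * r) - 1" using t by simp
  also have "\<dots> \<le> (cauchy_bound * r) * exp (cauchy_bound * r)"
  proof -
    have "(1 - cauchy_bound * r) * exp (cauchy_bound * r) \<le> exp (- (cauchy_bound * r)) * exp (cauchy_bound * r)"
      using exp_ge_add_one_self[of "- (cauchy_bound * r)"] by (intro mult_right_mono) auto
    thus ?thesis by (simp add: algebra_simps flip: exp_add)
  qed
  also have "\<dots> \<le> (cauchy_bound * r) * exp cauchy_bound"
    using r cauchy_bound_nonneg mult_left_mono[of r 1 cauchy_bound] by (intro mult_left_mono) auto
  finally show ?thesis by (simp add: r_def mult_ac)
qed

lemma cauchy_prodN_bound: "\<bar>cauchy_prodN N m - 1\<bar> \<le> cauchy_bound * exp cauchy_bound * (decay (real (Suc m)) / (real (Suc m))\<^sup>2)"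
  unfolding cauchy_prodN_def by (rule prod_minus_1_bound) (auto intro: cauchy_pert_bound)

lemma cauchy_prodN_tendsto: "(\<lambda>N. cauchy_prodN N m) \<longlonglongrightarrow> cauchy_prod m"
proof -
  have "summable (\<lambda>n. norm (cauchy_pert m n))"
    by (rule summable_comparison_test'[OF summable_mult[OF gap_wt_summable, of "\<bar>a\<bar> * gap_const" m]])
       (use cauchy_pert_bound in simp)
  hence "abs_convergent_prod (\<lambda>n. 1 + cauchy_pert m n)"
    by (subst abs_convergent_prod_conv_summable) simp
  hence "convergent (\<lambda>n. \<Prod>i\<le>n. 1 + cauchy_pert m i)"
    by (intro convergent_prod_imp_convergent abs_convergent_prod_imp_convergent_prod)
  then obtain L where "(\<lambda>n. cauchy_prodN (Suc n) m) \<longlonglongrightarrow> L"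
    by (auto simp: cauchy_prodN_def convergent_def lessThan_Suc_atMost)
  hence "(\<lambda>N. cauchy_prodN N m) \<longlonglongrightarrow> L" by (rule LIMSEQ_imp_Suc)
  thus ?thesis unfolding cauchy_prod_def by (simp add: limI)
qed

lemma cauchy_prod_bound: "\<bar>cauchy_prod m - 1\<bar> \<le> cauchy_bound * exp cauchy_bound * (decay (real (Suc m)) / (real (Suc m))\<^sup>2)"
  by (rule tendsto_upperbound[OF tendsto_rabs[OF tendsto_diff[OF cauchy_prodN_tendsto tendsto_const]]])
     (use cauchy_prodN_bound in auto)

lemma abs_cauchy_prodN_le: "\<bar>cauchy_prodN N m\<bar> \<le> 1 + cauchy_bound * exp cauchy_bound" and abs_cauchy_prod_le: "\<bar>cauchy_prod m\<bar> \<le> 1 + cauchy_bound * exp cauchy_bound"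
proof -
  have "cauchy_bound * exp cauchy_bound * (decay (real (Suc m)) / (real (Suc m))\<^sup>2) \<le> cauchy_bound * exp cauchy_bound * 1"
    using decay_over_square_le_1[of m] cauchy_bound_nonneg by (intro mult_left_mono) auto
  thus "\<bar>cauchy_prodN N m\<bar> \<le> 1 + cauchy_bound * exp cauchy_bound" "\<bar>cauchy_prod m\<bar> \<le> 1 + cauchy_bound * exp cauchy_bound"
    using cauchy_prodN_bound[of N m] cauchy_prod_bound[of m] by linarith+
qed

text \<open>\<open>cauchy_wt m\<close> is the residue at \<open>z = beta lam m - a\<close> of the meromorphic function
  \<open>\<Prod>n. (z - beta lam n) / (z + a - beta lam n)\<close>, which tends to \<open>1\<close> far from its poles. Evaluating its
  partial fraction expansion at the zeros \<open>beta lam n\<close> yields \<open>cauchy_wt_identity\<close> below.\<close>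

definition cauchy_wt :: "nat \<Rightarrow> real" where "cauchy_wt m = - a * cauchy_prod m"

text \<open>At n = m the gap equals a, and no multiple of the decaying \<open>gap_wt\<close>
  dominates 1 / |a| for all n. The diagonal entry is therefore carried separately.\<close>

lemma inverse_gap_bound: "1 / \<bar>gap n m\<bar> \<le> gap_const * gap_wt n m + (if m = n then 1 / \<bar>a\<bar> else 0)"
  using gap_inverse_le_gap_wt[of n m] gap_const(1) gap_wt_nonneg[of n m] by (auto simp: gap_def)

lemma gap_wt_summable': "summable (\<lambda>m. gap_wt n m)"
  using gap_wt_summable[of n] by (simp add: gap_wt_commute)

lemma inverse_gap_bound_summable: "summable (\<lambda>m. gap_const * gap_wt n m + (if m = n then 1 / \<bar>a\<bar> else 0))"
  by (intro summable_add summable_mult gap_wt_summable' summable_finite[of "{n}"]) auto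

lemma inverse_gap_summable:
  assumes "\<And>m. \<bar>D m\<bar> \<le> B"
  shows "summable (\<lambda>m. norm (D m / gap n m))"
proof (rule summable_comparison_test'[OF summable_mult[OF inverse_gap_bound_summable[of n], of B]])
  fix m
  have "B \<ge> 0" using assms[of 0] by simp
  hence "\<bar>D m\<bar> * (1 / \<bar>gap n m\<bar>) \<le> B * (gap_const * gap_wt n m + (if m = n then 1 / \<bar>a\<bar> else 0))"
    by (intro mult_mono assms inverse_gap_bound) auto
  thus "norm (norm (D m / gap n m)) \<le> B * (gap_const * gap_wt n m + (if m = n then 1 / \<bar>a\<bar> else 0))" by simp
qed

lemma cauchy_wt_bounded: "\<bar>cauchy_wt m\<bar> \<le> \<bar>a\<bar> * (1 + cauchy_bound * exp cauchy_bound)"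
  unfolding cauchy_wt_def abs_mult using abs_cauchy_prod_le[of m] by (simp add: mult_left_mono)

text \<open>Zeros \<beta> j and poles \<beta> j - a for j < N: at z = \<beta> n the product contains
  a vanishing factor exactly because n < N. The residue at the pole of index m is - a times the
  truncated product.\<close>

lemma cauchy_prodN_identity:
  assumes "n < N"
  shows "(\<Sum>m<N. - a * cauchy_prodN N m / gap n m) = - 1"
proof -
  have inj: "inj_on (\<lambda>m. beta lam m - a) {..<N}"
    using beta_ne by (auto simp: inj_on_def)
  have notin: "beta lam n \<notin> (\<lambda>m. beta lam m - a) ` {..<N}"
  proof
    assume "beta lam n \<in> (\<lambda>m. beta lam m - a) ` {..<N}"
    then obtain m where "beta lam n = beta lam m - a" by auto
    thus False using gap_ne[of n m] by simp
  qed
  have "(\<Prod>j<N. (beta lam n - beta lam j) / (beta lam n - (beta lam j - a))) = 0"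
    using assms by (intro prod_zero) auto
  hence "1 + (\<Sum>m<N. (beta lam m - a - beta lam m) * (\<Prod>j\<in>{..<N} - {m}. (beta lam m - a - beta lam j) / (beta lam m - a - (beta lam j - a)))
      / (beta lam n - (beta lam m - a))) = 0"
    using prod_partial_fraction[OF _ inj notin, of "beta lam"] by simp
  moreover have "(beta lam m - a - beta lam m) * (\<Prod>j\<in>{..<N} - {m}. (beta lam m - a - beta lam j) / (beta lam m - a - (beta lam j - a)))
     = - a * cauchy_prodN N m" if "m < N" for m
  proof -
    have "cauchy_prodN N m = (1 + cauchy_pert m m) * (\<Prod>j\<in>{..<N} - {m}. 1 + cauchy_pert m j)"
      unfolding cauchy_prodN_def using that by (subst prod.remove[of _ m]) auto
    also have "(\<Prod>j\<in>{..<N} - {m}. 1 + cauchy_pert m j) =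
        (\<Prod>j\<in>{..<N} - {m}. (beta lam m - a - beta lam j) / (beta lam m - a - (beta lam j - a)))"
      by (intro prod.cong) (auto simp: cauchy_pert_def field_simps beta_ne)
    finally show ?thesis by (simp add: cauchy_pert_def)
  qed
  hence "(\<Sum>m<N. (beta lam m - a - beta lam m) * (\<Prod>j\<in>{..<N} - {m}. (beta lam m - a - beta lam j) / (beta lam m - a - (beta lam j - a)))
      / (beta lam n - (beta lam m - a))) = (\<Sum>m<N. - a * cauchy_prodN N m / gap n m)"
    by (intro sum.cong) (simp_all add: gap_def algebra_simps)
  ultimately show ?thesis by simp
qed

lemma cauchy_wt_identity: "(\<lambda>m. cauchy_wt m / gap n m) sums (- 1)"
proof -
  \<comment> \<open>Extension by 0 turns the finite identity for N into a series over all m, so that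
    N may tend to infinity under the dominating sequence \<open>M\<close>.\<close>
  define T where "T = (\<lambda>m N. if m < N then - a * cauchy_prodN N m / gap n m else 0)"
  define B where "B = \<bar>a\<bar> * (1 + cauchy_bound * exp cauchy_bound)"
  define M where "M = (\<lambda>m. B * (gap_const * gap_wt n m + (if m = n then 1 / \<bar>a\<bar> else 0)))"
  have lim: "((\<lambda>N. T m N) \<longlongrightarrow> cauchy_wt m / gap n m) sequentially" for m
  proof (rule Lim_transform_eventually)
    show "(\<lambda>N. - a * cauchy_prodN N m / gap n m) \<longlonglongrightarrow> cauchy_wt m / gap n m"
      unfolding cauchy_wt_def by (intro tendsto_intros cauchy_prodN_tendsto) (simp add: gap_def gap_ne)
    show "\<forall>\<^sub>F N in sequentially. - a * cauchy_prodN N m / gap n m = T m N"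
      using eventually_gt_at_top[of m] by eventually_elim (simp add: T_def)
  qed
  have bound: "norm (T m N) \<le> M m" for m N
  proof -
    have "\<bar>a * cauchy_prodN N m\<bar> \<le> B" using abs_cauchy_prodN_le[of N m] by (simp add: B_def abs_mult mult_left_mono)
    hence "\<bar>a * cauchy_prodN N m\<bar> * (1 / \<bar>gap n m\<bar>) \<le> M m"
      unfolding M_def using B_def cauchy_bound_nonneg by (intro mult_mono inverse_gap_bound) (auto simp: abs_mult)
    moreover have "0 \<le> M m"
      unfolding M_def B_def using gap_const(1) gap_wt_nonneg cauchy_bound_nonneg by (auto intro!: mult_nonneg_nonneg add_nonneg_nonneg)
    ultimately show ?thesis by (auto simp: T_def abs_mult)
  qed
  have "summable M" unfolding M_def by (intro summable_mult inverse_gap_bound_summable)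
  from tannerys_theorem[of T "\<lambda>m. cauchy_wt m / gap n m" sequentially M, OF lim _ this]
  have 1: "summable (\<lambda>m. norm (cauchy_wt m / gap n m))" "(\<lambda>N. suminf (\<lambda>m. T m N)) \<longlonglongrightarrow> (\<Sum>m. cauchy_wt m / gap n m)"
    using bound by (auto simp: case_prod_unfold intro: always_eventually)
  have "suminf (\<lambda>m. T m N) = - 1" if "N > n" for N
  proof -
    have "suminf (\<lambda>m. T m N) = (\<Sum>m<N. T m N)" by (rule suminf_finite) (auto simp: T_def)
    also have "\<dots> = (\<Sum>m<N. - a * cauchy_prodN N m / gap n m)" by (rule sum.cong) (auto simp: T_def)
    finally show ?thesis using cauchy_prodN_identity[OF that] by simp
  qed
  hence "(\<lambda>N. suminf (\<lambda>m. T m N)) \<longlonglongrightarrow> - 1"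
    by (intro tendsto_eventually eventually_mono[OF eventually_gt_at_top[of n]])
  with 1(2) have "(\<Sum>m. cauchy_wt m / gap n m) = - 1" using LIMSEQ_unique by blast
  thus ?thesis using summable_norm_cancel[OF 1(1)] by (simp add: sums_iff)
qed

end

context nonresonant begin

text \<open>The equations are combined with the weights of a finite partial fraction expansion that vanishes at
  \<open>beta lam m\<close> for all \<open>m < N\<close> other than \<open>l\<close>; letting \<open>N\<close> grow isolates \<open>D l\<close>.\<close>

lemma cauchy_system_unique:
  assumes bounded: "\<And>m. \<bar>D m\<bar> \<le> B" and sums: "\<And>n. (\<lambda>m. D m / gap n m) sums S"
  shows "D l = - S * cauchy_wt l"
proof -
  \<comment> \<open>The rational function with zeros \<beta> j for j < N, j \<noteq> l, and poles
    \<beta> j + a for j < N, evaluated at \<beta> m. The missing zero at l makes it decay like 1 /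
    z, and leaves m = l as the only index below N where it does not vanish.\<close>
  define \<Phi> where "\<Phi> = (\<lambda>N m. (\<Prod>j\<in>{..<N} - {l}. (beta lam m - beta lam j) / (beta lam m - (beta lam j + a))) /
      (beta lam m - (beta lam l + a)))"
  have gap': "beta lam m - (beta lam j + a) = - gap j m" for m j by (simp add: gap_def)
  have gap_nz: "gap j m \<noteq> 0" for j m using gap_ne by (simp add: gap_def)
  have B: "B \<ge> 0" using bounded[of 0] by simp
  define C where "C = 1 + cauchy_bound * exp cauchy_bound"
  have C: "C \<ge> 1" using cauchy_bound_nonneg by (simp add: C_def)
  \<comment> \<open>Since the weights sum to 1, the combined right-hand side is - S for every N; the
    sign comes from the denominators, which are \<open>- gap n m\<close>.\<close>
  have total: "(\<lambda>m. D m * \<Phi> N m) sums (- S)" if N: "N > l" for N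
  proof -
    have ins: "insert l ({..<N} - {l}) = {..<N}" using N by auto
    have "inj_on (\<lambda>j. beta lam j + a) (insert l ({..<N} - {l}))"
      using beta_ne by (auto simp: inj_on_def)
    from prod_partial_fraction_weights[OF _ _ this, of "beta lam"]
    obtain w where w: "(\<Sum>n<N. w n) = 1"
      "\<And>z. z \<notin> (\<lambda>j. beta lam j + a) ` {..<N} \<Longrightarrow>
        (\<Prod>j\<in>{..<N} - {l}. (z - beta lam j) / (z - (beta lam j + a))) / (z - (beta lam l + a)) = (\<Sum>n<N. w n / (z - (beta lam n + a)))"
      unfolding ins by auto
    have "beta lam m \<notin> (\<lambda>j. beta lam j + a) ` {..<N}" for m
    proof
      assume "beta lam m \<in> (\<lambda>j. beta lam j + a) ` {..<N}"
      then obtain j where "beta lam m = beta lam j + a" by auto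
      with gap'[of m j] gap_nz[of j m] show False by simp
    qed
    hence "\<Phi> N m = (\<Sum>n<N. w n / (- gap n m))" for m
      unfolding \<Phi>_def using w(2)[of "beta lam m"] by (simp add: gap')
    hence eq: "D m * \<Phi> N m = (\<Sum>n<N. - w n * (D m / gap n m))" for m
      by (simp add: sum_distrib_left mult.commute)
    have "(\<lambda>m. \<Sum>n<N. - w n * (D m / gap n m)) sums (\<Sum>n<N. - w n * S)"
      by (intro sums_sum sums_mult sums)
    also have "(\<Sum>n<N. - w n * S) = - S" using w(1) by (simp add: sum_negf flip: sum_distrib_right)
    finally show ?thesis by (simp add: eq)
  qed
  have zero: "\<Phi> N m = 0" if "m < N" "m \<noteq> l" for N m
    using that unfolding \<Phi>_def by (auto intro!: prod_zero)
  \<comment> \<open>At m = l each factor of \<Phi> is the reciprocal of the corresponding factor of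
    \<open>cauchy_prodN\<close>.\<close>
  have diag: "cauchy_prodN N l * \<Phi> N l = - 1 / a" if "N > l" for N
  proof -
    have "cauchy_prodN N l = (1 + cauchy_pert l l) * (\<Prod>j\<in>{..<N} - {l}. 1 + cauchy_pert l j)"
      unfolding cauchy_prodN_def using that by (subst prod.remove[of _ l]) auto
    also have "1 + cauchy_pert l l = 1" by (simp add: cauchy_pert_def)
    finally have "cauchy_prodN N l = (\<Prod>j\<in>{..<N} - {l}. 1 + cauchy_pert l j)" by simp
    hence "cauchy_prodN N l * (\<Prod>j\<in>{..<N} - {l}. (beta lam l - beta lam j) / (beta lam l - (beta lam j + a))) =
       (\<Prod>j\<in>{..<N} - {l}. (1 + cauchy_pert l j) * ((beta lam l - beta lam j) / (beta lam l - (beta lam j + a))))"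
      by (simp only: prod.distrib)
    also have "\<dots> = (\<Prod>j\<in>{..<N} - {l}. 1)"
    proof (rule prod.cong[OF refl])
      fix j assume j: "j \<in> {..<N} - {l}"
      have "beta lam l - beta lam j \<noteq> 0" using beta_ne j by simp
      moreover have "beta lam l - (beta lam j + a) \<noteq> 0" unfolding gap' using gap_nz by simp
      moreover have "1 + cauchy_pert l j = (beta lam l - (beta lam j + a)) / (beta lam l - beta lam j)"
        using j calculation(1) by (simp add: cauchy_pert_def field_simps)
      ultimately show "(1 + cauchy_pert l j) * ((beta lam l - beta lam j) / (beta lam l - (beta lam j + a))) = 1"
        by simp
    qed
    finally have "cauchy_prodN N l * \<Phi> N l = 1 / (beta lam l - (beta lam l + a))" unfolding \<Phi>_def by simp
    thus ?thesis by simp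
  qed
  \<comment> \<open>Beyond N no factor vanishes, but each is 1 - a / gap j m, so the product is
    bounded uniformly in N and m.\<close>
  have far: "\<bar>\<Phi> N m\<bar> \<le> C * (1 / \<bar>gap l m\<bar>)" if "m \<ge> N" for N m
  proof -
    define f where "f = (\<lambda>j. if j = m then 0 else - a / gap j m)"
    have "\<bar>f j\<bar> \<le> \<bar>a\<bar> * gap_const * gap_wt j m" for j
      using mult_left_mono[OF gap_inverse_le_gap_wt(1)[of j m], of "\<bar>a\<bar>"] gap_const(1) gap_wt_nonneg[of j m]
      by (auto simp: f_def)
    hence "\<bar>(\<Prod>j\<in>{..<N} - {l}. 1 + f j) - 1\<bar> \<le> cauchy_bound * exp cauchy_bound * (decay (real (Suc m)) / (real (Suc m))\<^sup>2)"
      by (intro prod_minus_1_bound) auto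
    also have "\<dots> \<le> cauchy_bound * exp cauchy_bound * 1"
      using decay_over_square_le_1[of m] cauchy_bound_nonneg by (intro mult_left_mono) auto
    finally have "\<bar>\<Prod>j\<in>{..<N} - {l}. 1 + f j\<bar> \<le> C" unfolding C_def by linarith
    moreover have "(\<Prod>j\<in>{..<N} - {l}. 1 + f j) = (\<Prod>j\<in>{..<N} - {l}. (beta lam m - beta lam j) / (beta lam m - (beta lam j + a)))"
    proof (rule prod.cong[OF refl])
      fix j assume j: "j \<in> {..<N} - {l}"
      have "gap j m \<noteq> 0" by (rule gap_nz)
      moreover have "beta lam m - beta lam j = - gap j m + a" by (simp add: gap_def)
      moreover have "j \<noteq> m" using j that by auto
      ultimately show "1 + f j = (beta lam m - beta lam j) / (beta lam m - (beta lam j + a))"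
        unfolding gap' by (simp add: f_def diff_divide_distrib)
    qed
    ultimately have "\<bar>\<Prod>j\<in>{..<N} - {l}. (beta lam m - beta lam j) / (beta lam m - (beta lam j + a))\<bar> * (1 / \<bar>gap l m\<bar>) \<le> C * (1 / \<bar>gap l m\<bar>)"
      by (intro mult_right_mono) auto
    thus ?thesis unfolding \<Phi>_def by (simp add: gap')
  qed
  \<comment> \<open>Multiplication by the truncated product makes the term m = l independent of N,
    equal to - D l / a. The terms with m \<noteq> l vanish once N exceeds m, so only this one
    survives in the limit.\<close>
  define T where "T = (\<lambda>m N. if N > l then cauchy_prodN N l * (D m * \<Phi> N m) else 0)"
  define M where "M = (\<lambda>m. C * (B * (C * norm (1 / gap l m))) + (if m = l then \<bar>D l / a\<bar> else 0))"
  have sumM: "summable M"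
    unfolding M_def
    by (intro summable_add summable_mult inverse_gap_summable[of _ 1] summable_finite[of "{l}"]) auto
  have bound: "norm (T m N) \<le> M m" for m N
  proof -
    have M0: "M m \<ge> 0" using B C by (auto simp: M_def)
    consider "N \<le> l" | "N > l" "m = l" | "N > l" "m \<noteq> l" "m < N" | "N > l" "m \<ge> N" by linarith
    thus ?thesis
    proof cases
      case 2
      hence "T m N = D l * (cauchy_prodN N l * \<Phi> N l)" by (simp add: T_def mult.left_commute)
      hence "T m N = D l * (- 1 / a)" using diag[of N] 2 by simp
      moreover have "0 \<le> C * (B * (C * norm (1 / gap l m)))" using B C by auto
      ultimately show ?thesis using 2 by (simp add: M_def)
    next
      case 4
      have "\<bar>cauchy_prodN N l\<bar> * (\<bar>D m\<bar> * \<bar>\<Phi> N m\<bar>) \<le> C * (B * (C * norm (1 / gap l m)))"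
        using far[OF 4(2)] bounded abs_cauchy_prodN_le[of N l] B C unfolding C_def[symmetric]
        by (intro mult_mono) auto
      thus ?thesis using 4 by (simp add: T_def M_def abs_mult)
    qed (use M0 zero in \<open>auto simp: T_def\<close>)
  qed
  have lim: "((\<lambda>N. T m N) \<longlongrightarrow> (if m = l then - D l / a else 0)) sequentially" for m
    using diag zero[of m]
    by (intro tendsto_eventually eventually_mono[OF eventually_gt_at_top[of "l + m"]])
       (auto simp: T_def mult.left_commute)
  from tannerys_theorem[of T _ sequentially M, OF lim _ sumM]
  have "(\<lambda>N. suminf (\<lambda>m. T m N)) \<longlonglongrightarrow> suminf (\<lambda>m. if m = l then - D l / a else 0)"
    using bound by (auto simp: case_prod_unfold intro: always_eventually)
  also have "suminf (\<lambda>m. if m = l then - D l / a else 0) = - D l / a"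
    using suminf_finite[of "{l}" "\<lambda>m. if m = l then - D l / a else 0"] by simp
  finally have 1: "(\<lambda>N. suminf (\<lambda>m. T m N)) \<longlonglongrightarrow> - D l / a" .
  have "suminf (\<lambda>m. T m N) = cauchy_prodN N l * (- S)" if "N > l" for N
    using sums_mult[OF total[OF that], of "cauchy_prodN N l"] that by (simp add: T_def sums_iff)
  hence ev: "\<forall>\<^sub>F N in sequentially. cauchy_prodN N l * (- S) = suminf (\<lambda>m. T m N)"
    by (intro eventually_mono[OF eventually_gt_at_top[of l]]) simp
  have "(\<lambda>N. cauchy_prodN N l * (- S)) \<longlonglongrightarrow> cauchy_prod l * (- S)"
    by (intro tendsto_intros cauchy_prodN_tendsto)
  from Lim_transform_eventually[OF this ev]
  have "(\<lambda>N. suminf (\<lambda>m. T m N)) \<longlonglongrightarrow> cauchy_prod l * (- S)" .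
  with 1 have "- D l / a = cauchy_prod l * (- S)" using LIMSEQ_unique by blast
  thus ?thesis using a_ne_0 by (simp add: cauchy_wt_def field_simps)
qed

lemma cauchy_wt_tendsto: "cauchy_wt \<longlonglongrightarrow> - a"
proof -
  define c where "c = cauchy_bound * exp cauchy_bound"
  have "(\<lambda>m. \<bar>cauchy_prod m - 1\<bar>) \<longlonglongrightarrow> 0"
  proof (rule tendsto_sandwich[of "\<lambda>_. 0" _ _ "\<lambda>m. c * (1 / (real (Suc m))\<^sup>2)"])
    show "(\<lambda>m. c * (1 / (real (Suc m))\<^sup>2)) \<longlonglongrightarrow> 0"
      by real_asymp
    have "decay (real (Suc m)) / (real (Suc m))\<^sup>2 \<le> 1 / (real (Suc m))\<^sup>2" for m
      using decay_le_1[of "real (Suc m)"] by (intro divide_right_mono) auto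
    moreover have "c \<ge> 0" using cauchy_bound_nonneg by (simp add: c_def)
    ultimately have "c * (decay (real (Suc m)) / (real (Suc m))\<^sup>2) \<le> c * (1 / (real (Suc m))\<^sup>2)" for m
      by (rule mult_left_mono)
    hence "\<bar>cauchy_prod m - 1\<bar> \<le> c * (1 / (real (Suc m))\<^sup>2)" for m
      using order_trans[OF cauchy_prod_bound[of m]] unfolding c_def[symmetric] by blast
    thus "\<forall>\<^sub>F m in sequentially. \<bar>cauchy_prod m - 1\<bar> \<le> c * (1 / (real (Suc m))\<^sup>2)" by simp
  qed auto
  hence "cauchy_prod \<longlonglongrightarrow> 1" by (simp add: tendsto_rabs_zero_iff LIM_zero_iff)
  from tendsto_mult[OF tendsto_const[of "- a"] this] show ?thesis unfolding cauchy_wt_def[abs_def] by simp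
qed

text \<open>The first summand stems from \<open>\<delta>(x - y)\<close>, the
  second one from the unknown boundary values of the second \<open>x\<close>-derivative at \<open>x = 0\<close>.\<close>

definition ker_coeff :: "nat \<Rightarrow> nat \<Rightarrow> real"
  where "ker_coeff n m = (if n = m then 1 else 0) + cauchy_wt m * real (Suc n) / (real (Suc m) * gap n m)"

section \<open>Size of the kernel coefficients\<close>

lemma ker_coeff_gap: "gap n m * ker_coeff n m = (if n = m then a else 0) + cauchy_wt m * (real (Suc n) / real (Suc m))"
proof -
  have "gap n m \<noteq> 0" using gap_ne by (simp add: gap_def)
  hence "gap n m * (cauchy_wt m * real (Suc n) / (real (Suc m) * gap n m)) = cauchy_wt m * (real (Suc n) / real (Suc m))"
    by simp
  moreover have "gap n m * (if n = m then 1 else 0) = (if n = m then a else 0)" by (simp add: gap_def)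
  ultimately show ?thesis by (simp only: ker_coeff_def distrib_left)
qed

text \<open>On the diagonal the 1 coming from the Dirac measure almost cancels against the second
  summand, which is - \<open>cauchy_prod m\<close> there; what is left is as small as the
  off-diagonal entries. Off the diagonal the bound is that of the inverse gap, with the factor n / m
  kept.\<close>

lemma ker_coeff_bound_ex: "\<exists>C>0. \<forall>n m. \<bar>ker_coeff n m\<bar> \<le> C * (real (Suc n) / real (Suc m) * gap_wt n m)"
proof -
  define B where "B = \<bar>a\<bar> * (1 + cauchy_bound * exp cauchy_bound)"
  define C where "C = B * gap_const + 8 * (cauchy_bound * exp cauchy_bound) + 1"
  have B: "B \<ge> 0" using cauchy_bound_nonneg by (simp add: B_def)
  have nn: "B * gap_const \<ge> 0" "8 * (cauchy_bound * exp cauchy_bound) \<ge> 0" using B gap_const(1) cauchy_bound_nonneg by auto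
  have "\<bar>ker_coeff n m\<bar> \<le> C * (real (Suc n) / real (Suc m) * gap_wt n m)" for n m
  proof (cases "n = m")
    case True
    let ?M = "real (Suc m)"
    have "cauchy_wt m * ?M / (?M * a) = - cauchy_prod m" using a_ne_0 by (simp add: cauchy_wt_def del: of_nat_Suc)
    hence "ker_coeff n m = 1 - cauchy_prod m" using True by (simp add: ker_coeff_def gap_def del: of_nat_Suc)
    hence 1: "\<bar>ker_coeff n m\<bar> \<le> cauchy_bound * exp cauchy_bound * (decay ?M / ?M\<^sup>2)" using cauchy_prod_bound[of m] by (simp add: abs_minus_commute)
    \<comment> \<open>At n = m the weight is taken at 2 M instead of M. This costs at most a factor
      2 in \<open>decay\<close> and a factor 4 in the square, hence the 8.\<close>
    have "decay (?M + ?M) = 2 powr (-3/4) * decay ?M"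
      by (simp add: decay_def flip: powr_mult)
    moreover have "(1/2::real) \<le> 2 powr (-3/4)"
      using powr_mono[of "-1" "-3/4" "2::real"] powr_minus_divide[of "2::real" 1] by simp
    hence "1/2 * decay ?M \<le> 2 powr (-3/4) * decay ?M"
      by (rule mult_right_mono) (simp add: decay_def)
    ultimately have "decay ?M \<le> 2 * decay (?M + ?M)" by linarith
    hence "decay ?M / ?M\<^sup>2 \<le> 2 * decay (?M + ?M) / ?M\<^sup>2" by (intro divide_right_mono) auto
    also have "\<dots> = 8 * (decay (?M + ?M) / (?M + ?M)\<^sup>2)"
    proof -
      have "(?M + ?M)\<^sup>2 = 4 * ?M\<^sup>2" by (simp add: power2_eq_square algebra_simps)
      thus ?thesis by (simp del: of_nat_Suc)
    qed
    also have "\<dots> = 8 * gap_wt n m" using True by (simp add: gap_wt_def dist_wt_def del: of_nat_Suc)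
    finally have "decay ?M / ?M\<^sup>2 \<le> 8 * gap_wt n m" .
    hence "cauchy_bound * exp cauchy_bound * (decay ?M / ?M\<^sup>2) \<le> cauchy_bound * exp cauchy_bound * (8 * gap_wt n m)"
      using cauchy_bound_nonneg by (intro mult_left_mono) auto
    hence "\<bar>ker_coeff n m\<bar> \<le> cauchy_bound * exp cauchy_bound * (8 * gap_wt n m)" using 1 by linarith
    also have "\<dots> \<le> C * gap_wt n m"
      using mult_right_mono[OF _ gap_wt_nonneg[of n m], of "8 * (cauchy_bound * exp cauchy_bound)" C] nn by (simp add: C_def)
    finally show ?thesis using True by simp
  next
    case False
    have "\<bar>ker_coeff n m\<bar> = \<bar>cauchy_wt m\<bar> * (real (Suc n) / real (Suc m)) * (1 / \<bar>gap n m\<bar>)"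
      using False by (simp add: ker_coeff_def abs_mult)
    also have "\<dots> \<le> B * (real (Suc n) / real (Suc m)) * (gap_const * gap_wt n m)"
      using cauchy_wt_bounded[of m] gap_inverse_le_gap_wt(1)[OF False] B unfolding B_def[symmetric]
      by (intro mult_mono) auto
    also have "\<dots> = (B * gap_const) * (real (Suc n) / real (Suc m) * gap_wt n m)" by simp
    also have "\<dots> \<le> C * (real (Suc n) / real (Suc m) * gap_wt n m)"
      using nn gap_wt_nonneg[of n m] by (intro mult_right_mono) (auto simp: C_def)
    finally show ?thesis .
  qed
  moreover have "C > 0" using nn by (simp add: C_def)
  ultimately show ?thesis by blast
qed

definition ker_const :: real
  where "ker_const = (SOME C. C > 0 \<and> (\<forall>n m. \<bar>ker_coeff n m\<bar> \<le> C * (real (Suc n) / real (Suc m) * gap_wt n m)))"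

lemma ker_const: "ker_const > 0" "\<bar>ker_coeff n m\<bar> \<le> ker_const * (real (Suc n) / real (Suc m) * gap_wt n m)"
  using someI_ex[OF ker_coeff_bound_ex] unfolding ker_const_def[symmetric] by auto

text \<open>A quadratic weight uses up the square in \<open>gap_wt\<close>; the remaining decay in n
  + m may be charged to either index, as the later summation requires.\<close>

lemma gap_wt_times_le:
  fixes n m defines "N \<equiv> real (Suc n)" and "M \<equiv> real (Suc m)"
  assumes "0 \<le> u" "u \<le> (N + M)\<^sup>2"
  shows "u * gap_wt n m \<le> dist_wt n m * decay N" "u * gap_wt n m \<le> dist_wt n m * decay M"
proof -
  have "u * gap_wt n m \<le> (N + M)\<^sup>2 * gap_wt n m" using assms gap_wt_nonneg by (intro mult_right_mono) auto
  also have "\<dots> = dist_wt n m * decay (N + M)" by (simp add: gap_wt_def N_def M_def)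
  finally have *: "u * gap_wt n m \<le> dist_wt n m * decay (N + M)" .
  have "dist_wt n m * decay (N + M) \<le> dist_wt n m * decay N" "dist_wt n m * decay (N + M) \<le> dist_wt n m * decay M"
    using dist_wt_nonneg by (auto intro!: mult_left_mono decay_antimono simp: N_def M_def)
  with * show "u * gap_wt n m \<le> dist_wt n m * decay N" "u * gap_wt n m \<le> dist_wt n m * decay M" by auto
qed

text \<open>The first three weights belong to second derivatives and leave only
  \<open>decay\<close>, which is square summable. The last three belong to the function and its
  first derivatives and leave a summable weight. The weight N^2 is absent: with the factor N / M of
  \<open>ker_const\<close> it would become N^3 / M, which (N + M)^2 does not control.\<close>

lemma ker_coeff_bounds:
  fixes n m defines "N \<equiv> real (Suc n)" and "M \<equiv> real (Suc m)"
  shows "N * M * \<bar>ker_coeff n m\<bar> \<le> ker_const * (dist_wt n m * decay M)"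
    and "M\<^sup>2 * \<bar>ker_coeff n m\<bar> \<le> ker_const * (dist_wt n m * decay N)"
    and "M\<^sup>2 * \<bar>ker_coeff n m\<bar> \<le> ker_const * (dist_wt n m * decay M)"
    and "N * \<bar>ker_coeff n m\<bar> \<le> ker_const * (dist_wt n m * (decay M / M))"
    and "M * \<bar>ker_coeff n m\<bar> \<le> ker_const * (dist_wt n m * (decay M / M))"
    and "\<bar>ker_coeff n m\<bar> \<le> ker_const * (dist_wt n m * (decay M / M))"
proof -
  have NM: "N \<ge> 1" "M \<ge> 1" by (auto simp: N_def M_def)
  have *: "u * \<bar>ker_coeff n m\<bar> \<le> ker_const * ((u * (N / M)) * gap_wt n m)" if "u \<ge> 0" for u
    using mult_left_mono[OF ker_const(2)[of n m] that] by (simp add: N_def M_def mult_ac)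
  have u: "N\<^sup>2 \<le> (N + M)\<^sup>2" "N * M \<le> (N + M)\<^sup>2"
    using NM by (auto intro!: power_mono simp: power2_eq_square algebra_simps)
  have g: "N\<^sup>2 * gap_wt n m \<le> dist_wt n m * decay M" "N * M * gap_wt n m \<le> dist_wt n m * decay N" "N * M * gap_wt n m \<le> dist_wt n m * decay M"
    using gap_wt_times_le[of "N\<^sup>2" n m] gap_wt_times_le[of "N * M" n m] u NM unfolding N_def M_def by auto
  have mono: "ker_const * x \<le> ker_const * y" if "x \<le> y" for x y using that ker_const(1) by simp
  have "N * M * (N / M) = N\<^sup>2" "M\<^sup>2 * (N / M) = N * M" using NM by (auto simp: power2_eq_square)
  note e = this
  have nn: "0 \<le> N * M" using NM by simp
  have "N * M * \<bar>ker_coeff n m\<bar> \<le> ker_const * (N\<^sup>2 * gap_wt n m)" using *[OF nn] unfolding e .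
  moreover have "M\<^sup>2 * \<bar>ker_coeff n m\<bar> \<le> ker_const * (N * M * gap_wt n m)"
    using *[OF zero_le_power2[of M]] unfolding e .
  ultimately show 1: "N * M * \<bar>ker_coeff n m\<bar> \<le> ker_const * (dist_wt n m * decay M)"
    and "M\<^sup>2 * \<bar>ker_coeff n m\<bar> \<le> ker_const * (dist_wt n m * decay N)"
    and 2: "M\<^sup>2 * \<bar>ker_coeff n m\<bar> \<le> ker_const * (dist_wt n m * decay M)"
    using mono[OF g(1)] mono[OF g(2)] mono[OF g(3)] by linarith+
  have "N * \<bar>ker_coeff n m\<bar> = N * M * \<bar>ker_coeff n m\<bar> / M" using NM by auto
  also have "\<dots> \<le> ker_const * (dist_wt n m * decay M) / M" using 1 NM by (intro divide_right_mono) auto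
  finally show "N * \<bar>ker_coeff n m\<bar> \<le> ker_const * (dist_wt n m * (decay M / M))" by (simp only: times_divide_eq_right)
  have "M * \<bar>ker_coeff n m\<bar> = M\<^sup>2 * \<bar>ker_coeff n m\<bar> / M" using NM by (auto simp: power2_eq_square)
  also have "\<dots> \<le> ker_const * (dist_wt n m * decay M) / M" using 2 NM by (intro divide_right_mono) auto
  finally show 3: "M * \<bar>ker_coeff n m\<bar> \<le> ker_const * (dist_wt n m * (decay M / M))" by (simp only: times_divide_eq_right)
  have "1 * \<bar>ker_coeff n m\<bar> \<le> M * \<bar>ker_coeff n m\<bar>" using NM by (intro mult_right_mono) auto
  thus "\<bar>ker_coeff n m\<bar> \<le> ker_const * (dist_wt n m * (decay M / M))" using 3 by linarith
qed

lemma dist_wt_weight_summable_on: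
  assumes r_nonneg: "\<And>m. r m \<ge> (0::real)" and summ: "summable r"
  shows "(\<lambda>(n, m). dist_wt n m * r m) summable_on UNIV"
proof -
  have "summable (\<lambda>m. dist_wt_sum * r m)" using summ by (rule summable_mult)
  hence 1: "(\<lambda>m. dist_wt_sum * r m) summable_on UNIV"
    by (subst summable_on_UNIV_nonneg_real_iff) (use r_nonneg dist_wt_sum_ge_1 in \<open>auto intro!: mult_nonneg_nonneg\<close>)
  have 2: "(\<lambda>n. dist_wt n m * r m) summable_on UNIV" for m
    by (intro summable_on_cmult_left dist_wt_summable_on)
  have 3: "infsum (\<lambda>n. dist_wt n m * r m) UNIV \<le> dist_wt_sum * r m" for m
    using mult_right_mono[OF dist_wt_summable_on(2)[of m UNIV] r_nonneg[of m]]
    by (simp add: infsum_cmult_left')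
  have 4: "(\<lambda>m. infsum (\<lambda>n. dist_wt n m * r m) UNIV) summable_on UNIV"
    by (rule summable_on_comparison_test[OF 1 3]) (intro infsum_nonneg mult_nonneg_nonneg dist_wt_nonneg r_nonneg)
  have "(\<lambda>(m, n). dist_wt n m * r m) summable_on (UNIV \<times> UNIV)"
    by (rule summable_on_SigmaI[OF _ 4]) (use 2 in \<open>auto intro!: has_sum_infsum mult_nonneg_nonneg dist_wt_nonneg r_nonneg\<close>)
  hence "(\<lambda>p. dist_wt (fst p) (snd p) * r (snd p)) \<circ> prod.swap summable_on UNIV"
    by (simp add: case_prod_unfold o_def)
  thus ?thesis
    by (subst (asm) summable_on_reindex[symmetric]) (auto simp: case_prod_unfold)
qed

lemma summable_decay_over: "summable (\<lambda>m. decay (real (Suc m)) / real (Suc m))"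
proof -
  have "decay (real (Suc m)) / real (Suc m) = real (Suc m) powr (-(7/4))" for m
  proof -
    have "real (Suc m) powr (-3/4 - 1) = real (Suc m) powr (-3/4) / real (Suc m) powr 1"
      by (rule powr_diff)
    also have "(-3/4 - 1 :: real) = - (7/4)" by simp
    also have "real (Suc m) powr 1 = real (Suc m)" by (rule powr_one) simp
    finally show ?thesis unfolding decay_def ..
  qed
  thus ?thesis using powr_neg_summable[of "7/4"] by (simp del: of_nat_Suc)
qed

end

text \<open>M is at most twice the larger of N and D, so three quarter powers of M are paid for by
  the larger one, and the smaller one is left with the summable exponent -5/4. Adding both powers
  avoids a case distinction later on.\<close>

lemma quotient_powr_bound:
  fixes M N D :: real
  assumes "M > 0" "N > 0" "D > 0" "M \<le> N + D"
  shows "M / (N * D) \<le> 2 * (M * decay M) * (D powr (-5/4) + N powr (-5/4))"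
proof -
  have *: "M powr (3/4) \<le> 2 * (x * y * (y powr (-5/4)))" if "0 < y" "y \<le> x" "M \<le> x + y" for x y
  proof -
    have "M powr (3/4) \<le> (2 * x) powr (3/4)" using that assms by (intro powr_mono2) auto
    also have "\<dots> = 2 powr (3/4) * x powr (3/4)" using that by (simp add: powr_mult)
    also have "\<dots> \<le> 2 * x powr (3/4)"
      using powr_mono[of "3/4" 1 "2::real"] by (intro mult_right_mono) auto
    also have "x powr (3/4) = x * x powr (-1/4)"
      using that powr_add[of x 1 "-1/4"] by simp
    also have "\<dots> \<le> x * y powr (-1/4)" using that by (intro mult_left_mono powr_mono2') auto
    also have "y powr (-1/4) = y * y powr (-5/4)"
      using that powr_add[of y 1 "-5/4"] by simp
    finally show ?thesis by (simp add: mult.assoc)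
  qed
  have "M powr (3/4) \<le> 2 * (N * D * (D powr (-5/4) + N powr (-5/4)))"
  proof (cases "D \<le> N")
    case True
    have "0 \<le> N * D * N powr (-5/4)" using assms by simp
    thus ?thesis using *[of D N] True assms unfolding distrib_left by linarith
  next
    case False
    have "0 \<le> N * D * D powr (-5/4)" using assms by simp
    thus ?thesis using *[of N D] False assms unfolding distrib_left mult.commute[of D N] by linarith
  qed
  hence "M powr (3/4) * (M * decay M / (N * D)) \<le>
      2 * (N * D * (D powr (-5/4) + N powr (-5/4))) * (M * decay M / (N * D))"
    using assms by (intro mult_right_mono) (auto simp: decay_def)
  moreover have "M powr (3/4) * (M * decay M) = M"
    using assms powr_add[of M "3/4" "-3/4"] by (simp add: decay_def mult.left_commute)
  hence "M powr (3/4) * (M * decay M / (N * D)) = M / (N * D)" by simp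
  moreover have "2 * (N * D * (D powr (-5/4) + N powr (-5/4))) * (M * decay M / (N * D)) =
     2 * (M * decay M) * (D powr (-5/4) + N powr (-5/4))" using assms by simp
  ultimately show ?thesis by linarith
qed

section \<open>Row sums, and the coefficients without their leading part\<close>

context nonresonant begin

text \<open>This is k_y(x, 0) = 0 in the n-th sine coefficient: the derivative of sine m at 0 is
  proportional to m + 1. The Dirac part contributes n + 1, and by \<open>cauchy_wt_identity\<close>
  the other part contributes the opposite.\<close>

lemma ker_coeff_row_sums: "(\<lambda>m. real (Suc m) * ker_coeff n m) sums 0"
proof -
  have "(\<lambda>m. (if m = n then real (Suc n) else 0) + real (Suc n) * (cauchy_wt m / gap n m)) sums (real (Suc n) + real (Suc n) * (- 1))"
    using sums_single[of n "\<lambda>_. real (Suc n)"] by (intro sums_add sums_mult cauchy_wt_identity) (simp cong: if_cong)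
  moreover have "(if m = n then real (Suc n) else 0) + real (Suc n) * (cauchy_wt m / gap n m) = real (Suc m) * ker_coeff n m" for m
    by (simp add: ker_coeff_def distrib_left del: of_nat_Suc)
  ultimately show ?thesis by simp
qed

text \<open>Against \<open>n\<^sup>2\<close> the coefficients \<open>ker_coeff n m\<close> are not absolutely summable over \<open>n\<close>, because the second
  \<open>x\<close>-derivative of the kernel does not vanish at \<open>x = 0\<close>. The leading part \<open>n\<^sup>-\<^sup>3\<close> is split off;
  it sums up to a cubic polynomial.\<close>

definition ker_rem :: "nat \<Rightarrow> nat \<Rightarrow> real"
  where "ker_rem n m = ker_coeff n m - cauchy_wt m / (real (Suc m) * pi ^ 4 * real (Suc n) ^ 3)"

text \<open>Subtracting the leading part replaces the numerator N^4 of a common denominator by a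
  remainder of size N^2 + M^4. The N^2 part is controlled by \<open>gap_wt\<close>, the M^4 part by
  \<open>quotient_powr_bound\<close>, which is the source of the second weight, a power of N alone.
  On the diagonal both pieces are small by themselves.\<close>

lemma ker_rem_bound_ex: "\<exists>C>0. \<forall>n m. (real (Suc n))\<^sup>2 * \<bar>ker_rem n m\<bar> \<le>
   C * (decay (real (Suc m)) * (dist_wt n m + real (Suc n) powr (-5/4)))"
proof -
  define B where "B = \<bar>a\<bar> * (1 + cauchy_bound * exp cauchy_bound)"
  define E where "E = 2 * \<bar>lam\<bar> * pi\<^sup>2 + pi ^ 4 + \<bar>a\<bar>"
  define C where "C = ker_const + B + B * E * gap_const * 3 + 1"
  have B: "B \<ge> 0" using cauchy_bound_nonneg by (simp add: B_def)
  have E: "E \<ge> 0" by (simp add: E_def)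
  have BEg: "B * E * gap_const \<ge> 0" using B E gap_const(1) by simp
  have C: "C > 0" using B BEg ker_const(1) by (simp add: C_def)
  have pi1: "pi ^ 4 \<ge> 1" using pi_gt3 by (intro one_le_power) auto
  have "(real (Suc n))\<^sup>2 * \<bar>ker_rem n m\<bar> \<le> C * (decay (real (Suc m)) * (dist_wt n m + real (Suc n) powr (-5/4)))" for n m
  proof -
    define N where "N = real (Suc n)"
    define M where "M = real (Suc m)"
    define W where "W = decay M * (dist_wt n m + N powr (-5/4))"
    have NM: "N \<ge> 1" "M \<ge> 1" by (auto simp: N_def M_def)
    have W: "W \<ge> 0" by (simp add: W_def dist_wt_nonneg decay_def)
    have pwW: "decay M * dist_wt n m \<le> W" by (simp add: W_def distrib_left decay_def)
    show ?thesis
    proof (cases "n = m")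
      case True
      hence NM': "N = M" by (simp add: N_def M_def)
      have "M\<^sup>2 * \<bar>ker_coeff n m\<bar> \<le> ker_const * W"
      proof -
        have "M\<^sup>2 * \<bar>ker_coeff n m\<bar> \<le> ker_const * (decay M * dist_wt n m)"
          using ker_coeff_bounds(3)[of m n] by (simp only: M_def mult.commute)
        also have "\<dots> \<le> ker_const * W" using pwW ker_const(1) by (intro mult_left_mono) auto
        finally show ?thesis .
      qed
      moreover have "N\<^sup>2 * (\<bar>cauchy_wt m\<bar> / (M * pi ^ 4 * N ^ 3)) \<le> B * W"
      proof -
        have "M powr (-2) \<le> decay M" unfolding decay_def using NM by (intro powr_mono) auto
        also have "M powr (-2) = 1 / M\<^sup>2" using NM by (simp add: powr_minus_divide powr_numeral)
        finally have 1: "1 / M\<^sup>2 \<le> decay M" .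
        have "N\<^sup>2 * (\<bar>cauchy_wt m\<bar> / (M * pi ^ 4 * N ^ 3)) = \<bar>cauchy_wt m\<bar> * (1 / M\<^sup>2) / pi ^ 4"
          using NM' NM by (simp add: power2_eq_square power3_eq_cube)
        also have "\<dots> \<le> \<bar>cauchy_wt m\<bar> * (1 / M\<^sup>2) / 1"
          using pi1 by (intro divide_left_mono) auto
        also have "\<dots> = \<bar>cauchy_wt m\<bar> * (1 / M\<^sup>2)" by simp
        also have "\<dots> \<le> B * decay M"
          using 1 cauchy_wt_bounded[of m] B by (intro mult_mono) (auto simp: B_def)
        also have "\<dots> \<le> B * W" using pwW True B by (intro mult_left_mono) (auto simp: dist_wt_def)
        finally show ?thesis .
      qed
      moreover have "N\<^sup>2 * \<bar>ker_rem n m\<bar> \<le> N\<^sup>2 * \<bar>ker_coeff n m\<bar> + N\<^sup>2 * (\<bar>cauchy_wt m\<bar> / (M * pi ^ 4 * N ^ 3))"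
      proof -
        have "\<bar>ker_rem n m\<bar> \<le> \<bar>ker_coeff n m\<bar> + \<bar>cauchy_wt m / (M * pi ^ 4 * N ^ 3)\<bar>"
          unfolding ker_rem_def N_def M_def by (rule abs_triangle_ineq4)
        also have "\<bar>cauchy_wt m / (M * pi ^ 4 * N ^ 3)\<bar> = \<bar>cauchy_wt m\<bar> / (M * pi ^ 4 * N ^ 3)"
          using NM by (simp add: abs_mult)
        finally show ?thesis unfolding distrib_left[symmetric] by (rule mult_left_mono) simp
      qed
      ultimately have "N\<^sup>2 * \<bar>ker_rem n m\<bar> \<le> (ker_const + B) * W" using NM' by (simp add: distrib_right)
      also have "\<dots> \<le> C * W" using W BEg by (intro mult_right_mono) (auto simp: C_def)
      finally show ?thesis by (simp add: N_def M_def W_def)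
    next
      case False
      define D where "D = \<bar>real n - real m\<bar>"
      define s where "s = N + M"
      have D: "D > 0" "M \<le> N + D" "s > 0" using False NM by (auto simp: D_def N_def M_def s_def)
      have g: "gap n m \<noteq> 0" using gap_ne by (simp add: gap_def)
      \<comment> \<open>The part of the gap other than its leading term pi^4 N^4, with the opposite
        sign.\<close>
      define R where "R = lam * pi\<^sup>2 * N\<^sup>2 + pi ^ 4 * M ^ 4 - lam * pi\<^sup>2 * M\<^sup>2 - a"
      have gapR: "gap n m = pi ^ 4 * N ^ 4 - R"
        by (simp add: gap_def beta_def nu_def R_def N_def[symmetric] M_def[symmetric] power_mult_distrib del: of_nat_Suc)
      have "N / gap n m - 1 / (pi ^ 4 * N ^ 3) = (pi ^ 4 * N ^ 4 - gap n m) / (pi ^ 4 * N ^ 3 * gap n m)"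
        using g NM by (simp add: field_simps power3_eq_cube power4_eq_xxxx)
      also have "pi ^ 4 * N ^ 4 - gap n m = R" by (simp add: gapR)
      finally have e: "N / gap n m - 1 / (pi ^ 4 * N ^ 3) = R / (pi ^ 4 * N ^ 3 * gap n m)" .
      have "ker_rem n m = cauchy_wt m / M * (N / gap n m - 1 / (pi ^ 4 * N ^ 3))"
        using False by (simp add: ker_rem_def ker_coeff_def N_def[symmetric] M_def[symmetric] right_diff_distrib mult_ac del: of_nat_Suc)
      also note e
      finally have q: "ker_rem n m = cauchy_wt m / M * (R / (pi ^ 4 * N ^ 3 * gap n m))" .
      have "N\<^sup>2 * \<bar>ker_rem n m\<bar> = \<bar>cauchy_wt m\<bar> / M * (\<bar>R\<bar> / (pi ^ 4 * N)) * (1 / \<bar>gap n m\<bar>)"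
        using NM unfolding q by (simp add: abs_mult power2_eq_square power3_eq_cube)
      also have "\<dots> \<le> B / M * (E * (N\<^sup>2 + M ^ 4) / N) * (gap_const / (D * s ^ 3))"
      proof (intro mult_mono divide_right_mono)
        show "\<bar>cauchy_wt m\<bar> \<le> B" using cauchy_wt_bounded by (simp add: B_def)
        have "M\<^sup>2 \<le> M ^ 4" using NM by (intro power_increasing) auto
        hence "\<bar>lam * pi\<^sup>2 * M\<^sup>2\<bar> \<le> \<bar>lam\<bar> * pi\<^sup>2 * M ^ 4"
          by (simp add: abs_mult mult_left_mono)
        moreover have "1 \<le> N\<^sup>2" using NM by simp
        hence "\<bar>a\<bar> * 1 \<le> \<bar>a\<bar> * N\<^sup>2" by (intro mult_left_mono) auto
        moreover have "\<bar>lam * pi\<^sup>2 * N\<^sup>2\<bar> = \<bar>lam\<bar> * pi\<^sup>2 * N\<^sup>2" by (simp add: abs_mult)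
        moreover have "0 \<le> pi ^ 4 * M ^ 4" "0 \<le> pi ^ 4 * N\<^sup>2" "0 \<le> \<bar>a\<bar> * M ^ 4" "0 \<le> \<bar>lam\<bar> * pi\<^sup>2 * N\<^sup>2" "0 \<le> \<bar>lam\<bar> * pi\<^sup>2 * M ^ 4"
          using NM by auto
        moreover have "E * (N\<^sup>2 + M ^ 4) = 2 * (\<bar>lam\<bar> * pi\<^sup>2 * N\<^sup>2) + 2 * (\<bar>lam\<bar> * pi\<^sup>2 * M ^ 4) + pi ^ 4 * N\<^sup>2 + pi ^ 4 * M ^ 4 + \<bar>a\<bar> * N\<^sup>2 + \<bar>a\<bar> * M ^ 4"
          by (simp add: E_def algebra_simps)
        ultimately have R: "\<bar>R\<bar> \<le> E * (N\<^sup>2 + M ^ 4)" unfolding R_def by linarith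
        have "\<bar>R\<bar> / (pi ^ 4 * N) \<le> \<bar>R\<bar> / (1 * N)"
          using NM pi1 by (intro divide_left_mono mult_right_mono) auto
        also have "\<dots> \<le> E * (N\<^sup>2 + M ^ 4) / N" using R NM by (simp add: divide_right_mono)
        finally show "\<bar>R\<bar> / (pi ^ 4 * N) \<le> E * (N\<^sup>2 + M ^ 4) / N" .
        show "1 / \<bar>gap n m\<bar> \<le> gap_const / (D * s ^ 3)" using gap_const(2)[OF False] by (simp add: D_def s_def N_def M_def)
      qed (use NM B E D gap_const(1) in auto)
      \<comment> \<open>The summands N^2 and M^4 are separated here; they contribute 1 and 2 to the
        factor 3 below.\<close>
      also have "\<dots> = (B * E * gap_const) * ((N / (D * s ^ 3) + M ^ 4 / (N * (D * s ^ 3))) / M)"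
        using NM D by (simp add: field_simps power2_eq_square)
      also have "\<dots> \<le> (B * E * gap_const) * (3 * W)"
      proof (rule mult_left_mono[OF _ BEg])
        have sM: "s \<ge> M" "s \<ge> 1" "N \<le> s" using NM by (auto simp: s_def)
        have "N * 1 \<le> s * s" using sM NM by (intro mult_mono) auto
        hence "N * gap_wt n m \<le> dist_wt n m * decay M"
          using gap_wt_times_le(2)[of N n m] NM by (simp add: s_def N_def M_def power2_eq_square)
        moreover have "N * (1 / (D * s ^ 3)) \<le> N * gap_wt n m"
          using inverse_gap_le[OF False] NM unfolding gap_wt_def D_def s_def N_def M_def by (intro mult_left_mono) auto
        ultimately have "N / (D * s ^ 3) \<le> W" using pwW by (simp add: mult.commute)
        moreover have "W * 1 \<le> W * M" using W NM by (intro mult_left_mono) auto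
        ultimately have 1: "N / (D * s ^ 3) \<le> W * M" by linarith
        have "M ^ 4 / (N * (D * s ^ 3)) \<le> M ^ 4 / (N * (D * M ^ 3))"
          using sM NM D by (intro divide_left_mono mult_left_mono power_mono) auto
        also have "\<dots> = M / (N * D)" using NM by (simp add: power3_eq_cube power4_eq_xxxx)
        also have "\<dots> \<le> 2 * (M * decay M) * (D powr (-5/4) + N powr (-5/4))"
          using NM D by (intro quotient_powr_bound) auto
        also have "\<dots> = 2 * (W * M)" using False by (simp add: W_def dist_wt_def D_def)
        finally have "N / (D * s ^ 3) + M ^ 4 / (N * (D * s ^ 3)) \<le> 3 * W * M" using 1 by simp
        thus "(N / (D * s ^ 3) + M ^ 4 / (N * (D * s ^ 3))) / M \<le> 3 * W"
          using NM by (simp add: pos_divide_le_eq)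
      qed
      also have "\<dots> = (B * E * gap_const * 3) * W" by simp
      also have "\<dots> \<le> C * W" using W B ker_const(1) by (intro mult_right_mono) (auto simp: C_def)
      finally show ?thesis by (simp add: N_def M_def W_def)
    qed
  qed
  with C show ?thesis by blast
qed

end

section \<open>Square-integrable functions on the unit square\<close>

lemma open_square_eq_box: "open_square = box (0, 0) (1, 1)"
  by (auto simp: box_def Basis_prod_def)

lemma closed_square_eq_cbox: "closed_square = cbox (0, 0) (1, 1)"
  by (auto simp: cbox_Pair_eq)

lemma compact_closed_square: "compact closed_square"
  by (simp add: closed_square_eq_cbox)

lemma open_square_subset: "open_square \<subseteq> closed_square" by auto

lemma lebesgue_open_square [simp]: "open_square \<in> sets lebesgue"
  by (simp add: open_square_eq_box)

lemma lmeasurable_open_square: "open_square \<in> lmeasurable"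
  by (simp add: open_square_eq_box)

lemma continuous_integrable_square:
  fixes f :: "real \<times> real \<Rightarrow> real"
  assumes "continuous_on closed_square f"
  shows "integrable (lebesgue_on open_square) f"
proof -
  have "f absolutely_integrable_on closed_square"
    using assms unfolding closed_square_eq_cbox by (rule absolutely_integrable_continuous)
  hence "f absolutely_integrable_on open_square"
    by (rule set_integrable_subset) (use open_square_subset in auto)
  thus ?thesis by (simp add: absolutely_integrable_imp_integrable)
qed

lemma integral_square_eq_integral:
  fixes f :: "real \<times> real \<Rightarrow> real"
  assumes "continuous_on closed_square f"
  shows "(\<integral>p. f p \<partial>lebesgue_on open_square) = integral closed_square f"
  using lebesgue_integral_eq_integral[OF continuous_integrable_square[OF assms]]
  by (simp add: open_square_eq_box closed_square_eq_cbox integral_open_interval)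

lemma integral_square_iterated:
  fixes f :: "real \<times> real \<Rightarrow> real"
  assumes "continuous_on closed_square f"
  shows "(\<integral>p. f p \<partial>lebesgue_on open_square) = integral {0..1} (\<lambda>x. integral {0..1} (\<lambda>y. f (x, y)))"
    "(\<integral>p. f p \<partial>lebesgue_on open_square) = integral {0..1} (\<lambda>y. integral {0..1} (\<lambda>x. f (x, y)))"
proof -
  have "integral closed_square f = integral {0..1} (\<lambda>x. integral {0..1} (\<lambda>y. f (x, y)))"
    using integral_prod_continuous[of 0 0 1 1 f] assms unfolding closed_square_eq_cbox by simp
  thus 1: "(\<integral>p. f p \<partial>lebesgue_on open_square) = integral {0..1} (\<lambda>x. integral {0..1} (\<lambda>y. f (x, y)))"
    using integral_square_eq_integral[OF assms] by simp
  show "(\<integral>p. f p \<partial>lebesgue_on open_square) = integral {0..1} (\<lambda>y. integral {0..1} (\<lambda>x. f (x, y)))"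
    unfolding 1 using integral_swap_continuous[of 0 0 1 1 "\<lambda>x y. f (x, y)"] assms unfolding closed_square_eq_cbox by simp
qed

lemma integral_square_product:
  fixes f g :: "real \<Rightarrow> real"
  assumes "continuous_on {0..1} f" "continuous_on {0..1} g"
  shows "(\<integral>p. f (fst p) * g (snd p) \<partial>lebesgue_on open_square) = integral {0..1} f * integral {0..1} g"
proof -
  have "continuous_on closed_square (\<lambda>p. f (fst p) * g (snd p))"
    by (intro continuous_intros continuous_on_compose2[OF assms(1)] continuous_on_compose2[OF assms(2)]) auto
  thus ?thesis by (simp add: integral_square_iterated(1))
qed

lemma integral_unit_eq_integral:
  fixes f :: "real \<Rightarrow> real"
  assumes "continuous_on {0..1} f"
  shows "(\<integral>x. f x \<partial>lebesgue_on unit_open) = integral {0..1} f" "integrable (lebesgue_on unit_open) f"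
proof -
  have "f absolutely_integrable_on {0..1}"
    using assms by (rule absolutely_integrable_continuous_real)
  hence "f absolutely_integrable_on unit_open"
    by (rule set_integrable_subset) auto
  thus 1: "integrable (lebesgue_on unit_open) f" by (simp add: absolutely_integrable_imp_integrable)
  show "(\<integral>x. f x \<partial>lebesgue_on unit_open) = integral {0..1} f"
    using lebesgue_integral_eq_integral[OF 1] by (simp add: integral_open_interval_real)
qed

section \<open>Inner product, norm and limits in L2\<close>

lemma L2_measurable: "f \<in> L2 S \<Longrightarrow> f \<in> borel_measurable (lebesgue_on S)"
  by (simp add: L2_def)

lemma L2_mult_integrable:
  assumes "f \<in> L2 S" "g \<in> L2 S"
  shows "integrable (lebesgue_on S) (\<lambda>x. f x * g x)"
proof (rule Bochner_Integration.integrable_bound)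
  show "integrable (lebesgue_on S) (\<lambda>x. (f x)\<^sup>2 + (g x)\<^sup>2)"
    using assms by (simp add: L2_def)
  show "(\<lambda>x. f x * g x) \<in> borel_measurable (lebesgue_on S)"
    using assms by (auto simp: L2_def)
  have "\<bar>f x * g x\<bar> \<le> (f x)\<^sup>2 + (g x)\<^sup>2" for x
  proof -
    have "2 * (\<bar>f x\<bar> * \<bar>g x\<bar>) \<le> (f x)\<^sup>2 + (g x)\<^sup>2"
      using sum_squares_bound[of "\<bar>f x\<bar>" "\<bar>g x\<bar>"] by (simp add: mult.assoc)
    moreover have "0 \<le> \<bar>f x\<bar> * \<bar>g x\<bar>" by simp
    ultimately show ?thesis unfolding abs_mult by linarith
  qed
  thus "AE x in lebesgue_on S. norm (f x * g x) \<le> norm ((f x)\<^sup>2 + (g x)\<^sup>2)"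
    by (intro AE_I2) (metis abs_ge_self order_trans real_norm_def)
qed

lemma L2_scale: "f \<in> L2 S \<Longrightarrow> (\<lambda>x. c * f x) \<in> L2 S"
  by (auto simp: L2_def power_mult_distrib)

lemma L2_add:
  assumes "f \<in> L2 S" "g \<in> L2 S" shows "(\<lambda>x. f x + g x) \<in> L2 S"
proof -
  have "integrable (lebesgue_on S) (\<lambda>x. (f x)\<^sup>2 + (g x)\<^sup>2 + 2 * (f x * g x))"
    using assms L2_mult_integrable[OF assms] by (auto simp: L2_def)
  thus ?thesis using assms by (auto simp: L2_def power2_sum mult.assoc)
qed

lemma L2_diff:
  assumes "f \<in> L2 S" "g \<in> L2 S" shows "(\<lambda>x. f x - g x) \<in> L2 S"
  using L2_add[OF assms(1) L2_scale[OF assms(2), of "-1"]] by simp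

lemma L2_zero: "(\<lambda>x. 0) \<in> L2 S" by (simp add: L2_def)

lemma L2_Cauchy_Schwarz:
  assumes "f \<in> L2 S" "g \<in> L2 S"
  shows "\<bar>\<integral>x. f x * g x \<partial>lebesgue_on S\<bar> \<le> L2_norm S f * L2_norm S g"
proof -
  define A where "A = (\<integral>x. (f x)\<^sup>2 \<partial>lebesgue_on S)"
  define B where "B = (\<integral>x. (g x)\<^sup>2 \<partial>lebesgue_on S)"
  define c where "c = (\<integral>x. f x * g x \<partial>lebesgue_on S)"
  have AB: "A \<ge> 0" "B \<ge> 0" by (auto simp: A_def B_def)
  have quad: "0 \<le> t\<^sup>2 * A + 2 * t * c + B" for t
  proof -
    have "0 \<le> (\<integral>x. (t * f x + g x)\<^sup>2 \<partial>lebesgue_on S)" by simp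
    also have "\<dots> = (\<integral>x. t\<^sup>2 * (f x)\<^sup>2 + (2 * t) * (f x * g x) + (g x)\<^sup>2 \<partial>lebesgue_on S)"
      by (rule Bochner_Integration.integral_cong) (auto simp: power2_eq_square algebra_simps)
    also have "\<dots> = t\<^sup>2 * A + 2 * t * c + B"
      using assms L2_mult_integrable[OF assms] by (simp add: L2_def A_def B_def c_def)
    finally show ?thesis .
  qed
  have "c\<^sup>2 \<le> A * B"
  proof (cases "A = 0")
    case True
    have "c = 0"
    proof (rule ccontr)
      assume "c \<noteq> 0"
      \<comment> \<open>At this t the linear expression 2 t c + B equals -1, against nonnegativity
        of the quadratic.\<close>
      thus False using quad[of "- (B + 1) / (2 * c)"] True AB by (simp add: field_simps)
    qed
    thus ?thesis using AB by simp
  next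
    case False
    hence "A > 0" using AB by simp
    with quad[of "- c / A"] show ?thesis by (simp add: field_simps power2_eq_square)
  qed
  hence "sqrt (c\<^sup>2) \<le> sqrt (A * B)" by (rule real_sqrt_le_mono)
  thus ?thesis unfolding L2_norm_def A_def[symmetric] B_def[symmetric] c_def[symmetric]
    by (simp add: real_sqrt_mult)
qed

lemma L2_norm_nonneg: "L2_norm S f \<ge> 0" by (simp add: L2_norm_def)

lemma L2_norm_square: "(L2_norm S f)\<^sup>2 = (\<integral>x. (f x)\<^sup>2 \<partial>lebesgue_on S)"
  by (simp add: L2_norm_def)

lemma L2_norm_triangle:
  assumes "f \<in> L2 S" "g \<in> L2 S"
  shows "L2_norm S (\<lambda>x. f x + g x) \<le> L2_norm S f + L2_norm S g"
proof (rule power2_le_imp_le)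
  have "(L2_norm S (\<lambda>x. f x + g x))\<^sup>2 = (\<integral>x. (f x)\<^sup>2 + 2 * (f x * g x) + (g x)\<^sup>2 \<partial>lebesgue_on S)"
    unfolding L2_norm_square by (rule Bochner_Integration.integral_cong) (auto simp: power2_eq_square algebra_simps)
  also have "\<dots> = (L2_norm S f)\<^sup>2 + 2 * (\<integral>x. f x * g x \<partial>lebesgue_on S) + (L2_norm S g)\<^sup>2"
    using assms L2_mult_integrable[OF assms] by (simp add: L2_def L2_norm_square)
  also have "\<dots> \<le> (L2_norm S f + L2_norm S g)\<^sup>2"
    using L2_Cauchy_Schwarz[OF assms] by (simp add: power2_sum)
  finally show "(L2_norm S (\<lambda>x. f x + g x))\<^sup>2 \<le> (L2_norm S f + L2_norm S g)\<^sup>2" .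
qed (simp add: L2_norm_nonneg)

lemma L2_norm_triangle_diff:
  assumes "f \<in> L2 S" "g \<in> L2 S" "h \<in> L2 S"
  shows "L2_norm S (\<lambda>x. f x - h x) \<le> L2_norm S (\<lambda>x. f x - g x) + L2_norm S (\<lambda>x. g x - h x)"
  using L2_norm_triangle[OF L2_diff[OF assms(1,2)] L2_diff[OF assms(2,3)]] by simp

lemma L2_norm_commute: "L2_norm S (\<lambda>x. f x - g x) = L2_norm S (\<lambda>x. g x - f x)"
  by (simp add: L2_norm_def power2_commute)

lemma L2_norm_cong: "(\<And>x. x \<in> S \<Longrightarrow> f x = g x) \<Longrightarrow> L2_norm S f = L2_norm S g"
  unfolding L2_norm_def by (intro arg_cong[where f = sqrt] Bochner_Integration.integral_cong) auto

text \<open>Stated for an arbitrary filter, since it serves sequences of partial sums as well as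
  unordered sums along finite subsets.\<close>

lemma L2_weak_limit:
  assumes k: "k \<in> L2 S" and u: "\<And>n. u n \<in> L2 S" "v \<in> L2 S"
    and lim: "((\<lambda>n. L2_norm S (\<lambda>x. u n x - v x)) \<longlongrightarrow> 0) F"
  shows "((\<lambda>n. \<integral>x. k x * u n x \<partial>lebesgue_on S) \<longlongrightarrow> (\<integral>x. k x * v x \<partial>lebesgue_on S)) F"
proof -
  have "((\<lambda>n. (\<integral>x. k x * u n x \<partial>lebesgue_on S) - (\<integral>x. k x * v x \<partial>lebesgue_on S)) \<longlongrightarrow> 0) F"
  proof (rule Lim_null_comparison)
    show "\<forall>\<^sub>F n in F. norm ((\<integral>x. k x * u n x \<partial>lebesgue_on S) - (\<integral>x. k x * v x \<partial>lebesgue_on S))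
       \<le> L2_norm S k * L2_norm S (\<lambda>x. u n x - v x)"
    proof (intro always_eventually allI)
      fix n
      have "(\<integral>x. k x * u n x \<partial>lebesgue_on S) - (\<integral>x. k x * v x \<partial>lebesgue_on S) = (\<integral>x. k x * (u n x - v x) \<partial>lebesgue_on S)"
        using L2_mult_integrable[OF k u(1)] L2_mult_integrable[OF k u(2)] by (simp add: right_diff_distrib)
      thus "norm ((\<integral>x. k x * u n x \<partial>lebesgue_on S) - (\<integral>x. k x * v x \<partial>lebesgue_on S))
       \<le> L2_norm S k * L2_norm S (\<lambda>x. u n x - v x)"
        using L2_Cauchy_Schwarz[OF k L2_diff[OF u]] by simp
    qed
    show "((\<lambda>n. L2_norm S k * L2_norm S (\<lambda>x. u n x - v x)) \<longlongrightarrow> 0) F"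
      using tendsto_mult_left[OF lim, of "L2_norm S k"] by simp
  qed
  thus ?thesis by (simp add: LIM_zero_iff)
qed

lemma continuous_L2_square:
  assumes "continuous_on closed_square f" shows "f \<in> L2 open_square"
  using continuous_integrable_square[OF assms]
    continuous_integrable_square[OF continuous_on_power[OF assms], of 2]
  by (auto simp: L2_def)

lemma continuous_L2_unit:
  assumes "continuous_on {0..1} f" shows "f \<in> L2 unit_open"
  using integral_unit_eq_integral(2)[OF assms]
    integral_unit_eq_integral(2)[OF continuous_on_power[OF assms], of 2]
  by (auto simp: L2_def)

lemma measure_open_square: "measure (lebesgue_on open_square) (space (lebesgue_on open_square)) = 1"
  using lmeasurable_open_square integral_square_product[of "\<lambda>_. 1" "\<lambda>_. 1"] by simp

lemma L2_norm_square_le_sup: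
  assumes "f \<in> L2 open_square" "\<And>p. p \<in> open_square \<Longrightarrow> \<bar>f p\<bar> \<le> B"
  shows "L2_norm open_square f \<le> B"
proof -
  have B: "B \<ge> 0" using assms(2)[of "(1/2, 1/2)"] by simp
  have "(\<integral>p. (f p)\<^sup>2 \<partial>lebesgue_on open_square) \<le> (\<integral>p. B\<^sup>2 \<partial>lebesgue_on open_square)"
  proof (rule integral_mono)
    show "integrable (lebesgue_on open_square) (\<lambda>p. (f p)\<^sup>2)" using assms(1) by (simp add: L2_def)
    show "integrable (lebesgue_on open_square) (\<lambda>p. B\<^sup>2)"
      by (rule continuous_integrable_square) (intro continuous_intros)
    show "(f p)\<^sup>2 \<le> B\<^sup>2" if "p \<in> space (lebesgue_on open_square)" for p
      using that power_mono[OF assms(2)[of p], of 2] by auto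
  qed
  also have "\<dots> = B\<^sup>2" using measure_open_square by simp
  finally show ?thesis unfolding L2_norm_def using B real_le_lsqrt by auto
qed

lemma uniform_limit_L2_square:
  fixes u :: "'i \<Rightarrow> real \<times> real \<Rightarrow> real"
  assumes "uniform_limit closed_square u v F" and "\<And>i. continuous_on closed_square (u i)"
    and "continuous_on closed_square v"
  shows "((\<lambda>i. L2_norm open_square (\<lambda>p. u i p - v p)) \<longlongrightarrow> 0) F"
proof (rule tendstoI)
  fix e :: real assume e: "e > 0"
  have "\<forall>\<^sub>F i in F. \<forall>p\<in>closed_square. dist (u i p) (v p) < e / 2"
    using assms(1) e half_gt_zero unfolding uniform_limit_iff by blast
  thus "\<forall>\<^sub>F i in F. dist (L2_norm open_square (\<lambda>p. u i p - v p)) 0 < e"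
  proof eventually_elim
    case (elim i)
    have "0 \<le> L2_norm open_square (\<lambda>p. u i p - v p)" by (rule L2_norm_nonneg)
    moreover have "L2_norm open_square (\<lambda>p. u i p - v p) \<le> e / 2"
      by (rule L2_norm_square_le_sup)
         (use elim assms(2,3) in \<open>auto simp: dist_real_def less_imp_le intro!: continuous_L2_square continuous_intros\<close>)
    ultimately show ?case using e by (simp add: dist_real_def)
  qed
qed

lemma integral_by_parts_unit:
  fixes f u :: "real \<Rightarrow> real"
  assumes "\<And>x. x \<in> {0..1} \<Longrightarrow> (f has_vector_derivative f' x) (at x within {0..1})"
    and "\<And>x. x \<in> {0..1} \<Longrightarrow> (u has_vector_derivative u' x) (at x within {0..1})"
    and "continuous_on {0..1} f'" "continuous_on {0..1} u'"
  shows "integral {0..1} (\<lambda>x. f x * u' x) = f 1 * u 1 - f 0 * u 0 - integral {0..1} (\<lambda>x. f' x * u x)"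
proof -
  have cf: "continuous_on {0..1} f" "continuous_on {0..1} u"
    using continuous_on_vector_derivative[OF assms(1)] continuous_on_vector_derivative[OF assms(2)] by auto
  have "((\<lambda>x. f x * u' x + f' x * u x) has_integral (f 1 * u 1 - f 0 * u 0)) {0..1}"
    by (rule fundamental_theorem_of_calculus) (use has_vector_derivative_mult[OF assms(1,2)] in auto)
  hence "integral {0..1} (\<lambda>x. f x * u' x + f' x * u x) = f 1 * u 1 - f 0 * u 0"
    by (rule integral_unique)
  moreover have "integral {0..1} (\<lambda>x. f x * u' x + f' x * u x) =
      integral {0..1} (\<lambda>x. f x * u' x) + integral {0..1} (\<lambda>x. f' x * u x)"
    by (intro integral_add integrable_continuous_real continuous_intros cf assms)
  ultimately show ?thesis by simp
qed

section \<open>Differential calculus on the closed square\<close>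

lemma Dx_eqI:
  assumes "x \<in> {0..1}" "((\<lambda>t. f (t, y)) has_vector_derivative d) (at x within {0..1})"
  shows "Dx f (x, y) = d"
  using vector_derivative_within_cbox[of 0 1 x] assms by (simp add: Dx_def)

lemma Dy_eqI:
  assumes "y \<in> {0..1}" "((\<lambda>t. f (x, t)) has_vector_derivative d) (at y within {0..1})"
  shows "Dy f (x, y) = d"
  using vector_derivative_within_cbox[of 0 1 y] assms by (simp add: Dy_def)

lemma vector_derivative_within_cong:
  assumes "\<And>t. t \<in> S \<Longrightarrow> f t = g t" "x \<in> S"
  shows "vector_derivative f (at x within S) = vector_derivative g (at x within S)"
proof -
  have "(f has_vector_derivative d) (at x within S) \<longleftrightarrow> (g has_vector_derivative d) (at x within S)" for d
    by (rule has_vector_derivative_cong_ev) (use assms in \<open>auto simp: eventually_nhds\<close>)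
  thus ?thesis by (simp add: vector_derivative_def)
qed

lemma Dx_cong:
  assumes "\<And>p. p \<in> closed_square \<Longrightarrow> f p = g p" "p \<in> closed_square"
  shows "Dx f p = Dx g p"
  using assms by (cases p) (auto simp: Dx_def intro!: vector_derivative_within_cong)

lemma Dy_cong:
  assumes "\<And>p. p \<in> closed_square \<Longrightarrow> f p = g p" "p \<in> closed_square"
  shows "Dy f p = Dy g p"
  using assms by (cases p) (auto simp: Dy_def intro!: vector_derivative_within_cong)

lemma differentiable_cong_on:
  assumes "\<And>t. t \<in> S \<Longrightarrow> f t = g t" "x \<in> S" "f differentiable (at x within S)"
  shows "g differentiable (at x within S)"
  using assms differentiable_transform_within[of f x S 1 g] by auto

text \<open>\<open>C_n\<close> recurses through the functions \<open>Dx f\<close> and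
  \<open>Dy f\<close>, which agree with the expected formulas only on the closed square. This lemma
  lets such formulas be substituted during an induction.\<close>

lemma C_n_cong:
  assumes "\<And>p. p \<in> closed_square \<Longrightarrow> f p = g p" "C_n n f"
  shows "C_n n g"
  using assms
proof (induction n arbitrary: f g)
  case 0
  then show ?case using continuous_on_cong[of closed_square closed_square f g] by auto
next
  case (Suc n)
  have "continuous_on closed_square g"
    using Suc.prems continuous_on_cong[of closed_square closed_square f g] by auto
  moreover have "(\<lambda>t. g (t, y)) differentiable (at x within {0..1})"
    "(\<lambda>t. g (x, t)) differentiable (at y within {0..1})" if "x \<in> {0..1}" "y \<in> {0..1}" for x y
    using differentiable_cong_on[of "{0..1}" "\<lambda>t. f (t, y)" "\<lambda>t. g (t, y)" x]
      differentiable_cong_on[of "{0..1}" "\<lambda>t. f (x, t)" "\<lambda>t. g (x, t)" y] Suc.prems that by auto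
  moreover have "C_n n (Dx g)"
    using Suc.prems by (intro Suc.IH[of "Dx f" "Dx g"] Dx_cong) auto
  moreover have "C_n n (Dy g)"
    using Suc.prems by (intro Suc.IH[of "Dy f" "Dy g"] Dy_cong) auto
  ultimately show ?case by auto
qed

lemma C_infinity_cong:
  "(\<And>p. p \<in> closed_square \<Longrightarrow> f p = g p) \<Longrightarrow> C_infinity f \<Longrightarrow> C_infinity g"
  unfolding C_infinity_def using C_n_cong by blast

lemma C_infinity_continuous: "C_infinity f \<Longrightarrow> continuous_on closed_square f"
  using C_n.simps(1) unfolding C_infinity_def by blast

lemma C_infinity_Dx: "C_infinity f \<Longrightarrow> C_infinity (Dx f)"
  and C_infinity_Dy: "C_infinity f \<Longrightarrow> C_infinity (Dy f)"
  unfolding C_infinity_def by (metis C_n.simps(2))+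

lemma C_infinity_Dx_pow: "C_infinity f \<Longrightarrow> C_infinity ((Dx ^^ i) f)"
  by (induction i) (auto intro: C_infinity_Dx)

lemma C_infinity_Dy_pow: "C_infinity f \<Longrightarrow> C_infinity ((Dy ^^ i) f)"
  by (induction i) (auto intro: C_infinity_Dy)

lemma Dx_has_vector_derivative:
  assumes "C_infinity f" "x \<in> {0..1}" "y \<in> {0..1}"
  shows "((\<lambda>t. f (t, y)) has_vector_derivative Dx f (x, y)) (at x within {0..1})"
proof -
  have "C_n (Suc 0) f" using assms by (auto simp: C_infinity_def)
  hence "(\<lambda>t. f (t, y)) differentiable (at x within {0..1})" using assms by simp
  thus ?thesis unfolding Dx_def by (simp add: vector_derivative_works)
qed

lemma Dy_has_vector_derivative:
  assumes "C_infinity f" "x \<in> {0..1}" "y \<in> {0..1}"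
  shows "((\<lambda>t. f (x, t)) has_vector_derivative Dy f (x, y)) (at y within {0..1})"
proof -
  have "C_n (Suc 0) f" using assms by (auto simp: C_infinity_def)
  hence "(\<lambda>t. f (x, t)) differentiable (at y within {0..1})" using assms by simp
  thus ?thesis unfolding Dy_def by (simp add: vector_derivative_works)
qed

lemma Dx_lincomb:
  assumes "C_infinity f" "C_infinity g" "p \<in> closed_square"
  shows "Dx (\<lambda>p. a * f p + b * g p) p = a * Dx f p + b * Dx g p"
  using assms
  by (cases p) (auto intro!: Dx_eqI has_vector_derivative_add has_vector_derivative_mult_right Dx_has_vector_derivative)

lemma Dy_lincomb:
  assumes "C_infinity f" "C_infinity g" "p \<in> closed_square"
  shows "Dy (\<lambda>p. a * f p + b * g p) p = a * Dy f p + b * Dy g p"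
  using assms
  by (cases p) (auto intro!: Dy_eqI has_vector_derivative_add has_vector_derivative_mult_right Dy_has_vector_derivative)

lemma C_infinity_lincomb:
  assumes "C_infinity f" "C_infinity g"
  shows "C_infinity (\<lambda>p. a * f p + b * g p)"
proof -
  have cont: "continuous_on closed_square (\<lambda>p. a * f p + b * g p)" if "C_infinity f" "C_infinity g" for f g
    by (intro continuous_on_add continuous_on_mult continuous_on_const
      C_infinity_continuous[OF that(1)] C_infinity_continuous[OF that(2)])
  have "C_n n (\<lambda>p. a * f p + b * g p)" for n
    using assms
  proof (induction n arbitrary: f g)
    case 0
    thus ?case using cont by simp
  next
    case (Suc n)
    have "C_n n (Dx (\<lambda>p. a * f p + b * g p))"
      by (rule C_n_cong[OF _ Suc.IH[OF C_infinity_Dx[OF Suc.prems(1)] C_infinity_Dx[OF Suc.prems(2)]]])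
         (use Dx_lincomb[OF Suc.prems] in simp)
    moreover have "C_n n (Dy (\<lambda>p. a * f p + b * g p))"
      by (rule C_n_cong[OF _ Suc.IH[OF C_infinity_Dy[OF Suc.prems(1)] C_infinity_Dy[OF Suc.prems(2)]]])
         (use Dy_lincomb[OF Suc.prems] in simp)
    moreover have "(\<lambda>t. f (t, y)) differentiable at x within {0..1}" "(\<lambda>t. g (t, y)) differentiable at x within {0..1}"
      "(\<lambda>t. f (x, t)) differentiable at y within {0..1}" "(\<lambda>t. g (x, t)) differentiable at y within {0..1}"
      if "x \<in> {0..1}" "y \<in> {0..1}" for x y
      using Dx_has_vector_derivative[OF Suc.prems(1) that] Dx_has_vector_derivative[OF Suc.prems(2) that]
        Dy_has_vector_derivative[OF Suc.prems(1) that] Dy_has_vector_derivative[OF Suc.prems(2) that]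
      by (auto simp: differentiableI_vector)
    ultimately show ?case
      using cont[OF Suc.prems] by (simp add: differentiable_add differentiable_mult)
  qed
  thus ?thesis by (simp add: C_infinity_def)
qed

lemma C_infinity_zero: "C_infinity (\<lambda>p. 0)"
proof -
  have "C_n n (\<lambda>p. 0)" for n
  proof (induction n)
    case (Suc n)
    have "Dx (\<lambda>p. 0) p = 0" "Dy (\<lambda>p. 0) p = 0" if "p \<in> closed_square" for p
      using that by (cases p; auto intro!: Dx_eqI Dy_eqI)+
    hence "C_n n (Dx (\<lambda>p. 0))" "C_n n (Dy (\<lambda>p. 0))"
      by (auto intro!: C_n_cong[OF _ Suc])
    thus ?case by auto
  qed auto
  thus ?thesis by (simp add: C_infinity_def)
qed

text \<open>A smooth function of one variable given together with the sequence of all its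
  derivatives on [0, 1]. Inductions on the order of smoothness then become index shifts.\<close>

definition derivs :: "(nat \<Rightarrow> real \<Rightarrow> real) \<Rightarrow> bool"
  where "derivs F \<longleftrightarrow> (\<forall>i. \<forall>x\<in>{0..1}. (F i has_vector_derivative F (Suc i) x) (at x within {0..1}))"

lemma derivs_continuous: "derivs F \<Longrightarrow> continuous_on {0..1} (F i)"
  unfolding derivs_def by (blast intro: continuous_on_vector_derivative)

definition tensor :: "(real \<Rightarrow> real) \<Rightarrow> (real \<Rightarrow> real) \<Rightarrow> real \<times> real \<Rightarrow> real"
  where "tensor f g = (\<lambda>p. f (fst p) * g (snd p))"

lemma tensor_continuous:
  assumes "continuous_on {0..1} f" "continuous_on {0..1} g"
  shows "continuous_on closed_square (tensor f g)"
  unfolding tensor_def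
  by (intro continuous_on_mult continuous_on_compose2[OF assms(1) continuous_on_fst]
      continuous_on_compose2[OF assms(2) continuous_on_snd] continuous_on_id) auto

lemma Dx_tensor:
  assumes "p \<in> closed_square" "\<And>x. x \<in> {0..1} \<Longrightarrow> (f has_vector_derivative f' x) (at x within {0..1})"
  shows "Dx (tensor f g) p = tensor f' g p"
  using assms by (cases p) (auto simp: tensor_def intro!: Dx_eqI has_vector_derivative_mult_left)

lemma Dy_tensor:
  assumes "p \<in> closed_square" "\<And>x. x \<in> {0..1} \<Longrightarrow> (g has_vector_derivative g' x) (at x within {0..1})"
  shows "Dy (tensor f g) p = tensor f g' p"
  using assms by (cases p) (auto simp: tensor_def intro!: Dy_eqI has_vector_derivative_mult_right)

lemma C_infinity_tensor:
  assumes F: "derivs F" and G: "derivs G"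
  shows "C_infinity (tensor (F i) (G j))"
proof -
  have dF: "(F i has_vector_derivative F (Suc i) x) (at x within {0..1})"
    and dG: "(G i has_vector_derivative G (Suc i) x) (at x within {0..1})" if "x \<in> {0..1}" for i x
    using F G that by (auto simp: derivs_def)
  have "C_n n (tensor (F i) (G j))" for n
  proof (induction n arbitrary: i j)
    case 0
    then show ?case using F G by (auto intro!: tensor_continuous derivs_continuous)
  next
    case (Suc n)
    have "C_n n (Dx (tensor (F i) (G j)))"
      by (rule C_n_cong[OF _ Suc.IH[of "Suc i" j]]) (use Dx_tensor[OF _ dF] in simp)
    moreover have "C_n n (Dy (tensor (F i) (G j)))"
      by (rule C_n_cong[OF _ Suc.IH[of i "Suc j"]]) (use Dy_tensor[OF _ dG] in simp)
    moreover have "(\<lambda>t. tensor (F i) (G j) (t, y)) differentiable at x within {0..1}"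
      "(\<lambda>t. tensor (F i) (G j) (x, t)) differentiable at y within {0..1}"
      if "x \<in> {0..1}" "y \<in> {0..1}" for x y
      using differentiableI_vector[OF has_vector_derivative_mult_left[OF dF[OF that(1)]]]
        differentiableI_vector[OF has_vector_derivative_mult_right[OF dG[OF that(2)]]]
      by (auto simp: tensor_def)
    ultimately show ?case using F G by (auto intro!: tensor_continuous derivs_continuous)
  qed
  thus ?thesis by (simp add: C_infinity_def)
qed

lemma Dx_pow_tensor:
  assumes "derivs F" "p \<in> closed_square"
  shows "(Dx ^^ n) (tensor (F i) g) p = tensor (F (i + n)) g p"
  using assms(2)
proof (induction n arbitrary: p)
  case (Suc n)
  have "(Dx ^^ Suc n) (tensor (F i) g) p = Dx (tensor (F (i + n)) g) p"
    using Suc by (auto intro!: Dx_cong)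
  also have "\<dots> = tensor (F (Suc (i + n))) g p"
    by (rule Dx_tensor) (use Suc assms in \<open>auto simp: derivs_def\<close>)
  finally show ?case by simp
qed simp

lemma Dy_pow_tensor:
  assumes "derivs G" "p \<in> closed_square"
  shows "(Dy ^^ n) (tensor f (G i)) p = tensor f (G (i + n)) p"
  using assms(2)
proof (induction n arbitrary: p)
  case (Suc n)
  have "(Dy ^^ Suc n) (tensor f (G i)) p = Dy (tensor f (G (i + n))) p"
    using Suc by (auto intro!: Dy_cong)
  also have "\<dots> = tensor f (G (Suc (i + n))) p"
    by (rule Dy_tensor) (use Suc assms in \<open>auto simp: derivs_def\<close>)
  finally show ?case by simp
qed simp

lemma continuous_on_slice:
  assumes "continuous_on closed_square u"
  shows "y \<in> {0..1} \<Longrightarrow> continuous_on {0..1} (\<lambda>x. u (x, y))"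
    and "x \<in> {0..1} \<Longrightarrow> continuous_on {0..1} (\<lambda>y. u (x, y))"
  by (rule continuous_on_compose2[OF assms]; auto intro!: continuous_intros)+

text \<open>The boundary terms are kept. They vanish against test functions, and the elements of
  \<open>\<E>\<close> let exactly some of them survive.\<close>

lemma integral_tensor_Dx:
  assumes u: "C_infinity u" and f: "\<And>x. x \<in> {0..1} \<Longrightarrow> (f has_vector_derivative f' x) (at x within {0..1})"
    and f': "continuous_on {0..1} f'" and g: "continuous_on {0..1} g"
  shows "(\<integral>p. tensor f g p * Dx u p \<partial>lebesgue_on open_square) =
    integral {0..1} (\<lambda>y. g y * (f 1 * u (1, y) - f 0 * u (0, y))) - (\<integral>p. tensor f' g p * u p \<partial>lebesgue_on open_square)"
proof -
  have cu: "continuous_on closed_square u" "continuous_on closed_square (Dx u)"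
    using u C_infinity_Dx C_infinity_continuous by blast+
  have cf: "continuous_on {0..1} f" using f by (rule continuous_on_vector_derivative)
  have c: "continuous_on closed_square (\<lambda>p. tensor f g p * Dx u p)" "continuous_on closed_square (\<lambda>p. tensor f' g p * u p)"
    using cf f' g cu by (auto intro!: continuous_on_mult tensor_continuous)
  have inner: "integral {0..1} (\<lambda>x. f x * g y * Dx u (x, y)) =
    g y * (f 1 * u (1, y) - f 0 * u (0, y)) - integral {0..1} (\<lambda>x. f' x * g y * u (x, y))" if y: "y \<in> {0..1}" for y
  proof -
    have "integral {0..1} (\<lambda>x. f x * Dx u (x, y)) = f 1 * u (1, y) - f 0 * u (0, y) - integral {0..1} (\<lambda>x. f' x * u (x, y))"
      by (rule integral_by_parts_unit[OF f Dx_has_vector_derivative[OF u _ y] f' continuous_on_slice(1)[OF cu(2) y]])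
    hence "g y * integral {0..1} (\<lambda>x. f x * Dx u (x, y)) =
      g y * (f 1 * u (1, y) - f 0 * u (0, y)) - g y * integral {0..1} (\<lambda>x. f' x * u (x, y))"
      by (simp add: right_diff_distrib)
    thus ?thesis by (simp add: mult_ac flip: integral_mult_right)
  qed
  have "continuous_on {0..1} (\<lambda>y. g y * (f 1 * u (1, y) - f 0 * u (0, y)))"
    by (intro continuous_intros g continuous_on_slice(2)[OF cu(1)]) auto
  moreover have "continuous_on {0..1} (\<lambda>y. integral {0..1} (\<lambda>x. f' x * g y * u (x, y)))"
  proof -
    have "continuous_on (cbox 0 1 \<times> cbox 0 1) (\<lambda>(y, x). tensor f' g (x, y) * u (x, y))"
      unfolding case_prod_unfold
      by (rule continuous_on_compose2[OF c(2)]) (auto intro!: continuous_on_Pair continuous_on_fst continuous_on_snd continuous_on_id)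
    from integral_continuous_on_param[OF this] show ?thesis by (simp add: tensor_def)
  qed
  ultimately have "integral {0..1} (\<lambda>y. g y * (f 1 * u (1, y) - f 0 * u (0, y)) - integral {0..1} (\<lambda>x. f' x * g y * u (x, y))) =
     integral {0..1} (\<lambda>y. g y * (f 1 * u (1, y) - f 0 * u (0, y))) - integral {0..1} (\<lambda>y. integral {0..1} (\<lambda>x. f' x * g y * u (x, y)))"
    by (intro integral_diff integrable_continuous_real)
  moreover have "integral {0..1} (\<lambda>y. integral {0..1} (\<lambda>x. f x * g y * Dx u (x, y))) =
    integral {0..1} (\<lambda>y. g y * (f 1 * u (1, y) - f 0 * u (0, y)) - integral {0..1} (\<lambda>x. f' x * g y * u (x, y)))"
    by (rule Henstock_Kurzweil_Integration.integral_cong) (rule inner)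
  ultimately show ?thesis
    unfolding integral_square_iterated(2)[OF c(1)] integral_square_iterated(2)[OF c(2)] by (simp add: tensor_def)
qed

lemma integral_tensor_Dy:
  assumes u: "C_infinity u" and g: "\<And>x. x \<in> {0..1} \<Longrightarrow> (g has_vector_derivative g' x) (at x within {0..1})"
    and g': "continuous_on {0..1} g'" and f: "continuous_on {0..1} f"
  shows "(\<integral>p. tensor f g p * Dy u p \<partial>lebesgue_on open_square) =
    integral {0..1} (\<lambda>x. f x * (g 1 * u (x, 1) - g 0 * u (x, 0))) - (\<integral>p. tensor f g' p * u p \<partial>lebesgue_on open_square)"
proof -
  have cu: "continuous_on closed_square u" "continuous_on closed_square (Dy u)"
    using u C_infinity_Dy C_infinity_continuous by blast+
  have cg: "continuous_on {0..1} g" using g by (rule continuous_on_vector_derivative)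
  have c: "continuous_on closed_square (\<lambda>p. tensor f g p * Dy u p)" "continuous_on closed_square (\<lambda>p. tensor f g' p * u p)"
    using cg g' f cu by (auto intro!: continuous_on_mult tensor_continuous)
  have inner: "integral {0..1} (\<lambda>y. f x * g y * Dy u (x, y)) =
    f x * (g 1 * u (x, 1) - g 0 * u (x, 0)) - integral {0..1} (\<lambda>y. f x * g' y * u (x, y))" if x: "x \<in> {0..1}" for x
  proof -
    have "integral {0..1} (\<lambda>y. g y * Dy u (x, y)) = g 1 * u (x, 1) - g 0 * u (x, 0) - integral {0..1} (\<lambda>y. g' y * u (x, y))"
      by (rule integral_by_parts_unit[OF g Dy_has_vector_derivative[OF u x] g' continuous_on_slice(2)[OF cu(2) x]])
    hence "f x * integral {0..1} (\<lambda>y. g y * Dy u (x, y)) =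
      f x * (g 1 * u (x, 1) - g 0 * u (x, 0)) - f x * integral {0..1} (\<lambda>y. g' y * u (x, y))"
      by (simp add: right_diff_distrib)
    thus ?thesis by (simp add: mult_ac flip: integral_mult_right)
  qed
  have "continuous_on {0..1} (\<lambda>x. f x * (g 1 * u (x, 1) - g 0 * u (x, 0)))"
    by (intro continuous_intros f continuous_on_slice(1)[OF cu(1)]) auto
  moreover have "continuous_on {0..1} (\<lambda>x. integral {0..1} (\<lambda>y. f x * g' y * u (x, y)))"
  proof -
    have "continuous_on (cbox 0 1 \<times> cbox 0 1) (\<lambda>(x, y). tensor f g' (x, y) * u (x, y))"
      using c(2) by (simp add: case_prod_unfold)
    from integral_continuous_on_param[OF this] show ?thesis by (simp add: tensor_def)
  qed
  ultimately have "integral {0..1} (\<lambda>x. f x * (g 1 * u (x, 1) - g 0 * u (x, 0)) - integral {0..1} (\<lambda>y. f x * g' y * u (x, y))) =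
     integral {0..1} (\<lambda>x. f x * (g 1 * u (x, 1) - g 0 * u (x, 0))) - integral {0..1} (\<lambda>x. integral {0..1} (\<lambda>y. f x * g' y * u (x, y)))"
    by (intro integral_diff integrable_continuous_real)
  moreover have "integral {0..1} (\<lambda>x. integral {0..1} (\<lambda>y. f x * g y * Dy u (x, y))) =
    integral {0..1} (\<lambda>x. f x * (g 1 * u (x, 1) - g 0 * u (x, 0)) - integral {0..1} (\<lambda>y. f x * g' y * u (x, y)))"
    by (rule Henstock_Kurzweil_Integration.integral_cong) (rule inner)
  ultimately show ?thesis
    unfolding integral_square_iterated(1)[OF c(1)] integral_square_iterated(1)[OF c(2)] by (simp add: tensor_def)
qed

section \<open>Test functions and weak derivatives\<close>

lemma test_functionD:
  assumes "test_function \<phi>"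
  shows "C_infinity \<phi>" "p \<in> closed_square \<Longrightarrow> p \<notin> open_square \<Longrightarrow> \<phi> p = 0"
  using assms unfolding test_function_def by auto

lemma test_function_Dx:
  assumes "test_function \<phi>" shows "test_function (Dx \<phi>)"
proof -
  obtain K where K: "compact K" "K \<subseteq> open_square" "\<And>p. p \<in> closed_square - K \<Longrightarrow> \<phi> p = 0"
    using assms unfolding test_function_def by auto
  have "Dx \<phi> p = 0" if p: "p \<in> closed_square - K" for p
  proof -
    obtain x y where xy: "p = (x, y)" "x \<in> {0..1}" "y \<in> {0..1}" using p by auto
    have "open (- K)" using K(1) by (simp add: compact_imp_closed open_Compl)
    then obtain e where e: "e > 0" "ball p e \<subseteq> - K" using p by (auto simp: open_contains_ball)
    have "((\<lambda>t. \<phi> (t, y)) has_vector_derivative 0) (at x within {0..1})"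
    proof (rule has_vector_derivative_transform_within[where d = e])
      show "((\<lambda>t. 0) has_vector_derivative 0) (at x within {0..1})" by simp
      fix t assume "t \<in> {0..1}" "dist t x < e"
      hence "(t, y) \<in> closed_square - K" using e(2) xy by (auto simp: dist_Pair_Pair dist_commute subset_iff)
      thus "0 = \<phi> (t, y)" using K(3) by simp
    qed (use e xy in auto)
    thus ?thesis using xy by (simp add: Dx_eqI)
  qed
  thus ?thesis using K assms C_infinity_Dx unfolding test_function_def by blast
qed

lemma test_function_Dy:
  assumes "test_function \<phi>" shows "test_function (Dy \<phi>)"
proof -
  obtain K where K: "compact K" "K \<subseteq> open_square" "\<And>p. p \<in> closed_square - K \<Longrightarrow> \<phi> p = 0"
    using assms unfolding test_function_def by auto
  have "Dy \<phi> p = 0" if p: "p \<in> closed_square - K" for p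
  proof -
    obtain x y where xy: "p = (x, y)" "x \<in> {0..1}" "y \<in> {0..1}" using p by auto
    have "open (- K)" using K(1) by (simp add: compact_imp_closed open_Compl)
    then obtain e where e: "e > 0" "ball p e \<subseteq> - K" using p by (auto simp: open_contains_ball)
    have "((\<lambda>t. \<phi> (x, t)) has_vector_derivative 0) (at y within {0..1})"
    proof (rule has_vector_derivative_transform_within[where d = e])
      show "((\<lambda>t. 0) has_vector_derivative 0) (at y within {0..1})" by simp
      fix t assume "t \<in> {0..1}" "dist t y < e"
      hence "(x, t) \<in> closed_square - K" using e(2) xy by (auto simp: dist_Pair_Pair dist_commute subset_iff)
      thus "0 = \<phi> (x, t)" using K(3) by simp
    qed (use e xy in auto)
    thus ?thesis using xy by (simp add: Dy_eqI)
  qed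
  thus ?thesis using K assms C_infinity_Dy unfolding test_function_def by blast
qed

lemma test_function_Dy_pow: "test_function \<phi> \<Longrightarrow> test_function ((Dy ^^ j) \<phi>)"
  by (induction j) (auto intro: test_function_Dy)

lemma test_function_Dx_pow: "test_function \<phi> \<Longrightarrow> test_function ((Dx ^^ j) \<phi>)"
  by (induction j) (auto intro: test_function_Dx)

lemma test_function_L2: "test_function \<phi> \<Longrightarrow> \<phi> \<in> L2 open_square"
  by (intro continuous_L2_square C_infinity_continuous test_functionD)

lemma has_weak_deriv_self: "k \<in> L2 open_square \<Longrightarrow> has_weak_deriv 0 0 k k"
  by (simp add: has_weak_deriv_def)

text \<open>The y-derivatives of a test function form a test function again, so the x-derivative may
  be moved first. With the two lemmas below, weak derivatives of order two are obtained from
  first-order ones.\<close>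

lemma has_weak_deriv_compose:
  assumes "has_weak_deriv i 0 k w" "has_weak_deriv 0 j w v"
  shows "has_weak_deriv i j k v"
  using assms test_function_Dy_pow by (auto simp: has_weak_deriv_def power_add)

lemma has_weak_deriv_20:
  assumes "has_weak_deriv 1 0 k w" "has_weak_deriv 1 0 w v"
  shows "has_weak_deriv 2 0 k v"
  using assms test_function_Dx by (auto simp: has_weak_deriv_def numeral_2_eq_2)

lemma has_weak_deriv_02:
  assumes "has_weak_deriv 0 1 k w" "has_weak_deriv 0 1 w v"
  shows "has_weak_deriv 0 2 k v"
  using assms test_function_Dy by (auto simp: has_weak_deriv_def numeral_2_eq_2)

lemma has_weak_deriv_add_scaled:
  assumes "has_weak_deriv i j k w" "has_weak_deriv i j k' w'"
  shows "has_weak_deriv i j (\<lambda>p. k p + c * k' p) (\<lambda>p. w p + c * w' p)"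
proof -
  have L: "k \<in> L2 open_square" "k' \<in> L2 open_square" "w \<in> L2 open_square" "w' \<in> L2 open_square"
    using assms by (auto simp: has_weak_deriv_def)
  have split: "(\<integral>p. (f p + c * g p) * h p \<partial>lebesgue_on open_square) =
      (\<integral>p. f p * h p \<partial>lebesgue_on open_square) + c * (\<integral>p. g p * h p \<partial>lebesgue_on open_square)"
    if "f \<in> L2 open_square" "g \<in> L2 open_square" "h \<in> L2 open_square" for f g h
    using L2_mult_integrable[OF that(1,3)] L2_mult_integrable[OF that(2,3)]
    by (simp add: distrib_right mult.assoc)
  have "(\<integral>p. (k p + c * k' p) * (Dx ^^ i) ((Dy ^^ j) \<phi>) p \<partial>lebesgue_on open_square) =
     (-1) ^ (i + j) * (\<integral>p. (w p + c * w' p) * \<phi> p \<partial>lebesgue_on open_square)" if \<phi>: "test_function \<phi>" for \<phi>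
  proof -
    have "(Dx ^^ i) ((Dy ^^ j) \<phi>) \<in> L2 open_square" "\<phi> \<in> L2 open_square"
      using \<phi> by (auto intro!: test_function_L2 test_function_Dx_pow test_function_Dy_pow)
    thus ?thesis unfolding split[OF L(1,2) \<open>(Dx ^^ i) ((Dy ^^ j) \<phi>) \<in> L2 open_square\<close>] split[OF L(3,4) \<open>\<phi> \<in> L2 open_square\<close>]
      using assms \<phi> by (simp add: has_weak_deriv_def distrib_left mult.left_commute)
  qed
  thus ?thesis using L by (auto simp: has_weak_deriv_def intro!: L2_add L2_scale)
qed

lemma has_weak_deriv_zero: "has_weak_deriv i j (\<lambda>p. 0) (\<lambda>p. 0)"
  by (simp add: has_weak_deriv_def L2_zero)

lemma has_weak_deriv_scaled_sum:
  assumes "\<And>n. n \<in> I \<Longrightarrow> has_weak_deriv i j (k n) (w n)"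
  shows "has_weak_deriv i j (\<lambda>p. \<Sum>n\<in>I. c n * k n p) (\<lambda>p. \<Sum>n\<in>I. c n * w n p)"
  using assms
proof (induction I rule: infinite_finite_induct)
  case (insert x I)
  have "has_weak_deriv i j (\<lambda>p. (\<Sum>n\<in>I. c n * k n p) + c x * k x p) (\<lambda>p. (\<Sum>n\<in>I. c n * w n p) + c x * w x p)"
    using insert by (intro has_weak_deriv_add_scaled) auto
  thus ?case using insert by (simp add: add.commute)
qed (auto simp: has_weak_deriv_zero)

text \<open>Both sides of the defining identity are L2 pairings with a fixed function, hence
  continuous: differentiation is a closed operator. This is the passage from finite sums to the
  kernel.\<close>

lemma has_weak_deriv_limit:
  assumes F: "F \<noteq> bot" and wd: "\<And>n. has_weak_deriv i j (u n) (v n)"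
    and k: "k \<in> L2 open_square" and w: "w \<in> L2 open_square"
    and lim: "((\<lambda>n. L2_norm open_square (\<lambda>p. u n p - k p)) \<longlongrightarrow> 0) F"
      "((\<lambda>n. L2_norm open_square (\<lambda>p. v n p - w p)) \<longlongrightarrow> 0) F"
  shows "has_weak_deriv i j k w"
  unfolding has_weak_deriv_def
proof (intro conjI allI impI k w)
  fix \<phi> assume \<phi>: "test_function \<phi>"
  have L: "(Dx ^^ i) ((Dy ^^ j) \<phi>) \<in> L2 open_square" "\<phi> \<in> L2 open_square"
    using \<phi> by (auto intro!: test_function_L2 test_function_Dx_pow test_function_Dy_pow)
  have u: "u n \<in> L2 open_square" "v n \<in> L2 open_square" for n using wd[of n] by (auto simp: has_weak_deriv_def)
  have 1: "((\<lambda>n. \<integral>p. u n p * (Dx ^^ i) ((Dy ^^ j) \<phi>) p \<partial>lebesgue_on open_square) \<longlongrightarrow>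
     (\<integral>p. k p * (Dx ^^ i) ((Dy ^^ j) \<phi>) p \<partial>lebesgue_on open_square)) F"
    using L2_weak_limit[OF L(1) u(1) k lim(1)] by (simp add: mult.commute)
  have "((\<lambda>n. (-1) ^ (i + j) * (\<integral>p. v n p * \<phi> p \<partial>lebesgue_on open_square)) \<longlongrightarrow>
     (-1) ^ (i + j) * (\<integral>p. w p * \<phi> p \<partial>lebesgue_on open_square)) F"
    using L2_weak_limit[OF L(2) u(2) w lim(2)] by (intro tendsto_mult_left) (simp add: mult.commute)
  moreover have "(\<integral>p. u n p * (Dx ^^ i) ((Dy ^^ j) \<phi>) p \<partial>lebesgue_on open_square) =
     (-1) ^ (i + j) * (\<integral>p. v n p * \<phi> p \<partial>lebesgue_on open_square)" for n
    using wd[of n] \<phi> by (simp add: has_weak_deriv_def)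
  ultimately show "(\<integral>p. k p * (Dx ^^ i) ((Dy ^^ j) \<phi>) p \<partial>lebesgue_on open_square) =
     (-1) ^ (i + j) * (\<integral>p. w p * \<phi> p \<partial>lebesgue_on open_square)"
    using tendsto_unique[OF F 1] by simp
qed

lemma has_weak_deriv_tensor_x:
  assumes "\<And>x. x \<in> {0..1} \<Longrightarrow> (f has_vector_derivative f' x) (at x within {0..1})"
    and "continuous_on {0..1} f'" "continuous_on {0..1} g"
  shows "has_weak_deriv 1 0 (tensor f g) (tensor f' g)"
proof -
  have "continuous_on {0..1} f" using assms(1) by (rule continuous_on_vector_derivative)
  hence "tensor f g \<in> L2 open_square" "tensor f' g \<in> L2 open_square"
    using assms by (auto intro!: continuous_L2_square tensor_continuous)
  moreover have "(\<integral>p. tensor f g p * Dx \<phi> p \<partial>lebesgue_on open_square) = - (\<integral>p. tensor f' g p * \<phi> p \<partial>lebesgue_on open_square)"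
    if \<phi>: "test_function \<phi>" for \<phi>
  proof -
    have "integral {0..1} (\<lambda>y. g y * (f 1 * \<phi> (1, y) - f 0 * \<phi> (0, y))) = integral {0..1} (\<lambda>y::real. 0)"
      by (rule Henstock_Kurzweil_Integration.integral_cong) (use test_functionD(2)[OF \<phi>] in auto)
    thus ?thesis using integral_tensor_Dx[OF test_functionD(1)[OF \<phi>] assms] by simp
  qed
  ultimately show ?thesis by (simp add: has_weak_deriv_def)
qed

lemma has_weak_deriv_tensor_y:
  assumes "\<And>x. x \<in> {0..1} \<Longrightarrow> (g has_vector_derivative g' x) (at x within {0..1})"
    and "continuous_on {0..1} g'" "continuous_on {0..1} f"
  shows "has_weak_deriv 0 1 (tensor f g) (tensor f g')"
proof -
  have "continuous_on {0..1} g" using assms(1) by (rule continuous_on_vector_derivative)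
  hence "tensor f g \<in> L2 open_square" "tensor f g' \<in> L2 open_square"
    using assms by (auto intro!: continuous_L2_square tensor_continuous)
  moreover have "(\<integral>p. tensor f g p * Dy \<phi> p \<partial>lebesgue_on open_square) = - (\<integral>p. tensor f g' p * \<phi> p \<partial>lebesgue_on open_square)"
    if \<phi>: "test_function \<phi>" for \<phi>
  proof -
    have "integral {0..1} (\<lambda>x. f x * (g 1 * \<phi> (x, 1) - g 0 * \<phi> (x, 0))) = integral {0..1} (\<lambda>x::real. 0)"
      by (rule Henstock_Kurzweil_Integration.integral_cong) (use test_functionD(2)[OF \<phi>] in auto)
    thus ?thesis using integral_tensor_Dy[OF test_functionD(1)[OF \<phi>] assms] by simp
  qed
  ultimately show ?thesis by (simp add: has_weak_deriv_def)
qed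

text \<open>Finite smoothness is required here: in the induction for products the Leibniz rule
  yields a sum of two products that are known to be smooth only up to the current order.\<close>

lemma C_n_add: "C_n n f \<Longrightarrow> C_n n g \<Longrightarrow> C_n n (\<lambda>p. f p + g p)"
proof (induction n arbitrary: f g)
  case 0
  thus ?case by (simp add: continuous_on_add)
next
  case (Suc n)
  have d: "((\<lambda>t. h (t, y)) has_vector_derivative Dx h (x, y)) (at x within {0..1})"
    "((\<lambda>t. h (x, t)) has_vector_derivative Dy h (x, y)) (at y within {0..1})"
    if "C_n (Suc n) h" "x \<in> {0..1}" "y \<in> {0..1}" for h x y
    using that unfolding Dx_def Dy_def by (auto simp: vector_derivative_works)
  have "Dx (\<lambda>p. f p + g p) p = Dx f p + Dx g p" "Dy (\<lambda>p. f p + g p) p = Dy f p + Dy g p" if "p \<in> closed_square" for p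
    using that d[OF Suc.prems(1)] d[OF Suc.prems(2)]
    by (cases p; auto intro!: Dx_eqI Dy_eqI has_vector_derivative_add)+
  hence "C_n n (Dx (\<lambda>p. f p + g p))" "C_n n (Dy (\<lambda>p. f p + g p))"
    using Suc.IH[of "Dx f" "Dx g"] Suc.IH[of "Dy f" "Dy g"] Suc.prems
      C_n_cong[of "\<lambda>p. Dx f p + Dx g p" "Dx (\<lambda>p. f p + g p)" n]
      C_n_cong[of "\<lambda>p. Dy f p + Dy g p" "Dy (\<lambda>p. f p + g p)" n] by auto
  thus ?case using Suc.prems by (simp add: continuous_on_add differentiable_add)
qed

lemma Dx_mult:
  assumes "C_infinity f" "C_infinity g" "p \<in> closed_square"
  shows "Dx (\<lambda>p. f p * g p) p = f p * Dx g p + Dx f p * g p"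
proof -
  obtain x y where p: "p = (x, y)" "x \<in> {0..1}" "y \<in> {0..1}" using assms by auto
  show ?thesis
    using has_vector_derivative_mult[OF Dx_has_vector_derivative[OF assms(1) p(2,3)] Dx_has_vector_derivative[OF assms(2) p(2,3)]] p
    by (simp add: Dx_eqI)
qed

lemma Dy_mult:
  assumes "C_infinity f" "C_infinity g" "p \<in> closed_square"
  shows "Dy (\<lambda>p. f p * g p) p = f p * Dy g p + Dy f p * g p"
proof -
  obtain x y where p: "p = (x, y)" "x \<in> {0..1}" "y \<in> {0..1}" using assms by auto
  show ?thesis
    using has_vector_derivative_mult[OF Dy_has_vector_derivative[OF assms(1) p(2,3)] Dy_has_vector_derivative[OF assms(2) p(2,3)]] p
    by (simp add: Dy_eqI)
qed

lemma C_infinity_mult: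
  assumes "C_infinity f" "C_infinity g"
  shows "C_infinity (\<lambda>p. f p * g p)"
proof -
  have "C_n n (\<lambda>p. f p * g p)" for n
    using assms
  proof (induction n arbitrary: f g)
    case 0
    thus ?case by (simp add: continuous_on_mult C_infinity_continuous)
  next
    case (Suc n)
    note fg = Suc.prems C_infinity_Dx[OF Suc.prems(1)] C_infinity_Dx[OF Suc.prems(2)]
      C_infinity_Dy[OF Suc.prems(1)] C_infinity_Dy[OF Suc.prems(2)]
    have "C_n n (Dx (\<lambda>p. f p * g p))"
      by (rule C_n_cong[OF _ C_n_add[OF Suc.IH[OF fg(1) fg(4)] Suc.IH[OF fg(3) fg(2)]]]) (simp add: Dx_mult Suc.prems)
    moreover have "C_n n (Dy (\<lambda>p. f p * g p))"
      by (rule C_n_cong[OF _ C_n_add[OF Suc.IH[OF fg(1) fg(6)] Suc.IH[OF fg(5) fg(2)]]]) (simp add: Dy_mult Suc.prems)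
    moreover have "C_n (Suc 0) f" "C_n (Suc 0) g" using Suc.prems by (simp_all add: C_infinity_def del: C_n.simps)
    ultimately show ?case by (simp add: continuous_on_mult)
  qed
  thus ?thesis by (simp add: C_infinity_def)
qed

section \<open>Smooth cut-off functions\<close>

text \<open>The polynomial makes the family closed under differentiation: with s = 1 / t the
  derivative replaces p by s^2 (p - p'). All derivatives of the standard function exp (- 1 / t) are
  treated at once.\<close>

definition bump :: "real poly \<Rightarrow> real \<Rightarrow> real"
  where "bump p t = (if t > 0 then poly p (1 / t) * exp (- (1 / t)) else 0)"

lemma poly_exp_tendsto_0: "((\<lambda>s::real. poly p s * exp (- s)) \<longlongrightarrow> 0) at_top"
proof -
  have "((\<lambda>s. \<Sum>i\<le>degree p. coeff p i * (s ^ i / exp s)) \<longlongrightarrow> (\<Sum>i\<le>degree p. coeff p i * 0)) at_top"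
    by (intro tendsto_sum tendsto_mult_left tendsto_power_div_exp_0)
  thus ?thesis by (simp add: poly_altdef sum_distrib_right exp_minus divide_inverse mult.assoc)
qed

lemma bump_has_derivative:
  "(bump p has_real_derivative bump ([:0, 0, 1:] * (p - pderiv p)) t) (at t)"
proof -
  consider "t > 0" | "t < 0" | "t = 0" by linarith
  thus ?thesis
  proof cases
    case 1
    have "((\<lambda>t. poly p (1 / t) * exp (- (1 / t))) has_real_derivative bump ([:0, 0, 1:] * (p - pderiv p)) t) (at t)"
      using 1 by (auto intro!: derivative_eq_intros simp: bump_def)
        (simp add: field_simps power2_eq_square)
    thus ?thesis
      by (rule DERIV_cong_ev[THEN iffD1, rotated -1])
         (use 1 in \<open>auto simp: bump_def intro!: eventually_mono[OF eventually_nhds_in_open[of "{0<..}"]]\<close>)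
  next
    case 2
    have "((\<lambda>t. 0) has_real_derivative bump ([:0, 0, 1:] * (p - pderiv p)) t) (at t)"
      using 2 by (simp add: bump_def)
    thus ?thesis
      by (rule DERIV_cong_ev[THEN iffD1, rotated -1])
         (use 2 in \<open>auto simp: bump_def intro!: eventually_mono[OF eventually_nhds_in_open[of "{..<0}"]]\<close>)
  next
    case 3
    \<comment> \<open>Dividing by t multiplies the polynomial in 1 / t by its variable, which is
      \<open>pCons 0 p\<close>.\<close>
    have "((\<lambda>t. poly (pCons 0 p) (1 / t) * exp (- (1 / t))) \<longlongrightarrow> 0) (at_right 0)"
      using filterlim_compose[OF poly_exp_tendsto_0[of "pCons 0 p"] filterlim_inverse_at_top_right]
      by (simp add: inverse_eq_divide)
    hence "((\<lambda>t. bump p t / t) \<longlongrightarrow> 0) (at_right 0)"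
      by (rule Lim_transform_eventually)
         (auto simp: bump_def eventually_at_right_field field_simps intro!: exI[of _ 1])
    moreover have "((\<lambda>t. bump p t / t) \<longlongrightarrow> 0) (at_left 0)"
      by (rule Lim_transform_eventually[of "\<lambda>t. 0"])
         (auto simp: bump_def eventually_at_left_field intro!: exI[of _ "-1"])
    ultimately have "((\<lambda>t. bump p t / t) \<longlongrightarrow> 0) (at 0)" by (simp add: filterlim_at_split)
    thus ?thesis using 3 by (simp add: has_field_derivative_iff bump_def)
  qed
qed

primrec bump_poly :: "nat \<Rightarrow> real poly" where
  "bump_poly 0 = 1"
| "bump_poly (Suc i) = [:0, 0, 1:] * (bump_poly i - pderiv (bump_poly i))"

lemma derivs_bump_affine: "derivs (\<lambda>i x. c ^ i * bump (bump_poly i) (c * x + d))"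
  unfolding derivs_def
proof (intro allI ballI)
  fix i and x :: real
  have "((\<lambda>x. bump (bump_poly i) (c * x + d)) has_real_derivative bump (bump_poly (Suc i)) (c * x + d) * c) (at x within {0..1})"
    unfolding bump_poly.simps
    by (rule DERIV_chain2[OF bump_has_derivative]) (auto intro!: derivative_eq_intros)
  from DERIV_cmult[OF this, of "c ^ i"]
  show "((\<lambda>x. c ^ i * bump (bump_poly i) (c * x + d)) has_vector_derivative c ^ Suc i * bump (bump_poly (Suc i)) (c * x + d)) (at x within {0..1})"
    by (simp add: has_real_derivative_iff_has_vector_derivative mult_ac)
qed

text \<open>\<open>cutoff j\<close> has no plateau. What matters is that \<open>x * cutoff' j x\<close> is bounded and tends to \<open>0\<close>
  pointwise, so that multiplying by it does not disturb \<open>H\<^sup>1\<close> limits of functions vanishing at \<open>0\<close>.\<close>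

definition cutoff :: "nat \<Rightarrow> real \<Rightarrow> real"
  where "cutoff j x = bump 1 (real (Suc j) * x - 1)"

definition cutoff' :: "nat \<Rightarrow> real \<Rightarrow> real"
  where "cutoff' j x = real (Suc j) * bump [:0, 0, 1:] (real (Suc j) * x - 1)"

lemma cutoff_bounds: "0 \<le> cutoff j x" "cutoff j x \<le> 1"
  by (auto simp: cutoff_def bump_def)

lemma cutoff_eq_0: "real (Suc j) * x \<le> 1 \<Longrightarrow> cutoff j x = 0"
  by (simp add: cutoff_def bump_def)

lemma cutoff'_nonneg: "0 \<le> cutoff' j x"
  by (auto simp: cutoff'_def bump_def)

lemma cutoff_tendsto:
  assumes "x > 0" shows "(\<lambda>j. cutoff j x) \<longlonglongrightarrow> 1"
proof (rule Lim_transform_eventually)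
  show "(\<lambda>j. exp (- (1 / (real (Suc j) * x - 1)))) \<longlonglongrightarrow> 1" using assms by real_asymp
  have "eventually (\<lambda>j. real (Suc j) * x - 1 > 0) sequentially" using assms by real_asymp
  thus "\<forall>\<^sub>F j in sequentially. exp (- (1 / (real (Suc j) * x - 1))) = cutoff j x"
    by eventually_elim (simp add: cutoff_def bump_def)
qed

lemma cutoff'_tendsto:
  assumes "x > 0" shows "(\<lambda>j. cutoff' j x) \<longlonglongrightarrow> 0"
proof (rule Lim_transform_eventually)
  show "(\<lambda>j. real (Suc j) * ((1 / (real (Suc j) * x - 1))\<^sup>2 * exp (- (1 / (real (Suc j) * x - 1))))) \<longlonglongrightarrow> 0"
    using assms by real_asymp
  have "eventually (\<lambda>j. real (Suc j) * x - 1 > 0) sequentially" using assms by real_asymp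
  thus "\<forall>\<^sub>F j in sequentially. real (Suc j) * ((1 / (real (Suc j) * x - 1))\<^sup>2 * exp (- (1 / (real (Suc j) * x - 1)))) = cutoff' j x"
    by eventually_elim (simp add: cutoff'_def bump_def power2_eq_square)
qed

text \<open>With t = (j + 1) x - 1 and s = 1 / t the quantity is (s^2 + s) exp (- s). The factor j +
  1 of the chain rule is absorbed by x, so the bound does not depend on j.\<close>

lemma cutoff'_bound: "x * cutoff' j x \<le> 3"
proof (cases "real (Suc j) * x - 1 > 0")
  case True
  define t where "t = real (Suc j) * x - 1"
  define s where "s = 1 / t"
  have s: "s > 0" using True by (simp add: s_def t_def)
  have "x * cutoff' j x = (1 + t) * (s * s * exp (- s))"
    using True by (simp add: cutoff'_def bump_def s_def t_def)
  also have "\<dots> = (s\<^sup>2 + s) * exp (- s)"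
  proof -
    have "t > 0" using True by (simp add: t_def)
    thus ?thesis by (simp add: s_def power2_eq_square field_simps)
  qed
  also have "\<dots> \<le> (3 * exp s) * exp (- s)"
  proof (rule mult_right_mono)
    have "1 + s + s\<^sup>2 / 2 \<le> exp s" using exp_lower_Taylor_quadratic[of s] s by simp
    moreover have "0 \<le> s\<^sup>2" by simp
    ultimately show "s\<^sup>2 + s \<le> 3 * exp s" using s by linarith
  qed simp
  also have "\<dots> = 3" by (simp flip: exp_add)
  finally show ?thesis .
qed (auto simp: cutoff'_def bump_def)

definition cut :: "nat \<Rightarrow> real \<Rightarrow> real" where "cut j x = cutoff j x * cutoff j (1 - x)"

definition cut' :: "nat \<Rightarrow> real \<Rightarrow> real"
  where "cut' j x = cutoff' j x * cutoff j (1 - x) - cutoff j x * cutoff' j (1 - x)"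

lemma cut_bounds: "0 \<le> cut j x" "cut j x \<le> 1"
  using cutoff_bounds by (auto simp: cut_def mult_le_one)

lemma cut_tendsto: "0 < x \<Longrightarrow> x < 1 \<Longrightarrow> (\<lambda>j. cut j x) \<longlonglongrightarrow> 1"
  using tendsto_mult[OF cutoff_tendsto[of x] cutoff_tendsto[of "1 - x"]] by (simp add: cut_def)

lemma cut'_tendsto: "0 < x \<Longrightarrow> x < 1 \<Longrightarrow> (\<lambda>j. cut' j x) \<longlonglongrightarrow> 0"
  using tendsto_diff[OF tendsto_mult[OF cutoff'_tendsto[of x] cutoff_tendsto[of "1 - x"]]
     tendsto_mult[OF cutoff_tendsto[of x] cutoff'_tendsto[of "1 - x"]]] by (simp add: cut'_def)

text \<open>Near either end the linear smallness of v compensates the size of the derivative of the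
  cut-off there; each end contributes 3 B.\<close>

lemma cut'_bound:
  assumes "0 \<le> x" "x \<le> 1" "\<bar>v\<bar> \<le> B * x" "\<bar>v\<bar> \<le> B * (1 - x)" "B \<ge> 0"
  shows "\<bar>v * cut' j x\<bar> \<le> 6 * B"
proof -
  have *: "\<bar>v\<bar> * (cutoff' j y * cutoff j z) \<le> 3 * B" if "\<bar>v\<bar> \<le> B * y" for y z
  proof -
    have "\<bar>v\<bar> * (cutoff' j y * cutoff j z) \<le> (B * y) * (cutoff' j y * cutoff j z)"
      using that cutoff'_nonneg cutoff_bounds by (intro mult_right_mono mult_nonneg_nonneg) auto
    also have "\<dots> = B * ((y * cutoff' j y) * cutoff j z)" by simp
    also have "\<dots> \<le> B * (3 * 1)"
      using assms cutoff'_bound cutoff_bounds by (intro mult_left_mono mult_mono) auto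
    finally show ?thesis by simp
  qed
  have nn: "0 \<le> cutoff' j y * cutoff j z" for y z using cutoff'_nonneg cutoff_bounds by simp
  have "\<bar>v * cut' j x\<bar> \<le> \<bar>v\<bar> * (cutoff' j x * cutoff j (1 - x)) + \<bar>v\<bar> * (cutoff' j (1 - x) * cutoff j x)"
    unfolding abs_mult distrib_left[symmetric] cut'_def
    using nn[of x "1 - x"] nn[of "1 - x" x] by (intro mult_left_mono) (auto simp: mult.commute)
  with *[OF assms(3), of "1 - x"] *[OF assms(4), of x] show ?thesis by linarith
qed

definition cut2 :: "nat \<Rightarrow> real \<times> real \<Rightarrow> real"
  where "cut2 j = tensor (cut j) (cut j)"

lemma cut2_eq_0:
  assumes "p \<in> closed_square" "p \<notin> cbox (1 / real (Suc j), 1 / real (Suc j)) (1 - 1 / real (Suc j), 1 - 1 / real (Suc j))"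
  shows "cut2 j p = 0"
proof -
  have *: "cutoff j x = 0" if "\<not> 1 / real (Suc j) \<le> x" for x
    using that by (intro cutoff_eq_0) (simp add: field_simps del: of_nat_Suc)
  have "\<not> 1 / real (Suc j) \<le> fst p \<or> \<not> 1 / real (Suc j) \<le> 1 - fst p \<or>
      \<not> 1 / real (Suc j) \<le> snd p \<or> \<not> 1 / real (Suc j) \<le> 1 - snd p"
    using assms(2) by (cases p) (auto simp: cbox_Pair_eq simp del: of_nat_Suc)
  thus ?thesis using *[of "fst p"] *[of "1 - fst p"] *[of "snd p"] *[of "1 - snd p"]
    by (auto simp: cut2_def tensor_def cut_def)
qed

lemma cutoff_derivs:
  "\<exists>F. derivs F \<and> F 0 = cutoff j \<and> F 1 = cutoff' j"
  "\<exists>F. derivs F \<and> F 0 = (\<lambda>x. cutoff j (1 - x)) \<and> F 1 = (\<lambda>x. - cutoff' j (1 - x))"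
proof -
  show "\<exists>F. derivs F \<and> F 0 = cutoff j \<and> F 1 = cutoff' j"
    by (intro exI[of _ "\<lambda>i x. real (Suc j) ^ i * bump (bump_poly i) (real (Suc j) * x + (- 1))"] conjI derivs_bump_affine)
       (auto simp: cutoff_def cutoff'_def fun_eq_iff one_pCons)
  show "\<exists>F. derivs F \<and> F 0 = (\<lambda>x. cutoff j (1 - x)) \<and> F 1 = (\<lambda>x. - cutoff' j (1 - x))"
    by (intro exI[of _ "\<lambda>i x. (- real (Suc j)) ^ i * bump (bump_poly i) ((- real (Suc j)) * x + (real (Suc j) - 1))"] conjI derivs_bump_affine)
       (auto simp: cutoff_def cutoff'_def fun_eq_iff one_pCons algebra_simps)
qed

lemma cut_has_derivative:
  assumes "x \<in> {0..1}"
  shows "(cut j has_vector_derivative cut' j x) (at x within {0..1})"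
proof -
  obtain F where F: "derivs F" "F 0 = cutoff j" "F 1 = cutoff' j" using cutoff_derivs(1) by blast
  obtain G where G: "derivs G" "G 0 = (\<lambda>x. cutoff j (1 - x))" "G 1 = (\<lambda>x. - cutoff' j (1 - x))" using cutoff_derivs(2) by blast
  have "(F 0 has_vector_derivative F 1 x) (at x within {0..1})" "(G 0 has_vector_derivative G 1 x) (at x within {0..1})"
    using F(1) G(1) assms unfolding derivs_def One_nat_def by blast+
  from has_vector_derivative_mult[OF this] show ?thesis
    unfolding F G cut'_def cut_def[abs_def] by (simp add: algebra_simps)
qed

lemma C_infinity_cut2: "C_infinity (cut2 j)"
proof -
  obtain F where F: "derivs F" "F 0 = cutoff j" using cutoff_derivs(1) by blast
  obtain G where G: "derivs G" "G 0 = (\<lambda>x. cutoff j (1 - x))" using cutoff_derivs(2) by blast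
  have "C_infinity (\<lambda>p. tensor (F 0) (F 0) p * tensor (G 0) (G 0) p)"
    by (intro C_infinity_mult C_infinity_tensor F G)
  thus ?thesis by (rule C_infinity_cong[rotated]) (simp add: F G cut2_def tensor_def cut_def)
qed

lemma Dx_cut2: "p \<in> closed_square \<Longrightarrow> Dx (cut2 j) p = cut' j (fst p) * cut j (snd p)"
  and Dy_cut2: "p \<in> closed_square \<Longrightarrow> Dy (cut2 j) p = cut j (fst p) * cut' j (snd p)"
  using Dx_tensor[of p "cut j" "cut' j" "cut j"] Dy_tensor[of p "cut j" "cut' j" "cut j"] cut_has_derivative[of _ j]
  by (auto simp: cut2_def tensor_def)

lemma test_function_cut2_mult:
  assumes "C_infinity u" shows "test_function (\<lambda>p. u p * cut2 j p)"
  unfolding test_function_def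
proof (intro conjI exI)
  let ?K = "cbox (1 / real (Suc j), 1 / real (Suc j)) (1 - 1 / real (Suc j), 1 - 1 / real (Suc j)) :: (real \<times> real) set"
  show "C_infinity (\<lambda>p. u p * cut2 j p)" by (intro C_infinity_mult assms C_infinity_cut2)
  show "compact ?K" by simp
  have pos: "0 < 1 / real (Suc j)" by simp
  show "?K \<subseteq> open_square"
  proof
    fix p assume p: "p \<in> ?K"
    obtain x y where "p = (x, y)" by (cases p)
    with p have "1 / real (Suc j) \<le> x \<and> x \<le> 1 - 1 / real (Suc j) \<and> 1 / real (Suc j) \<le> y \<and> y \<le> 1 - 1 / real (Suc j)"
      by (simp add: cbox_Pair_eq del: of_nat_Suc)
    hence "0 < x \<and> x < 1 \<and> 0 < y \<and> y < 1" using pos by linarith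
    thus "p \<in> open_square" using \<open>p = (x, y)\<close> by simp
  qed
  show "\<forall>p\<in>closed_square - ?K. u p * cut2 j p = 0" using cut2_eq_0 by auto
qed

lemma L2_norm_dominated:
  assumes "\<And>j. continuous_on closed_square (f j)" "\<And>j p. p \<in> open_square \<Longrightarrow> \<bar>f j p\<bar> \<le> B"
    and "\<And>p. p \<in> open_square \<Longrightarrow> (\<lambda>j. f j p) \<longlonglongrightarrow> 0"
  shows "(\<lambda>j. L2_norm open_square (f j)) \<longlonglongrightarrow> 0"
proof -
  have "(\<lambda>j. \<integral>p. (f j p)\<^sup>2 \<partial>lebesgue_on open_square) \<longlonglongrightarrow> (\<integral>p. 0 \<partial>lebesgue_on open_square)"
  proof (rule integral_dominated_convergence[where w = "\<lambda>p. B\<^sup>2"])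
    show "(\<lambda>p. (f j p)\<^sup>2) \<in> borel_measurable (lebesgue_on open_square)" for j
      using continuous_L2_square[OF assms(1)] by (auto simp: L2_def)
    show "integrable (lebesgue_on open_square) (\<lambda>p. B\<^sup>2)"
      by (rule continuous_integrable_square) (intro continuous_intros)
    show "AE p in lebesgue_on open_square. (\<lambda>j. (f j p)\<^sup>2) \<longlonglongrightarrow> 0"
      using tendsto_power[OF assms(3), of _ 2] by (intro AE_I2) auto
    show "AE p in lebesgue_on open_square. norm ((f j p)\<^sup>2) \<le> B\<^sup>2" for j
      using power_mono[OF assms(2), of _ j 2] by (intro AE_I2) auto
  qed simp
  from tendsto_real_sqrt[OF this] show ?thesis by (simp add: L2_norm_def[abs_def])
qed

lemma continuous_bounded_square:
  fixes f :: "real \<times> real \<Rightarrow> real"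
  assumes "continuous_on closed_square f"
  obtains B where "B > 0" "\<And>p. p \<in> closed_square \<Longrightarrow> \<bar>f p\<bar> \<le> B"
proof -
  have "compact (f ` closed_square)" using assms compact_closed_square by (rule compact_continuous_image)
  then obtain B where "B > 0" "\<And>x. x \<in> f ` closed_square \<Longrightarrow> norm x \<le> B"
    using compact_imp_bounded bounded_pos by metis
  thus ?thesis using that by auto
qed

lemma vector_derivative_bound_unit:
  fixes f :: "real \<Rightarrow> real"
  assumes "\<And>t. t \<in> {0..1} \<Longrightarrow> (f has_vector_derivative f' t) (at t within {0..1})"
    and "\<And>t. t \<in> {0..1} \<Longrightarrow> \<bar>f' t\<bar> \<le> B" "s \<in> {0..1}" "t \<in> {0..1}"
  shows "\<bar>f s - f t\<bar> \<le> B * \<bar>s - t\<bar>"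
  using field_differentiable_bound[of "{0..1}" f f' B s t] assms
  by (simp add: has_real_derivative_iff_has_vector_derivative)

section \<open>Smooth functions vanishing on the boundary are H1 limits of test functions\<close>

definition zero_boundary :: "(real \<times> real \<Rightarrow> real) \<Rightarrow> bool"
  where "zero_boundary u \<longleftrightarrow> (\<forall>t\<in>{0..1}. u (0, t) = 0 \<and> u (1, t) = 0 \<and> u (t, 0) = 0 \<and> u (t, 1) = 0)"

text \<open>By the mean value inequality a function with bounded first derivatives that vanishes on
  a side is bounded by a multiple of the distance to that side, as \<open>cut'_bound\<close>
  requires.\<close>

lemma zero_boundary_bound:
  assumes u: "C_infinity u" "zero_boundary u"
  obtains B where "B > 0" "\<And>x y. x \<in> {0..1} \<Longrightarrow> y \<in> {0..1} \<Longrightarrow>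
    \<bar>u (x, y)\<bar> \<le> B \<and> \<bar>Dx u (x, y)\<bar> \<le> B \<and> \<bar>Dy u (x, y)\<bar> \<le> B \<and>
    \<bar>u (x, y)\<bar> \<le> B * x \<and> \<bar>u (x, y)\<bar> \<le> B * (1 - x) \<and> \<bar>u (x, y)\<bar> \<le> B * y \<and> \<bar>u (x, y)\<bar> \<le> B * (1 - y)"
proof -
  obtain A where A: "A > 0" "\<And>p. p \<in> closed_square \<Longrightarrow> \<bar>u p\<bar> \<le> A"
    using continuous_bounded_square[OF C_infinity_continuous[OF u(1)]] by blast
  obtain A1 where A1: "A1 > 0" "\<And>p. p \<in> closed_square \<Longrightarrow> \<bar>Dx u p\<bar> \<le> A1"
    using continuous_bounded_square[OF C_infinity_continuous[OF C_infinity_Dx[OF u(1)]]] by blast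
  obtain A2 where A2: "A2 > 0" "\<And>p. p \<in> closed_square \<Longrightarrow> \<bar>Dy u p\<bar> \<le> A2"
    using continuous_bounded_square[OF C_infinity_continuous[OF C_infinity_Dy[OF u(1)]]] by blast
  define B where "B = max A (max A1 A2)"
  have x: "\<bar>u (s, y) - u (t, y)\<bar> \<le> B * \<bar>s - t\<bar>" if "s \<in> {0..1}" "t \<in> {0..1}" "y \<in> {0..1}" for s t y
  proof (rule vector_derivative_bound_unit[where f = "\<lambda>t. u (t, y)", OF Dx_has_vector_derivative[OF u(1) _ that(3)] _ that(1,2)])
    fix r :: real assume "r \<in> {0..1}"
    thus "\<bar>Dx u (r, y)\<bar> \<le> B" using A1(2)[of "(r, y)"] that by (auto simp: B_def)
  qed
  have y: "\<bar>u (y, s) - u (y, t)\<bar> \<le> B * \<bar>s - t\<bar>" if "s \<in> {0..1}" "t \<in> {0..1}" "y \<in> {0..1}" for s t y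
  proof (rule vector_derivative_bound_unit[where f = "\<lambda>t. u (y, t)", OF Dy_has_vector_derivative[OF u(1) that(3)] _ that(1,2)])
    fix r :: real assume "r \<in> {0..1}"
    thus "\<bar>Dy u (y, r)\<bar> \<le> B" using A2(2)[of "(y, r)"] that by (auto simp: B_def)
  qed
  show ?thesis
  proof (rule that[of B])
    show "B > 0" using A by (simp add: B_def)
    fix s t :: real assume st: "s \<in> {0..1}" "t \<in> {0..1}"
    have "\<bar>u (s, t)\<bar> \<le> B" "\<bar>Dx u (s, t)\<bar> \<le> B" "\<bar>Dy u (s, t)\<bar> \<le> B"
      using A(2)[of "(s, t)"] A1(2)[of "(s, t)"] A2(2)[of "(s, t)"] st by (auto simp: B_def)
    thus "\<bar>u (s, t)\<bar> \<le> B \<and> \<bar>Dx u (s, t)\<bar> \<le> B \<and> \<bar>Dy u (s, t)\<bar> \<le> B \<and>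
      \<bar>u (s, t)\<bar> \<le> B * s \<and> \<bar>u (s, t)\<bar> \<le> B * (1 - s) \<and> \<bar>u (s, t)\<bar> \<le> B * t \<and> \<bar>u (s, t)\<bar> \<le> B * (1 - t)"
      using x[of s 0 t] x[of s 1 t] y[of t 0 s] y[of t 1 s] st u(2)
      by (simp add: zero_boundary_def abs_if split: if_splits)
  qed
qed

lemma cut2_H1_limit:
  assumes u: "C_infinity u" "zero_boundary u"
  shows "(\<lambda>j. L2_norm open_square (\<lambda>p. u p * cut2 j p - u p)) \<longlonglongrightarrow> 0"
    "(\<lambda>j. L2_norm open_square (\<lambda>p. Dx (\<lambda>p. u p * cut2 j p) p - Dx u p)) \<longlonglongrightarrow> 0"
    "(\<lambda>j. L2_norm open_square (\<lambda>p. Dy (\<lambda>p. u p * cut2 j p) p - Dy u p)) \<longlonglongrightarrow> 0"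
proof -
  obtain B where B: "B > 0" "\<And>x y. x \<in> {0..1} \<Longrightarrow> y \<in> {0..1} \<Longrightarrow>
    \<bar>u (x, y)\<bar> \<le> B \<and> \<bar>Dx u (x, y)\<bar> \<le> B \<and> \<bar>Dy u (x, y)\<bar> \<le> B \<and>
    \<bar>u (x, y)\<bar> \<le> B * x \<and> \<bar>u (x, y)\<bar> \<le> B * (1 - x) \<and> \<bar>u (x, y)\<bar> \<le> B * y \<and> \<bar>u (x, y)\<bar> \<le> B * (1 - y)"
    using zero_boundary_bound[OF u] by blast
  have prod: "C_infinity (\<lambda>p. u p * cut2 j p)" for j by (intro C_infinity_mult u C_infinity_cut2)
  have cont: "continuous_on closed_square (\<lambda>p. f p - g p)" if "C_infinity f" "C_infinity g" for f g :: "real \<times> real \<Rightarrow> real"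
    using that by (intro continuous_on_diff C_infinity_continuous)
  have c2: "0 \<le> cut2 j p" "cut2 j p \<le> 1" for j p
    using cut_bounds by (auto simp: cut2_def tensor_def mult_le_one)
  have c2lim: "(\<lambda>j. cut2 j p) \<longlonglongrightarrow> 1" if "p \<in> open_square" for p
  proof -
    have "(\<lambda>j. cut j (fst p) * cut j (snd p)) \<longlonglongrightarrow> 1 * 1"
      using that by (intro tendsto_mult cut_tendsto) auto
    thus ?thesis by (simp add: cut2_def tensor_def)
  qed
  have near1: "\<bar>v * cut2 j p - v\<bar> \<le> B" if "\<bar>v\<bar> \<le> B" for v j p
  proof -
    have "v * cut2 j p - v = v * (cut2 j p - 1)" by (simp add: right_diff_distrib)
    also have "\<bar>\<dots>\<bar> = \<bar>v\<bar> * (1 - cut2 j p)" using c2(2)[of j p] by (simp add: abs_mult)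
    also have "\<dots> \<le> B * 1" using that c2[of j p] by (intro mult_mono) auto
    finally show ?thesis by simp
  qed
  show "(\<lambda>j. L2_norm open_square (\<lambda>p. u p * cut2 j p - u p)) \<longlonglongrightarrow> 0"
  proof (rule L2_norm_dominated[where B = B])
    show "continuous_on closed_square (\<lambda>p. u p * cut2 j p - u p)" for j
      by (rule cont[OF prod u(1)])
    fix p assume p: "p \<in> open_square"
    show "\<bar>u p * cut2 j p - u p\<bar> \<le> B" for j
      using B(2)[of "fst p" "snd p"] p by (intro near1) auto
    show "(\<lambda>j. u p * cut2 j p - u p) \<longlonglongrightarrow> 0"
      using tendsto_diff[OF tendsto_mult_left[OF c2lim[OF p], of "u p"] tendsto_const[of "u p"]] by simp
  qed
  show "(\<lambda>j. L2_norm open_square (\<lambda>p. Dx (\<lambda>p. u p * cut2 j p) p - Dx u p)) \<longlonglongrightarrow> 0"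
  proof (rule L2_norm_dominated[where B = "6 * B + B"])
    show "continuous_on closed_square (\<lambda>p. Dx (\<lambda>p. u p * cut2 j p) p - Dx u p)" for j
      by (intro cont C_infinity_Dx prod u)
    fix p assume p: "p \<in> open_square"
    then obtain x y where xy: "p = (x, y)" "0 < x" "x < 1" "0 < y" "y < 1" by auto
    have eq: "Dx (\<lambda>p. u p * cut2 j p) p - Dx u p = (u p * cut' j x) * cut j y + (Dx u p * cut2 j p - Dx u p)" for j
      using Dx_mult[OF u(1) C_infinity_cut2, of p] Dx_cut2[of p] xy by simp
    show "\<bar>Dx (\<lambda>p. u p * cut2 j p) p - Dx u p\<bar> \<le> 6 * B + B" for j
    proof -
      have "\<bar>u p * cut' j x\<bar> \<le> 6 * B"
        using B(2)[of x y] B(1) xy by (intro cut'_bound) auto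
      hence "\<bar>u p * cut' j x\<bar> * \<bar>cut j y\<bar> \<le> (6 * B) * 1"
        using cut_bounds[of j y] B(1) by (intro mult_mono) auto
      moreover have "\<bar>Dx u p * cut2 j p - Dx u p\<bar> \<le> B" using B(2)[of x y] xy by (intro near1) auto
      ultimately show ?thesis
        unfolding eq using abs_triangle_ineq[of "(u p * cut' j x) * cut j y" "Dx u p * cut2 j p - Dx u p"]
        by (simp add: abs_mult)
    qed
    have "(\<lambda>j. (u p * cut' j x) * cut j y + (Dx u p * cut2 j p - Dx u p)) \<longlonglongrightarrow> (u p * 0) * 1 + (Dx u p * 1 - Dx u p)"
      using xy by (intro tendsto_intros cut_tendsto cut'_tendsto c2lim p) auto
    thus "(\<lambda>j. Dx (\<lambda>p. u p * cut2 j p) p - Dx u p) \<longlonglongrightarrow> 0" unfolding eq by simp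
  qed
  show "(\<lambda>j. L2_norm open_square (\<lambda>p. Dy (\<lambda>p. u p * cut2 j p) p - Dy u p)) \<longlonglongrightarrow> 0"
  proof (rule L2_norm_dominated[where B = "6 * B + B"])
    show "continuous_on closed_square (\<lambda>p. Dy (\<lambda>p. u p * cut2 j p) p - Dy u p)" for j
      by (intro cont C_infinity_Dy prod u)
    fix p assume p: "p \<in> open_square"
    then obtain x y where xy: "p = (x, y)" "0 < x" "x < 1" "0 < y" "y < 1" by auto
    have eq: "Dy (\<lambda>p. u p * cut2 j p) p - Dy u p = (u p * cut' j y) * cut j x + (Dy u p * cut2 j p - Dy u p)" for j
      using Dy_mult[OF u(1) C_infinity_cut2, of p] Dy_cut2[of p] xy by simp
    show "\<bar>Dy (\<lambda>p. u p * cut2 j p) p - Dy u p\<bar> \<le> 6 * B + B" for j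
    proof -
      have "\<bar>u p * cut' j y\<bar> \<le> 6 * B"
        using B(2)[of x y] B(1) xy by (intro cut'_bound) auto
      hence "\<bar>u p * cut' j y\<bar> * \<bar>cut j x\<bar> \<le> (6 * B) * 1"
        using cut_bounds[of j x] B(1) by (intro mult_mono) auto
      moreover have "\<bar>Dy u p * cut2 j p - Dy u p\<bar> \<le> B" using B(2)[of x y] xy by (intro near1) auto
      ultimately show ?thesis
        unfolding eq using abs_triangle_ineq[of "(u p * cut' j y) * cut j x" "Dy u p * cut2 j p - Dy u p"]
        by (simp add: abs_mult)
    qed
    have "(\<lambda>j. (u p * cut' j y) * cut j x + (Dy u p * cut2 j p - Dy u p)) \<longlonglongrightarrow> (u p * 0) * 1 + (Dy u p * 1 - Dy u p)"
      using xy by (intro tendsto_intros cut_tendsto cut'_tendsto c2lim p) auto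
    thus "(\<lambda>j. Dy (\<lambda>p. u p * cut2 j p) p - Dy u p) \<longlonglongrightarrow> 0" unfolding eq by simp
  qed
qed

text \<open>Finite sine sums vanish on the boundary but are not compactly supported. By the
  preceding cut-off limits it suffices to approximate by such functions; each of the two
  approximations takes half of e.\<close>

lemma H1_0_I:
  assumes wd: "has_weak_deriv 1 0 k kx" "has_weak_deriv 0 1 k ky"
    and approx: "\<And>e. e > 0 \<Longrightarrow> \<exists>u. C_infinity u \<and> zero_boundary u \<and>
      L2_norm open_square (\<lambda>p. u p - k p) < e \<and> L2_norm open_square (\<lambda>p. Dx u p - kx p) < e \<and>
      L2_norm open_square (\<lambda>p. Dy u p - ky p) < e"
  shows "k \<in> H1_0"
proof -
  have L: "k \<in> L2 open_square" "kx \<in> L2 open_square" "ky \<in> L2 open_square"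
    using wd by (auto simp: has_weak_deriv_def)
  have C: "f \<in> L2 open_square" if "C_infinity f" for f using that by (intro continuous_L2_square C_infinity_continuous)
  have "\<exists>\<phi>. test_function \<phi> \<and> L2_norm open_square (\<lambda>p. \<phi> p - k p) < e \<and>
      L2_norm open_square (\<lambda>p. Dx \<phi> p - kx p) < e \<and> L2_norm open_square (\<lambda>p. Dy \<phi> p - ky p) < e" if e: "e > 0" for e
  proof -
    obtain u where u: "C_infinity u" "zero_boundary u"
      "L2_norm open_square (\<lambda>p. u p - k p) < e / 2" "L2_norm open_square (\<lambda>p. Dx u p - kx p) < e / 2"
      "L2_norm open_square (\<lambda>p. Dy u p - ky p) < e / 2"
      using approx[of "e / 2"] e by auto
    have ev: "\<forall>\<^sub>F j in sequentially. L2_norm open_square (\<lambda>p. u p * cut2 j p - u p) < e / 2 \<and>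
      L2_norm open_square (\<lambda>p. Dx (\<lambda>p. u p * cut2 j p) p - Dx u p) < e / 2 \<and>
      L2_norm open_square (\<lambda>p. Dy (\<lambda>p. u p * cut2 j p) p - Dy u p) < e / 2"
      using cut2_H1_limit[OF u(1,2), THEN order_tendstoD(2), of "e / 2"] e by (simp add: eventually_conj_iff)
    then obtain j where j: "L2_norm open_square (\<lambda>p. u p * cut2 j p - u p) < e / 2"
      "L2_norm open_square (\<lambda>p. Dx (\<lambda>p. u p * cut2 j p) p - Dx u p) < e / 2"
      "L2_norm open_square (\<lambda>p. Dy (\<lambda>p. u p * cut2 j p) p - Dy u p) < e / 2"
      using eventually_happens[OF ev] by auto
    have T: "test_function (\<lambda>p. u p * cut2 j p)" by (rule test_function_cut2_mult[OF u(1)])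
    note CT = test_functionD(1)[OF T]
    show ?thesis
      using T u(3-5) j L2_norm_triangle_diff[OF C[OF CT] C[OF u(1)] L(1)]
        L2_norm_triangle_diff[OF C[OF C_infinity_Dx[OF CT]] C[OF C_infinity_Dx[OF u(1)]] L(2)]
        L2_norm_triangle_diff[OF C[OF C_infinity_Dy[OF CT]] C[OF C_infinity_Dy[OF u(1)]] L(3)]
      by (intro exI[of _ "\<lambda>p. u p * cut2 j p"]) auto
  qed
  hence "\<forall>n. \<exists>\<phi>. test_function \<phi> \<and> L2_norm open_square (\<lambda>p. \<phi> p - k p) < 1 / real (Suc n) \<and>
      L2_norm open_square (\<lambda>p. Dx \<phi> p - kx p) < 1 / real (Suc n) \<and> L2_norm open_square (\<lambda>p. Dy \<phi> p - ky p) < 1 / real (Suc n)"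
    by simp
  from choice[OF this] obtain \<phi> where \<phi>: "\<And>n. test_function (\<phi> n)"
    "\<And>n. L2_norm open_square (\<lambda>p. \<phi> n p - k p) < 1 / real (Suc n)"
    "\<And>n. L2_norm open_square (\<lambda>p. Dx (\<phi> n) p - kx p) < 1 / real (Suc n)"
    "\<And>n. L2_norm open_square (\<lambda>p. Dy (\<phi> n) p - ky p) < 1 / real (Suc n)" by blast
  have lim0: "(\<lambda>n. g n) \<longlonglongrightarrow> 0" if "\<And>n. g n < 1 / real (Suc n)" "\<And>n. 0 \<le> g n" for g :: "nat \<Rightarrow> real"
  proof (rule tendsto_sandwich[of "\<lambda>_. 0" g sequentially "\<lambda>n. 1 / real (Suc n)"])
    show "\<forall>\<^sub>F n in sequentially. g n \<le> 1 / real (Suc n)"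
      using less_imp_le[OF that(1)] by (intro always_eventually allI)
    show "(\<lambda>n. 1 / real (Suc n)) \<longlonglongrightarrow> 0" by (rule LIMSEQ_Suc[OF lim_1_over_n])
  qed (use that(2) in simp_all)
  show ?thesis unfolding H1_0_def
    using wd \<phi>(1) lim0[OF \<phi>(2) L2_norm_nonneg] lim0[OF \<phi>(3) L2_norm_nonneg] lim0[OF \<phi>(4) L2_norm_nonneg] by blast
qed

section \<open>Completeness of the sine system\<close>

lemma L2_mult_continuous:
  assumes "k \<in> L2 open_square" "continuous_on closed_square f"
  shows "(\<lambda>p. k p * f p) \<in> L2 open_square"
proof -
  obtain B where B: "B > 0" "\<And>p. p \<in> closed_square \<Longrightarrow> \<bar>f p\<bar> \<le> B"
    using continuous_bounded_square[OF assms(2)] by blast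
  have m: "k \<in> borel_measurable (lebesgue_on open_square)" "f \<in> borel_measurable (lebesgue_on open_square)"
    using assms continuous_L2_square by (auto simp: L2_def)
  have "integrable (lebesgue_on open_square) (\<lambda>p. (k p * f p)\<^sup>2)"
  proof (rule Bochner_Integration.integrable_bound)
    show "integrable (lebesgue_on open_square) (\<lambda>p. B\<^sup>2 * (k p)\<^sup>2)" using assms(1) by (simp add: L2_def)
    have "(k p * f p)\<^sup>2 \<le> B\<^sup>2 * (k p)\<^sup>2" if "p \<in> open_square" for p
    proof -
      have "(f p)\<^sup>2 \<le> B\<^sup>2" using that B(2)[of p] power_mono[of "\<bar>f p\<bar>" B 2] by auto
      thus ?thesis by (simp add: power_mult_distrib mult.commute mult_right_mono)
    qed
    thus "AE p in lebesgue_on open_square. norm ((k p * f p)\<^sup>2) \<le> norm (B\<^sup>2 * (k p)\<^sup>2)"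
      by (intro AE_I2) auto
  qed (use m in measurable)
  thus ?thesis using m by (simp add: L2_def)
qed

lemma L2_integrable_square:
  assumes "k \<in> L2 open_square" shows "integrable (lebesgue_on open_square) k"
  using L2_mult_integrable[OF assms continuous_L2_square[of "\<lambda>_. 1"]] by simp

text \<open>The sign of K is almost everywhere a limit of continuous functions. Testing K with them
  gives the integral of |K| in the limit.\<close>

lemma AE_zero_if_orthogonal_to_continuous:
  assumes K: "K \<in> L2 open_square"
    and orth: "\<And>g. continuous_on closed_square g \<Longrightarrow> (\<integral>p. K p * g p \<partial>lebesgue_on open_square) = 0"
  shows "AE p in lebesgue_on open_square. K p = 0"
proof -
  have Km: "K \<in> borel_measurable (lebesgue_on open_square)" using K by (rule L2_measurable)
  have "(\<lambda>p. sgn (K p)) \<in> borel_measurable (lebesgue_on open_square)" using Km by measurable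
  hence "(\<lambda>p. sgn (K p)) measurable_on open_square"
    by (simp add: measurable_on_iff_borel_measurable)
  then obtain N g where N: "negligible N" and g: "\<And>n. continuous_on UNIV (g n)"
    "\<And>p. p \<notin> N \<Longrightarrow> (\<lambda>n. g n p) \<longlonglongrightarrow> (if p \<in> open_square then sgn (K p) else 0)"
    unfolding measurable_on_def by metis
  \<comment> \<open>Truncation to [-1, 1] keeps continuity and the limit, and provides |K| as an
    integrable majorant.\<close>
  define h where "h = (\<lambda>n p. max (- 1) (min 1 (g n p)) :: real)"
  have hc: "continuous_on closed_square (h n)" for n
    unfolding h_def by (intro continuous_intros continuous_on_subset[OF g(1)]) auto
  have "(\<lambda>n. \<integral>p. K p * h n p \<partial>lebesgue_on open_square) \<longlonglongrightarrow> (\<integral>p. \<bar>K p\<bar> \<partial>lebesgue_on open_square)"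
  proof (rule integral_dominated_convergence[where w = "\<lambda>p. \<bar>K p\<bar>"])
    show "integrable (lebesgue_on open_square) (\<lambda>p. \<bar>K p\<bar>)"
      using L2_integrable_square[OF K] by simp
    show "(\<lambda>p. K p * h n p) \<in> borel_measurable (lebesgue_on open_square)" for n
      using Km continuous_L2_square[OF hc, of n] by (auto simp: L2_def)
    show "(\<lambda>p. \<bar>K p\<bar>) \<in> borel_measurable (lebesgue_on open_square)" using Km by measurable
    have "\<bar>h n p\<bar> \<le> 1" for n p by (auto simp: h_def)
    hence "\<bar>K p\<bar> * \<bar>h n p\<bar> \<le> \<bar>K p\<bar> * 1" for n p by (intro mult_left_mono) auto
    thus "AE p in lebesgue_on open_square. norm (K p * h n p) \<le> \<bar>K p\<bar>" for n by (simp add: abs_mult)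
    have "AE p in lebesgue_on open_square. p \<notin> N"
      using AE_not_in[of N lebesgue] N by (auto simp: AE_restrict_space_iff negligible_iff_null_sets elim: eventually_mono)
    thus "AE p in lebesgue_on open_square. (\<lambda>n. K p * h n p) \<longlonglongrightarrow> \<bar>K p\<bar>"
      using AE_space
    proof eventually_elim
      case (elim p)
      hence "(\<lambda>n. g n p) \<longlonglongrightarrow> sgn (K p)" using g(2)[of p] by simp
      hence "(\<lambda>n. K p * h n p) \<longlonglongrightarrow> K p * max (- 1) (min 1 (sgn (K p)))"
        unfolding h_def by (intro tendsto_intros)
      moreover have "max (- 1) (min 1 (sgn (K p))) = sgn (K p)" by (auto simp: sgn_if)
      moreover have "K p * sgn (K p) = \<bar>K p\<bar>" by (simp add: sgn_if)
      ultimately show ?case by metis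
    qed
  qed
  hence "(\<integral>p. \<bar>K p\<bar> \<partial>lebesgue_on open_square) = 0"
    using orth[OF hc] LIMSEQ_unique[OF tendsto_const[of 0]] by simp
  thus ?thesis
    using integral_nonneg_eq_0_iff_AE[of "lebesgue_on open_square" "\<lambda>p. \<bar>K p\<bar>"] L2_integrable_square[OF K] by simp
qed

definition sine :: "nat \<Rightarrow> real \<Rightarrow> real" where "sine n x = sin (nu n * x)"
definition cosine :: "nat \<Rightarrow> real \<Rightarrow> real" where "cosine n x = cos (nu n * x)"

lemma continuous_on_sine [continuous_intros]: "continuous_on (A :: 'a::t2_space set) f \<Longrightarrow> continuous_on A (\<lambda>x. sine n (f x))"
  unfolding sine_def by (rule continuous_on_sin[OF continuous_on_mult[OF continuous_on_const]])

lemma continuous_on_cosine [continuous_intros]: "continuous_on (A :: 'a::t2_space set) f \<Longrightarrow> continuous_on A (\<lambda>x. cosine n (f x))"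
  unfolding cosine_def by (rule continuous_on_cos[OF continuous_on_mult[OF continuous_on_const]])

text \<open>For n = 0 the lower neighbour would have frequency 0 and vanishes, hence the case
  distinction.\<close>

lemma sine_times_cos: "cos (pi * x) * sine n x = (sine (Suc n) x + (if n = 0 then 0 else sine (n - 1) x)) / 2"
proof -
  have "sin (nu n * x + pi * x) + sin (nu n * x - pi * x) = 2 * (cos (pi * x) * sine n x)"
    by (simp add: sine_def sin_add sin_diff)
  moreover have "nu n * x + pi * x = nu (Suc n) * x" by (simp add: nu_def algebra_simps)
  moreover have "nu n * x - pi * x = (if n = 0 then 0 else nu (n - 1) * x)"
    by (cases n) (auto simp: nu_def algebra_simps)
  ultimately show ?thesis by (auto simp: sine_def split: if_splits)
qed

abbreviation sine2 :: "nat \<times> nat \<Rightarrow> real \<times> real \<Rightarrow> real"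
  where "sine2 i \<equiv> tensor (sine (fst i)) (sine (snd i))"

lemma continuous_sine2: "continuous_on closed_square (sine2 i)"
  by (intro tensor_continuous continuous_intros)

text \<open>Since \<open>cos (\<pi> x) sine n x\<close> is a combination of sines, the functions \<open>f\<close> that multiply the annihilator
  \<open>W\<close> into itself form an algebra containing \<open>cos (\<pi> x)\<close> and \<open>cos (\<pi> y)\<close>, which separate points, and
  the Stone-Weierstrass theorem applies to it.\<close>

theorem sine_system_complete:
  assumes k: "k \<in> L2 open_square"
    and orth: "\<And>n m. (\<integral>p. k p * sine2 (n, m) p \<partial>lebesgue_on open_square) = 0"
  shows "AE p in lebesgue_on open_square. k p = 0"
proof -
  define W where "W = {h. continuous_on closed_square h \<and>
    (\<forall>n m. (\<integral>p. k p * (sine2 (n, m) p * h p) \<partial>lebesgue_on open_square) = 0)}"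
  define V where "V = {f. continuous_on closed_square f \<and> (\<forall>h\<in>W. (\<lambda>p. f p * h p) \<in> W)}"
  have int: "integrable (lebesgue_on open_square) (\<lambda>p. k p * (sine2 i p * h p))" if "continuous_on closed_square h" for i h
    using L2_mult_integrable[OF k continuous_L2_square[OF continuous_on_mult[OF continuous_sine2 that]]] .
  have W_add: "(\<lambda>p. f p + g p) \<in> W" if "f \<in> W" "g \<in> W" for f g
    using that int[of f] int[of g] by (auto simp: W_def distrib_left intro!: continuous_on_add)
  have W_scale: "(\<lambda>p. c * f p) \<in> W" if "f \<in> W" for f c
    using that by (auto simp: W_def mult.left_commute[of _ c] intro!: continuous_on_mult continuous_on_const)
  have W_one: "(\<lambda>p. 1) \<in> W" using orth by (simp add: W_def)
  have cosx: "(\<lambda>p. cos (pi * fst p)) \<in> V"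
    unfolding V_def
  proof (intro CollectI conjI ballI)
    show "continuous_on closed_square (\<lambda>p. cos (pi * fst p))" by (intro continuous_intros)
    fix h assume h: "h \<in> W"
    hence hc: "continuous_on closed_square h" by (simp add: W_def)
    have "(\<integral>p. k p * (sine2 (n, m) p * (cos (pi * fst p) * h p)) \<partial>lebesgue_on open_square) = 0" for n m
    proof -
      have "sine2 (n, m) p * (cos (pi * fst p) * h p) =
          (sine2 (Suc n, m) p * h p + (if n = 0 then 0 else sine2 (n - 1, m) p * h p)) / 2" for p
      proof -
        have "sine2 (n, m) p * (cos (pi * fst p) * h p) = (cos (pi * fst p) * sine n (fst p)) * (sine m (snd p) * h p)"
          by (simp add: tensor_def)
        thus ?thesis unfolding sine_times_cos by (auto simp: tensor_def algebra_simps)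
      qed
      note e = this
      have e2: "k p * (sine2 (n, m) p * (cos (pi * fst p) * h p)) =
          (k p * (sine2 (Suc n, m) p * h p) + (if n = 0 then 0 else k p * (sine2 (n - 1, m) p * h p))) / 2" for p
        unfolding e by (cases "n = 0") (simp_all only: simp_thms if_True if_False add_0_right mult_zero_right times_divide_eq_right distrib_left)
      have "(\<integral>p. k p * (sine2 (i, j) p * h p) \<partial>lebesgue_on open_square) = 0"
        "integrable (lebesgue_on open_square) (\<lambda>p. k p * (sine2 (i, j) p * h p))" for i j
        using h int[OF hc, of "(i, j)"] by (simp_all add: W_def)
      thus ?thesis unfolding e2 by (cases "n = 0") simp_all
    qed
    thus "(\<lambda>p. cos (pi * fst p) * h p) \<in> W"
      unfolding W_def using hc by (auto intro!: continuous_intros)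
  qed
  have cosy: "(\<lambda>p. cos (pi * snd p)) \<in> V"
    unfolding V_def
  proof (intro CollectI conjI ballI)
    show "continuous_on closed_square (\<lambda>p. cos (pi * snd p))" by (intro continuous_intros)
    fix h assume h: "h \<in> W"
    hence hc: "continuous_on closed_square h" by (simp add: W_def)
    have "(\<integral>p. k p * (sine2 (m, n) p * (cos (pi * snd p) * h p)) \<partial>lebesgue_on open_square) = 0" for n m
    proof -
      have "sine2 (m, n) p * (cos (pi * snd p) * h p) =
          (sine2 (m, Suc n) p * h p + (if n = 0 then 0 else sine2 (m, n - 1) p * h p)) / 2" for p
      proof -
        have "sine2 (m, n) p * (cos (pi * snd p) * h p) = (cos (pi * snd p) * sine n (snd p)) * (sine m (fst p) * h p)"
          by (simp add: tensor_def)
        thus ?thesis unfolding sine_times_cos by (auto simp: tensor_def algebra_simps)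
      qed
      note e = this
      have e2: "k p * (sine2 (m, n) p * (cos (pi * snd p) * h p)) =
          (k p * (sine2 (m, Suc n) p * h p) + (if n = 0 then 0 else k p * (sine2 (m, n - 1) p * h p))) / 2" for p
        unfolding e by (cases "n = 0") (simp_all only: simp_thms if_True if_False add_0_right mult_zero_right times_divide_eq_right distrib_left)
      have "(\<integral>p. k p * (sine2 (i, j) p * h p) \<partial>lebesgue_on open_square) = 0"
        "integrable (lebesgue_on open_square) (\<lambda>p. k p * (sine2 (i, j) p * h p))" for i j
        using h int[OF hc, of "(i, j)"] by (simp_all add: W_def)
      thus ?thesis unfolding e2 by (cases "n = 0") simp_all
    qed
    thus "(\<lambda>p. cos (pi * snd p) * h p) \<in> W"
      unfolding W_def using hc by (auto intro!: continuous_intros)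
  qed
  interpret function_ring_on V closed_square
  proof
    show "compact closed_square" by (rule compact_closed_square)
    show "continuous_on closed_square f" if "f \<in> V" for f using that by (simp add: V_def)
    show "(\<lambda>x. f x + g x) \<in> V" if "f \<in> V" "g \<in> V" for f g
      using that W_add by (auto simp: V_def distrib_right intro!: continuous_on_add)
    show "(\<lambda>x. f x * g x) \<in> V" if "f \<in> V" "g \<in> V" for f g
      using that by (auto simp: V_def mult.assoc intro!: continuous_on_mult)
    show "(\<lambda>_. c) \<in> V" for c using W_scale by (auto simp: V_def)
    show "\<exists>f\<in>V. f x \<noteq> f y" if "x \<in> closed_square" "y \<in> closed_square" "x \<noteq> y" for x y
    proof -
      have inj: "s = t" if "cos (pi * s) = cos (pi * t)" "s \<in> {0..1}" "t \<in> {0..1}" for s t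
      proof -
        have "pi * s = pi * t" by (rule cos_inj_pi) (use that in auto)
        thus ?thesis by simp
      qed
      have "fst x \<in> {0..1}" "fst y \<in> {0..1}" "snd x \<in> {0..1}" "snd y \<in> {0..1}"
        "fst x \<noteq> fst y \<or> snd x \<noteq> snd y" using that by (auto simp: prod_eq_iff)
      hence "cos (pi * fst x) \<noteq> cos (pi * fst y) \<or> cos (pi * snd x) \<noteq> cos (pi * snd y)"
        using inj[of "fst x" "fst y"] inj[of "snd x" "snd y"] by blast
      thus ?thesis
      proof
        assume "cos (pi * fst x) \<noteq> cos (pi * fst y)"
        thus ?thesis by (rule bexI[OF _ cosx])
      next
        assume "cos (pi * snd x) \<noteq> cos (pi * snd y)"
        thus ?thesis by (rule bexI[OF _ cosy])
      qed
    qed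
  qed
  \<comment> \<open>Since 1 lies in \<open>W\<close>, the function K is orthogonal to
    \<open>V\<close> and hence to all continuous functions. The lowest sine product is positive
    inside the square, so K = 0 forces k = 0.\<close>
  define K where "K = (\<lambda>p. k p * sine2 (0, 0) p)"
  have KL: "K \<in> L2 open_square" unfolding K_def by (rule L2_mult_continuous[OF k continuous_sine2])
  have orthV: "(\<integral>p. K p * f p \<partial>lebesgue_on open_square) = 0" if f: "f \<in> V" for f
  proof -
    have "\<forall>h\<in>W. (\<lambda>p. f p * h p) \<in> W" using f unfolding V_def by blast
    from bspec[OF this W_one] have "(\<lambda>p. f p * 1) \<in> W" .
    hence "(\<integral>p. k p * (sine2 (0, 0) p * (f p * 1)) \<partial>lebesgue_on open_square) = 0"
      unfolding W_def by blast
    thus ?thesis unfolding K_def by (simp only: mult.assoc mult_1_right)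
  qed
  have "AE p in lebesgue_on open_square. K p = 0"
  proof (rule AE_zero_if_orthogonal_to_continuous[OF KL])
    fix g :: "real \<times> real \<Rightarrow> real" assume g: "continuous_on closed_square g"
    have "\<exists>f\<in>V. \<forall>p\<in>closed_square. \<bar>g p - f p\<bar> < 1 / real (Suc n)" for n
      by (rule Stone_Weierstrass_basic[OF g]) simp
    then obtain f where f: "\<And>n. f n \<in> V" "\<And>n p. p \<in> closed_square \<Longrightarrow> \<bar>g p - f n p\<bar> < 1 / real (Suc n)"
      by metis
    have L: "f n \<in> L2 open_square" "g \<in> L2 open_square" for n
      using f(1) g by (auto simp: V_def intro!: continuous_L2_square)
    have lim: "(\<lambda>n. L2_norm open_square (\<lambda>p. f n p - g p)) \<longlonglongrightarrow> 0"
    proof (rule tendsto_sandwich[of "\<lambda>_. 0" _ sequentially "\<lambda>n. 1 / real (Suc n)"])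
      show "\<forall>\<^sub>F n in sequentially. L2_norm open_square (\<lambda>p. f n p - g p) \<le> 1 / real (Suc n)"
      proof (intro always_eventually allI L2_norm_square_le_sup L2_diff L)
        fix n and p :: "real \<times> real" assume "p \<in> open_square"
        thus "\<bar>f n p - g p\<bar> \<le> 1 / real (Suc n)"
          using f(2)[of p n] by (subst abs_minus_commute) (intro less_imp_le, auto)
      qed
      show "(\<lambda>n. 1 / real (Suc n)) \<longlonglongrightarrow> 0" by (rule LIMSEQ_Suc[OF lim_1_over_n])
    qed (auto simp: L2_norm_nonneg)
    have "(\<lambda>n. \<integral>p. K p * f n p \<partial>lebesgue_on open_square) \<longlonglongrightarrow> (\<integral>p. K p * g p \<partial>lebesgue_on open_square)"
      by (rule L2_weak_limit[OF KL L lim])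
    thus "(\<integral>p. K p * g p \<partial>lebesgue_on open_square) = 0"
      using orthV[OF f(1)] LIMSEQ_unique[OF tendsto_const[of 0]] by simp
  qed
  thus ?thesis using AE_space
  proof eventually_elim
    case (elim p)
    have "sin (pi * t) > 0" if "0 < t" "t < 1" for t using that by (intro sin_gt_zero) auto
    from this[of "fst p"] this[of "snd p"] have "sin (pi * fst p) > 0" "sin (pi * snd p) > 0"
      using elim(2) by auto
    hence "sine2 (0, 0) p \<noteq> 0" by (simp add: tensor_def sine_def nu_def)
    thus ?case using elim(1) by (simp add: K_def)
  qed
qed

section \<open>Series converging in L2 uniformly in a parameter\<close>

lemma nn_integral_square_iterated:
  fixes F :: "real \<times> real \<Rightarrow> ennreal"
  assumes [measurable]: "F \<in> borel_measurable borel"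
  shows "(\<integral>\<^sup>+p. F p \<partial>lebesgue_on open_square) =
      (\<integral>\<^sup>+x. indicator unit_open x * (\<integral>\<^sup>+y. F (x, y) \<partial>lebesgue_on unit_open) \<partial>lborel)"
    "(\<integral>\<^sup>+p. F p \<partial>lebesgue_on open_square) =
      (\<integral>\<^sup>+y. indicator unit_open y * (\<integral>\<^sup>+x. F (x, y) \<partial>lebesgue_on unit_open) \<partial>lborel)"
proof -
  have Q: "open_square \<in> sets borel" by (simp add: open_square_eq_box)
  have inner: "(\<integral>\<^sup>+y. f y \<partial>lebesgue_on unit_open) = (\<integral>\<^sup>+y. f y * indicator unit_open y \<partial>lborel)"
    if [measurable]: "f \<in> borel_measurable borel" for f :: "real \<Rightarrow> ennreal"
    by (simp add: nn_integral_restrict_space nn_integral_completion)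
  define G where "G = (\<lambda>(x, y). F (x, y) * indicator unit_open x * indicator unit_open y)"
  have [measurable]: "F \<in> borel_measurable (borel \<Otimes>\<^sub>M borel)" by (simp add: borel_prod)
  have Gm [measurable]: "G \<in> borel_measurable (lborel \<Otimes>\<^sub>M lborel)"
    unfolding G_def by measurable
  have "(\<integral>\<^sup>+p. F p \<partial>lebesgue_on open_square) = (\<integral>\<^sup>+p. F p * indicator open_square p \<partial>lborel)"
    using Q by (simp add: nn_integral_restrict_space nn_integral_completion)
  also have "\<dots> = (\<integral>\<^sup>+p. G p \<partial>(lborel \<Otimes>\<^sub>M lborel))"
    unfolding lborel_prod by (rule nn_integral_cong) (auto simp: G_def indicator_def split: prod.splits)
  finally have eq: "(\<integral>\<^sup>+p. F p \<partial>lebesgue_on open_square) = (\<integral>\<^sup>+p. G p \<partial>(lborel \<Otimes>\<^sub>M lborel))" .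
  have "(\<integral>\<^sup>+p. G p \<partial>(lborel \<Otimes>\<^sub>M lborel)) = (\<integral>\<^sup>+x. \<integral>\<^sup>+y. G (x, y) \<partial>lborel \<partial>lborel)"
    by (rule lborel.nn_integral_fst[symmetric]) measurable
  also have "\<dots> = (\<integral>\<^sup>+x. indicator unit_open x * (\<integral>\<^sup>+y. F (x, y) \<partial>lebesgue_on unit_open) \<partial>lborel)"
  proof (rule nn_integral_cong)
    fix x :: real
    have [measurable]: "(\<lambda>y. F (x, y)) \<in> borel_measurable borel" by measurable
    show "(\<integral>\<^sup>+y. G (x, y) \<partial>lborel) = indicator unit_open x * (\<integral>\<^sup>+y. F (x, y) \<partial>lebesgue_on unit_open)"
      by (subst inner) (auto simp: G_def indicator_def mult.commute intro!: nn_integral_cong)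
  qed
  finally show "(\<integral>\<^sup>+p. F p \<partial>lebesgue_on open_square) =
      (\<integral>\<^sup>+x. indicator unit_open x * (\<integral>\<^sup>+y. F (x, y) \<partial>lebesgue_on unit_open) \<partial>lborel)"
    unfolding eq .
  have "(\<integral>\<^sup>+p. G p \<partial>(lborel \<Otimes>\<^sub>M lborel)) = (\<integral>\<^sup>+y. \<integral>\<^sup>+x. G (x, y) \<partial>lborel \<partial>lborel)"
    by (rule lborel_pair.nn_integral_snd[symmetric]) (use Gm in \<open>simp add: case_prod_unfold\<close>)
  also have "\<dots> = (\<integral>\<^sup>+y. indicator unit_open y * (\<integral>\<^sup>+x. F (x, y) \<partial>lebesgue_on unit_open) \<partial>lborel)"
  proof (rule nn_integral_cong)
    fix y :: real
    have [measurable]: "(\<lambda>x. F (x, y)) \<in> borel_measurable borel" by measurable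
    show "(\<integral>\<^sup>+x. G (x, y) \<partial>lborel) = indicator unit_open y * (\<integral>\<^sup>+x. F (x, y) \<partial>lebesgue_on unit_open)"
      by (subst inner) (auto simp: G_def indicator_def mult.commute intro!: nn_integral_cong)
  qed
  finally show "(\<integral>\<^sup>+p. F p \<partial>lebesgue_on open_square) =
      (\<integral>\<^sup>+y. indicator unit_open y * (\<integral>\<^sup>+x. F (x, y) \<partial>lebesgue_on unit_open) \<partial>lborel)"
    unfolding eq .
qed

lemma borel_measurable_lebesgue_on:
  fixes f :: "'a::euclidean_space \<Rightarrow> real"
  assumes "f \<in> borel_measurable borel" shows "f \<in> borel_measurable (lebesgue_on S)"
  using assms by (intro measurable_restrict_space1 measurable_completion) simp

lemma L2_norm_le_of_nn_integral:
  assumes "f \<in> borel_measurable (lebesgue_on S)" "(\<integral>\<^sup>+x. ennreal ((f x)\<^sup>2) \<partial>lebesgue_on S) \<le> ennreal b" "b \<ge> 0"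
  shows "f \<in> L2 S" "L2_norm S f \<le> sqrt b"
proof -
  have "integrable (lebesgue_on S) (\<lambda>x. (f x)\<^sup>2)"
    using assms by (intro integrableI_nonneg) (auto simp: le_less_trans ennreal_less_top)
  thus 1: "f \<in> L2 S" using assms by (simp add: L2_def)
  have "ennreal (\<integral>x. (f x)\<^sup>2 \<partial>lebesgue_on S) \<le> ennreal b"
    using assms(2) 1 by (subst nn_integral_eq_integral[symmetric]) (auto simp: L2_def)
  thus "L2_norm S f \<le> sqrt b" using assms(3) by (simp add: L2_norm_def)
qed

lemma nn_integral_L2:
  "f \<in> L2 S \<Longrightarrow> (\<integral>\<^sup>+x. ennreal ((f x)\<^sup>2) \<partial>lebesgue_on S) = ennreal ((L2_norm S f)\<^sup>2)"
  unfolding L2_norm_square by (rule nn_integral_eq_integral) (auto simp: L2_def)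

lemma L1_le_L2_unit:
  assumes "f \<in> L2 unit_open"
  shows "(\<integral>\<^sup>+y. ennreal \<bar>f y\<bar> \<partial>lebesgue_on unit_open) \<le> ennreal (L2_norm unit_open f)"
proof -
  have one: "(\<lambda>x::real. 1) \<in> L2 unit_open" by (rule continuous_L2_unit) auto
  have absL: "(\<lambda>y. \<bar>f y\<bar>) \<in> L2 unit_open" using assms by (auto simp: L2_def)
  have "L2_norm unit_open (\<lambda>x::real. 1) = 1"
    using integral_unit_eq_integral(1)[of "\<lambda>_. 1"] by (simp add: L2_norm_def)
  moreover have "L2_norm unit_open (\<lambda>y. \<bar>f y\<bar>) = L2_norm unit_open f" by (simp add: L2_norm_def)
  ultimately have "(\<integral>y. \<bar>f y\<bar> \<partial>lebesgue_on unit_open) \<le> L2_norm unit_open f"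
    using L2_Cauchy_Schwarz[OF absL one] by simp
  thus ?thesis
    using L2_mult_integrable[OF absL one] by (subst nn_integral_eq_integral) (auto intro: ennreal_leI)
qed

text \<open>On the unit interval the L1 norm is at most the L2 norm, so the increments have
  geometrically bounded L1 norms and their absolute values sum to a finite limit almost
  everywhere.\<close>

lemma AE_convergent_of_fast_Cauchy:
  fixes f :: "nat \<Rightarrow> real \<Rightarrow> real"
  assumes f: "\<And>j. f j \<in> L2 unit_open"
    and fast: "\<And>j. L2_norm unit_open (\<lambda>y. f (Suc j) y - f j y) \<le> (1/2) ^ j"
  shows "AE y in lebesgue_on unit_open. convergent (\<lambda>j. f j y)"
proof -
  define g where "g = (\<lambda>j y. f (Suc j) y - f j y)"
  have gL: "g j \<in> L2 unit_open" for j unfolding g_def by (intro L2_diff f)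
  hence [measurable]: "g j \<in> borel_measurable (lebesgue_on unit_open)" for j by (rule L2_measurable)
  have "(\<integral>\<^sup>+y. (\<Sum>j. ennreal \<bar>g j y\<bar>) \<partial>lebesgue_on unit_open) = (\<Sum>j. \<integral>\<^sup>+y. ennreal \<bar>g j y\<bar> \<partial>lebesgue_on unit_open)"
    by (rule nn_integral_suminf) measurable
  also have "\<dots> \<le> (\<Sum>j. ennreal ((1/2) ^ j))"
  proof (rule suminf_le)
    show "(\<integral>\<^sup>+y. ennreal \<bar>g j y\<bar> \<partial>lebesgue_on unit_open) \<le> ennreal ((1/2) ^ j)" for j
      using L1_le_L2_unit[OF gL, of j] fast[of j] unfolding g_def by (meson ennreal_leI order_trans)
  qed auto
  also have "\<dots> = ennreal (\<Sum>j. (1/2) ^ j)"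
    by (rule suminf_ennreal2) (auto intro: summable_geometric)
  also have "\<dots> < \<infinity>" by simp
  finally have "AE y in lebesgue_on unit_open. (\<Sum>j. ennreal \<bar>g j y\<bar>) \<noteq> \<infinity>"
    by (intro nn_integral_PInf_AE) auto
  thus ?thesis
  proof eventually_elim
    case (elim y)
    hence "summable (\<lambda>j. \<bar>g j y\<bar>)" by (intro summable_suminf_not_top) auto
    hence "summable (\<lambda>j. f (Suc j) y - f j y)" unfolding g_def by (rule summable_rabs_cancel)
    hence "convergent (\<lambda>n. f n y - f 0 y)"
      by (simp only: summable_iff_convergent sum_lessThan_telescope[of "\<lambda>j. f j y"])
    thus ?case by (simp add: convergent_diff_const_right_iff)
  qed
qed

lemma Fatou_L2_unit:
  fixes f :: "nat \<Rightarrow> real \<Rightarrow> real"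
  assumes f: "\<And>j. f j \<in> L2 unit_open" and w: "w \<in> borel_measurable (lebesgue_on unit_open)"
    and lim: "AE y in lebesgue_on unit_open. (\<lambda>j. f j y) \<longlonglongrightarrow> w y"
    and s: "s \<in> L2 unit_open" and b: "b \<ge> 0"
    and bound: "eventually (\<lambda>j. (L2_norm unit_open (\<lambda>y. f j y - s y))\<^sup>2 \<le> b) sequentially"
  shows "(\<integral>\<^sup>+y. ennreal ((w y - s y)\<^sup>2) \<partial>lebesgue_on unit_open) \<le> ennreal b"
proof -
  have [measurable]: "f j \<in> borel_measurable (lebesgue_on unit_open)" "s \<in> borel_measurable (lebesgue_on unit_open)" for j
    using f s by (auto intro: L2_measurable)
  have "(\<integral>\<^sup>+y. ennreal ((w y - s y)\<^sup>2) \<partial>lebesgue_on unit_open) =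
     (\<integral>\<^sup>+y. liminf (\<lambda>j. ennreal ((f j y - s y)\<^sup>2)) \<partial>lebesgue_on unit_open)"
  proof (rule nn_integral_cong_AE)
    show "AE y in lebesgue_on unit_open. ennreal ((w y - s y)\<^sup>2) = liminf (\<lambda>j. ennreal ((f j y - s y)\<^sup>2))"
      using lim
    proof eventually_elim
      case (elim y)
      have "(\<lambda>j. ennreal ((f j y - s y)\<^sup>2)) \<longlonglongrightarrow> ennreal ((w y - s y)\<^sup>2)"
        by (intro tendsto_ennrealI tendsto_intros elim)
      from lim_imp_Liminf[OF sequentially_bot this] show ?case by simp
    qed
  qed
  also have "\<dots> \<le> liminf (\<lambda>j. \<integral>\<^sup>+y. ennreal ((f j y - s y)\<^sup>2) \<partial>lebesgue_on unit_open)"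
    by (rule nn_integral_liminf) measurable
  also have "\<dots> \<le> liminf (\<lambda>j. ennreal b)"
  proof (rule Liminf_mono)
    show "\<forall>\<^sub>F j in sequentially. (\<integral>\<^sup>+y. ennreal ((f j y - s y)\<^sup>2) \<partial>lebesgue_on unit_open) \<le> ennreal b"
      using bound by eventually_elim (simp add: nn_integral_L2 L2_diff f s ennreal_leI)
  qed
  also have "\<dots> = ennreal b" by (simp add: Liminf_const)
  finally show ?thesis .
qed

text \<open>The partial sums converge along a subsequence fast enough, uniformly in \<open>x\<close>, to converge almost
  everywhere on every slice. Hence a single Borel function \<open>w\<close> on the plane represents both the
  limit on the square and the limits on all slices.\<close>

locale L2_series =
  fixes e u :: "nat \<Rightarrow> real \<Rightarrow> real" and B :: "nat \<Rightarrow> real"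
  assumes e_cont: "\<And>m. continuous_on UNIV (e m)"
    and e_orth: "\<And>m l. integral {0..1} (\<lambda>y. e m y * e l y) = (if m = l then 1 / 2 else 0)"
    and u_cont: "\<And>m. continuous_on UNIV (u m)"
    and u_bound: "\<And>m x. x \<in> {0..1} \<Longrightarrow> \<bar>u m x\<bar> \<le> B m"
    and B_summable: "summable (\<lambda>m. (B m)\<^sup>2)"
begin

definition S :: "nat \<Rightarrow> real \<Rightarrow> real \<Rightarrow> real" where "S N x y = (\<Sum>m<N. u m x * e m y)"

definition tail :: "nat \<Rightarrow> real" where "tail N = (\<Sum>m. (B (m + N))\<^sup>2)"

lemma tail_nonneg: "tail N \<ge> 0"
  unfolding tail_def using summable_ignore_initial_segment[OF B_summable] by (intro suminf_nonneg) auto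

lemma tail_tendsto: "tail \<longlonglongrightarrow> 0"
  unfolding tail_def[abs_def] by (rule suminf_exist_split2[OF B_summable])

lemma sum_le_tail:
  assumes "M \<le> N" shows "(\<Sum>m=M..<N. (B m)\<^sup>2) \<le> tail M"
proof -
  have "(\<Sum>m=M..<N. (B m)\<^sup>2) = (\<Sum>m<N - M. (B (m + M))\<^sup>2)"
    using assms by (intro sum.reindex_bij_witness[of _ "\<lambda>m. m + M" "\<lambda>m. m - M"]) auto
  also have "\<dots> \<le> tail M"
    unfolding tail_def using summable_ignore_initial_segment[OF B_summable] by (intro sum_le_suminf) auto
  finally show ?thesis .
qed

lemma tail_antimono: assumes "M \<le> N" shows "tail N \<le> tail M"
proof -
  have "summable (\<lambda>m. (B (m + M))\<^sup>2)" by (rule summable_ignore_initial_segment[OF B_summable])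
  from suminf_split_initial_segment[OF this, of "N - M"]
  have "tail M = tail N + (\<Sum>m<N - M. (B (m + M))\<^sup>2)"
    using assms by (simp add: tail_def add.assoc)
  thus ?thesis by (simp add: sum_nonneg)
qed

lemma e_cont': "continuous_on A (e m)" using e_cont continuous_on_subset by blast

lemma e_combination_norm:
  assumes "finite I"
  shows "(L2_norm unit_open (\<lambda>y. \<Sum>m\<in>I. c m * e m y))\<^sup>2 = (\<Sum>m\<in>I. (c m)\<^sup>2) / 2"
proof -
  have "(L2_norm unit_open (\<lambda>y. \<Sum>m\<in>I. c m * e m y))\<^sup>2 = integral {0..1} (\<lambda>y. (\<Sum>m\<in>I. c m * e m y)\<^sup>2)"
    unfolding L2_norm_square by (intro integral_unit_eq_integral continuous_intros e_cont')
  also have "\<dots> = integral {0..1} (\<lambda>y. \<Sum>m\<in>I. \<Sum>l\<in>I. (c m * c l) * (e m y * e l y))"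
    by (simp add: power2_eq_square sum_product mult_ac)
  also have "\<dots> = (\<Sum>m\<in>I. \<Sum>l\<in>I. (c m * c l) * integral {0..1} (\<lambda>y. e m y * e l y))"
    by (subst integral_sum[OF assms], (intro integrable_continuous_real continuous_intros e_cont')[1],
        intro sum.cong refl, subst integral_sum[OF assms], (intro integrable_continuous_real continuous_intros e_cont')[1]) simp
  also have "\<dots> = (\<Sum>m\<in>I. (c m)\<^sup>2 / 2)"
    using assms by (intro sum.cong refl) (simp add: e_orth power2_eq_square if_distrib[of "\<lambda>t. _ * t"] cong: if_cong)
  finally show ?thesis by (simp add: sum_divide_distrib)
qed

lemma S_cont: "continuous_on A (S N x)"
  unfolding S_def[abs_def] by (intro continuous_intros e_cont')

lemma S_L2: "S N x \<in> L2 unit_open"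
  by (intro continuous_L2_unit S_cont)

lemma S_diff_norm:
  assumes "M \<le> N" "x \<in> {0..1}"
  shows "(L2_norm unit_open (\<lambda>y. S N x y - S M x y))\<^sup>2 \<le> tail M"
proof -
  have "S N x y - S M x y = (\<Sum>m=M..<N. u m x * e m y)" for y
    using assms sum_diff_nat_ivl[of 0 M N "\<lambda>m. u m x * e m y"] by (simp add: S_def atLeast0LessThan)
  hence "(L2_norm unit_open (\<lambda>y. S N x y - S M x y))\<^sup>2 = (\<Sum>m=M..<N. (u m x)\<^sup>2) / 2"
    by (simp add: e_combination_norm)
  also have "\<dots> \<le> (\<Sum>m=M..<N. (B m)\<^sup>2)"
  proof -
    have "(\<Sum>m=M..<N. (u m x)\<^sup>2) \<le> (\<Sum>m=M..<N. (B m)\<^sup>2)"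
      using power_mono[OF u_bound[OF assms(2)] abs_ge_zero, where n = 2] by (intro sum_mono) simp
    moreover have "(\<Sum>m=M..<N. (u m x)\<^sup>2) \<ge> 0" by (intro sum_nonneg) auto
    ultimately show ?thesis by linarith
  qed
  also have "\<dots> \<le> tail M" by (rule sum_le_tail[OF assms(1)])
  finally show ?thesis .
qed

lemma fast_index_ex: "\<exists>r. (\<forall>j. tail (r j) \<le> ((1/2) ^ j)\<^sup>2) \<and> mono r \<and> (\<forall>j. j \<le> r j)"
proof -
  have "\<exists>N. tail N \<le> ((1/2) ^ j)\<^sup>2" for j
  proof -
    have "\<forall>\<^sub>F N in sequentially. tail N < ((1/2) ^ j)\<^sup>2"
      by (rule order_tendstoD(2)[OF tail_tendsto]) simp
    from eventually_happens'[OF sequentially_bot this] show ?thesis by (auto intro: less_imp_le)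
  qed
  then obtain N where N: "\<And>j. tail (N j) \<le> ((1/2) ^ j)\<^sup>2" by metis
  \<comment> \<open>The summand j forces r j \<ge> j; the accumulated sum makes r monotone and at
    least N j, so that the tail bound is inherited.\<close>
  define r where "r = (\<lambda>j. j + (\<Sum>i\<le>j. N i))"
  have "N j \<le> r j" for j unfolding r_def by (simp add: member_le_sum trans_le_add2)
  hence "tail (r j) \<le> ((1/2) ^ j)\<^sup>2" for j using N tail_antimono order_trans by blast
  moreover have "mono r" unfolding r_def by (intro monoI add_mono sum_mono2) auto
  ultimately show ?thesis unfolding r_def by (intro exI[of _ r]) (auto simp: r_def)
qed

definition r :: "nat \<Rightarrow> nat"
  where "r = (SOME r. (\<forall>j. tail (r j) \<le> ((1/2) ^ j)\<^sup>2) \<and> mono r \<and> (\<forall>j. j \<le> r j))"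

lemma r: "tail (r j) \<le> ((1/2) ^ j)\<^sup>2" "mono r" "j \<le> r j"
  using someI_ex[OF fast_index_ex] unfolding r_def[symmetric] by auto

text \<open>A pointwise limit, hence one Borel function on the plane; the arbitrary value of
  \<open>lim\<close> matters only on a null set of each slice over [0, 1]. On a slice where all u m
  vanish it is exactly 0, which later gives the boundary values of k_yy.\<close>

definition w :: "real \<times> real \<Rightarrow> real"
  where "w p = lim (\<lambda>j. S (r j) (fst p) (snd p))"

lemma S_measurable [measurable]: "(\<lambda>p. S N (fst p) (snd p)) \<in> borel_measurable borel"
proof -
  have [measurable]: "u m \<in> borel_measurable borel" "e m \<in> borel_measurable borel" for m
    using u_cont e_cont by (auto intro: borel_measurable_continuous_onI)
  have "(\<lambda>p. S N (fst p) (snd p)) \<in> borel_measurable (borel \<Otimes>\<^sub>M borel)"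
    unfolding S_def by measurable
  thus ?thesis by (simp add: borel_prod)
qed

lemma w_measurable [measurable]: "w \<in> borel_measurable borel"
  unfolding w_def[abs_def] by (rule borel_measurable_lim_metric) measurable

lemma w_slice_measurable [measurable]: "(\<lambda>y. w (x, y)) \<in> borel_measurable borel"
proof -
  have [measurable]: "w \<in> borel_measurable (borel \<Otimes>\<^sub>M borel)" by (simp add: borel_prod)
  show ?thesis by measurable
qed

lemma w_slice_AE:
  assumes x: "x \<in> {0..1}"
  shows "AE y in lebesgue_on unit_open. (\<lambda>j. S (r j) x y) \<longlonglongrightarrow> w (x, y)"
proof -
  have "AE y in lebesgue_on unit_open. convergent (\<lambda>j. S (r j) x y)"
  proof (rule AE_convergent_of_fast_Cauchy[OF S_L2])
    fix j
    have "(L2_norm unit_open (\<lambda>y. S (r (Suc j)) x y - S (r j) x y))\<^sup>2 \<le> ((1/2) ^ j)\<^sup>2"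
      using S_diff_norm[OF monoD[OF r(2)] x, of j "Suc j"] r(1)[of j] by simp
    thus "L2_norm unit_open (\<lambda>y. S (r (Suc j)) x y - S (r j) x y) \<le> (1/2) ^ j"
      by (rule power2_le_imp_le) simp
  qed
  thus ?thesis by eventually_elim (simp add: w_def convergent_LIMSEQ_iff)
qed

lemma w_slice_nn:
  assumes x: "x \<in> {0..1}"
  shows "(\<integral>\<^sup>+y. ennreal ((w (x, y) - S N x y)\<^sup>2) \<partial>lebesgue_on unit_open) \<le> ennreal (tail N)"
proof (rule Fatou_L2_unit[OF S_L2 _ w_slice_AE[OF x] S_L2 tail_nonneg])
  show "(\<lambda>y. w (x, y)) \<in> borel_measurable (lebesgue_on unit_open)"
    by (rule borel_measurable_lebesgue_on) measurable
  show "\<forall>\<^sub>F j in sequentially. (L2_norm unit_open (\<lambda>y. S (r j) x y - S N x y))\<^sup>2 \<le> tail N"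
    using eventually_ge_at_top[of N]
    by eventually_elim (rule S_diff_norm[OF order_trans[OF _ r(3)] x])
qed

lemma w_slice:
  assumes x: "x \<in> {0..1}"
  shows "(\<lambda>y. w (x, y)) \<in> L2 unit_open" "L2_norm unit_open (\<lambda>y. w (x, y) - S N x y) \<le> sqrt (tail N)"
proof -
  have [measurable]: "S N x \<in> borel_measurable borel" for N
    using S_cont by (rule borel_measurable_continuous_onI)
  have "(\<lambda>y. w (x, y) - S N x y) \<in> borel_measurable (lebesgue_on unit_open)" for N
    by (rule borel_measurable_lebesgue_on) measurable
  note * = L2_norm_le_of_nn_integral[OF this w_slice_nn[OF x] tail_nonneg]
  show "L2_norm unit_open (\<lambda>y. w (x, y) - S N x y) \<le> sqrt (tail N)" by (rule *(2))
  show "(\<lambda>y. w (x, y)) \<in> L2 unit_open" using *(1)[of 0] by (simp add: S_def)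
qed

lemma w_square_nn:
  "(\<integral>\<^sup>+p. ennreal ((w p - S N (fst p) (snd p))\<^sup>2) \<partial>lebesgue_on open_square) \<le> ennreal (tail N)"
  "(\<integral>\<^sup>+p. ennreal ((w (prod.swap p) - S N (snd p) (fst p))\<^sup>2) \<partial>lebesgue_on open_square) \<le> ennreal (tail N)"
proof -
  have bound: "(\<integral>\<^sup>+x. indicator unit_open x * (\<integral>\<^sup>+y. ennreal ((w (x, y) - S N x y)\<^sup>2) \<partial>lebesgue_on unit_open) \<partial>lborel)
     \<le> ennreal (tail N)"
  proof -
    have "(\<integral>\<^sup>+x. indicator unit_open x * (\<integral>\<^sup>+y. ennreal ((w (x, y) - S N x y)\<^sup>2) \<partial>lebesgue_on unit_open) \<partial>lborel)
      \<le> (\<integral>\<^sup>+x. ennreal (tail N) * indicator unit_open x \<partial>lborel)"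
      by (rule nn_integral_mono) (auto simp: indicator_def w_slice_nn)
    also have "\<dots> = ennreal (tail N)" by (simp add: nn_integral_cmult_indicator)
    finally show ?thesis .
  qed
  show "(\<integral>\<^sup>+p. ennreal ((w p - S N (fst p) (snd p))\<^sup>2) \<partial>lebesgue_on open_square) \<le> ennreal (tail N)"
    using bound by (subst nn_integral_square_iterated(1)) auto
  have [measurable]: "w \<in> borel_measurable (borel \<Otimes>\<^sub>M borel)" "(\<lambda>p. S N (fst p) (snd p)) \<in> borel_measurable (borel \<Otimes>\<^sub>M borel)"
    by (simp_all add: borel_prod)
  have "(\<lambda>p. ennreal ((w (snd p, fst p) - S N (fst (snd p, fst p)) (snd (snd p, fst p)))\<^sup>2)) \<in> borel_measurable (borel \<Otimes>\<^sub>M borel)"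
    by measurable
  hence "(\<lambda>p. ennreal ((w (prod.swap p) - S N (snd p) (fst p))\<^sup>2)) \<in> borel_measurable borel"
    by (simp add: borel_prod prod.swap_def)
  thus "(\<integral>\<^sup>+p. ennreal ((w (prod.swap p) - S N (snd p) (fst p))\<^sup>2) \<partial>lebesgue_on open_square) \<le> ennreal (tail N)"
    using bound by (subst nn_integral_square_iterated(2)) auto
qed

text \<open>The versions with \<open>prod.swap\<close> are for k_yy, where the parameter is y and
  the expansion runs in x.\<close>

lemma w_square:
  "w \<in> L2 open_square" "(\<lambda>N. L2_norm open_square (\<lambda>p. S N (fst p) (snd p) - w p)) \<longlonglongrightarrow> 0"
  "(\<lambda>p. w (prod.swap p)) \<in> L2 open_square"
  "(\<lambda>N. L2_norm open_square (\<lambda>p. S N (snd p) (fst p) - w (prod.swap p))) \<longlonglongrightarrow> 0"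
proof -
  have [measurable]: "w \<in> borel_measurable (borel \<Otimes>\<^sub>M borel)" "(\<lambda>p. S N (fst p) (snd p)) \<in> borel_measurable (borel \<Otimes>\<^sub>M borel)" for N
    by (simp_all add: borel_prod)
  have "(\<lambda>p. w p - S N (fst p) (snd p)) \<in> borel_measurable (borel \<Otimes>\<^sub>M borel)"
    "(\<lambda>p. w (snd p, fst p) - S N (fst (snd p, fst p)) (snd (snd p, fst p))) \<in> borel_measurable (borel \<Otimes>\<^sub>M borel)" for N
    by measurable
  hence m: "(\<lambda>p. w p - S N (fst p) (snd p)) \<in> borel_measurable (lebesgue_on open_square)"
    "(\<lambda>p. w (prod.swap p) - S N (snd p) (fst p)) \<in> borel_measurable (lebesgue_on open_square)" for N
    by (auto intro!: borel_measurable_lebesgue_on simp: borel_prod prod.swap_def)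
  note 1 = L2_norm_le_of_nn_integral[OF m(1) w_square_nn(1) tail_nonneg]
  note 2 = L2_norm_le_of_nn_integral[OF m(2) w_square_nn(2) tail_nonneg]
  show "w \<in> L2 open_square" using 1(1)[of 0] by (simp add: S_def)
  show "(\<lambda>p. w (prod.swap p)) \<in> L2 open_square" using 2(1)[of 0] by (simp add: S_def)
  have lim: "(\<lambda>N. sqrt (tail N)) \<longlonglongrightarrow> 0" using tendsto_real_sqrt[OF tail_tendsto] by simp
  show "(\<lambda>N. L2_norm open_square (\<lambda>p. S N (fst p) (snd p) - w p)) \<longlonglongrightarrow> 0"
    by (rule tendsto_sandwich[OF _ _ tendsto_const lim])
       (auto simp: L2_norm_nonneg L2_norm_commute[of _ _ w] intro!: always_eventually 1(2))
  show "(\<lambda>N. L2_norm open_square (\<lambda>p. S N (snd p) (fst p) - w (prod.swap p))) \<longlonglongrightarrow> 0"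
    by (rule tendsto_sandwich[OF _ _ tendsto_const lim])
       (auto simp: L2_norm_nonneg L2_norm_commute[of _ _ "\<lambda>p. w (prod.swap p)"] intro!: always_eventually 2(2))
qed

text \<open>The tails are small uniformly in x and finite partial sums depend continuously on x; the
  claim is a three-epsilon argument.\<close>

lemma w_C0_L2: "(\<lambda>x y. w (x, y)) \<in> C0_L2"
  unfolding C0_L2_def
proof (intro CollectI conjI ballI)
  show "(\<lambda>y. w (s, y)) \<in> L2 unit_open" if "s \<in> {0..1}" for s using w_slice(1)[OF that] .
  fix s :: real assume s: "s \<in> {0..1}"
  show "((\<lambda>x. L2_norm unit_open (\<lambda>y. w (x, y) - w (s, y))) \<longlongrightarrow> 0) (at s within {0..1})"
  proof (rule tendstoI)
    fix \<epsilon> :: real assume \<epsilon>: "\<epsilon> > 0"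
    have lim: "(\<lambda>N. sqrt (tail N)) \<longlonglongrightarrow> 0" using tendsto_real_sqrt[OF tail_tendsto] by simp
    obtain N where N: "sqrt (tail N) < \<epsilon> / 3"
      using eventually_happens'[OF sequentially_bot order_tendstoD(2)[OF lim, of "\<epsilon> / 3"]] \<epsilon> by auto
    have u_lim: "((\<lambda>x. u m x) \<longlongrightarrow> u m s) (at s within {0..1})" for m
      using u_cont[of m] by (meson continuous_on_def continuous_on_subset s subset_UNIV)
    have "((\<lambda>x. sqrt ((\<Sum>m<N. (u m x - u m s)\<^sup>2) / 2)) \<longlongrightarrow> sqrt ((\<Sum>m<N. (u m s - u m s)\<^sup>2) / 2)) (at s within {0..1})"
      by (intro tendsto_intros u_lim) auto
    hence "((\<lambda>x. L2_norm unit_open (\<lambda>y. S N x y - S N s y)) \<longlongrightarrow> 0) (at s within {0..1})"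
    proof -
      assume a: "((\<lambda>x. sqrt ((\<Sum>m<N. (u m x - u m s)\<^sup>2) / 2)) \<longlongrightarrow> sqrt ((\<Sum>m<N. (u m s - u m s)\<^sup>2) / 2)) (at s within {0..1})"
      have "L2_norm unit_open (\<lambda>y. S N x y - S N s y) = sqrt ((\<Sum>m<N. (u m x - u m s)\<^sup>2) / 2)" for x
      proof -
        have "S N x y - S N s y = (\<Sum>m<N. (u m x - u m s) * e m y)" for y
          by (simp add: S_def sum_subtractf left_diff_distrib)
        hence "(L2_norm unit_open (\<lambda>y. S N x y - S N s y))\<^sup>2 = (\<Sum>m<N. (u m x - u m s)\<^sup>2) / 2"
          by (simp add: e_combination_norm)
        thus ?thesis using L2_norm_nonneg[of unit_open "\<lambda>y. S N x y - S N s y"] real_sqrt_unique by metis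
      qed
      thus ?thesis using a by simp
    qed
    hence "\<forall>\<^sub>F x in at s within {0..1}. L2_norm unit_open (\<lambda>y. S N x y - S N s y) < \<epsilon> / 3"
      using \<epsilon> by (intro order_tendstoD(2)) auto
    moreover have "\<forall>\<^sub>F x in at s within {0..1}. x \<in> {0..1}" by (simp add: eventually_at_filter)
    ultimately show "\<forall>\<^sub>F x in at s within {0..1}. dist (L2_norm unit_open (\<lambda>y. w (x, y) - w (s, y))) 0 < \<epsilon>"
    proof eventually_elim
      case (elim x)
      have "L2_norm unit_open (\<lambda>y. w (x, y) - w (s, y)) \<le>
          L2_norm unit_open (\<lambda>y. w (x, y) - S N x y) + L2_norm unit_open (\<lambda>y. S N x y - w (s, y))"
        by (rule L2_norm_triangle_diff[OF w_slice(1)[OF elim(2)] S_L2 w_slice(1)[OF s]])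
      also have "L2_norm unit_open (\<lambda>y. S N x y - w (s, y)) \<le>
          L2_norm unit_open (\<lambda>y. S N x y - S N s y) + L2_norm unit_open (\<lambda>y. S N s y - w (s, y))"
        by (rule L2_norm_triangle_diff[OF S_L2 S_L2 w_slice(1)[OF s]])
      also have "L2_norm unit_open (\<lambda>y. S N s y - w (s, y)) = L2_norm unit_open (\<lambda>y. w (s, y) - S N s y)"
        by (rule L2_norm_commute)
      finally have "L2_norm unit_open (\<lambda>y. w (x, y) - w (s, y)) < \<epsilon>"
        using N elim(1) w_slice(2)[OF elim(2), of N] w_slice(2)[OF s, of N] by linarith
      moreover have "0 \<le> L2_norm unit_open (\<lambda>y. w (x, y) - w (s, y))" by (rule L2_norm_nonneg)
      ultimately show ?case by simp
    qed
  qed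
qed

end

section \<open>Sine expansions\<close>

lemma nu_pos: "nu n > 0" by (simp add: nu_def)

lemma nu_ne_0 [simp]: "nu n \<noteq> 0" using nu_pos[of n] by simp

lemma nu_ge_1: "nu n \<ge> 1"
proof -
  have "1 * 1 \<le> real (Suc n) * pi" using pi_gt3 by (intro mult_mono) auto
  thus ?thesis by (simp add: nu_def)
qed

lemma abs_sine_le_1: "\<bar>sine n x\<bar> \<le> 1" and abs_cosine_le_1: "\<bar>cosine n x\<bar> \<le> 1"
  by (simp_all add: sine_def cosine_def)

lemma sine_0 [simp]: "sine n 0 = 0" by (simp add: sine_def)
lemma sine_1 [simp]: "sine n 1 = 0"
  using sin_npi[of "Suc n"] by (simp add: sine_def nu_def)
lemma cosine_0 [simp]: "cosine n 0 = 1" by (simp add: cosine_def)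

lemma sine_has_derivative: "(sine n has_real_derivative nu n * cosine n x) (at x within A)"
  unfolding sine_def cosine_def by (auto intro!: derivative_eq_intros)

lemma cosine_has_derivative: "(cosine n has_real_derivative - nu n * sine n x) (at x within A)"
  unfolding sine_def cosine_def by (auto intro!: derivative_eq_intros)

definition sine_deriv :: "nat \<Rightarrow> nat \<Rightarrow> real \<Rightarrow> real"
  where "sine_deriv n i x = nu n ^ i * sin (nu n * x + real i * (pi / 2))"

lemma derivs_sine_deriv: "derivs (sine_deriv n)"
  unfolding derivs_def
proof (intro allI ballI)
  fix i and x :: real
  have "(sine_deriv n i has_real_derivative nu n ^ i * (cos (nu n * x + real i * (pi / 2)) * nu n)) (at x within {0..1})"
    unfolding sine_deriv_def[abs_def] by (auto intro!: derivative_eq_intros)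
  moreover have "sin (nu n * x + real (Suc i) * (pi / 2)) = cos (nu n * x + real i * (pi / 2))"
    using sin_add[of "nu n * x + real i * (pi / 2)" "pi / 2"] by (simp add: algebra_simps add_divide_distrib)
  ultimately show "(sine_deriv n i has_vector_derivative sine_deriv n (Suc i) x) (at x within {0..1})"
    by (simp add: has_real_derivative_iff_has_vector_derivative sine_deriv_def mult_ac)
qed

lemma sine_deriv_simps:
  "sine_deriv n 0 = sine n" "sine_deriv n 1 x = nu n * cosine n x" "sine_deriv n 2 x = - ((nu n)\<^sup>2 * sine n x)" "sine_deriv n 4 x = nu n ^ 4 * sine n x"
proof -
  show "sine_deriv n 0 = sine n" by (simp add: sine_deriv_def sine_def fun_eq_iff)
  show "sine_deriv n 1 x = nu n * cosine n x" by (simp add: sine_deriv_def cosine_def sin_add)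
  show "sine_deriv n 2 x = - ((nu n)\<^sup>2 * sine n x)" by (simp add: sine_deriv_def sine_def sin_add)
  have "real 4 * (pi / 2) = 2 * pi" by simp
  thus "sine_deriv n 4 x = nu n ^ 4 * sine n x" by (simp add: sine_deriv_def sine_def)
qed

lemma integral_unit_FTC:
  fixes F :: "real \<Rightarrow> real"
  assumes "\<And>x. (F has_real_derivative f x) (at x)"
  shows "integral {0..1} f = F 1 - F 0"
  by (rule integral_unique, rule fundamental_theorem_of_calculus)
     (use assms in \<open>auto simp: has_real_derivative_iff_has_vector_derivative intro: has_vector_derivative_at_within\<close>)

lemma integral_cos_unit: "(c::real) \<noteq> 0 \<Longrightarrow> integral {0..1} (\<lambda>x. cos (c * x)) = sin c / c"
  by (subst integral_unit_FTC[where F = "\<lambda>x. sin (c * x) / c"]) (auto intro!: derivative_eq_intros)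

lemma trig_orthogonal:
  "integral {0..1} (\<lambda>x. sine m x * sine l x) = (if m = l then 1 / 2 else 0)"
  "integral {0..1} (\<lambda>x. cosine m x * cosine l x) = (if m = l then 1 / 2 else 0)"
proof -
  have ints: "integral {0..1} (\<lambda>x. cos ((real k * pi) * x)) = 0" if "k > 0" for k :: nat
    using that sin_npi[of k] by (subst integral_cos_unit) auto
  define I1 where "I1 = integral {0..1} (\<lambda>x. cos ((nu m - nu l) * x))"
  define I2 where "I2 = integral {0..1} (\<lambda>x. cos ((nu m + nu l) * x))"
  have I2: "I2 = 0"
  proof -
    have "nu m + nu l = real (Suc m + Suc l) * pi" by (simp add: nu_def algebra_simps)
    thus ?thesis unfolding I2_def using ints[of "Suc m + Suc l"] by simp
  qed
  have I1: "I1 = (if m = l then 1 else 0)"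
  proof -
    consider "m = l" | "m < l" | "l < m" by linarith
    thus ?thesis
    proof cases
      case 2
      have "nu m - nu l = - (real (l - m) * pi)" using 2 by (simp add: nu_def algebra_simps of_nat_diff)
      hence "cos ((nu m - nu l) * x) = cos ((real (l - m) * pi) * x)" for x
        by (metis cos_minus mult_minus_left)
      thus ?thesis unfolding I1_def using ints[of "l - m"] 2 by simp
    next
      case 3
      have "nu m - nu l = real (m - l) * pi" using 3 by (simp add: nu_def algebra_simps of_nat_diff)
      thus ?thesis unfolding I1_def using ints[of "m - l"] 3 by simp
    qed (simp add: I1_def)
  qed
  have int: "(\<lambda>x. cos (c * x)) integrable_on {0..1}" for c :: real
    by (intro integrable_continuous_real continuous_on_cos continuous_on_mult continuous_on_const continuous_on_id)
  have "sine m x * sine l x = 1/2 * cos ((nu m - nu l) * x) - 1/2 * cos ((nu m + nu l) * x)" for x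
    by (simp add: sine_def algebra_simps cos_diff cos_add)
  hence "integral {0..1} (\<lambda>x. sine m x * sine l x) = integral {0..1} (\<lambda>x. 1/2 * cos ((nu m - nu l) * x) - 1/2 * cos ((nu m + nu l) * x))"
    by simp
  also have "\<dots> = 1/2 * I1 - 1/2 * I2"
    unfolding I1_def I2_def by (subst integral_diff) (use int in \<open>auto intro!: integrable_on_cmult_left\<close>)
  also have "\<dots> = (if m = l then 1 / 2 else 0)" unfolding I1 I2 by auto
  finally show "integral {0..1} (\<lambda>x. sine m x * sine l x) = (if m = l then 1 / 2 else 0)" .
  have "cosine m x * cosine l x = 1/2 * cos ((nu m - nu l) * x) + 1/2 * cos ((nu m + nu l) * x)" for x
    by (simp add: cosine_def algebra_simps cos_diff cos_add)
  hence "integral {0..1} (\<lambda>x. cosine m x * cosine l x) = integral {0..1} (\<lambda>x. 1/2 * cos ((nu m - nu l) * x) + 1/2 * cos ((nu m + nu l) * x))"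
    by simp
  also have "\<dots> = 1/2 * I1 + 1/2 * I2"
    unfolding I1_def I2_def by (subst integral_add) (use int in \<open>auto intro!: integrable_on_cmult_left\<close>)
  also have "\<dots> = (if m = l then 1 / 2 else 0)" unfolding I1 I2 by auto
  finally show "integral {0..1} (\<lambda>x. cosine m x * cosine l x) = (if m = l then 1 / 2 else 0)" .
qed

lemma integral_sine2: "(\<integral>p. sine2 i p * sine2 j p \<partial>lebesgue_on open_square) = (if i = j then 1 / 4 else 0)"
proof -
  have "(\<integral>p. sine2 i p * sine2 j p \<partial>lebesgue_on open_square) =
     (\<integral>p. (sine (fst i) (fst p) * sine (fst j) (fst p)) * (sine (snd i) (snd p) * sine (snd j) (snd p)) \<partial>lebesgue_on open_square)"
    by (simp add: tensor_def mult_ac)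
  also have "\<dots> = integral {0..1} (\<lambda>x. sine (fst i) x * sine (fst j) x) * integral {0..1} (\<lambda>x. sine (snd i) x * sine (snd j) x)"
    by (rule integral_square_product) (intro continuous_intros)+
  finally show ?thesis by (auto simp: trig_orthogonal prod_eq_iff)
qed

text \<open>The Weierstrass test along finite subsets. Unordered sums are used so that a double
  series may afterwards be arranged by rows or by columns.\<close>

lemma abs_summable_series_square:
  fixes F :: "'i \<Rightarrow> real \<times> real \<Rightarrow> real"
  assumes c: "(\<lambda>i. \<bar>c i\<bar>) summable_on UNIV" and F: "\<And>i. continuous_on closed_square (F i)"
    and F1: "\<And>i p. p \<in> closed_square \<Longrightarrow> \<bar>F i p\<bar> \<le> 1"
  shows "uniform_limit closed_square (\<lambda>X p. \<Sum>i\<in>X. c i * F i p) (\<lambda>p. \<Sum>\<^sub>\<infinity>i. c i * F i p) (finite_subsets_at_top UNIV)"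
    and "continuous_on closed_square (\<lambda>p. \<Sum>\<^sub>\<infinity>i. c i * F i p)"
    and "((\<lambda>X. L2_norm open_square (\<lambda>p. (\<Sum>i\<in>X. c i * F i p) - (\<Sum>\<^sub>\<infinity>i. c i * F i p))) \<longlongrightarrow> 0) (finite_subsets_at_top UNIV)"
    and "h \<in> L2 open_square \<Longrightarrow>
      ((\<lambda>i. c i * (\<integral>p. h p * F i p \<partial>lebesgue_on open_square)) has_sum
        (\<integral>p. h p * (\<Sum>\<^sub>\<infinity>i. c i * F i p) \<partial>lebesgue_on open_square)) UNIV"
proof -
  show 1: "uniform_limit closed_square (\<lambda>X p. \<Sum>i\<in>X. c i * F i p) (\<lambda>p. \<Sum>\<^sub>\<infinity>i. c i * F i p) (finite_subsets_at_top UNIV)"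
  proof (rule Weierstrass_m_test_general[OF _ c])
    fix i p assume "p \<in> closed_square"
    hence "\<bar>c i\<bar> * \<bar>F i p\<bar> \<le> \<bar>c i\<bar> * 1" by (intro mult_left_mono F1) auto
    thus "norm (c i * F i p) \<le> \<bar>c i\<bar>" by (simp add: abs_mult)
  qed
  have part: "continuous_on closed_square (\<lambda>p. \<Sum>i\<in>X. c i * F i p)" for X
    by (intro continuous_on_sum continuous_on_mult continuous_on_const F)
  show 2: "continuous_on closed_square (\<lambda>p. \<Sum>\<^sub>\<infinity>i. c i * F i p)"
    by (rule uniform_limit_theorem[OF always_eventually 1]) (use part in auto)
  show 3: "((\<lambda>X. L2_norm open_square (\<lambda>p. (\<Sum>i\<in>X. c i * F i p) - (\<Sum>\<^sub>\<infinity>i. c i * F i p))) \<longlongrightarrow> 0) (finite_subsets_at_top UNIV)"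
    by (rule uniform_limit_L2_square[OF 1 part 2])
  assume h: "h \<in> L2 open_square"
  have "((\<lambda>X. \<integral>p. h p * (\<Sum>i\<in>X. c i * F i p) \<partial>lebesgue_on open_square) \<longlongrightarrow>
     (\<integral>p. h p * (\<Sum>\<^sub>\<infinity>i. c i * F i p) \<partial>lebesgue_on open_square)) (finite_subsets_at_top UNIV)"
    by (rule L2_weak_limit[OF h continuous_L2_square[OF part] continuous_L2_square[OF 2] 3])
  moreover have "(\<integral>p. h p * (\<Sum>i\<in>X. c i * F i p) \<partial>lebesgue_on open_square) =
     (\<Sum>i\<in>X. c i * (\<integral>p. h p * F i p \<partial>lebesgue_on open_square))" for X
  proof -
    have "(\<integral>p. h p * (\<Sum>i\<in>X. c i * F i p) \<partial>lebesgue_on open_square) = (\<integral>p. (\<Sum>i\<in>X. c i * (h p * F i p)) \<partial>lebesgue_on open_square)"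
      by (simp add: sum_distrib_left mult.left_commute)
    also have "\<dots> = (\<Sum>i\<in>X. \<integral>p. c i * (h p * F i p) \<partial>lebesgue_on open_square)"
      using L2_mult_integrable[OF h continuous_L2_square[OF F]] by (intro Bochner_Integration.integral_sum) simp
    finally show ?thesis by simp
  qed
  ultimately show "((\<lambda>i. c i * (\<integral>p. h p * F i p \<partial>lebesgue_on open_square)) has_sum
        (\<integral>p. h p * (\<Sum>\<^sub>\<infinity>i. c i * F i p) \<partial>lebesgue_on open_square)) UNIV"
    by (simp add: has_sum_def)
qed

lemma abs_sine2_le_1: "\<bar>sine2 i p\<bar> \<le> 1"
  using abs_sine_le_1 by (auto simp: tensor_def abs_mult intro!: mult_le_one)

lemma continuous_zero_of_orthogonal:
  assumes f: "continuous_on closed_square f"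
    and orth: "\<And>n m. (\<integral>p. f p * sine2 (n, m) p \<partial>lebesgue_on open_square) = 0"
    and p: "p \<in> closed_square"
  shows "f p = 0"
proof -
  have "AE p in lebesgue_on open_square. f p = 0"
    by (rule sine_system_complete[OF continuous_L2_square[OF f] orth])
  hence "AE p in lebesgue_on open_square. (f p)\<^sup>2 = 0" by eventually_elim simp
  hence "(\<integral>p. (f p)\<^sup>2 \<partial>lebesgue_on open_square) = 0"
    by (rule integral_eq_zero_AE)
  hence "integral closed_square (\<lambda>p. (f p)\<^sup>2) = 0"
    using integral_square_eq_integral[OF continuous_on_power[OF f, of 2]] by simp
  hence 0: "integral (cbox (0, 0) (1, 1)) (\<lambda>p. (f p)\<^sup>2) = 0" unfolding closed_square_eq_cbox .
  have ne: "box (0, 0) (1, 1) \<noteq> ({} :: (real \<times> real) set)"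
  proof -
    have "(1/2, 1/2) \<in> open_square" by simp
    thus ?thesis unfolding open_square_eq_box by blast
  qed
  have "continuous_on (cbox (0, 0) (1, 1)) (\<lambda>p. (f p)\<^sup>2)"
    using continuous_on_power[OF f, of 2] unfolding closed_square_eq_cbox .
  from integral_cbox_eq_0_iff[OF this ne] 0 have "\<forall>p\<in>cbox (0, 0) (1, 1). (f p)\<^sup>2 = 0" by simp
  hence "(f p)\<^sup>2 = 0" using p unfolding closed_square_eq_cbox by blast
  thus ?thesis by simp
qed

text \<open>Reduced to the square by tensoring with \<open>sine 0\<close>, which equals 1 at
  1/2.\<close>

lemma continuous_zero_of_orthogonal_unit:
  assumes f: "continuous_on {0..1} f" and orth: "\<And>n. integral {0..1} (\<lambda>x. f x * sine n x) = 0" and x: "x \<in> {0..1}"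
  shows "f x = 0"
proof -
  have "tensor f (sine 0) (x, 1/2) = 0"
  proof (rule continuous_zero_of_orthogonal)
    show "continuous_on closed_square (tensor f (sine 0))" by (intro tensor_continuous f continuous_intros)
    fix n m
    have "(\<integral>p. tensor f (sine 0) p * sine2 (n, m) p \<partial>lebesgue_on open_square) =
       (\<integral>p. (f (fst p) * sine n (fst p)) * (sine 0 (snd p) * sine m (snd p)) \<partial>lebesgue_on open_square)"
      by (simp add: tensor_def mult_ac)
    also have "\<dots> = integral {0..1} (\<lambda>x. f x * sine n x) * integral {0..1} (\<lambda>y. sine 0 y * sine m y)"
      by (rule integral_square_product) (intro continuous_intros f)+
    finally show "(\<integral>p. tensor f (sine 0) p * sine2 (n, m) p \<partial>lebesgue_on open_square) = 0" using orth by simp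
  qed (use x in auto)
  thus ?thesis by (simp add: tensor_def sine_def nu_def)
qed

text \<open>The series on the right has the same sine coefficients as f, and both are continuous, so
  completeness identifies them. The 4 is the inverse of the squared norm 1/4 of a sine
  product.\<close>

lemma sine_expansion_square:
  assumes f: "continuous_on closed_square f"
    and summ: "(\<lambda>i. \<bar>\<integral>p. f p * sine2 i p \<partial>lebesgue_on open_square\<bar>) summable_on UNIV"
    and p: "p \<in> closed_square"
  shows "f p = (\<Sum>\<^sub>\<infinity>i. 4 * (\<integral>p. f p * sine2 i p \<partial>lebesgue_on open_square) * sine2 i p)"
proof -
  define c where "c = (\<lambda>i. 4 * (\<integral>p. f p * sine2 i p \<partial>lebesgue_on open_square))"
  have cs: "(\<lambda>i. \<bar>c i\<bar>) summable_on UNIV"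
    unfolding c_def abs_mult using summ by (intro summable_on_cmult_right)
  note series = abs_summable_series_square[OF cs continuous_sine2 abs_sine2_le_1]
  define R where "R = (\<lambda>p. \<Sum>\<^sub>\<infinity>i. c i * sine2 i p)"
  have Rc: "continuous_on closed_square R" unfolding R_def by (rule series(2))
  have coeff: "(\<integral>p. R p * sine2 j p \<partial>lebesgue_on open_square) = (\<integral>p. f p * sine2 j p \<partial>lebesgue_on open_square)" for j
  proof -
    have "((\<lambda>i. c i * (\<integral>p. sine2 j p * sine2 i p \<partial>lebesgue_on open_square)) has_sum
        (\<integral>p. sine2 j p * R p \<partial>lebesgue_on open_square)) UNIV"
      unfolding R_def by (rule series(4)[OF continuous_L2_square[OF continuous_sine2]])
    moreover have "((\<lambda>i. c i * (\<integral>p. sine2 j p * sine2 i p \<partial>lebesgue_on open_square)) has_sum (c j / 4)) UNIV"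
    proof (rule has_sum_cong_neutral[THEN iffD1])
      show "((\<lambda>i. c i * (1/4)) has_sum (c j / 4)) {j}" using has_sum_finite[of "{j}" "\<lambda>i. c i * (1/4)"] by simp
    qed (auto simp: integral_sine2)
    ultimately have "(\<integral>p. sine2 j p * R p \<partial>lebesgue_on open_square) = c j / 4" by (rule has_sum_unique)
    thus ?thesis by (simp add: c_def mult.commute)
  qed
  have "f p - R p = 0"
  proof (rule continuous_zero_of_orthogonal[OF continuous_on_diff[OF f Rc] _ p])
    fix n m
    have "integrable (lebesgue_on open_square) (\<lambda>p. f p * sine2 (n, m) p)" "integrable (lebesgue_on open_square) (\<lambda>p. R p * sine2 (n, m) p)"
      by (intro continuous_integrable_square continuous_on_mult f Rc continuous_sine2)+
    thus "(\<integral>p. (f p - R p) * sine2 (n, m) p \<partial>lebesgue_on open_square) = 0"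
      using coeff[of "(n, m)"] by (simp add: left_diff_distrib)
  qed
  thus ?thesis by (simp add: R_def c_def)
qed

section \<open>Two polynomials and their sine series\<close>

definition lin :: "real \<Rightarrow> real" where "lin x = 1 - x"
text \<open>The cubic vanishing at 0 and 1 with second derivative 1 - x. Its second derivative is
  thus 1 at 0 and 0 at 1, the profile of a function violating only the sine condition at 0.\<close>

definition cub :: "real \<Rightarrow> real" where "cub x = x\<^sup>2 / 2 - x ^ 3 / 6 - x / 3"
definition cub' :: "real \<Rightarrow> real" where "cub' x = x - x\<^sup>2 / 2 - 1 / 3"

lemma lin_continuous: "continuous_on A lin" and cub_continuous: "continuous_on A cub" "continuous_on A cub'"
  unfolding lin_def[abs_def] cub_def[abs_def] cub'_def[abs_def] by (intro continuous_intros; simp)+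

lemma cub_has_derivative: "(cub has_real_derivative cub' x) (at x within A)"
  and cub'_has_derivative: "(cub' has_real_derivative lin x) (at x within A)"
  and lin_has_derivative: "(lin has_real_derivative - 1) (at x within A)"
  unfolding cub_def[abs_def] cub'_def[abs_def] lin_def[abs_def]
  by (auto intro!: derivative_eq_intros simp: field_simps)

lemma integral_lin_sine: "integral {0..1} (\<lambda>x. lin x * sine n x) = 1 / nu n"
proof -
  have "integral {0..1} (\<lambda>x. lin x * sine n x) = (- (lin 1 * cosine n 1) / nu n - sine n 1 / (nu n)\<^sup>2) - (- (lin 0 * cosine n 0) / nu n - sine n 0 / (nu n)\<^sup>2)"
    using nu_pos[of n]
    by (intro integral_unit_FTC[where F = "\<lambda>x. - (lin x * cosine n x) / nu n - sine n x / (nu n)\<^sup>2"])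
       (auto intro!: derivative_eq_intros lin_has_derivative sine_has_derivative cosine_has_derivative simp: field_simps power2_eq_square)
  thus ?thesis by (simp add: lin_def)
qed

lemma integral_cub_sine: "integral {0..1} (\<lambda>x. cub x * sine n x) = - 1 / nu n ^ 3"
proof -
  define F where "F = (\<lambda>x. - (cub x * cosine n x) / nu n + cub' x * sine n x / (nu n)\<^sup>2 + lin x * cosine n x / nu n ^ 3 + sine n x / nu n ^ 4)"
  have "integral {0..1} (\<lambda>x. cub x * sine n x) = F 1 - F 0"
    using nu_pos[of n] unfolding F_def
    by (intro integral_unit_FTC)
       (auto intro!: derivative_eq_intros lin_has_derivative cub_has_derivative cub'_has_derivative sine_has_derivative cosine_has_derivative
         simp: field_simps power2_eq_square power3_eq_cube power4_eq_xxxx)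
  thus ?thesis by (simp add: F_def lin_def cub_def)
qed

text \<open>By orthogonality this is the value \<open>\<pi>\<^sup>2 / 6\<close> of \<open>\<Sum>n. 1 / n\<^sup>2\<close>.\<close>

lemma lin_expansion_L2:
  "(\<lambda>N. integral {0..1} (\<lambda>x. ((\<Sum>n<N. 2 / nu n * sine n x) - lin x)\<^sup>2)) \<longlonglongrightarrow> 0"
proof -
  have eq: "integral {0..1} (\<lambda>x. ((\<Sum>n<N. 2 / nu n * sine n x) - lin x)\<^sup>2) = 1 / 3 - (\<Sum>n<N. 2 / (nu n)\<^sup>2)" for N
  proof -
    define T where "T = (\<lambda>x. \<Sum>n<N. 2 / nu n * sine n x)"
    have Tc: "continuous_on {0..1} T" unfolding T_def by (intro continuous_intros)
    have "integral {0..1} (\<lambda>x. T x * sine l x) = 1 / nu l" if "l < N" for l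
    proof -
      have "integral {0..1} (\<lambda>x. T x * sine l x) = integral {0..1} (\<lambda>x. \<Sum>n<N. 2 / nu n * (sine n x * sine l x))"
        by (simp add: T_def sum_distrib_right mult.assoc)
      also have "\<dots> = (\<Sum>n<N. integral {0..1} (\<lambda>x. 2 / nu n * (sine n x * sine l x)))"
        by (rule integral_sum) (auto intro!: integrable_continuous_real continuous_intros)
      also have "\<dots> = (\<Sum>n<N. if n = l then 1 / nu l else 0)"
        by (rule sum.cong) (auto simp: trig_orthogonal)
      finally show ?thesis using that by simp
    qed
    moreover have "integral {0..1} (\<lambda>x. T x * h x) = (\<Sum>n<N. 2 / nu n * integral {0..1} (\<lambda>x. sine n x * h x))"
      if "continuous_on {0..1} h" for h
    proof -
      have "integral {0..1} (\<lambda>x. T x * h x) = integral {0..1} (\<lambda>x. \<Sum>n<N. 2 / nu n * (sine n x * h x))"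
        by (simp add: T_def sum_distrib_right mult.assoc)
      also have "\<dots> = (\<Sum>n<N. integral {0..1} (\<lambda>x. 2 / nu n * (sine n x * h x)))"
        by (rule integral_sum) (auto intro!: integrable_continuous_real continuous_intros that)
      finally show ?thesis by simp
    qed
    ultimately have "integral {0..1} (\<lambda>x. T x * T x) = (\<Sum>n<N. 2 / (nu n)\<^sup>2)"
      "integral {0..1} (\<lambda>x. T x * lin x) = (\<Sum>n<N. 2 / (nu n)\<^sup>2)"
      using Tc lin_continuous integral_lin_sine by (simp_all add: mult.commute[of "sine _ _"] power2_eq_square)
    moreover have "integral {0..1} (\<lambda>x. lin x * lin x) = 1 / 3"
      by (subst integral_unit_FTC[where F = "\<lambda>x. - (lin x ^ 3) / 3"])
         (auto intro!: derivative_eq_intros lin_has_derivative simp: power2_eq_square lin_def)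
    moreover have "integral {0..1} (\<lambda>x. (T x - lin x)\<^sup>2) =
       integral {0..1} (\<lambda>x. T x * T x) - 2 * integral {0..1} (\<lambda>x. T x * lin x) + integral {0..1} (\<lambda>x. lin x * lin x)"
    proof -
      have i: "(\<lambda>x. T x * T x) integrable_on {0..1}" "(\<lambda>x. 2 * (T x * lin x)) integrable_on {0..1}" "(\<lambda>x. lin x * lin x) integrable_on {0..1}"
        by (intro integrable_continuous_real continuous_intros Tc lin_continuous)+
      have "integral {0..1} (\<lambda>x. (T x - lin x)\<^sup>2) = integral {0..1} (\<lambda>x. (T x * T x - 2 * (T x * lin x)) + lin x * lin x)"
        by (simp add: power2_eq_square algebra_simps)
      also have "\<dots> = integral {0..1} (\<lambda>x. T x * T x - 2 * (T x * lin x)) + integral {0..1} (\<lambda>x. lin x * lin x)"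
        by (intro integral_add integrable_diff i)
      also have "integral {0..1} (\<lambda>x. T x * T x - 2 * (T x * lin x)) = integral {0..1} (\<lambda>x. T x * T x) - integral {0..1} (\<lambda>x. 2 * (T x * lin x))"
        by (intro integral_diff i)
      finally show ?thesis by simp
    qed
    ultimately show ?thesis by (simp add: T_def)
  qed
  have "(\<lambda>n. 2 / pi\<^sup>2 * (1 / (real n + 1)\<^sup>2)) sums (2 / pi\<^sup>2 * (pi\<^sup>2 / 6))"
    using inverse_squares_sums by (intro sums_mult) (simp add: add.commute)
  moreover have "2 / pi\<^sup>2 * (1 / (real n + 1)\<^sup>2) = 2 / (nu n)\<^sup>2" for n
    by (simp add: nu_def power_mult_distrib add.commute mult.commute)
  ultimately have "(\<lambda>n. 2 / (nu n)\<^sup>2) sums (1 / 3)" by simp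
  hence "(\<lambda>N. 1 / 3 - (\<Sum>n<N. 2 / (nu n)\<^sup>2)) \<longlonglongrightarrow> 1 / 3 - 1 / 3"
    unfolding sums_def by (intro tendsto_intros)
  thus ?thesis unfolding eq by simp
qed

section \<open>Columns and rows of the kernel\<close>

lemma trig_series_continuous:
  fixes f :: "nat \<Rightarrow> real \<Rightarrow> real"
  assumes "summable (\<lambda>n. \<bar>c n\<bar>)" "\<And>n. continuous_on UNIV (f n)" "\<And>n x. \<bar>f n x\<bar> \<le> 1"
  shows "continuous_on UNIV (\<lambda>x. \<Sum>n. c n * f n x)"
    and "\<bar>\<Sum>n. c n * f n x\<bar> \<le> (\<Sum>n. \<bar>c n\<bar>)"
    and "summable (\<lambda>n. c n * f n x)"
proof -
  have b: "norm (c n * f n x) \<le> \<bar>c n\<bar>" for n x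
    using mult_left_mono[OF assms(3), of "\<bar>c n\<bar>" n x] by (simp add: abs_mult)
  have "uniform_limit UNIV (\<lambda>N x. \<Sum>n<N. c n * f n x) (\<lambda>x. \<Sum>n. c n * f n x) sequentially"
    by (rule Weierstrass_m_test[OF b assms(1)])
  thus "continuous_on UNIV (\<lambda>x. \<Sum>n. c n * f n x)"
    by (rule uniform_limit_theorem[rotated]) (auto intro!: always_eventually continuous_on_sum continuous_on_mult continuous_on_const assms(2))
  have s: "summable (\<lambda>n. norm (c n * f n x))"
    by (rule summable_comparison_test'[OF assms(1)]) (use b in simp)
  thus "summable (\<lambda>n. c n * f n x)" by (rule summable_norm_cancel)
  have "\<bar>\<Sum>n. c n * f n x\<bar> \<le> (\<Sum>n. norm (c n * f n x))"
    using summable_norm[OF s] by simp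
  also have "\<dots> \<le> (\<Sum>n. \<bar>c n\<bar>)" using s assms(1) b by (intro suminf_le) auto
  finally show "\<bar>\<Sum>n. c n * f n x\<bar> \<le> (\<Sum>n. \<bar>c n\<bar>)" .
qed

lemma sine_continuous: "continuous_on A (sine n)" and cosine_continuous: "continuous_on A (cosine n)"
  using continuous_on_sine[OF continuous_on_id] continuous_on_cosine[OF continuous_on_id] by auto

lemma sine_series:
  assumes "summable (\<lambda>n. \<bar>c n\<bar>)"
  shows "continuous_on UNIV (\<lambda>x. \<Sum>n. c n * sine n x)"
    and "\<bar>\<Sum>n. c n * sine n x\<bar> \<le> (\<Sum>n. \<bar>c n\<bar>)"
    and "summable (\<lambda>n. c n * sine n x)"
  by (fact trig_series_continuous[where f = sine, OF assms sine_continuous abs_sine_le_1])+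

lemma cosine_series:
  assumes "summable (\<lambda>n. \<bar>c n\<bar>)"
  shows "continuous_on UNIV (\<lambda>x. \<Sum>n. c n * cosine n x)"
    and "\<bar>\<Sum>n. c n * cosine n x\<bar> \<le> (\<Sum>n. \<bar>c n\<bar>)"
    and "summable (\<lambda>n. c n * cosine n x)"
  by (fact trig_series_continuous[where f = cosine, OF assms cosine_continuous abs_cosine_le_1])+

lemma neg_sine_series:
  assumes "summable (\<lambda>n. \<bar>c n\<bar>)"
  shows "continuous_on A (\<lambda>x. \<Sum>n. c n * - sine n x)" "\<bar>\<Sum>n. c n * - sine n x\<bar> \<le> (\<Sum>n. \<bar>c n\<bar>)"
proof -
  have c: "continuous_on UNIV (\<lambda>x. - sine n x)" and b: "\<bar>- sine n x\<bar> \<le> 1" for n x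
    using continuous_on_minus[OF sine_continuous] abs_sine_le_1[of n x] by auto
  show "continuous_on A (\<lambda>x. \<Sum>n. c n * - sine n x)"
    using trig_series_continuous(1)[where f = "\<lambda>n x. - sine n x", OF assms c b] by (rule continuous_on_subset) simp
  show "\<bar>\<Sum>n. c n * - sine n x\<bar> \<le> (\<Sum>n. \<bar>c n\<bar>)"
    by (rule trig_series_continuous(2)[where f = "\<lambda>n x. - sine n x", OF assms c b])
qed

lemma trig_series_derivative:
  fixes f g :: "nat \<Rightarrow> real \<Rightarrow> real"
  assumes "summable (\<lambda>n. \<bar>c n * nu n\<bar>)"
    and der: "\<And>n x. (f n has_real_derivative nu n * g n x) (at x)" and g: "\<And>n x. \<bar>g n x\<bar> \<le> 1"
    and s0: "summable (\<lambda>n. c n * f n 0)"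
  shows "((\<lambda>x. \<Sum>n. c n * f n x) has_real_derivative (\<Sum>n. (c n * nu n) * g n x)) (at x)"
proof (rule has_field_derivative_series'(2)[where S = UNIV])
  show "uniformly_convergent_on UNIV (\<lambda>N x. \<Sum>n<N. (c n * nu n) * g n x)"
  proof (rule Weierstrass_m_test'[OF _ assms(1)])
    fix n x show "norm ((c n * nu n) * g n x) \<le> \<bar>c n * nu n\<bar>"
      using mult_left_mono[OF g, of "\<bar>c n * nu n\<bar>" n x] by (simp add: abs_mult)
  qed
  show "((\<lambda>x. c n * f n x) has_real_derivative (c n * nu n) * g n y) (at y within UNIV)" for n y
    using DERIV_cmult[OF der, of "c n" n y] by (simp add: mult.assoc)
qed (use s0 in auto)

lemma summable_of_nu_weight:
  assumes "summable (\<lambda>n. \<bar>c n * nu n\<bar>)" shows "summable (\<lambda>n. \<bar>c n\<bar>)"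
proof (rule summable_comparison_test'[OF assms])
  fix n
  have "\<bar>c n\<bar> * 1 \<le> \<bar>c n\<bar> * nu n" using nu_ge_1 by (intro mult_left_mono) auto
  thus "norm \<bar>c n\<bar> \<le> \<bar>c n * nu n\<bar>" using nu_pos[of n] by (simp add: abs_mult)
qed

lemma sine_series_derivative:
  assumes "summable (\<lambda>n. \<bar>c n * nu n\<bar>)"
  shows "((\<lambda>x. \<Sum>n. c n * sine n x) has_real_derivative (\<Sum>n. (c n * nu n) * cosine n x)) (at x)"
  by (rule trig_series_derivative[OF assms sine_has_derivative abs_cosine_le_1]) simp

lemma cosine_series_derivative:
  assumes "summable (\<lambda>n. \<bar>c n * nu n\<bar>)"
  shows "((\<lambda>x. \<Sum>n. c n * cosine n x) has_real_derivative (\<Sum>n. (c n * nu n) * - sine n x)) (at x)"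
proof (rule trig_series_derivative[OF assms])
  show "(cosine n has_real_derivative nu n * - sine n x) (at x)" for n x
    using cosine_has_derivative[of n x UNIV] by simp
  show "\<bar>- sine n x\<bar> \<le> 1" for n x using abs_sine_le_1[of n x] by simp
  show "summable (\<lambda>n. c n * cosine n 0)"
    by (rule cosine_series(3)[OF summable_of_nu_weight[OF assms]])
qed

lemma real_Suc_le_nu: "real (Suc n) \<le> nu n"
  using mult_left_mono[of 1 pi "real (Suc n)"] pi_gt3 by (simp add: nu_def)

lemma cube_summable: "summable (\<lambda>n. \<bar>- 2 / nu n ^ 3\<bar>)"
proof (rule summable_comparison_test'[OF summable_mult[OF powr_neg_summable[of 3], of 2]])
  fix n
  have "real (Suc n) ^ 3 \<le> nu n ^ 3"
    by (intro power_mono real_Suc_le_nu) simp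
  hence "2 / nu n ^ 3 \<le> 2 / real (Suc n) ^ 3" by (intro divide_left_mono) (auto simp: nu_pos)
  also have "\<dots> = 2 * real (Suc n) powr (- 3)" by (simp add: powr_minus_divide powr_numeral del: of_nat_Suc)
  finally show "norm \<bar>- 2 / nu n ^ 3\<bar> \<le> 2 * real (Suc n) powr (- 3)" using nu_pos[of n] by (simp add: abs_div_pos)
qed simp

text \<open>The coefficients - 2 / nu n^3 are summable, so the series has a continuous sum with the
  same sine coefficients as \<open>cub\<close>. The identity is confined to [0, 1], since outside
  the series continues as an odd periodic function.\<close>

lemma cub_expansion:
  assumes "x \<in> {0..1}"
  shows "(\<lambda>n. - 2 / nu n ^ 3 * sine n x) sums cub x"
proof -
  define c where "c = (\<lambda>n. - 2 / nu n ^ 3)"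
  have cs: "summable (\<lambda>n. \<bar>c n\<bar>)" unfolding c_def by (rule cube_summable)
  define R where "R = (\<lambda>x. \<Sum>n. c n * sine n x)"
  have Rc: "continuous_on {0..1} R"
    unfolding R_def using sine_series(1)[OF cs] by (rule continuous_on_subset) simp
  have ul: "uniform_limit {0..1} (\<lambda>N x. \<Sum>n<N. c n * sine n x) R sequentially"
    unfolding R_def
  proof (rule Weierstrass_m_test[OF _ cs])
    fix n x show "norm (c n * sine n x) \<le> \<bar>c n\<bar>"
      using mult_left_mono[OF abs_sine_le_1, of "\<bar>c n\<bar>" n x] by (simp add: abs_mult)
  qed
  have coeff: "integral {0..1} (\<lambda>x. R x * sine l x) = c l / 2" for l
  proof -
    have ul2: "uniform_limit {0..1} (\<lambda>N x. (\<Sum>n<N. c n * sine n x) * sine l x) (\<lambda>x. R x * sine l x) sequentially"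
    proof (rule uniform_lim_mult[OF ul uniform_limit_const])
      show "bounded (R ` {0..1})" using compact_continuous_image[OF Rc] compact_imp_bounded by auto
      show "bounded (sine l ` {0..1})" using abs_sine_le_1 by (auto intro!: boundedI[of _ 1])
    qed
    obtain I J where IJ: "\<And>N. ((\<lambda>x. (\<Sum>n<N. c n * sine n x) * sine l x) has_integral I N) {0..1}"
      "((\<lambda>x. R x * sine l x) has_integral J) {0..1}" "I \<longlonglongrightarrow> J"
    proof (rule uniform_limit_integral[OF ul2])
      show "continuous_on {0..1} (\<lambda>x. (\<Sum>n<N. c n * sine n x) * sine l x)" for N
        by (intro continuous_on_mult continuous_on_sum continuous_on_const sine_continuous)
    qed auto
    have "I = (\<lambda>N. integral {0..1} (\<lambda>x. (\<Sum>n<N. c n * sine n x) * sine l x))"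
      using integral_unique[OF IJ(1)] by auto
    hence "(\<lambda>N. integral {0..1} (\<lambda>x. (\<Sum>n<N. c n * sine n x) * sine l x)) \<longlonglongrightarrow> integral {0..1} (\<lambda>x. R x * sine l x)"
      using IJ(3) integral_unique[OF IJ(2)] by simp
    moreover have "integral {0..1} (\<lambda>x. (\<Sum>n<N. c n * sine n x) * sine l x) = c l / 2" if "N > l" for N
    proof -
      have "integral {0..1} (\<lambda>x. (\<Sum>n<N. c n * sine n x) * sine l x) = integral {0..1} (\<lambda>x. \<Sum>n<N. c n * (sine n x * sine l x))"
        by (simp add: sum_distrib_right mult.assoc)
      also have "\<dots> = (\<Sum>n<N. integral {0..1} (\<lambda>x. c n * (sine n x * sine l x)))"
        by (rule integral_sum) (auto intro!: integrable_continuous_real continuous_on_mult continuous_on_const sine_continuous)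
      also have "\<dots> = (\<Sum>n<N. if n = l then c l / 2 else 0)"
        by (rule sum.cong) (auto simp: trig_orthogonal)
      finally show ?thesis using that by simp
    qed
    hence "(\<lambda>N. integral {0..1} (\<lambda>x. (\<Sum>n<N. c n * sine n x) * sine l x)) \<longlonglongrightarrow> c l / 2"
      by (intro tendsto_eventually eventually_mono[OF eventually_gt_at_top[of l]]) auto
    ultimately show ?thesis using LIMSEQ_unique by blast
  qed
  have "cub x - R x = 0"
  proof (rule continuous_zero_of_orthogonal_unit[OF _ _ assms])
    show "continuous_on {0..1} (\<lambda>x. cub x - R x)" by (intro continuous_on_diff cub_continuous Rc)
    fix l
    have "integral {0..1} (\<lambda>x. (cub x - R x) * sine l x) = integral {0..1} (\<lambda>x. cub x * sine l x) - integral {0..1} (\<lambda>x. R x * sine l x)"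
      unfolding left_diff_distrib
      by (intro integral_diff integrable_continuous_real continuous_on_mult cub_continuous Rc sine_continuous)
    thus "integral {0..1} (\<lambda>x. (cub x - R x) * sine l x) = 0" by (simp add: coeff integral_cub_sine c_def)
  qed
  thus ?thesis using sine_series(3)[OF cs, of x] by (simp add: R_def c_def sums_iff)
qed

lemma decay_square_summable: "summable (\<lambda>m. (C * decay (real (Suc m)))\<^sup>2)"
proof -
  have "(decay (real (Suc m)))\<^sup>2 = real (Suc m) powr (-(3/2))" for m
    unfolding decay_def power2_eq_square by (subst powr_add[symmetric]) simp
  thus ?thesis using powr_neg_summable[of "3/2"] by (simp add: power_mult_distrib summable_mult del: of_nat_Suc)
qed

context nonresonant begin

definition ker_rem_const :: real
  where "ker_rem_const = (SOME C. C > 0 \<and> (\<forall>n m. (real (Suc n))\<^sup>2 * \<bar>ker_rem n m\<bar> \<le> C * (decay (real (Suc m)) * (dist_wt n m + real (Suc n) powr (-5/4)))))"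

lemma ker_rem_const: "ker_rem_const > 0" "(real (Suc n))\<^sup>2 * \<bar>ker_rem n m\<bar> \<le> ker_rem_const * (decay (real (Suc m)) * (dist_wt n m + real (Suc n) powr (-5/4)))"
  using someI_ex[OF ker_rem_bound_ex] unfolding ker_rem_const_def[symmetric] by auto

lemma dist_wt_summable: "summable (\<lambda>n. dist_wt n m)" "(\<Sum>n. dist_wt n m) \<le> dist_wt_sum" "summable (\<lambda>m. dist_wt n m)" "(\<Sum>m. dist_wt n m) \<le> dist_wt_sum"
proof -
  have *: "summable (\<lambda>n. dist_wt n m) \<and> (\<Sum>n. dist_wt n m) \<le> dist_wt_sum" for m
    using summable_on_imp_summable[OF dist_wt_summable_on(1)] sum_dist_wt_le
    by (auto intro: suminf_le_const)
  thus "summable (\<lambda>n. dist_wt n m)" "(\<Sum>n. dist_wt n m) \<le> dist_wt_sum" by auto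
  show "summable (\<lambda>m. dist_wt n m)" "(\<Sum>m. dist_wt n m) \<le> dist_wt_sum" using *[of n] by (simp_all add: dist_wt_commute)
qed

lemma summable_dominated:
  fixes f g :: "nat \<Rightarrow> real"
  assumes "\<And>n. \<bar>f n\<bar> \<le> C * g n" "summable g" "(\<Sum>n. g n) \<le> G" "C \<ge> 0"
  shows "summable (\<lambda>n. \<bar>f n\<bar>)" "(\<Sum>n. \<bar>f n\<bar>) \<le> C * G"
proof -
  show s: "summable (\<lambda>n. \<bar>f n\<bar>)"
    by (rule summable_comparison_test'[OF summable_mult[OF assms(2), of C]]) (use assms(1) in simp)
  have "(\<Sum>n. \<bar>f n\<bar>) \<le> (\<Sum>n. C * g n)"
    by (rule suminf_le[OF assms(1) s summable_mult[OF assms(2)]])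
  also have "\<dots> = C * (\<Sum>n. g n)" by (rule suminf_mult[OF assms(2)])
  also have "\<dots> \<le> C * G" using assms by (intro mult_left_mono) auto
  finally show "(\<Sum>n. \<bar>f n\<bar>) \<le> C * G" .
qed

definition ker_col :: "nat \<Rightarrow> real \<Rightarrow> real" where "ker_col m x = (\<Sum>n. 2 * ker_coeff n m * sine n x)"
definition ker_col1 :: "nat \<Rightarrow> real \<Rightarrow> real" where "ker_col1 m x = (\<Sum>n. (2 * ker_coeff n m * nu n) * cosine n x)"
definition ker_rem2 :: "nat \<Rightarrow> real \<Rightarrow> real" where "ker_rem2 m x = (\<Sum>n. ((2 * ker_rem n m * nu n) * nu n) * - sine n x)"
text \<open>The term with \<open>lin\<close> is the second derivative of the cubic that has been
  split off. It carries the boundary value at x = 0, since the sine series \<open>ker_rem2\<close>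
  vanishes there.\<close>

definition ker_col2 :: "nat \<Rightarrow> real \<Rightarrow> real" where "ker_col2 m x = - cauchy_wt m / nu m * lin x + ker_rem2 m x"

lemma ker_coeff_col_summable:
  "summable (\<lambda>n. \<bar>2 * ker_coeff n m * nu n\<bar>)"
  "real (Suc m) * (\<Sum>n. \<bar>2 * ker_coeff n m * nu n\<bar>) \<le> 2 * pi * ker_const * decay (real (Suc m)) * dist_wt_sum"
proof -
  let ?M = "real (Suc m)"
  have b: "\<bar>2 * ker_coeff n m * nu n\<bar> \<le> (2 * pi * ker_const * (decay ?M / ?M)) * dist_wt n m" for n
  proof -
    have "\<bar>2 * ker_coeff n m * nu n\<bar> = 2 * pi * (real (Suc n) * \<bar>ker_coeff n m\<bar>)" by (simp add: abs_mult nu_def)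
    also have "\<dots> \<le> 2 * pi * (ker_const * (dist_wt n m * (decay ?M / ?M)))"
      using ker_coeff_bounds(4)[of n m] by (intro mult_left_mono) auto
    finally show ?thesis by (simp add: mult_ac)
  qed
  have nn: "2 * pi * ker_const * (decay ?M / ?M) \<ge> 0" using ker_const(1) by (auto simp: decay_def)
  note * = summable_dominated[OF b dist_wt_summable(1,2) nn]
  show "summable (\<lambda>n. \<bar>2 * ker_coeff n m * nu n\<bar>)" by (rule *(1))
  have "?M * (\<Sum>n. \<bar>2 * ker_coeff n m * nu n\<bar>) \<le> ?M * ((2 * pi * ker_const * (decay ?M / ?M)) * dist_wt_sum)"
    by (intro mult_left_mono *(2)) simp
  also have "\<dots> = 2 * pi * ker_const * decay ?M * dist_wt_sum" by (simp del: of_nat_Suc)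
  finally show "?M * (\<Sum>n. \<bar>2 * ker_coeff n m * nu n\<bar>) \<le> 2 * pi * ker_const * decay ?M * dist_wt_sum" .
qed

lemma ker_col_has_derivative: "(ker_col m has_real_derivative ker_col1 m x) (at x)"
  unfolding ker_col_def[abs_def] ker_col1_def by (rule sine_series_derivative[OF ker_coeff_col_summable(1)])

lemma ker_col_continuous: "continuous_on A (ker_col m)" and ker_col1_continuous: "continuous_on A (ker_col1 m)"
proof -
  show "continuous_on A (ker_col m)"
    unfolding ker_col_def[abs_def] using sine_series(1)[OF summable_of_nu_weight[OF ker_coeff_col_summable(1)]]
    by (rule continuous_on_subset) simp
  show "continuous_on A (ker_col1 m)"
    unfolding ker_col1_def[abs_def] using cosine_series(1)[OF ker_coeff_col_summable(1)] by (rule continuous_on_subset) simp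
qed

lemma ker_col1_bound: "\<bar>nu m * ker_col1 m x\<bar> \<le> (2 * pi\<^sup>2 * ker_const * dist_wt_sum) * decay (real (Suc m))"
proof -
  have "\<bar>nu m * ker_col1 m x\<bar> = nu m * \<bar>ker_col1 m x\<bar>" using nu_pos[of m] by (simp add: abs_mult)
  also have "\<dots> \<le> nu m * (\<Sum>n. \<bar>2 * ker_coeff n m * nu n\<bar>)"
    unfolding ker_col1_def using cosine_series(2)[OF ker_coeff_col_summable(1)] nu_pos[of m] by (intro mult_left_mono) auto
  also have "\<dots> = pi * (real (Suc m) * (\<Sum>n. \<bar>2 * ker_coeff n m * nu n\<bar>))" by (simp add: nu_def mult_ac)
  also have "\<dots> \<le> pi * (2 * pi * ker_const * decay (real (Suc m)) * dist_wt_sum)"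
    by (intro mult_left_mono ker_coeff_col_summable(2)) auto
  finally show ?thesis by (simp add: power2_eq_square mult_ac)
qed

definition ker_rem_sum :: real where "ker_rem_sum = dist_wt_sum + (\<Sum>n. real (Suc n) powr (-5/4))"

lemma ker_rem_summable:
  "summable (\<lambda>n. \<bar>(2 * ker_rem n m * nu n) * nu n\<bar>)"
  "(\<Sum>n. \<bar>(2 * ker_rem n m * nu n) * nu n\<bar>) \<le> (2 * pi\<^sup>2 * ker_rem_const * ker_rem_sum) * decay (real (Suc m))"
proof -
  let ?M = "real (Suc m)"
  let ?g = "\<lambda>n. dist_wt n m + real (Suc n) powr (-5/4)"
  have b: "\<bar>(2 * ker_rem n m * nu n) * nu n\<bar> \<le> (2 * pi\<^sup>2 * (ker_rem_const * decay ?M)) * ?g n" for n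
  proof -
    have "\<bar>(2 * ker_rem n m * nu n) * nu n\<bar> = 2 * pi\<^sup>2 * ((real (Suc n))\<^sup>2 * \<bar>ker_rem n m\<bar>)"
      by (simp add: abs_mult nu_def power2_eq_square)
    also have "\<dots> \<le> 2 * pi\<^sup>2 * (ker_rem_const * (decay ?M * ?g n))" using ker_rem_const(2)[of n m] by (intro mult_left_mono) auto
    finally show ?thesis by (simp only: mult.assoc)
  qed
  have s: "summable (\<lambda>n. real (Suc n) powr (-5/4))" using powr_neg_summable[of "5/4"] by simp
  have g: "summable ?g" by (intro summable_add dist_wt_summable s)
  have "suminf ?g \<le> ker_rem_sum"
    using dist_wt_summable(2)[of m] suminf_add[OF dist_wt_summable(1)[of m] s] by (simp add: ker_rem_sum_def)
  note b' = summable_dominated[OF b g this]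
  have nn: "2 * pi\<^sup>2 * (ker_rem_const * decay ?M) \<ge> 0" using ker_rem_const(1) by (auto simp: decay_def)
  show "summable (\<lambda>n. \<bar>(2 * ker_rem n m * nu n) * nu n\<bar>)" by (rule b'(1)[OF nn])
  have "(2 * pi\<^sup>2 * (ker_rem_const * decay ?M)) * ker_rem_sum = (2 * pi\<^sup>2 * ker_rem_const * ker_rem_sum) * decay ?M" by (simp only: mult_ac)
  with b'(2)[OF nn] show "(\<Sum>n. \<bar>(2 * ker_rem n m * nu n) * nu n\<bar>) \<le> (2 * pi\<^sup>2 * ker_rem_const * ker_rem_sum) * decay ?M" by linarith
qed

lemma ker_col2_continuous: "continuous_on A (ker_col2 m)"
  unfolding ker_col2_def[abs_def] ker_rem2_def
  by (intro continuous_on_add continuous_on_mult continuous_on_const lin_continuous neg_sine_series(1) ker_rem_summable(1))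

definition ker_col2_const :: real where "ker_col2_const = \<bar>a\<bar> * (1 + cauchy_bound * exp cauchy_bound) + 2 * pi\<^sup>2 * ker_rem_const * ker_rem_sum"

lemma ker_col2_bound:
  assumes "x \<in> {0..1}" shows "\<bar>ker_col2 m x\<bar> \<le> ker_col2_const * decay (real (Suc m))"
proof -
  let ?M = "real (Suc m)" and ?B = "\<bar>a\<bar> * (1 + cauchy_bound * exp cauchy_bound)"
  have "\<bar>ker_rem2 m x\<bar> \<le> (2 * pi\<^sup>2 * ker_rem_const * ker_rem_sum) * decay ?M"
    using neg_sine_series(2)[OF ker_rem_summable(1)] ker_rem_summable(2) unfolding ker_rem2_def by (rule order_trans)
  moreover have "\<bar>- cauchy_wt m / nu m * lin x\<bar> \<le> ?B * decay ?M"
  proof -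
    have "1 / nu m \<le> 1 / ?M" using real_Suc_le_nu[of m] by (intro divide_left_mono) (auto simp: nu_pos)
    also have "\<dots> = ?M powr (-1)" by (simp add: powr_minus_divide del: of_nat_Suc)
    also have "\<dots> \<le> decay ?M" unfolding decay_def by (intro powr_mono) auto
    finally have "\<bar>cauchy_wt m\<bar> * (1 / nu m) \<le> ?B * decay ?M"
      using cauchy_wt_bounded[of m] cauchy_bound_nonneg by (intro mult_mono) (auto simp: nu_pos less_imp_le)
    moreover have "\<bar>- cauchy_wt m / nu m * lin x\<bar> = \<bar>cauchy_wt m\<bar> * (1 / nu m) * \<bar>lin x\<bar>"
      using nu_pos[of m] by (simp add: abs_mult)
    moreover have "\<dots> \<le> \<bar>cauchy_wt m\<bar> * (1 / nu m) * 1"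
      using assms nu_pos[of m] by (intro mult_left_mono) (auto simp: lin_def)
    ultimately show ?thesis by linarith
  qed
  ultimately show ?thesis unfolding ker_col2_def ker_col2_const_def distrib_right by linarith
qed

text \<open>The sine series of the column cannot be differentiated twice term by term up to x = 0.
  On [0, 1] it is rewritten as a multiple of \<open>cub\<close> plus a series with coefficients
  \<open>ker_rem\<close>, which can.\<close>

lemma ker_col1_has_derivative:
  assumes x: "x \<in> {0..1}" shows "(ker_col1 m has_vector_derivative ker_col2 m x) (at x within {0..1})"
proof -
  define Q where "Q = (\<lambda>x. \<Sum>n. 2 * ker_rem n m * sine n x)"
  define Q1 where "Q1 = (\<lambda>x. \<Sum>n. (2 * ker_rem n m * nu n) * cosine n x)"
  note q1 = summable_of_nu_weight[OF ker_rem_summable(1)]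
  have dQ: "(Q has_real_derivative Q1 y) (at y)" for y
    unfolding Q_def Q1_def by (rule sine_series_derivative[OF q1])
  have dQ1: "(Q1 has_real_derivative ker_rem2 m y) (at y)" for y
    unfolding Q1_def ker_rem2_def by (rule cosine_series_derivative[OF ker_rem_summable(1)])
  have eq: "ker_col m y = - cauchy_wt m / nu m * cub y + Q y" if y: "y \<in> {0..1}" for y
  proof -
    have "(\<lambda>n. - cauchy_wt m / nu m * (- 2 / nu n ^ 3 * sine n y) + 2 * ker_rem n m * sine n y) sums (- cauchy_wt m / nu m * cub y + Q y)"
      unfolding Q_def using sine_series(3)[OF summable_of_nu_weight[OF q1], of m y]
      by (intro sums_add sums_mult cub_expansion y summable_sums)
    moreover have "- cauchy_wt m / nu m * (- 2 / nu n ^ 3 * sine n y) + 2 * ker_rem n m * sine n y = 2 * ker_coeff n m * sine n y" for n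
    proof -
      have "nu m * nu n ^ 3 = real (Suc m) * pi ^ 4 * real (Suc n) ^ 3"
        by (simp add: nu_def power_mult_distrib power3_eq_cube power4_eq_xxxx del: of_nat_Suc)
      hence "2 * ker_rem n m = 2 * ker_coeff n m - 2 * cauchy_wt m / (nu m * nu n ^ 3)" by (simp add: ker_rem_def)
      thus ?thesis by (simp add: left_diff_distrib)
    qed
    ultimately show ?thesis by (simp add: ker_col_def sums_iff)
  qed
  \<comment> \<open>The two expressions for the column agree only on [0, 1]; uniqueness of the
    derivative within this interval transfers the identity to first derivatives, end points
    included.\<close>
  have ker_col1_eq: "ker_col1 m y = - cauchy_wt m / nu m * cub' y + Q1 y" if y: "y \<in> {0..1}" for y
  proof (rule vector_derivative_unique_within[where f = "ker_col m" and x = y and S = "{0..1}"])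
    show "at y within {0..1} \<noteq> bot" using y by (simp add: trivial_limit_within islimpt_Icc)
    show "(ker_col m has_vector_derivative ker_col1 m y) (at y within {0..1})"
      using ker_col_has_derivative[of m y] has_field_derivative_at_within
      by (auto simp: has_real_derivative_iff_has_vector_derivative[symmetric])
    have "((\<lambda>y. - cauchy_wt m / nu m * cub y + Q y) has_real_derivative - cauchy_wt m / nu m * cub' y + Q1 y) (at y within {0..1})"
      by (intro DERIV_add DERIV_cmult cub_has_derivative has_field_derivative_at_within[OF dQ])
    thus "(ker_col m has_vector_derivative - cauchy_wt m / nu m * cub' y + Q1 y) (at y within {0..1})"
      unfolding has_real_derivative_iff_has_vector_derivative
      by (rule has_vector_derivative_transform[OF y, rotated]) (use eq in simp)
  qed
  have "((\<lambda>y. - cauchy_wt m / nu m * cub' y + Q1 y) has_real_derivative ker_col2 m x) (at x within {0..1})"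
    unfolding ker_col2_def by (intro DERIV_add DERIV_cmult cub'_has_derivative has_field_derivative_at_within[OF dQ1])
  thus ?thesis
    unfolding has_real_derivative_iff_has_vector_derivative
    by (rule has_vector_derivative_transform[OF x, rotated]) (use ker_col1_eq in simp)
qed

text \<open>Rows are functions of y. Here the weight m^2 is absolutely summable, so term-by-term
  differentiation works twice and no boundary correction occurs.\<close>

definition ker_row :: "nat \<Rightarrow> real \<Rightarrow> real" where "ker_row n y = (\<Sum>m. 2 * ker_coeff n m * sine m y)"
definition ker_row1 :: "nat \<Rightarrow> real \<Rightarrow> real" where "ker_row1 n y = (\<Sum>m. (2 * ker_coeff n m * nu m) * cosine m y)"
definition ker_row2 :: "nat \<Rightarrow> real \<Rightarrow> real" where "ker_row2 n y = (\<Sum>m. ((2 * ker_coeff n m * nu m) * nu m) * - sine m y)"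

lemma ker_coeff_row_summable:
  "summable (\<lambda>m. \<bar>(2 * ker_coeff n m * nu m) * nu m\<bar>)"
  "(\<Sum>m. \<bar>(2 * ker_coeff n m * nu m) * nu m\<bar>) \<le> (2 * pi\<^sup>2 * ker_const * dist_wt_sum) * decay (real (Suc n))"
proof -
  let ?N = "real (Suc n)"
  have b: "\<bar>(2 * ker_coeff n m * nu m) * nu m\<bar> \<le> (2 * pi\<^sup>2 * (ker_const * decay ?N)) * dist_wt n m" for m
  proof -
    have "\<bar>(2 * ker_coeff n m * nu m) * nu m\<bar> = 2 * pi\<^sup>2 * ((real (Suc m))\<^sup>2 * \<bar>ker_coeff n m\<bar>)"
      by (simp add: abs_mult nu_def power2_eq_square)
    also have "\<dots> \<le> 2 * pi\<^sup>2 * (ker_const * (dist_wt n m * decay ?N))" using ker_coeff_bounds(2)[of m n] by (intro mult_left_mono) auto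
    finally show ?thesis by (simp only: mult_ac)
  qed
  have nn: "2 * pi\<^sup>2 * (ker_const * decay ?N) \<ge> 0" using ker_const(1) by (auto simp: decay_def)
  note b' = summable_dominated[OF b dist_wt_summable(3,4) nn]
  show "summable (\<lambda>m. \<bar>(2 * ker_coeff n m * nu m) * nu m\<bar>)" by (rule b'(1))
  have "(2 * pi\<^sup>2 * (ker_const * decay ?N)) * dist_wt_sum = (2 * pi\<^sup>2 * ker_const * dist_wt_sum) * decay ?N" by (simp only: mult_ac)
  with b'(2) show "(\<Sum>m. \<bar>(2 * ker_coeff n m * nu m) * nu m\<bar>) \<le> (2 * pi\<^sup>2 * ker_const * dist_wt_sum) * decay ?N" by linarith
qed

lemma ker_row_has_derivative: "(ker_row n has_real_derivative ker_row1 n y) (at y)"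
  unfolding ker_row_def[abs_def] ker_row1_def by (rule sine_series_derivative[OF summable_of_nu_weight[OF ker_coeff_row_summable(1)]])

lemma ker_row1_has_derivative: "(ker_row1 n has_real_derivative ker_row2 n y) (at y)"
  unfolding ker_row1_def[abs_def] ker_row2_def by (rule cosine_series_derivative[OF ker_coeff_row_summable(1)])

lemma ker_row2_continuous: "continuous_on A (ker_row2 n)"
  unfolding ker_row2_def[abs_def] by (rule neg_sine_series(1)[OF ker_coeff_row_summable(1)])

lemma ker_row2_bound: "\<bar>ker_row2 n y\<bar> \<le> (2 * pi\<^sup>2 * ker_const * dist_wt_sum) * decay (real (Suc n))"
  using neg_sine_series(2)[OF ker_coeff_row_summable(1)] ker_coeff_row_summable(2) unfolding ker_row2_def by (rule order_trans)

lemma ker_row2_boundary: "ker_row2 n 0 = 0" "ker_row2 n 1 = 0"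
  by (simp_all add: ker_row2_def)

end

section \<open>The kernel and its regularity\<close>

lemma summable_on_swap:
  assumes "f summable_on (UNIV :: ('a \<times> 'b) set)"
  shows "(\<lambda>(m, n). f (n, m)) summable_on (UNIV :: ('b \<times> 'a) set)"
proof -
  have b: "bij_betw prod.swap (UNIV :: ('b \<times> 'a) set) (UNIV :: ('a \<times> 'b) set)" by simp
  show ?thesis
    using summable_on_reindex_bij_betw[OF b, of f] assms by (simp add: case_prod_unfold prod.swap_def)
qed

lemma has_sum_swap:
  assumes "(f has_sum s) (UNIV :: ('a \<times> 'b) set)"
  shows "((\<lambda>(m, n). f (n, m)) has_sum s) (UNIV :: ('b \<times> 'a) set)"
proof -
  have b: "bij_betw prod.swap (UNIV :: ('b \<times> 'a) set) (UNIV :: ('a \<times> 'b) set)" by simp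
  show ?thesis
    using has_sum_reindex_bij_betw[OF b, of f] assms by (simp add: case_prod_unfold prod.swap_def)
qed

lemma has_sum_iterated:
  fixes f :: "'a \<times> 'b \<Rightarrow> real"
  assumes "(f has_sum s) UNIV" "\<And>x. ((\<lambda>y. f (x, y)) has_sum g x) UNIV"
  shows "(g has_sum s) UNIV"
  using has_sum_SigmaD[where f = f and A = UNIV and B = "\<lambda>_. UNIV"] assms by simp

lemma abs_summable_sections:
  fixes c :: "'a \<times> 'b \<Rightarrow> real"
  assumes "(\<lambda>i. \<bar>c i\<bar>) summable_on UNIV"
  shows "(\<lambda>y. \<bar>c (x, y)\<bar>) summable_on UNIV" "(\<lambda>x. \<Sum>\<^sub>\<infinity>y. \<bar>c (x, y)\<bar>) summable_on UNIV"
proof -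
  have "(\<lambda>(x, y). \<bar>c (x, y)\<bar>) summable_on (UNIV \<times> UNIV)" using assms by (simp add: case_prod_unfold)
  from summable_on_SigmaD1[OF this] show 1: "(\<lambda>y. \<bar>c (x, y)\<bar>) summable_on UNIV" for x by simp
  have "(\<lambda>i. \<bar>c i\<bar>) summable_on (UNIV \<times> UNIV)" using assms by simp
  from summable_on_SigmaD[OF this 1] show "(\<lambda>x. \<Sum>\<^sub>\<infinity>y. \<bar>c (x, y)\<bar>) summable_on UNIV" .
qed

text \<open>Summing the inner index first turns an unordered double series into a sequence of
  partial sums, still with uniform convergence, because the inner absolute sums are
  summable.\<close>

lemma iterated_series_uniform_limit:
  fixes c :: "nat \<times> nat \<Rightarrow> real"
  assumes c: "(\<lambda>i. \<bar>c i\<bar>) summable_on UNIV" and F1: "\<And>i p. p \<in> A \<Longrightarrow> \<bar>F i p\<bar> \<le> 1"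
    and G: "\<And>m p. p \<in> A \<Longrightarrow> ((\<lambda>n. c (m, n) * F (m, n) p) has_sum G m p) UNIV"
  shows "uniform_limit A (\<lambda>N p. \<Sum>m<N. G m p) (\<lambda>p. \<Sum>\<^sub>\<infinity>i. c i * F i p) sequentially"
proof -
  define b where "b = (\<lambda>m. \<Sum>\<^sub>\<infinity>n. \<bar>c (m, n)\<bar>)"
  have tm: "norm (c i * F i p) \<le> \<bar>c i\<bar>" if "p \<in> A" for i p
    using mult_left_mono[OF F1[OF that], of "\<bar>c i\<bar>" i] by (simp add: abs_mult)
  have "uniform_limit A (\<lambda>N p. \<Sum>m<N. G m p) (\<lambda>p. \<Sum>m. G m p) sequentially"
  proof (rule Weierstrass_m_test)
    show "summable b" unfolding b_def by (rule summable_on_imp_summable[OF abs_summable_sections(2)[OF c]])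
    fix m p assume p: "p \<in> A"
    have "((\<lambda>n. \<bar>c (m, n)\<bar>) has_sum b m) UNIV" unfolding b_def by (rule has_sum_infsum[OF abs_summable_sections(1)[OF c]])
    moreover have "(\<lambda>n. norm (c (m, n) * F (m, n) p)) summable_on UNIV"
      by (rule Infinite_Sum.abs_summable_on_comparison_test'[OF abs_summable_sections(1)[OF c]]) (rule tm[OF p])
    ultimately show "norm (G m p) \<le> b m"
      using norm_infsum_le[OF G[OF p] _ tm[OF p]] by blast
  qed
  moreover have "(\<Sum>m. G m p) = (\<Sum>\<^sub>\<infinity>i. c i * F i p)" if p: "p \<in> A" for p
  proof -
    have "(\<lambda>i. norm (c i * F i p)) summable_on UNIV"
      by (rule Infinite_Sum.abs_summable_on_comparison_test'[OF c]) (rule tm[OF p])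
    hence "(\<lambda>i. c i * F i p) summable_on UNIV" by (rule abs_summable_summable)
    from has_sum_iterated[OF has_sum_infsum[OF this] G[OF p]]
    show ?thesis using has_sum_imp_sums sums_unique by metis
  qed
  ultimately show ?thesis
    using uniform_limit_cong'[of A "\<lambda>N p. \<Sum>m<N. G m p" "\<lambda>N p. \<Sum>m<N. G m p" "\<lambda>p. \<Sum>m. G m p" "\<lambda>p. \<Sum>\<^sub>\<infinity>i. c i * F i p"] by simp
qed

lemma sine_series_has_sum:
  assumes "summable (\<lambda>n. \<bar>c n\<bar>)"
  shows "((\<lambda>n. c n * sine n x) has_sum (\<Sum>n. c n * sine n x)) UNIV"
proof -
  have s: "summable (\<lambda>n. norm (c n * sine n x))"
  proof (rule summable_comparison_test'[OF assms])
    fix n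
    have "\<bar>c n\<bar> * \<bar>sine n x\<bar> \<le> \<bar>c n\<bar> * 1" by (intro mult_left_mono abs_sine_le_1) simp
    thus "norm (norm (c n * sine n x)) \<le> \<bar>c n\<bar>" by (simp add: abs_mult)
  qed
  show ?thesis by (rule norm_summable_imp_has_sum[OF s summable_sums[OF summable_norm_cancel[OF s]]])
qed

lemma C_infinity_scaled_sum:
  assumes "finite I" "\<And>i. i \<in> I \<Longrightarrow> C_infinity (f i)"
  shows "C_infinity (\<lambda>p. \<Sum>i\<in>I. c i * f i p) \<and>
    (\<forall>p\<in>closed_square. Dx (\<lambda>p. \<Sum>i\<in>I. c i * f i p) p = (\<Sum>i\<in>I. c i * Dx (f i) p) \<and>
       Dy (\<lambda>p. \<Sum>i\<in>I. c i * f i p) p = (\<Sum>i\<in>I. c i * Dy (f i) p))"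
  using assms
proof (induction I rule: finite_induct)
  case empty
  have "Dx (\<lambda>p. 0) p = 0" "Dy (\<lambda>p. 0) p = 0" if "p \<in> closed_square" for p
    using that by (cases p; auto intro!: Dx_eqI Dy_eqI)+
  thus ?case by (simp add: C_infinity_zero)
next
  case (insert j I)
  hence IH: "C_infinity (\<lambda>p. \<Sum>i\<in>I. c i * f i p)"
    "\<And>p. p \<in> closed_square \<Longrightarrow> Dx (\<lambda>p. \<Sum>i\<in>I. c i * f i p) p = (\<Sum>i\<in>I. c i * Dx (f i) p)"
    "\<And>p. p \<in> closed_square \<Longrightarrow> Dy (\<lambda>p. \<Sum>i\<in>I. c i * f i p) p = (\<Sum>i\<in>I. c i * Dy (f i) p)"
    and fj: "C_infinity (f j)" by auto
  have eq: "(\<lambda>p. \<Sum>i\<in>insert j I. c i * f i p) = (\<lambda>p. c j * f j p + 1 * (\<Sum>i\<in>I. c i * f i p))"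
    using insert.hyps by simp
  show ?case
    unfolding eq using C_infinity_lincomb[OF fj IH(1), of "c j" 1] Dx_lincomb[OF fj IH(1), of _ "c j" 1]
      Dy_lincomb[OF fj IH(1), of _ "c j" 1] IH insert.hyps by simp
qed

lemma has_weak_deriv_sum:
  assumes "\<And>m. has_weak_deriv i j (f m) (g m)"
  shows "has_weak_deriv i j (\<lambda>p. \<Sum>m<(N::nat). f m p) (\<lambda>p. \<Sum>m<N. g m p)"
  using has_weak_deriv_scaled_sum[where c = "\<lambda>_. 1" and I = "{..<N}" and k = f and w = g] assms by simp

lemma sine_vector_derivative: "(sine n has_vector_derivative nu n * cosine n x) (at x within A)"
  using sine_has_derivative by (simp add: has_real_derivative_iff_has_vector_derivative)

lemma cosine_vector_derivative: "(cosine n has_vector_derivative - nu n * sine n x) (at x within A)"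
  using cosine_has_derivative[of n x A] by (simp add: has_real_derivative_iff_has_vector_derivative)

lemma C_infinity_sine2: "C_infinity (sine2 i)"
  using C_infinity_tensor[OF derivs_sine_deriv derivs_sine_deriv, of "fst i" 0 "snd i" 0] by (simp add: sine_deriv_simps)

lemma Dx_sine2: "p \<in> closed_square \<Longrightarrow> Dx (sine2 i) p = nu (fst i) * tensor (cosine (fst i)) (sine (snd i)) p"
  and Dy_sine2: "p \<in> closed_square \<Longrightarrow> Dy (sine2 i) p = nu (snd i) * tensor (sine (fst i)) (cosine (snd i)) p"
  using Dx_tensor[where f = "sine (fst i)" and g = "sine (snd i)", OF _ sine_vector_derivative]
    Dy_tensor[where f = "sine (fst i)" and g = "sine (snd i)", OF _ sine_vector_derivative]
  by (auto simp: tensor_def)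

context nonresonant begin

text \<open>The factor 2 stems from the expansion of the Dirac measure on the diagonal, which is
  twice the sum of sine n (x) sine n (y).\<close>

definition sine_coeff :: "nat \<times> nat \<Rightarrow> real" where "sine_coeff i = 2 * ker_coeff (fst i) (snd i)"

definition kernel :: "real \<times> real \<Rightarrow> real" where "kernel p = (\<Sum>\<^sub>\<infinity>i. sine_coeff i * sine2 i p)"
definition kernel_x :: "real \<times> real \<Rightarrow> real"
  where "kernel_x p = (\<Sum>\<^sub>\<infinity>i. (sine_coeff i * nu (fst i)) * tensor (cosine (fst i)) (sine (snd i)) p)"
definition kernel_y :: "real \<times> real \<Rightarrow> real"
  where "kernel_y p = (\<Sum>\<^sub>\<infinity>i. (sine_coeff i * nu (snd i)) * tensor (sine (fst i)) (cosine (snd i)) p)"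

lemma sine_coeff_summable:
  "(\<lambda>i. \<bar>sine_coeff i\<bar>) summable_on UNIV" "(\<lambda>i. \<bar>sine_coeff i * nu (fst i)\<bar>) summable_on UNIV"
  "(\<lambda>i. \<bar>sine_coeff i * nu (snd i)\<bar>) summable_on UNIV"
proof -
  let ?W = "\<lambda>i. dist_wt (fst i) (snd i) * (decay (real (Suc (snd i))) / real (Suc (snd i)))"
  have W: "?W summable_on UNIV"
    using dist_wt_weight_summable_on[OF _ summable_decay_over] by (simp add: case_prod_unfold decay_def)
  have *: "(\<lambda>i. \<bar>f i\<bar>) summable_on UNIV" if "\<And>i. \<bar>f i\<bar> \<le> C * ?W i" for f :: "nat \<times> nat \<Rightarrow> real" and C
    using Infinite_Sum.abs_summable_on_comparison_test'[OF summable_on_cmult_right[OF W, of C], of f] that by simp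
  show "(\<lambda>i. \<bar>sine_coeff i\<bar>) summable_on UNIV"
  proof (rule *[where C = "2 * ker_const"])
    fix i
    have "\<bar>sine_coeff i\<bar> = 2 * \<bar>ker_coeff (fst i) (snd i)\<bar>" by (simp add: sine_coeff_def abs_mult)
    also have "\<dots> \<le> 2 * (ker_const * ?W i)" by (intro mult_left_mono ker_coeff_bounds(6)) simp
    finally show "\<bar>sine_coeff i\<bar> \<le> 2 * ker_const * ?W i" by (simp only: mult.assoc)
  qed
  show "(\<lambda>i. \<bar>sine_coeff i * nu (fst i)\<bar>) summable_on UNIV"
  proof (rule *[where C = "2 * pi * ker_const"])
    fix i
    have "\<bar>sine_coeff i * nu (fst i)\<bar> = 2 * pi * (real (Suc (fst i)) * \<bar>ker_coeff (fst i) (snd i)\<bar>)"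
      by (simp add: sine_coeff_def abs_mult nu_def)
    also have "\<dots> \<le> 2 * pi * (ker_const * ?W i)" by (intro mult_left_mono ker_coeff_bounds(4)) simp
    finally show "\<bar>sine_coeff i * nu (fst i)\<bar> \<le> 2 * pi * ker_const * ?W i" by (simp only: mult.assoc)
  qed
  show "(\<lambda>i. \<bar>sine_coeff i * nu (snd i)\<bar>) summable_on UNIV"
  proof (rule *[where C = "2 * pi * ker_const"])
    fix i
    have "\<bar>sine_coeff i * nu (snd i)\<bar> = 2 * pi * (real (Suc (snd i)) * \<bar>ker_coeff (fst i) (snd i)\<bar>)"
      by (simp add: sine_coeff_def abs_mult nu_def)
    also have "\<dots> \<le> 2 * pi * (ker_const * ?W i)" by (intro mult_left_mono ker_coeff_bounds(5)) simp
    finally show "\<bar>sine_coeff i * nu (snd i)\<bar> \<le> 2 * pi * ker_const * ?W i" by (simp only: mult.assoc)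
  qed
qed

lemma tensor_trig_bounds:
  "\<bar>tensor (cosine n) (sine m) p\<bar> \<le> 1" "\<bar>tensor (sine n) (cosine m) p\<bar> \<le> 1"
  using abs_sine_le_1 abs_cosine_le_1 by (auto simp: tensor_def abs_mult intro!: mult_le_one)

lemma tensor_trig_continuous:
  "continuous_on closed_square (tensor (cosine n) (sine m))" "continuous_on closed_square (tensor (sine n) (cosine m))"
  by (intro tensor_continuous sine_continuous cosine_continuous)+

lemmas kernel_series = abs_summable_series_square[where F = "\<lambda>i. sine2 i",
    OF sine_coeff_summable(1) continuous_sine2 abs_sine2_le_1, folded kernel_def]
lemmas kernel_x_series = abs_summable_series_square[where F = "\<lambda>i. tensor (cosine (fst i)) (sine (snd i))",
    OF sine_coeff_summable(2) tensor_trig_continuous(1) tensor_trig_bounds(1), folded kernel_x_def]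
lemmas kernel_y_series = abs_summable_series_square[where F = "\<lambda>i. tensor (sine (fst i)) (cosine (snd i))",
    OF sine_coeff_summable(3) tensor_trig_continuous(2) tensor_trig_bounds(2), folded kernel_y_def]

lemma kernel_L2: "kernel \<in> L2 open_square" "kernel_x \<in> L2 open_square" "kernel_y \<in> L2 open_square"
  using kernel_series(2) kernel_x_series(2) kernel_y_series(2) by (auto intro: continuous_L2_square)

lemma kernel_weak_deriv_x: "has_weak_deriv 1 0 kernel kernel_x"
proof (rule has_weak_deriv_limit[OF _ _ kernel_L2(1,2) kernel_series(3) kernel_x_series(3)])
  fix A :: "(nat \<times> nat) set"
  have "has_weak_deriv 1 0 (\<lambda>p. \<Sum>i\<in>A. sine_coeff i * sine2 i p) (\<lambda>p. \<Sum>i\<in>A. sine_coeff i * tensor (\<lambda>x. nu (fst i) * cosine (fst i) x) (sine (snd i)) p)"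
    by (intro has_weak_deriv_scaled_sum has_weak_deriv_tensor_x sine_vector_derivative continuous_on_mult continuous_on_const
        sine_continuous cosine_continuous)
  thus "has_weak_deriv 1 0 (\<lambda>p. \<Sum>i\<in>A. sine_coeff i * sine2 i p) (\<lambda>p. \<Sum>i\<in>A. (sine_coeff i * nu (fst i)) * tensor (cosine (fst i)) (sine (snd i)) p)"
    by (simp add: tensor_def mult.assoc)
qed simp

lemma kernel_weak_deriv_y: "has_weak_deriv 0 1 kernel kernel_y"
proof (rule has_weak_deriv_limit[OF _ _ kernel_L2(1,3) kernel_series(3) kernel_y_series(3)])
  fix A :: "(nat \<times> nat) set"
  have "has_weak_deriv 0 1 (\<lambda>p. \<Sum>i\<in>A. sine_coeff i * sine2 i p) (\<lambda>p. \<Sum>i\<in>A. sine_coeff i * tensor (sine (fst i)) (\<lambda>x. nu (snd i) * cosine (snd i) x) p)"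
    by (intro has_weak_deriv_scaled_sum has_weak_deriv_tensor_y sine_vector_derivative continuous_on_mult continuous_on_const
        sine_continuous cosine_continuous)
  thus "has_weak_deriv 0 1 (\<lambda>p. \<Sum>i\<in>A. sine_coeff i * sine2 i p) (\<lambda>p. \<Sum>i\<in>A. (sine_coeff i * nu (snd i)) * tensor (sine (fst i)) (cosine (snd i)) p)"
    by (simp add: tensor_def mult_ac)
qed simp

lemma kernel_H1_0: "kernel \<in> H1_0"
proof (rule H1_0_I[OF kernel_weak_deriv_x kernel_weak_deriv_y])
  fix e :: real assume e: "e > 0"
  have "\<forall>\<^sub>F A in finite_subsets_at_top UNIV. finite (A :: (nat \<times> nat) set)"
    by (rule eventually_finite_subsets_at_top_weakI) simp
  note this = eventually_conj[OF order_tendstoD(2)[OF kernel_series(3) e] eventually_conj[OF order_tendstoD(2)[OF kernel_x_series(3) e]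
        eventually_conj[OF order_tendstoD(2)[OF kernel_y_series(3) e] this]]]
  from eventually_happens'[OF _ this] obtain A where A:
    "L2_norm open_square (\<lambda>p. (\<Sum>i\<in>A. sine_coeff i * sine2 i p) - kernel p) < e"
    "L2_norm open_square (\<lambda>p. (\<Sum>i\<in>A. (sine_coeff i * nu (fst i)) * tensor (cosine (fst i)) (sine (snd i)) p) - kernel_x p) < e"
    "L2_norm open_square (\<lambda>p. (\<Sum>i\<in>A. (sine_coeff i * nu (snd i)) * tensor (sine (fst i)) (cosine (snd i)) p) - kernel_y p) < e" "finite A"
    by auto
  define u where "u = (\<lambda>p. \<Sum>i\<in>A. sine_coeff i * sine2 i p)"
  have u: "C_infinity u" "\<And>p. p \<in> closed_square \<Longrightarrow> Dx u p = (\<Sum>i\<in>A. sine_coeff i * Dx (sine2 i) p)"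
    "\<And>p. p \<in> closed_square \<Longrightarrow> Dy u p = (\<Sum>i\<in>A. sine_coeff i * Dy (sine2 i) p)"
    using C_infinity_scaled_sum[OF A(4) C_infinity_sine2, of sine_coeff] by (auto simp: u_def)
  have "zero_boundary u" by (auto simp: zero_boundary_def u_def tensor_def)
  moreover have "L2_norm open_square (\<lambda>p. Dx u p - kernel_x p) =
      L2_norm open_square (\<lambda>p. (\<Sum>i\<in>A. (sine_coeff i * nu (fst i)) * tensor (cosine (fst i)) (sine (snd i)) p) - kernel_x p)"
  proof (rule L2_norm_cong)
    fix p assume "p \<in> open_square"
    hence "p \<in> closed_square" using open_square_subset by blast
    thus "Dx u p - kernel_x p = (\<Sum>i\<in>A. (sine_coeff i * nu (fst i)) * tensor (cosine (fst i)) (sine (snd i)) p) - kernel_x p"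
      by (simp add: u(2) Dx_sine2 mult.assoc)
  qed
  moreover have "L2_norm open_square (\<lambda>p. Dy u p - kernel_y p) =
      L2_norm open_square (\<lambda>p. (\<Sum>i\<in>A. (sine_coeff i * nu (snd i)) * tensor (sine (fst i)) (cosine (snd i)) p) - kernel_y p)"
  proof (rule L2_norm_cong)
    fix p assume "p \<in> open_square"
    hence "p \<in> closed_square" using open_square_subset by blast
    thus "Dy u p - kernel_y p = (\<Sum>i\<in>A. (sine_coeff i * nu (snd i)) * tensor (sine (fst i)) (cosine (snd i)) p) - kernel_y p"
      by (simp add: u(3) Dy_sine2 mult.assoc)
  qed
  ultimately show "\<exists>u. C_infinity u \<and> zero_boundary u \<and> L2_norm open_square (\<lambda>p. u p - kernel p) < e \<and>
      L2_norm open_square (\<lambda>p. Dx u p - kernel_x p) < e \<and> L2_norm open_square (\<lambda>p. Dy u p - kernel_y p) < e"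
    using u(1) A(1-3) by (intro exI[of _ u]) (simp add: u_def)
qed

lemma kernel_uniform_ker_col:
  "uniform_limit closed_square (\<lambda>N p. \<Sum>m<N. tensor (ker_col m) (sine m) p) kernel sequentially"
proof -
  have s: "(\<lambda>i. \<bar>sine_coeff (prod.swap i)\<bar>) summable_on UNIV"
    using summable_on_swap[OF sine_coeff_summable(1)] by (simp add: case_prod_unfold prod.swap_def)
  have b: "\<bar>sine2 (prod.swap i) p\<bar> \<le> 1" for i p by (rule abs_sine2_le_1)
  have "((\<lambda>n. sine_coeff (prod.swap (m, n)) * sine2 (prod.swap (m, n)) p) has_sum tensor (ker_col m) (sine m) p) UNIV" for m p
  proof -
    have "((\<lambda>n. 2 * ker_coeff n m * sine n (fst p)) has_sum ker_col m (fst p)) UNIV"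
      unfolding ker_col_def by (rule sine_series_has_sum[OF summable_of_nu_weight[OF ker_coeff_col_summable(1)]])
    from has_sum_cmult_left[OF this, of "sine m (snd p)"]
    show ?thesis by (simp add: sine_coeff_def tensor_def mult.assoc)
  qed
  from iterated_series_uniform_limit[OF s b this]
  have "uniform_limit closed_square (\<lambda>N p. \<Sum>m<N. tensor (ker_col m) (sine m) p) (\<lambda>p. \<Sum>\<^sub>\<infinity>i. sine_coeff (prod.swap i) * sine2 (prod.swap i) p) sequentially" .
  moreover have "(\<Sum>\<^sub>\<infinity>i. sine_coeff (prod.swap i) * sine2 (prod.swap i) p) = kernel p" for p
    unfolding kernel_def by (rule infsum_reindex_bij_betw[of prod.swap UNIV UNIV "\<lambda>i. sine_coeff i * sine2 i p"]) simp
  ultimately show ?thesis by simp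
qed

lemma kernel_uniform_ker_row:
  "uniform_limit closed_square (\<lambda>N p. \<Sum>n<N. tensor (sine n) (ker_row n) p) kernel sequentially"
proof -
  have "((\<lambda>m. sine_coeff (n, m) * sine2 (n, m) p) has_sum tensor (sine n) (ker_row n) p) UNIV" for n p
  proof -
    have "((\<lambda>m. 2 * ker_coeff n m * sine m (snd p)) has_sum ker_row n (snd p)) UNIV"
      unfolding ker_row_def by (rule sine_series_has_sum[OF summable_of_nu_weight[OF summable_of_nu_weight[OF ker_coeff_row_summable(1)]]])
    from has_sum_cmult_right[OF this, of "sine n (fst p)"]
    show ?thesis by (simp add: sine_coeff_def tensor_def mult_ac)
  qed
  from iterated_series_uniform_limit[OF sine_coeff_summable(1) abs_sine2_le_1 this]
  show ?thesis by (simp add: kernel_def[abs_def])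
qed

lemma kernel_limit_ker_col: "(\<lambda>N. L2_norm open_square (\<lambda>p. (\<Sum>m<N. tensor (ker_col m) (sine m) p) - kernel p)) \<longlonglongrightarrow> 0"
  by (rule uniform_limit_L2_square[OF kernel_uniform_ker_col _ kernel_series(2)])
     (intro continuous_on_sum tensor_continuous ker_col_continuous sine_continuous)

lemma ker_row_continuous: "continuous_on A (ker_row n)"
  using ker_row_has_derivative by (meson DERIV_continuous_on has_field_derivative_at_within)

lemma kernel_limit_ker_row: "(\<lambda>N. L2_norm open_square (\<lambda>p. (\<Sum>n<N. tensor (sine n) (ker_row n) p) - kernel p)) \<longlonglongrightarrow> 0"
  by (rule uniform_limit_L2_square[OF kernel_uniform_ker_row _ kernel_series(2)])
     (intro continuous_on_sum tensor_continuous ker_row_continuous sine_continuous)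

text \<open>Each second derivative is expanded so that its coefficient functions are controlled:
  k_xx in sines and k_xy in cosines of y with parameter x, k_yy in sines of x with parameter y. The
  bounds are multiples of \<open>decay\<close>, square summable as the locale demands.\<close>

sublocale Sxx: L2_series sine ker_col2 "\<lambda>m. ker_col2_const * decay (real (Suc m))"
  by unfold_locales (auto intro: sine_continuous ker_col2_continuous ker_col2_bound decay_square_summable simp: trig_orthogonal simp del: of_nat_Suc)

sublocale Sxy: L2_series cosine "\<lambda>m x. nu m * ker_col1 m x" "\<lambda>m. (2 * pi\<^sup>2 * ker_const * dist_wt_sum) * decay (real (Suc m))"
  by unfold_locales (auto intro!: cosine_continuous ker_col1_continuous continuous_on_mult ker_col1_bound decay_square_summable simp: trig_orthogonal simp del: of_nat_Suc)

sublocale Syy: L2_series sine ker_row2 "\<lambda>m. (2 * pi\<^sup>2 * ker_const * dist_wt_sum) * decay (real (Suc m))"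
  by unfold_locales (auto intro: sine_continuous ker_row2_continuous ker_row2_bound decay_square_summable simp: trig_orthogonal simp del: of_nat_Suc)

lemma ker_col_vector_derivative: "(ker_col m has_vector_derivative ker_col1 m x) (at x within A)"
  using has_field_derivative_at_within[OF ker_col_has_derivative]
  by (simp add: has_real_derivative_iff_has_vector_derivative)

lemma kernel_weak_deriv_xx: "has_weak_deriv 2 0 kernel Sxx.w"
proof (rule has_weak_deriv_limit[OF sequentially_bot _ kernel_L2(1) Sxx.w_square(1) kernel_limit_ker_col Sxx.w_square(2)])
  fix N
  have "has_weak_deriv 2 0 (\<lambda>p. \<Sum>m<N. tensor (ker_col m) (sine m) p) (\<lambda>p. \<Sum>m<N. tensor (ker_col2 m) (sine m) p)"
    by (intro has_weak_deriv_sum has_weak_deriv_20[OF has_weak_deriv_tensor_x[OF ker_col_vector_derivative ker_col1_continuous sine_continuous]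
        has_weak_deriv_tensor_x[OF ker_col1_has_derivative ker_col2_continuous sine_continuous]])
  thus "has_weak_deriv 2 0 (\<lambda>p. \<Sum>m<N. tensor (ker_col m) (sine m) p) (\<lambda>p. Sxx.S N (fst p) (snd p))"
    by (simp add: Sxx.S_def tensor_def)
qed

lemma kernel_weak_deriv_xy: "has_weak_deriv 1 1 kernel Sxy.w"
proof (rule has_weak_deriv_limit[OF sequentially_bot _ kernel_L2(1) Sxy.w_square(1) kernel_limit_ker_col Sxy.w_square(2)])
  fix N
  have "has_weak_deriv 1 1 (\<lambda>p. \<Sum>m<N. tensor (ker_col m) (sine m) p) (\<lambda>p. \<Sum>m<N. tensor (ker_col1 m) (\<lambda>y. nu m * cosine m y) p)"
    by (intro has_weak_deriv_sum has_weak_deriv_compose[OF has_weak_deriv_tensor_x[OF ker_col_vector_derivative ker_col1_continuous sine_continuous]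
        has_weak_deriv_tensor_y[OF sine_vector_derivative continuous_on_mult[OF continuous_on_const cosine_continuous] ker_col1_continuous]])
  thus "has_weak_deriv 1 1 (\<lambda>p. \<Sum>m<N. tensor (ker_col m) (sine m) p) (\<lambda>p. Sxy.S N (fst p) (snd p))"
    by (simp add: Sxy.S_def tensor_def mult_ac)
qed

lemma kernel_weak_deriv_yy: "has_weak_deriv 0 2 kernel (\<lambda>p. Syy.w (prod.swap p))"
proof (rule has_weak_deriv_limit[OF sequentially_bot _ kernel_L2(1) Syy.w_square(3) kernel_limit_ker_row Syy.w_square(4)])
  fix N
  have ker_row: "(ker_row n has_vector_derivative ker_row1 n x) (at x within A)" "(ker_row1 n has_vector_derivative ker_row2 n x) (at x within A)" for n x A
    using has_field_derivative_at_within[OF ker_row_has_derivative] has_field_derivative_at_within[OF ker_row1_has_derivative]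
    by (simp_all add: has_real_derivative_iff_has_vector_derivative)
  have X1c: "continuous_on {0..1} (ker_row1 n)" for n using ker_row(2) by (rule continuous_on_vector_derivative)
  have "has_weak_deriv 0 2 (\<lambda>p. \<Sum>n<N. tensor (sine n) (ker_row n) p) (\<lambda>p. \<Sum>n<N. tensor (sine n) (ker_row2 n) p)"
    by (intro has_weak_deriv_sum has_weak_deriv_02[OF has_weak_deriv_tensor_y[OF ker_row(1) X1c sine_continuous]
        has_weak_deriv_tensor_y[OF ker_row(2) ker_row2_continuous sine_continuous]])
  thus "has_weak_deriv 0 2 (\<lambda>p. \<Sum>n<N. tensor (sine n) (ker_row n) p) (\<lambda>p. Syy.S N (snd p) (fst p))"
    by (simp add: Syy.S_def tensor_def mult.commute)
qed

lemma kernel_H2: "kernel \<in> H2"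
  unfolding H2_def
proof (intro CollectI allI impI)
  fix i j :: nat assume "i + j \<le> 2"
  then consider "i = 0" "j = 0" | "i = 1" "j = 0" | "i = 0" "j = 1" | "i = 1" "j = 1" | "i = 2" "j = 0" | "i = 0" "j = 2"
    by linarith
  thus "\<exists>w. has_weak_deriv i j kernel w"
    using has_weak_deriv_self[OF kernel_L2(1)] kernel_weak_deriv_x kernel_weak_deriv_y kernel_weak_deriv_xx kernel_weak_deriv_xy
      kernel_weak_deriv_yy by cases blast+
qed

lemma kernel_in_G: "kernel \<in> \<G>"
proof -
  \<comment> \<open>The rows have vanishing second derivatives at both ends, so every partial sum,
    and hence its pointwise limit, is 0 there.\<close>
  have zero: "Syy.w (0, x) = 0" "Syy.w (1, x) = 0" for x
    unfolding Syy.w_def Syy.S_def by (simp_all add: ker_row2_boundary)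
  have "\<exists>kxx g. has_weak_deriv 2 0 kernel kxx \<and> g \<in> C0_L2 \<and>
       (AE x in lebesgue_on unit_open. AE y in lebesgue_on unit_open. g x y = kxx (x, y))"
    by (intro exI[of _ Sxx.w] exI[of _ "\<lambda>x y. Sxx.w (x, y)"] conjI kernel_weak_deriv_xx Sxx.w_C0_L2) simp
  moreover have "\<exists>kyy h. has_weak_deriv 0 2 kernel kyy \<and> h \<in> C0_L2 \<and>
       (AE y in lebesgue_on unit_open. AE x in lebesgue_on unit_open. h y x = kyy (x, y)) \<and>
       (AE x in lebesgue_on unit_open. h 0 x = 0) \<and> (AE x in lebesgue_on unit_open. h 1 x = 0)"
    by (intro exI[of _ "\<lambda>p. Syy.w (prod.swap p)"] exI[of _ "\<lambda>x y. Syy.w (x, y)"] conjI kernel_weak_deriv_yy Syy.w_C0_L2)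
       (simp_all add: zero del: of_nat_Suc)
  ultimately show ?thesis using kernel_H2 kernel_H1_0 unfolding \<G>_def by blast
qed

end

section \<open>The kernel equation\<close>

definition coef :: "(real \<times> real \<Rightarrow> real) \<Rightarrow> nat \<times> nat \<Rightarrow> real"
  where "coef f i = (\<integral>p. f p * sine2 i p \<partial>lebesgue_on open_square)"

lemma coef_Dx2:
  assumes u: "C_infinity u" and zero: "\<And>y. y \<in> {0..1} \<Longrightarrow> u (0, y) = 0 \<and> u (1, y) = 0"
  shows "coef (Dx (Dx u)) (n, m) = - ((nu n)\<^sup>2 * coef u (n, m))"
proof -
  have 1: "(\<integral>p. tensor (sine n) (sine m) p * Dx (Dx u) p \<partial>lebesgue_on open_square) =
     - (\<integral>p. tensor (\<lambda>x. nu n * cosine n x) (sine m) p * Dx u p \<partial>lebesgue_on open_square)"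
    using integral_tensor_Dx[OF C_infinity_Dx[OF u] sine_vector_derivative, of n "sine m"]
    by (simp add: continuous_on_mult continuous_on_const cosine_continuous sine_continuous)
  have d: "((\<lambda>x. nu n * cosine n x) has_vector_derivative - ((nu n)\<^sup>2) * sine n x) (at x within {0..1})" for x
    using has_vector_derivative_mult_right[OF cosine_vector_derivative[of n x "{0..1}"], of "nu n"] by (simp add: power2_eq_square mult.assoc)
  have "(\<integral>p. tensor (\<lambda>x. nu n * cosine n x) (sine m) p * Dx u p \<partial>lebesgue_on open_square) =
     integral {0..1} (\<lambda>y. sine m y * (nu n * cosine n 1 * u (1, y) - nu n * cosine n 0 * u (0, y))) -
     (\<integral>p. tensor (\<lambda>x. - ((nu n)\<^sup>2) * sine n x) (sine m) p * u p \<partial>lebesgue_on open_square)"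
    by (rule integral_tensor_Dx[OF u d]) (intro continuous_on_mult continuous_on_const sine_continuous)+
  also have "integral {0..1} (\<lambda>y. sine m y * (nu n * cosine n 1 * u (1, y) - nu n * cosine n 0 * u (0, y))) = integral {0..1} (\<lambda>y::real. 0)"
    by (rule Henstock_Kurzweil_Integration.integral_cong) (use zero in auto)
  finally have 2: "(\<integral>p. tensor (\<lambda>x. nu n * cosine n x) (sine m) p * Dx u p \<partial>lebesgue_on open_square) =
     (nu n)\<^sup>2 * (\<integral>p. tensor (sine n) (sine m) p * u p \<partial>lebesgue_on open_square)"
    by (simp add: tensor_def mult.assoc)
  show ?thesis using 1 2 by (simp add: coef_def mult.commute)
qed

text \<open>Only the value at y = 1 is assumed to vanish. Applied to the second y-derivative of an
  element of \<open>\<E>\<close>, whose trace at y = 0 is free, the remaining boundary term is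
  essential.\<close>

lemma coef_Dy2:
  assumes u: "C_infinity u" and zero: "\<And>x. x \<in> {0..1} \<Longrightarrow> u (x, 1) = 0"
  shows "coef (Dy (Dy u)) (n, m) = nu m * integral {0..1} (\<lambda>x. sine n x * u (x, 0)) - (nu m)\<^sup>2 * coef u (n, m)"
proof -
  have 1: "(\<integral>p. tensor (sine n) (sine m) p * Dy (Dy u) p \<partial>lebesgue_on open_square) =
     - (\<integral>p. tensor (sine n) (\<lambda>x. nu m * cosine m x) p * Dy u p \<partial>lebesgue_on open_square)"
    using integral_tensor_Dy[OF C_infinity_Dy[OF u] sine_vector_derivative, of m "sine n"]
    by (simp add: continuous_on_mult continuous_on_const cosine_continuous sine_continuous)
  have d: "((\<lambda>x. nu m * cosine m x) has_vector_derivative - ((nu m)\<^sup>2) * sine m x) (at x within {0..1})" for x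
    using has_vector_derivative_mult_right[OF cosine_vector_derivative[of m x "{0..1}"], of "nu m"] by (simp add: power2_eq_square mult.assoc)
  have "(\<integral>p. tensor (sine n) (\<lambda>x. nu m * cosine m x) p * Dy u p \<partial>lebesgue_on open_square) =
     integral {0..1} (\<lambda>x. sine n x * (nu m * cosine m 1 * u (x, 1) - nu m * cosine m 0 * u (x, 0))) -
     (\<integral>p. tensor (sine n) (\<lambda>x. - ((nu m)\<^sup>2) * sine m x) p * u p \<partial>lebesgue_on open_square)"
    by (rule integral_tensor_Dy[OF u d]) (intro continuous_on_mult continuous_on_const sine_continuous)+
  also have "integral {0..1} (\<lambda>x. sine n x * (nu m * cosine m 1 * u (x, 1) - nu m * cosine m 0 * u (x, 0))) =
      integral {0..1} (\<lambda>x. - nu m * (sine n x * u (x, 0)))"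
    by (rule Henstock_Kurzweil_Integration.integral_cong) (use zero in auto)
  also have "\<dots> = - nu m * integral {0..1} (\<lambda>x. sine n x * u (x, 0))"
    by (rule integral_mult_right)
  finally have 2: "(\<integral>p. tensor (sine n) (\<lambda>x. nu m * cosine m x) p * Dy u p \<partial>lebesgue_on open_square) =
     - nu m * integral {0..1} (\<lambda>x. sine n x * u (x, 0)) + (nu m)\<^sup>2 * (\<integral>p. tensor (sine n) (sine m) p * u p \<partial>lebesgue_on open_square)"
    by (simp add: tensor_def mult.assoc mult.left_commute[of "sine n _"])
  show ?thesis using 1 2 by (simp add: coef_def mult.commute[of _ "tensor _ _ _"])
qed

lemma Dx_zero_on_horizontal:
  assumes "\<And>x. x \<in> {0..1} \<Longrightarrow> u (x, b) = 0" "x \<in> {0..1}"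
  shows "Dx u (x, b) = 0"
proof (rule Dx_eqI[OF assms(2)])
  show "((\<lambda>t. u (t, b)) has_vector_derivative 0) (at x within {0..1})"
    by (rule has_vector_derivative_transform[where f = "\<lambda>_. 0"]) (use assms in auto)
qed

lemma coef_bound:
  assumes "continuous_on closed_square f" "\<And>p. p \<in> closed_square \<Longrightarrow> \<bar>f p\<bar> \<le> B"
  shows "\<bar>coef f i\<bar> \<le> B"
proof -
  have L: "f \<in> L2 open_square" "sine2 i \<in> L2 open_square"
    using assms(1) continuous_sine2 by (auto intro: continuous_L2_square)
  have "\<bar>coef f i\<bar> \<le> L2_norm open_square f * L2_norm open_square (sine2 i)"
    unfolding coef_def by (rule L2_Cauchy_Schwarz[OF L])
  also have "\<dots> \<le> B * 1"
  proof (rule mult_mono)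
    show "L2_norm open_square f \<le> B"
      using assms(2) open_square_subset by (intro L2_norm_square_le_sup L) blast
    show "L2_norm open_square (sine2 i) \<le> 1"
      by (intro L2_norm_square_le_sup L abs_sine2_le_1)
    show "0 \<le> B" using assms(2)[of "(0, 0)"] by simp
  qed (rule L2_norm_nonneg)
  finally show ?thesis by simp
qed

lemma tensor_L2_norm:
  assumes "continuous_on {0..1} f" "continuous_on {0..1} g"
  shows "L2_norm open_square (tensor f g) = sqrt (integral {0..1} (\<lambda>x. (f x)\<^sup>2)) * sqrt (integral {0..1} (\<lambda>y. (g y)\<^sup>2))"
proof -
  have "(\<integral>p. (tensor f g p)\<^sup>2 \<partial>lebesgue_on open_square) = (\<integral>p. (f (fst p))\<^sup>2 * (g (snd p))\<^sup>2 \<partial>lebesgue_on open_square)"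
    by (simp add: tensor_def power_mult_distrib)
  also have "\<dots> = integral {0..1} (\<lambda>x. (f x)\<^sup>2) * integral {0..1} (\<lambda>y. (g y)\<^sup>2)"
    by (rule integral_square_product) (intro continuous_on_power assms)+
  finally show ?thesis by (simp add: L2_norm_def real_sqrt_mult)
qed

definition linN :: "nat \<Rightarrow> real \<Rightarrow> real" where "linN N x = (\<Sum>n<N. 2 / nu n * sine n x)"

lemma linN_continuous: "continuous_on A (linN N)"
  unfolding linN_def[abs_def] by (intro continuous_on_sum continuous_on_mult continuous_on_const sine_continuous)

text \<open>\<open>lin\<close> does not vanish at 0, so its sine series cannot converge uniformly on
  [0, 1]; L2 convergence suffices for pairings with L2 functions.\<close>

lemma lin_tensor_limit:
  assumes g: "continuous_on {0..1} g"
  shows "(\<lambda>N. L2_norm open_square (\<lambda>p. tensor (linN N) g p - tensor lin g p)) \<longlonglongrightarrow> 0"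
    "(\<lambda>N. L2_norm open_square (\<lambda>p. tensor g (linN N) p - tensor g lin p)) \<longlonglongrightarrow> 0"
proof -
  have lim: "(\<lambda>N. sqrt (integral {0..1} (\<lambda>x. (linN N x - lin x)\<^sup>2))) \<longlonglongrightarrow> 0"
    using tendsto_real_sqrt[OF lin_expansion_L2] by (simp add: linN_def)
  have c: "continuous_on {0..1} (\<lambda>x. linN N x - lin x)" for N
    by (intro continuous_on_diff linN_continuous lin_continuous)
  have e: "(\<lambda>p. tensor (linN N) g p - tensor lin g p) = tensor (\<lambda>x. linN N x - lin x) g"
    "(\<lambda>p. tensor g (linN N) p - tensor g lin p) = tensor g (\<lambda>x. linN N x - lin x)" for N
    by (auto simp: tensor_def left_diff_distrib right_diff_distrib)
  show "(\<lambda>N. L2_norm open_square (\<lambda>p. tensor (linN N) g p - tensor lin g p)) \<longlonglongrightarrow> 0"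
    unfolding e tensor_L2_norm[OF c g] using tendsto_mult_right[OF lim, of "sqrt (integral {0..1} (\<lambda>y. (g y)\<^sup>2))"] by simp
  show "(\<lambda>N. L2_norm open_square (\<lambda>p. tensor g (linN N) p - tensor g lin p)) \<longlonglongrightarrow> 0"
    unfolding e tensor_L2_norm[OF g c] using tendsto_mult_left[OF lim, of "sqrt (integral {0..1} (\<lambda>y. (g y)\<^sup>2))"] by simp
qed

lemma lin_tensor_sums:
  assumes h: "h \<in> L2 open_square"
  shows "(\<lambda>n. 2 / nu n * coef h (n, m)) sums (\<integral>p. h p * tensor lin (sine m) p \<partial>lebesgue_on open_square)"
    "(\<lambda>n. 2 / nu n * coef h (m, n)) sums (\<integral>p. h p * tensor (sine m) lin p \<partial>lebesgue_on open_square)"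
proof -
  have i: "integrable (lebesgue_on open_square) (\<lambda>p. h p * sine2 j p)" for j
    by (rule L2_mult_integrable[OF h continuous_L2_square[OF continuous_sine2]])
  have sumint: "(\<integral>p. (\<Sum>n<N. 2 / nu n * (h p * sine2 (f n) p)) \<partial>lebesgue_on open_square) = (\<Sum>n<N. 2 / nu n * coef h (f n))" for N f
    unfolding coef_def using i by (subst Bochner_Integration.integral_sum) auto
  have "(\<lambda>N. \<integral>p. h p * tensor (linN N) (sine m) p \<partial>lebesgue_on open_square) \<longlonglongrightarrow> (\<integral>p. h p * tensor lin (sine m) p \<partial>lebesgue_on open_square)"
    by (intro L2_weak_limit[OF h _ _ lin_tensor_limit(1)] continuous_L2_square tensor_continuous linN_continuous lin_continuous sine_continuous)
  moreover have "h p * tensor (linN N) (sine m) p = (\<Sum>n<N. 2 / nu n * (h p * sine2 (n, m) p))" for p N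
    by (simp add: tensor_def linN_def sum_distrib_left sum_distrib_right mult_ac)
  ultimately show "(\<lambda>n. 2 / nu n * coef h (n, m)) sums (\<integral>p. h p * tensor lin (sine m) p \<partial>lebesgue_on open_square)"
    using sumint[where f = "\<lambda>n. (n, m)"] by (simp add: sums_def)
  have "(\<lambda>N. \<integral>p. h p * tensor (sine m) (linN N) p \<partial>lebesgue_on open_square) \<longlonglongrightarrow> (\<integral>p. h p * tensor (sine m) lin p \<partial>lebesgue_on open_square)"
    by (intro L2_weak_limit[OF h _ _ lin_tensor_limit(2)] continuous_L2_square tensor_continuous linN_continuous lin_continuous sine_continuous)
  moreover have "h p * tensor (sine m) (linN N) p = (\<Sum>n<N. 2 / nu n * (h p * sine2 (m, n) p))" for p N
    by (simp add: tensor_def linN_def sum_distrib_left sum_distrib_right mult_ac)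
  ultimately show "(\<lambda>n. 2 / nu n * coef h (m, n)) sums (\<integral>p. h p * tensor (sine m) lin p \<partial>lebesgue_on open_square)"
    using sumint[where f = "\<lambda>n. (m, n)"] by (simp add: sums_def)
qed

definition kernel_op :: "real \<Rightarrow> real \<Rightarrow> (real \<times> real \<Rightarrow> real) \<Rightarrow> real \<times> real \<Rightarrow> real"
  where "kernel_op lam a \<rho> p = (Dx ^^ 4) \<rho> p + lam * (Dx ^^ 2) \<rho> p - (Dy ^^ 4) \<rho> p - lam * (Dy ^^ 2) \<rho> p + a * \<rho> p"

lemma kernel_op_continuous: "C_infinity \<rho> \<Longrightarrow> continuous_on closed_square (kernel_op lam a \<rho>)"
  unfolding kernel_op_def[abs_def]
  by (intro continuous_on_add continuous_on_diff continuous_on_mult continuous_on_const C_infinity_continuous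
      C_infinity_Dx_pow C_infinity_Dy_pow)

section \<open>Sine coefficients of the functions in \<open>\<E>\<close>\<close>

locale test_data =
  fixes \<rho> :: "real \<times> real \<Rightarrow> real"
  assumes \<rho>_E: "\<rho> \<in> \<E>"
begin

lemma smooth: "C_infinity \<rho>" using \<rho>_E by (simp add: \<E>_def)

lemma boundary:
  assumes "t \<in> {0..1}"
  shows "\<rho> (0, t) = 0" "\<rho> (1, t) = 0" "\<rho> (t, 0) = 0" "\<rho> (t, 1) = 0"
    "Dx \<rho> (0, t) = 0" "Dx (Dx \<rho>) (0, t) = 0" "Dx (Dx \<rho>) (1, t) = 0" "Dy (Dy \<rho>) (t, 1) = 0"
  using \<rho>_E assms by (auto simp: \<E>_def numeral_2_eq_2)

text \<open>The sine coefficients of the trace of \<rho>_yy at y = 0, which \<open>\<E>\<close>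
  leaves free. They act as multipliers that enforce k_y(x, 0) = 0.\<close>

definition trace_coeff :: "nat \<Rightarrow> real" where "trace_coeff n = integral {0..1} (\<lambda>x. sine n x * Dy (Dy \<rho>) (x, 0))"

lemma coef_derivs:
  "coef ((Dx ^^ 2) \<rho>) (n, m) = - ((nu n)\<^sup>2 * coef \<rho> (n, m))"
  "coef ((Dx ^^ 4) \<rho>) (n, m) = nu n ^ 4 * coef \<rho> (n, m)"
  "coef ((Dy ^^ 2) \<rho>) (n, m) = - ((nu m)\<^sup>2 * coef \<rho> (n, m))"
  "coef ((Dy ^^ 4) \<rho>) (n, m) = nu m * trace_coeff n + nu m ^ 4 * coef \<rho> (n, m)"
proof -
  have x2: "coef (Dx (Dx \<rho>)) (n, m) = - ((nu n)\<^sup>2 * coef \<rho> (n, m))"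
    by (rule coef_Dx2[OF smooth]) (simp add: boundary)
  thus "coef ((Dx ^^ 2) \<rho>) (n, m) = - ((nu n)\<^sup>2 * coef \<rho> (n, m))" by (simp add: numeral_2_eq_2)
  have "coef (Dx (Dx (Dx (Dx \<rho>)))) (n, m) = - ((nu n)\<^sup>2 * coef (Dx (Dx \<rho>)) (n, m))"
    by (rule coef_Dx2[OF C_infinity_Dx[OF C_infinity_Dx[OF smooth]]]) (simp add: boundary)
  thus "coef ((Dx ^^ 4) \<rho>) (n, m) = nu n ^ 4 * coef \<rho> (n, m)"
    unfolding x2 by (simp add: eval_nat_numeral)
  have "integral {0..1} (\<lambda>x. sine n x * \<rho> (x, 0)) = integral {0..1} (\<lambda>x::real. 0)"
    by (rule Henstock_Kurzweil_Integration.integral_cong) (simp add: boundary)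
  moreover have "coef (Dy (Dy \<rho>)) (n, m) = nu m * integral {0..1} (\<lambda>x. sine n x * \<rho> (x, 0)) - (nu m)\<^sup>2 * coef \<rho> (n, m)"
    by (rule coef_Dy2[OF smooth]) (simp add: boundary)
  ultimately have y2: "coef (Dy (Dy \<rho>)) (n, m) = - ((nu m)\<^sup>2 * coef \<rho> (n, m))" by simp
  thus "coef ((Dy ^^ 2) \<rho>) (n, m) = - ((nu m)\<^sup>2 * coef \<rho> (n, m))" by (simp add: numeral_2_eq_2)
  have "coef (Dy (Dy (Dy (Dy \<rho>)))) (n, m) = nu m * trace_coeff n - (nu m)\<^sup>2 * coef (Dy (Dy \<rho>)) (n, m)"
    unfolding trace_coeff_def by (rule coef_Dy2[OF C_infinity_Dy[OF C_infinity_Dy[OF smooth]]]) (simp add: boundary)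
  thus "coef ((Dy ^^ 4) \<rho>) (n, m) = nu m * trace_coeff n + nu m ^ 4 * coef \<rho> (n, m)"
    unfolding y2 by (simp add: eval_nat_numeral)
qed

lemma coef_kernel_op:
  "coef (kernel_op lam a \<rho>) (n, m) = (beta lam n - beta lam m + a) * coef \<rho> (n, m) - nu m * trace_coeff n"
proof -
  have i: "integrable (lebesgue_on open_square) (\<lambda>p. f p * sine2 (n, m) p)" if "C_infinity f" for f
    by (intro continuous_integrable_square continuous_on_mult C_infinity_continuous that continuous_sine2)
  note ii = i[OF C_infinity_Dx_pow[OF smooth, of 4]] i[OF C_infinity_Dx_pow[OF smooth, of 2]]
    i[OF C_infinity_Dy_pow[OF smooth, of 4]] i[OF C_infinity_Dy_pow[OF smooth, of 2]] i[OF smooth]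
  have "coef (kernel_op lam a \<rho>) (n, m) = (\<integral>p. (Dx ^^ 4) \<rho> p * sine2 (n, m) p + lam * ((Dx ^^ 2) \<rho> p * sine2 (n, m) p)
     - (Dy ^^ 4) \<rho> p * sine2 (n, m) p - lam * ((Dy ^^ 2) \<rho> p * sine2 (n, m) p) + a * (\<rho> p * sine2 (n, m) p) \<partial>lebesgue_on open_square)"
    unfolding coef_def kernel_op_def by (rule arg_cong[where f = "integral\<^sup>L _"]) (simp add: fun_eq_iff algebra_simps)
  also have "\<dots> = coef ((Dx ^^ 4) \<rho>) (n, m) + lam * coef ((Dx ^^ 2) \<rho>) (n, m) - coef ((Dy ^^ 4) \<rho>) (n, m)
      - lam * coef ((Dy ^^ 2) \<rho>) (n, m) + a * coef \<rho> (n, m)"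
    unfolding coef_def using ii by simp
  finally show ?thesis unfolding coef_derivs beta_def by (simp add: algebra_simps)
qed

text \<open>Four integrations by parts in x are free of boundary terms, since \<rho> and \<rho>_xx
  vanish at both ends. Two more in y follow because \<rho>_xxxx vanishes with \<rho> along y = 0 and
  y = 1; a further pair would meet the free trace of \<rho>_yy.\<close>

lemma coef_decay: "\<exists>B>0. \<forall>n m. \<bar>coef \<rho> (n, m)\<bar> \<le> B / (nu n ^ 4 * (nu m)\<^sup>2)"
proof -
  define v where "v = Dx (Dx (Dx (Dx \<rho>)))"
  have v: "C_infinity v" unfolding v_def by (intro C_infinity_Dx smooth)
  have vz: "v (x, 0) = 0" "v (x, 1) = 0" if "x \<in> {0..1}" for x
    unfolding v_def by (intro Dx_zero_on_horizontal that boundary; assumption)+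
  obtain B where B: "B > 0" "\<And>p. p \<in> closed_square \<Longrightarrow> \<bar>Dy (Dy v) p\<bar> \<le> B"
    using continuous_bounded_square[OF C_infinity_continuous[OF C_infinity_Dy[OF C_infinity_Dy[OF v]]]] by blast
  have "\<bar>coef \<rho> (n, m)\<bar> \<le> B / (nu n ^ 4 * (nu m)\<^sup>2)" for n m
  proof -
    have "integral {0..1} (\<lambda>x. sine n x * v (x, 0)) = integral {0..1} (\<lambda>x::real. 0)"
      by (rule Henstock_Kurzweil_Integration.integral_cong) (simp add: vz)
    hence "coef (Dy (Dy v)) (n, m) = - ((nu m)\<^sup>2 * coef v (n, m))"
      using coef_Dy2[OF v, of n m] vz by simp
    also have "coef v (n, m) = nu n ^ 4 * coef \<rho> (n, m)"
      using coef_derivs(2) by (simp add: v_def eval_nat_numeral)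
    finally have "\<bar>coef (Dy (Dy v)) (n, m)\<bar> = (nu n ^ 4 * (nu m)\<^sup>2) * \<bar>coef \<rho> (n, m)\<bar>"
      by (simp add: abs_mult)
    moreover have "\<bar>coef (Dy (Dy v)) (n, m)\<bar> \<le> B"
      by (rule coef_bound[OF C_infinity_continuous[OF C_infinity_Dy[OF C_infinity_Dy[OF v]]] B(2)])
    moreover have "nu n ^ 4 * (nu m)\<^sup>2 > 0" using nu_pos by simp
    ultimately show ?thesis by (simp add: pos_le_divide_eq mult.commute)
  qed
  thus ?thesis using B(1) by blast
qed

lemma square_weights_summable: "(\<lambda>i. C * (1 / (nu (fst i))\<^sup>2 * (1 / (nu (snd i))\<^sup>2))) summable_on (UNIV :: (nat \<times> nat) set)"
proof -
  have s: "(\<lambda>n. 1 / (nu n)\<^sup>2) summable_on UNIV"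
  proof (subst summable_on_UNIV_nonneg_real_iff)
    have "summable (\<lambda>n. 1 / pi\<^sup>2 * (1 / (real n + 1)\<^sup>2))"
      using inverse_squares_sums by (intro summable_mult) (auto simp: sums_iff add.commute)
    moreover have "1 / pi\<^sup>2 * (1 / (real n + 1)\<^sup>2) = 1 / (nu n)\<^sup>2" for n
      by (simp add: nu_def power_mult_distrib add.commute mult.commute)
    ultimately show "summable (\<lambda>n. 1 / (nu n)\<^sup>2)" by simp
  qed auto
  have "(\<lambda>i. 1 / (nu (fst i))\<^sup>2 * (1 / (nu (snd i))\<^sup>2)) summable_on (UNIV \<times> UNIV :: (nat \<times> nat) set)"
  proof (rule summable_on_SigmaI[where g = "\<lambda>n. 1 / (nu n)\<^sup>2 * (\<Sum>\<^sub>\<infinity>m. 1 / (nu m)\<^sup>2)"])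
    show "((\<lambda>m. 1 / (nu (fst (n, m)))\<^sup>2 * (1 / (nu (snd (n, m)))\<^sup>2)) has_sum 1 / (nu n)\<^sup>2 * (\<Sum>\<^sub>\<infinity>m. 1 / (nu m)\<^sup>2)) UNIV" for n
      using has_sum_cmult_right[OF has_sum_infsum[OF s], of "1 / (nu n)\<^sup>2"] by simp
    show "(\<lambda>n. 1 / (nu n)\<^sup>2 * (\<Sum>\<^sub>\<infinity>m. 1 / (nu m)\<^sup>2)) summable_on UNIV" by (rule summable_on_cmult_left[OF s])
  qed simp
  thus ?thesis using summable_on_cmult_right by fastforce
qed

lemma coef_summable:
  "(\<lambda>i. \<bar>coef \<rho> i\<bar>) summable_on UNIV" "(\<lambda>i. \<bar>nu (fst i) * coef \<rho> i\<bar>) summable_on UNIV"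
proof -
  obtain B where B: "B > 0" "\<And>n m. \<bar>coef \<rho> (n, m)\<bar> \<le> B / (nu n ^ 4 * (nu m)\<^sup>2)" using coef_decay by blast
  have bnd: "nu (fst i) * \<bar>coef \<rho> i\<bar> \<le> B * (1 / (nu (fst i))\<^sup>2 * (1 / (nu (snd i))\<^sup>2))" for i
  proof -
    obtain n m where i: "i = (n, m)" by (cases i)
    have "nu n * \<bar>coef \<rho> (n, m)\<bar> \<le> nu n * (B / (nu n ^ 4 * (nu m)\<^sup>2))"
      using B nu_pos[of n] by (intro mult_left_mono) auto
    also have "\<dots> = B / (nu n ^ 3 * (nu m)\<^sup>2)" by (simp add: power3_eq_cube power4_eq_xxxx)
    also have "\<dots> \<le> B / ((nu n)\<^sup>2 * (nu m)\<^sup>2)"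
      using B nu_pos nu_ge_1[of n] by (intro divide_left_mono mult_right_mono power_increasing) auto
    finally show ?thesis by (simp add: i)
  qed
  have "norm \<bar>nu (fst i) * coef \<rho> i\<bar> \<le> B * (1 / (nu (fst i))\<^sup>2 * (1 / (nu (snd i))\<^sup>2))" for i
    using bnd[of i] nu_pos[of "fst i"] by (simp add: abs_mult)
  from Infinite_Sum.abs_summable_on_comparison_test'[OF square_weights_summable this]
  show 2: "(\<lambda>i. \<bar>nu (fst i) * coef \<rho> i\<bar>) summable_on UNIV" by simp
  have "norm (coef \<rho> i) \<le> \<bar>nu (fst i) * coef \<rho> i\<bar>" for i
    using mult_right_mono[OF nu_ge_1, of "\<bar>coef \<rho> i\<bar>" "fst i"] nu_pos[of "fst i"] by (simp add: abs_mult)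
  from Infinite_Sum.abs_summable_on_comparison_test'[OF 2 this]
  show "(\<lambda>i. \<bar>coef \<rho> i\<bar>) summable_on UNIV" by simp
qed

text \<open>The sine series of \<rho> converges uniformly, hence also on the diagonal, where
  orthogonality removes the terms with distinct indices. The 2 is the 4 of the expansion times the
  squared norm 1/2 of a sine.\<close>

lemma diagonal_has_sum:
  "((\<lambda>i. if fst i = snd i then 2 * coef \<rho> i else 0) has_sum integral {0..1} (\<lambda>x. \<rho> (x, x))) UNIV"
proof -
  define c where "c = (\<lambda>i. 4 * coef \<rho> i)"
  have cs: "(\<lambda>i. \<bar>c i\<bar>) summable_on UNIV"
    unfolding c_def abs_mult using coef_summable(1) by (intro summable_on_cmult_right)
  note series = abs_summable_series_square[where F = "\<lambda>i. sine2 i", OF cs continuous_sine2 abs_sine2_le_1]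
  have eq: "\<rho> p = (\<Sum>\<^sub>\<infinity>i. c i * sine2 i p)" if "p \<in> closed_square" for p
    using sine_expansion_square[OF C_infinity_continuous[OF smooth] _ that] coef_summable(1) by (simp add: c_def coef_def)
  have ul: "uniform_limit {0..1} (\<lambda>X x. \<Sum>i\<in>X. c i * sine2 i (x, x)) (\<lambda>x. \<rho> (x, x)) (finite_subsets_at_top UNIV)"
  proof (rule uniform_limitI)
    fix e :: real assume "e > 0"
    from uniform_limitD[OF series(1) this]
    show "\<forall>\<^sub>F X in finite_subsets_at_top UNIV. \<forall>x\<in>{0..1}. dist (\<Sum>i\<in>X. c i * sine2 i (x, x)) (\<rho> (x, x)) < e"
    proof eventually_elim
      case (elim X)
      show ?case
      proof
        fix x :: real assume "x \<in> {0..1}"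
        hence "(x, x) \<in> closed_square" by simp
        thus "dist (\<Sum>i\<in>X. c i * sine2 i (x, x)) (\<rho> (x, x)) < e" using elim eq by fastforce
      qed
    qed
  qed
  have cont: "continuous_on {0..1} (\<lambda>x. sine (fst i) x * sine (snd i) x)" for i :: "nat \<times> nat"
    by (intro continuous_on_mult sine_continuous)
  obtain I J where IJ: "\<And>X. ((\<lambda>x. \<Sum>i\<in>X. c i * sine2 i (x, x)) has_integral I X) {0..1}"
    "((\<lambda>x. \<rho> (x, x)) has_integral J) {0..1}" "(I \<longlongrightarrow> J) (finite_subsets_at_top UNIV)"
  proof (rule uniform_limit_integral[OF ul])
    show "continuous_on {0..1} (\<lambda>x. \<Sum>i\<in>X. c i * sine2 i (x, x))" for X
      unfolding tensor_def fst_conv snd_conv by (intro continuous_on_sum continuous_on_mult continuous_on_const sine_continuous)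
  qed auto
  have "I X = (\<Sum>i\<in>X. if fst i = snd i then 2 * coef \<rho> i else 0)" if "finite X" for X
  proof -
    have "I X = integral {0..1} (\<lambda>x. \<Sum>i\<in>X. c i * (sine (fst i) x * sine (snd i) x))"
      using integral_unique[OF IJ(1)[of X]] by (simp add: tensor_def)
    also have "\<dots> = (\<Sum>i\<in>X. integral {0..1} (\<lambda>x. c i * (sine (fst i) x * sine (snd i) x)))"
      by (rule integral_sum[OF that]) (intro integrable_continuous_real continuous_on_mult continuous_on_const sine_continuous)
    also have "\<dots> = (\<Sum>i\<in>X. if fst i = snd i then 2 * coef \<rho> i else 0)"
      by (rule sum.cong) (auto simp: trig_orthogonal c_def)
    finally show ?thesis .
  qed
  hence "\<forall>\<^sub>F X in finite_subsets_at_top UNIV. I X = (\<Sum>i\<in>X. if fst i = snd i then 2 * coef \<rho> i else 0)"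
    by (intro eventually_finite_subsets_at_top_weakI)
  from Lim_transform_eventually[OF IJ(3) this] show ?thesis
    unfolding has_sum_def using integral_unique[OF IJ(2)] by simp
qed

text \<open>This is \<rho>_x(0, y) = 0 in terms of coefficients. It is obtained by pairing \<rho>_xx
  with 1 - x: two integrations by parts leave nothing, while the coefficients 1 / nu n of 1 - x
  reduce nu n^2 to nu n.\<close>

lemma coef_column_sums: "(\<lambda>n. nu n * coef \<rho> (n, m)) sums 0"
proof -
  have h: "Dx (Dx \<rho>) \<in> L2 open_square"
    by (intro continuous_L2_square C_infinity_continuous C_infinity_Dx smooth)
  have "(\<integral>p. tensor lin (sine m) p * Dx (Dx \<rho>) p \<partial>lebesgue_on open_square) =
      integral {0..1} (\<lambda>y. sine m y * (lin 1 * Dx \<rho> (1, y) - lin 0 * Dx \<rho> (0, y))) -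
      (\<integral>p. tensor (\<lambda>x. - 1) (sine m) p * Dx \<rho> p \<partial>lebesgue_on open_square)"
    by (rule integral_tensor_Dx[OF C_infinity_Dx[OF smooth]])
       (use lin_has_derivative in \<open>auto simp: has_real_derivative_iff_has_vector_derivative sine_continuous\<close>)
  also have "integral {0..1} (\<lambda>y. sine m y * (lin 1 * Dx \<rho> (1, y) - lin 0 * Dx \<rho> (0, y))) = integral {0..1} (\<lambda>y::real. 0)"
    by (rule Henstock_Kurzweil_Integration.integral_cong) (simp add: boundary lin_def)
  also have "(\<integral>p. tensor (\<lambda>x. - 1) (sine m) p * Dx \<rho> p \<partial>lebesgue_on open_square) =
      integral {0..1} (\<lambda>y. sine m y * (- 1 * \<rho> (1, y) - - 1 * \<rho> (0, y))) -
      (\<integral>p. tensor (\<lambda>x. 0) (sine m) p * \<rho> p \<partial>lebesgue_on open_square)"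
    by (rule integral_tensor_Dx[OF smooth]) (auto simp: sine_continuous)
  also have "integral {0..1} (\<lambda>y. sine m y * (- 1 * \<rho> (1, y) - - 1 * \<rho> (0, y))) = integral {0..1} (\<lambda>y::real. 0)"
    by (rule Henstock_Kurzweil_Integration.integral_cong) (simp add: boundary)
  also have "(\<lambda>p. tensor (\<lambda>x. 0) (sine m) p * \<rho> p) = (\<lambda>p. 0)" by (simp add: tensor_def)
  finally have "(\<integral>p. Dx (Dx \<rho>) p * tensor lin (sine m) p \<partial>lebesgue_on open_square) = 0"
    by (simp add: mult.commute)
  with lin_tensor_sums(1)[OF h, of m] have "(\<lambda>n. 2 / nu n * coef (Dx (Dx \<rho>)) (n, m)) sums 0" by simp
  from sums_mult[OF this, of "-1/2"]
  have "(\<lambda>n. - 1 / 2 * (2 / nu n * coef (Dx (Dx \<rho>)) (n, m))) sums 0" by simp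
  moreover have "- 1 / 2 * (2 / nu n * coef (Dx (Dx \<rho>)) (n, m)) = nu n * coef \<rho> (n, m)" for n
    using coef_derivs(1)[of n m] by (simp add: numeral_2_eq_2 power2_eq_square)
  ultimately show ?thesis by simp
qed

end

context nonresonant begin

lemma kernel_equation:
  assumes "\<rho> \<in> \<E>"
  shows "(\<integral>p. kernel_op lam a \<rho> p * kernel p \<partial>lebesgue_on open_square) = (\<integral>x. a * \<rho> (x, x) \<partial>lebesgue_on unit_open)"
proof -
  interpret test_data \<rho> by unfold_locales (rule assms)
  have h: "kernel_op lam a \<rho> \<in> L2 open_square" by (rule continuous_L2_square[OF kernel_op_continuous[OF smooth]])
  have total: "((\<lambda>i. sine_coeff i * coef (kernel_op lam a \<rho>) i) has_sum (\<integral>p. kernel_op lam a \<rho> p * kernel p \<partial>lebesgue_on open_square)) UNIV"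
    using kernel_series(4)[OF h] by (simp add: coef_def)
  define tA where "tA = (\<lambda>i. if fst i = snd i then 2 * coef \<rho> i else 0)"
  define tB where "tB = (\<lambda>i. 2 * (cauchy_wt (snd i) / nu (snd i)) * (nu (fst i) * coef \<rho> i))"
  define tC where "tC = (\<lambda>i. sine_coeff i * nu (snd i) * trace_coeff (fst i))"
  \<comment> \<open>Multiplying by the gap undoes the denominator of \<open>ker_coeff\<close> and
    leaves the Dirac part \<open>tA\<close> and the multiplier part \<open>tB\<close>;
    \<open>tC\<close> comes from the trace of \<rho>_yy. Only \<open>tA\<close> contributes to the
    sum.\<close>
  have split: "sine_coeff i * coef (kernel_op lam a \<rho>) i = a * tA i + tB i + (- 1) * tC i" for i
  proof -
    obtain n m where i: "i = (n, m)" by (cases i)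
    have "real (Suc n) / real (Suc m) = nu n / nu m" by (simp add: nu_def)
    hence g: "gap n m * ker_coeff n m = (if n = m then a else 0) + cauchy_wt m * (nu n / nu m)" by (simp only: ker_coeff_gap)
    have "sine_coeff i * coef (kernel_op lam a \<rho>) i = 2 * (gap n m * ker_coeff n m) * coef \<rho> i - sine_coeff i * nu m * trace_coeff n"
      unfolding i coef_kernel_op by (simp add: sine_coeff_def gap_def algebra_simps)
    thus ?thesis unfolding g tA_def tB_def tC_def i by (simp add: algebra_simps)
  qed
  have A: "(tA has_sum integral {0..1} (\<lambda>x. \<rho> (x, x))) UNIV"
    unfolding tA_def by (rule diagonal_has_sum)
  \<comment> \<open>column sums vanish because of \<open>\<rho>\<^sub>x(0, y) = 0\<close>\<close>
  have B: "(tB has_sum 0) UNIV"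
  proof -
    define K where "K = 2 * (\<bar>a\<bar> * (1 + cauchy_bound * exp cauchy_bound))"
    have "norm (tB i) \<le> K * \<bar>nu (fst i) * coef \<rho> i\<bar>" for i
    proof -
      have "\<bar>cauchy_wt (snd i)\<bar> / nu (snd i) \<le> \<bar>cauchy_wt (snd i)\<bar> / 1"
        using nu_ge_1 nu_pos by (intro divide_left_mono) auto
      hence "2 * \<bar>cauchy_wt (snd i) / nu (snd i)\<bar> \<le> K"
        using cauchy_wt_bounded[of "snd i"] nu_pos[of "snd i"] by (simp add: K_def)
      from mult_right_mono[OF this, of "\<bar>nu (fst i) * coef \<rho> i\<bar>"] show ?thesis by (simp add: tB_def abs_mult)
    qed
    from Infinite_Sum.abs_summable_on_comparison_test'[OF summable_on_cmult_right[OF coef_summable(2)] this]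
    have s: "tB summable_on UNIV" by (rule Infinite_Sum.abs_summable_summable)
    have s2: "(\<lambda>i. \<bar>nu (snd i) * coef \<rho> (snd i, fst i)\<bar>) summable_on UNIV"
      using summable_on_swap[OF coef_summable(2)] by (simp add: case_prod_unfold)
    have col: "((\<lambda>n. nu n * coef \<rho> (n, m)) has_sum 0) UNIV" for m
    proof -
      have "(\<lambda>n. \<bar>nu n * coef \<rho> (n, m)\<bar>) summable_on UNIV"
        using abs_summable_sections(1)[OF s2, of m] by simp
      hence "(\<lambda>n. nu n * coef \<rho> (n, m)) summable_on UNIV"
        using Infinite_Sum.abs_summable_summable[of "\<lambda>n. nu n * coef \<rho> (n, m)" UNIV] by simp
      from has_sum_infsum[OF this] has_sum_imp_sums[OF has_sum_infsum[OF this]] coef_column_sums[of m]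
      show ?thesis using sums_unique2 by metis
    qed
    have "((\<lambda>(m, n). tB (n, m)) has_sum infsum tB UNIV) UNIV" by (rule has_sum_swap[OF has_sum_infsum[OF s]])
    moreover have "((\<lambda>n. (\<lambda>(m, n). tB (n, m)) (m, n)) has_sum 0) UNIV" for m
      using has_sum_cmult_right[OF col[of m], of "2 * (cauchy_wt m / nu m)"] by (simp add: tB_def)
    ultimately have "((\<lambda>m::nat. 0) has_sum infsum tB UNIV) UNIV" by (rule has_sum_iterated)
    hence "infsum tB UNIV = 0" by (rule has_sum_unique[OF _ has_sum_0]) simp
    thus ?thesis using has_sum_infsum[OF s] by simp
  qed
  \<comment> \<open>row sums vanish because the coefficients \<open>cauchy_wt\<close> were chosen such that \<open>k\<^sub>y(x, 0) = 0\<close>\<close>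
  have C: "(tC has_sum 0) UNIV"
  proof -
    have cg: "continuous_on {0..1} (\<lambda>x. Dy (Dy \<rho>) (x, 0))"
      by (rule continuous_on_slice(1)[OF C_infinity_continuous[OF C_infinity_Dy[OF C_infinity_Dy[OF smooth]]]]) simp
    obtain K where K: "K > 0" "\<And>p. p \<in> closed_square \<Longrightarrow> \<bar>Dy (Dy \<rho>) p\<bar> \<le> K"
      using continuous_bounded_square[OF C_infinity_continuous[OF C_infinity_Dy[OF C_infinity_Dy[OF smooth]]]] by blast
    have trace_coeff: "\<bar>trace_coeff n\<bar> \<le> K" for n
    proof -
      have "norm (integral {0..1} (\<lambda>x. sine n x * Dy (Dy \<rho>) (x, 0))) \<le> K * (1 - 0)"
      proof (rule integral_bound)
        fix x :: real assume "x \<in> {0..1}"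
        hence "\<bar>sine n x\<bar> * \<bar>Dy (Dy \<rho>) (x, 0)\<bar> \<le> 1 * K" by (intro mult_mono abs_sine_le_1 K) auto
        thus "norm (sine n x * Dy (Dy \<rho>) (x, 0)) \<le> K" by (simp add: abs_mult)
      qed (auto intro!: continuous_on_mult sine_continuous cg)
      thus ?thesis by (simp add: trace_coeff_def)
    qed
    have "norm (tC i) \<le> K * \<bar>sine_coeff i * nu (snd i)\<bar>" for i
      using mult_left_mono[OF trace_coeff[of "fst i"], of "\<bar>sine_coeff i * nu (snd i)\<bar>"] by (simp add: tC_def abs_mult mult_ac)
    from Infinite_Sum.abs_summable_on_comparison_test'[OF summable_on_cmult_right[OF sine_coeff_summable(3)] this]
    have s: "tC summable_on UNIV" by (rule Infinite_Sum.abs_summable_summable)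
    have row: "((\<lambda>m. sine_coeff (n, m) * nu m) has_sum 0) UNIV" for n
    proof -
      have "(\<lambda>m. \<bar>sine_coeff (n, m) * nu m\<bar>) summable_on UNIV"
        using abs_summable_sections(1)[OF sine_coeff_summable(3), of n] by simp
      hence sm: "(\<lambda>m. sine_coeff (n, m) * nu m) summable_on UNIV"
        using Infinite_Sum.abs_summable_summable[of "\<lambda>m. sine_coeff (n, m) * nu m" UNIV] by simp
      have "(\<lambda>m. 2 * pi * (real (Suc m) * ker_coeff n m)) sums (2 * pi * 0)" by (rule sums_mult[OF ker_coeff_row_sums])
      moreover have "2 * pi * (real (Suc m) * ker_coeff n m) = sine_coeff (n, m) * nu m" for m by (simp add: sine_coeff_def nu_def)
      ultimately have "(\<lambda>m. sine_coeff (n, m) * nu m) sums 0" by simp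
      with has_sum_imp_sums[OF has_sum_infsum[OF sm]] has_sum_infsum[OF sm] show ?thesis using sums_unique2 by metis
    qed
    have "((\<lambda>m. tC (n, m)) has_sum 0) UNIV" for n
      using has_sum_cmult_left[OF row[of n], of "trace_coeff n"] by (simp add: tC_def)
    from has_sum_iterated[OF has_sum_infsum[OF s] this]
    have "((\<lambda>n::nat. 0) has_sum infsum tC UNIV) UNIV" .
    hence "infsum tC UNIV = 0" by (rule has_sum_unique[OF _ has_sum_0]) simp
    thus ?thesis using has_sum_infsum[OF s] by simp
  qed
  have "((\<lambda>i. a * tA i + tB i + (- 1) * tC i) has_sum (a * integral {0..1} (\<lambda>x. \<rho> (x, x)) + 0 + (- 1) * 0)) UNIV"
    by (intro has_sum_add has_sum_cmult_right A B C)
  with total have "(\<integral>p. kernel_op lam a \<rho> p * kernel p \<partial>lebesgue_on open_square) = a * integral {0..1} (\<lambda>x. \<rho> (x, x))"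
    unfolding split using has_sum_unique by fastforce
  moreover have cont: "continuous_on {0..1} (\<lambda>x. a * \<rho> (x, x))"
    by (intro continuous_on_mult continuous_on_const continuous_on_compose2[OF C_infinity_continuous[OF smooth]]
        continuous_on_Pair continuous_on_id) auto
  ultimately show ?thesis unfolding integral_unit_eq_integral(1)[OF cont] by simp
qed

end

section \<open>Uniqueness\<close>

lemma derivs_lincomb:
  assumes "derivs F" "derivs G"
  shows "derivs (\<lambda>i x. \<alpha> * F i x + \<beta> * G i x)"
  using assms unfolding derivs_def
  by (auto intro!: has_vector_derivative_add has_vector_derivative_mult_right)

lemma tensor_in_E:
  assumes F: "derivs F" "F 0 0 = 0" "F 0 1 = 0" "F 1 0 = 0" "F 2 0 = 0" "F 2 1 = 0"
    and G: "derivs G" "G 0 0 = 0" "G 0 1 = 0" "G 2 1 = 0"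
  shows "tensor (F 0) (G 0) \<in> \<E>"
    and "p \<in> closed_square \<Longrightarrow> kernel_op lam a (tensor (F 0) (G 0)) p =
      (F 4 (fst p) + lam * F 2 (fst p) + a * F 0 (fst p)) * G 0 (snd p) - F 0 (fst p) * (G 4 (snd p) + lam * G 2 (snd p))"
proof -
  have x: "(Dx ^^ n) (tensor (F 0) (G 0)) p = tensor (F n) (G 0) p" if "p \<in> closed_square" for n p
    using Dx_pow_tensor[OF F(1) that, of n 0] by simp
  have y: "(Dy ^^ n) (tensor (F 0) (G 0)) p = tensor (F 0) (G n) p" if "p \<in> closed_square" for n p
    using Dy_pow_tensor[OF G(1) that, of n _ 0] by simp
  have x1: "Dx (tensor (F 0) (G 0)) p = tensor (F 1) (G 0) p" if "p \<in> closed_square" for p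
    using x[OF that, of 1] by simp
  show "tensor (F 0) (G 0) \<in> \<E>"
    unfolding \<E>_def using C_infinity_tensor[OF F(1) G(1), of 0 0] F G by (auto simp: x x1 y) (auto simp: tensor_def)
  show "kernel_op lam a (tensor (F 0) (G 0)) p =
      (F 4 (fst p) + lam * F 2 (fst p) + a * F 0 (fst p)) * G 0 (snd p) - F 0 (fst p) * (G 4 (snd p) + lam * G 2 (snd p))"
    if "p \<in> closed_square"
    unfolding kernel_op_def x[OF that] y[OF that] by (simp add: tensor_def algebra_simps)
qed

definition cub_derivs :: "nat \<Rightarrow> real \<Rightarrow> real"
  where "cub_derivs i = (if i = 0 then cub else if i = 1 then cub' else if i = 2 then lin else if i = 3 then (\<lambda>_. - 1) else (\<lambda>_. 0))"

lemma derivs_cub_derivs: "derivs cub_derivs"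
  unfolding derivs_def
proof (intro allI ballI)
  fix i :: nat and x :: real
  consider "i = 0" | "i = 1" | "i = 2" | "i = 3" | "i > 3" by linarith
  thus "(cub_derivs i has_vector_derivative cub_derivs (Suc i) x) (at x within {0..1})"
    by cases (auto simp: cub_derivs_def cub_has_derivative cub'_has_derivative lin_has_derivative simp flip: has_real_derivative_iff_has_vector_derivative)
qed

text \<open>The test functions need \<open>\<rho>\<^sub>x(0, y) = 0\<close>, which no single sine satisfies in \<open>x\<close>, but this difference does.
  In \<open>y\<close> they may have \<open>\<rho>\<^sub>y\<^sub>y(x, 0) \<noteq> 0\<close>, for which \<open>cub\<close> is used.\<close>

definition sine_diff :: "nat \<Rightarrow> nat \<Rightarrow> real \<Rightarrow> real"
  where "sine_diff n i x = (1 / nu n) * sine_deriv n i x + (- 1 / nu 0) * sine_deriv 0 i x"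

lemma derivs_sine_diff: "derivs (sine_diff n)"
  unfolding sine_diff_def[abs_def] by (rule derivs_lincomb[OF derivs_sine_deriv derivs_sine_deriv])

lemma sine_diff_simps:
  "sine_diff n 0 x = 1 / nu n * sine n x - 1 / nu 0 * sine 0 x"
  "sine_diff n 1 0 = 0"
  "sine_diff n 2 x = - (1 / nu n * ((nu n)\<^sup>2 * sine n x) - 1 / nu 0 * ((nu 0)\<^sup>2 * sine 0 x))"
  "sine_diff n 4 x = 1 / nu n * (nu n ^ 4 * sine n x) - 1 / nu 0 * (nu 0 ^ 4 * sine 0 x)"
  unfolding sine_diff_def by (simp_all only: sine_deriv_simps) simp_all

lemma sine_diff_op:
  "sine_diff n 4 x + lam * sine_diff n 2 x + a * sine_diff n 0 x =
    1 / nu n * ((beta lam n + a) * sine n x) - 1 / nu 0 * ((beta lam 0 + a) * sine 0 x)"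
  unfolding sine_diff_simps beta_def by (simp add: algebra_simps)

lemma cub_tensor_sums:
  assumes h: "h \<in> L2 open_square"
  shows "(\<lambda>m. - 2 / nu m ^ 3 * coef h (n, m)) sums (\<integral>p. h p * tensor (sine n) cub p \<partial>lebesgue_on open_square)"
proof -
  have term_cont: "continuous_on closed_square (\<lambda>p. \<Sum>m<N. - 2 / nu m ^ 3 * sine2 (n, m) p)" for N
    by (intro continuous_on_sum continuous_on_mult continuous_on_const continuous_sine2)
  have cont: "continuous_on closed_square (tensor (sine n) cub)"
    by (intro tensor_continuous sine_continuous cub_continuous)
  have "uniform_limit closed_square (\<lambda>N p. \<Sum>m<N. - 2 / nu m ^ 3 * sine2 (n, m) p) (\<lambda>p. \<Sum>m. - 2 / nu m ^ 3 * sine2 (n, m) p) sequentially"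
  proof (rule Weierstrass_m_test[OF _ cube_summable])
    fix m p
    show "norm (- 2 / nu m ^ 3 * sine2 (n, m) p) \<le> \<bar>- 2 / nu m ^ 3\<bar>"
      using mult_left_mono[OF abs_sine2_le_1[of "(n, m)" p], of "\<bar>- 2 / nu m ^ 3\<bar>"] by (simp add: abs_mult)
  qed
  moreover have "(\<Sum>m. - 2 / nu m ^ 3 * sine2 (n, m) p) = tensor (sine n) cub p" if "p \<in> closed_square" for p
  proof -
    have "snd p \<in> {0..1}" using that by auto
    from sums_mult[OF cub_expansion[OF this], of "sine n (fst p)"]
    show ?thesis by (simp add: sums_iff tensor_def mult_ac)
  qed
  ultimately have ul: "uniform_limit closed_square (\<lambda>N p. \<Sum>m<N. - 2 / nu m ^ 3 * sine2 (n, m) p) (tensor (sine n) cub) sequentially"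
    using uniform_limit_cong'[of closed_square "\<lambda>N p. \<Sum>m<N. - 2 / nu m ^ 3 * sine2 (n, m) p" "\<lambda>N p. \<Sum>m<N. - 2 / nu m ^ 3 * sine2 (n, m) p"
        "\<lambda>p. \<Sum>m. - 2 / nu m ^ 3 * sine2 (n, m) p" "tensor (sine n) cub"] by simp
  have "(\<lambda>N. \<integral>p. h p * (\<Sum>m<N. - 2 / nu m ^ 3 * sine2 (n, m) p) \<partial>lebesgue_on open_square) \<longlonglongrightarrow>
      (\<integral>p. h p * tensor (sine n) cub p \<partial>lebesgue_on open_square)"
    by (rule L2_weak_limit[OF h continuous_L2_square[OF term_cont] continuous_L2_square[OF cont] uniform_limit_L2_square[OF ul term_cont cont]])
  moreover have "(\<integral>p. h p * (\<Sum>m<N. - 2 / nu m ^ 3 * sine2 (n, m) p) \<partial>lebesgue_on open_square) = (\<Sum>m<N. - 2 / nu m ^ 3 * coef h (n, m))" for N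
  proof -
    have i: "integrable (lebesgue_on open_square) (\<lambda>p. - 2 / nu m ^ 3 * (h p * sine2 (n, m) p))" for m
      using L2_mult_integrable[OF h continuous_L2_square[OF continuous_sine2], of "(n, m)"] by simp
    have "(\<integral>p. h p * (\<Sum>m<N. - 2 / nu m ^ 3 * sine2 (n, m) p) \<partial>lebesgue_on open_square) =
       (\<integral>p. (\<Sum>m<N. - 2 / nu m ^ 3 * (h p * sine2 (n, m) p)) \<partial>lebesgue_on open_square)"
      by (simp only: sum_distrib_left mult.left_commute)
    also have "\<dots> = (\<Sum>m<N. \<integral>p. - 2 / nu m ^ 3 * (h p * sine2 (n, m) p) \<partial>lebesgue_on open_square)"
      by (rule Bochner_Integration.integral_sum[OF i])
    finally show ?thesis by (simp add: coef_def)
  qed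
  ultimately show ?thesis by (simp add: sums_def)
qed

text \<open>Bessel's inequality: k is paired with its own partial sum T, Cauchy-Schwarz is applied,
  and the common sum of squares is cancelled. The diagonal is enough, because there the gap is the
  constant a.\<close>

lemma coef_diagonal_tendsto_0:
  assumes k: "k \<in> L2 open_square"
  shows "(\<lambda>m. coef k (m, m)) \<longlonglongrightarrow> 0"
proof -
  define c where "c = (\<lambda>m. coef k (m, m))"
  have bessel: "(\<Sum>m<N. (c m)\<^sup>2) \<le> (L2_norm open_square k)\<^sup>2" for N
  proof -
    define T where "T = (\<lambda>p. \<Sum>m<N. c m * sine2 (m, m) p)"
    have Tc: "continuous_on closed_square T"
      unfolding T_def by (intro continuous_on_sum continuous_on_mult continuous_on_const continuous_sine2)
    have TL: "T \<in> L2 open_square" by (rule continuous_L2_square[OF Tc])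
    have expand: "(\<integral>p. h p * T p \<partial>lebesgue_on open_square) = (\<Sum>m<N. c m * coef h (m, m))" if h: "h \<in> L2 open_square" for h
    proof -
      have i: "integrable (lebesgue_on open_square) (\<lambda>p. c m * (h p * sine2 (m, m) p))" for m
        using L2_mult_integrable[OF h continuous_L2_square[OF continuous_sine2], of "(m, m)"] by simp
      have "(\<integral>p. h p * T p \<partial>lebesgue_on open_square) = (\<integral>p. (\<Sum>m<N. c m * (h p * sine2 (m, m) p)) \<partial>lebesgue_on open_square)"
        by (simp only: T_def sum_distrib_left mult.left_commute)
      also have "\<dots> = (\<Sum>m<N. \<integral>p. c m * (h p * sine2 (m, m) p) \<partial>lebesgue_on open_square)"
        by (rule Bochner_Integration.integral_sum[OF i])
      finally show ?thesis by (simp add: coef_def)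
    qed
    have kT: "(\<integral>p. k p * T p \<partial>lebesgue_on open_square) = (\<Sum>m<N. (c m)\<^sup>2)"
      unfolding expand[OF k] by (simp add: c_def power2_eq_square)
    have "coef T (l, l) = c l / 4" if "l < N" for l
    proof -
      have "coef T (l, l) = (\<integral>p. sine2 (l, l) p * T p \<partial>lebesgue_on open_square)" by (simp add: coef_def mult.commute)
      also have "\<dots> = (\<Sum>m<N. c m * coef (sine2 (l, l)) (m, m))"
        by (rule expand[OF continuous_L2_square[OF continuous_sine2]])
      also have "\<dots> = (\<Sum>m<N. if m = l then c l / 4 else 0)"
        unfolding coef_def integral_sine2 by (rule sum.cong) auto
      finally show ?thesis using that by simp
    qed
    hence "(\<Sum>m<N. c m * coef T (m, m)) = (\<Sum>m<N. (c m)\<^sup>2 / 4)"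
      by (intro sum.cong) (auto simp: power2_eq_square)
    hence TT: "(L2_norm open_square T)\<^sup>2 = (\<Sum>m<N. (c m)\<^sup>2) / 4"
      using expand[OF TL] unfolding L2_norm_square by (simp add: power2_eq_square sum_divide_distrib)
    have "\<bar>\<Sum>m<N. (c m)\<^sup>2\<bar> \<le> L2_norm open_square k * L2_norm open_square T"
      using L2_Cauchy_Schwarz[OF k TL] unfolding kT .
    hence "(\<Sum>m<N. (c m)\<^sup>2)\<^sup>2 \<le> (L2_norm open_square k * L2_norm open_square T)\<^sup>2"
      by (intro power_mono) (auto simp: sum_nonneg)
    also have "\<dots> = (L2_norm open_square k)\<^sup>2 * ((\<Sum>m<N. (c m)\<^sup>2) / 4)" by (simp add: power_mult_distrib TT)
    also have "\<dots> \<le> (L2_norm open_square k)\<^sup>2 * (\<Sum>m<N. (c m)\<^sup>2)"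
      by (intro mult_left_mono) (auto simp: sum_nonneg)
    finally have *: "(\<Sum>m<N. (c m)\<^sup>2) * (\<Sum>m<N. (c m)\<^sup>2) \<le> (L2_norm open_square k)\<^sup>2 * (\<Sum>m<N. (c m)\<^sup>2)"
      by (simp add: power2_eq_square)
    show ?thesis
    proof (cases "(\<Sum>m<N. (c m)\<^sup>2) = 0")
      case False
      hence "(\<Sum>m<N. (c m)\<^sup>2) > 0" using sum_nonneg[of "{..<N}" "\<lambda>m. (c m)\<^sup>2"] by force
      with * show ?thesis by (rule mult_right_le_imp_le)
    qed simp
  qed
  have "summable (\<lambda>m. (c m)\<^sup>2)" by (rule summableI_nonneg_bounded[OF _ bessel]) simp
  hence "(\<lambda>m. (c m)\<^sup>2) \<longlonglongrightarrow> 0" by (rule summable_LIMSEQ_zero)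
  from tendsto_real_sqrt[OF this] have "(\<lambda>m. \<bar>c m\<bar>) \<longlonglongrightarrow> 0" by simp
  thus ?thesis by (simp add: c_def tendsto_rabs_zero_iff)
qed

context nonresonant begin

lemma homogeneous_solution_zero:
  assumes k: "k \<in> L2 open_square"
    and eq: "\<And>\<rho>. \<rho> \<in> \<E> \<Longrightarrow> (\<integral>p. kernel_op lam a \<rho> p * k p \<partial>lebesgue_on open_square) = 0"
  shows "AE p in lebesgue_on open_square. k p = 0"
proof -
  have gap_nz: "gap n m \<noteq> 0" for n m using gap_ne by (simp add: gap_def)
  have int: "integrable (lebesgue_on open_square) (\<lambda>p. k p * tensor f g p)" if "continuous_on {0..1} f" "continuous_on {0..1} g" for f g
    by (intro L2_mult_integrable[OF k] continuous_L2_square tensor_continuous that)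
  have test: "(\<integral>p. k p * (tensor (\<lambda>x. 1 / nu n * ((beta lam n + a) * sine n x) - 1 / nu 0 * ((beta lam 0 + a) * sine 0 x)) (G 0) p
        - tensor (\<lambda>x. 1 / nu n * sine n x - 1 / nu 0 * sine 0 x) (\<lambda>y. G 4 y + lam * G 2 y) p) \<partial>lebesgue_on open_square) = 0"
    if G: "derivs G" "G 0 0 = 0" "G 0 1 = 0" "G 2 1 = 0" for n G
  proof -
    have s: "sine_diff n 0 0 = 0" "sine_diff n 0 1 = 0" "sine_diff n 1 0 = 0" "sine_diff n 2 0 = 0" "sine_diff n 2 1 = 0"
      by (simp_all only: sine_diff_simps) simp_all
    note E = tensor_in_E[OF derivs_sine_diff s G]
    have "(\<integral>p. kernel_op lam a (tensor (sine_diff n 0) (G 0)) p * k p \<partial>lebesgue_on open_square) = 0"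
      by (rule eq[OF E(1)])
    moreover have "(\<integral>p. kernel_op lam a (tensor (sine_diff n 0) (G 0)) p * k p \<partial>lebesgue_on open_square) =
      (\<integral>p. k p * (tensor (\<lambda>x. 1 / nu n * ((beta lam n + a) * sine n x) - 1 / nu 0 * ((beta lam 0 + a) * sine 0 x)) (G 0) p
        - tensor (\<lambda>x. 1 / nu n * sine n x - 1 / nu 0 * sine 0 x) (\<lambda>y. G 4 y + lam * G 2 y) p) \<partial>lebesgue_on open_square)"
    proof (rule Bochner_Integration.integral_cong[OF refl])
      fix p assume "p \<in> space (lebesgue_on open_square)"
      hence p: "p \<in> closed_square" using open_square_subset by auto
      show "kernel_op lam a (tensor (sine_diff n 0) (G 0)) p * k p =
        k p * (tensor (\<lambda>x. 1 / nu n * ((beta lam n + a) * sine n x) - 1 / nu 0 * ((beta lam 0 + a) * sine 0 x)) (G 0) p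
        - tensor (\<lambda>x. 1 / nu n * sine n x - 1 / nu 0 * sine 0 x) (\<lambda>y. G 4 y + lam * G 2 y) p)"
        unfolding E(2)[OF p] sine_diff_op unfolding tensor_def sine_diff_simps(1) by (rule mult.commute)
    qed
    ultimately show ?thesis by simp
  qed
  \<comment> \<open>Testing with the difference of two normalised sines shows that the pairing with
    sine n, divided by \<open>nu n\<close>, has the same value for all n as for n = 0.\<close>
  have test': "(\<integral>p. k p * (tensor (sine n) (\<lambda>y. (beta lam n + a) * G 0 y - (G 4 y + lam * G 2 y)) p) \<partial>lebesgue_on open_square) / nu n =
      (\<integral>p. k p * (tensor (sine 0) (\<lambda>y. (beta lam 0 + a) * G 0 y - (G 4 y + lam * G 2 y)) p) \<partial>lebesgue_on open_square) / nu 0"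
    if G: "derivs G" "G 0 0 = 0" "G 0 1 = 0" "G 2 1 = 0" for n G
  proof -
    have Gc: "continuous_on {0..1} (\<lambda>y. (beta lam n + a) * G 0 y - (G 4 y + lam * G 2 y))" for n
      by (intro continuous_on_diff continuous_on_add continuous_on_mult continuous_on_const derivs_continuous[OF G(1)])
    have "(\<integral>p. k p * (tensor (\<lambda>x. 1 / nu n * ((beta lam n + a) * sine n x) - 1 / nu 0 * ((beta lam 0 + a) * sine 0 x)) (G 0) p
        - tensor (\<lambda>x. 1 / nu n * sine n x - 1 / nu 0 * sine 0 x) (\<lambda>y. G 4 y + lam * G 2 y) p) \<partial>lebesgue_on open_square) =
      (\<integral>p. (1 / nu n) * (k p * tensor (sine n) (\<lambda>y. (beta lam n + a) * G 0 y - (G 4 y + lam * G 2 y)) p) -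
        (1 / nu 0) * (k p * tensor (sine 0) (\<lambda>y. (beta lam 0 + a) * G 0 y - (G 4 y + lam * G 2 y)) p) \<partial>lebesgue_on open_square)"
      by (rule arg_cong[where f = "integral\<^sup>L _"]) (simp only: fun_eq_iff tensor_def algebra_simps, simp)
    also have "\<dots> = (1 / nu n) * (\<integral>p. k p * tensor (sine n) (\<lambda>y. (beta lam n + a) * G 0 y - (G 4 y + lam * G 2 y)) p \<partial>lebesgue_on open_square) -
        (1 / nu 0) * (\<integral>p. k p * tensor (sine 0) (\<lambda>y. (beta lam 0 + a) * G 0 y - (G 4 y + lam * G 2 y)) p \<partial>lebesgue_on open_square)"
      using int[OF sine_continuous Gc] by simp
    finally show ?thesis using test[OF G, of n] by simp
  qed
  define \<kappa> where "\<kappa> = (\<lambda>n m. coef k (n, m))"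
  \<comment> \<open>The value common to all rows, taken from row 0. Formally it is, up to sign, the
    m-th sine coefficient of the unknown trace k_xx(0, y).\<close>
  define e where "e = (\<lambda>m. gap 0 m * \<kappa> 0 m / nu 0)"
  have \<kappa>_eq: "\<kappa> n m = nu n * e m / gap n m" for n m
  proof -
    have op: "(beta lam n + a) * sine_deriv m 0 y - (sine_deriv m 4 y + lam * sine_deriv m 2 y) = gap n m * sine m y" for n y
      unfolding sine_deriv_simps gap_def beta_def by (simp add: algebra_simps)
    have int_eq: "(\<integral>p. k p * (tensor (sine n) (\<lambda>y. (beta lam n + a) * sine_deriv m 0 y - (sine_deriv m 4 y + lam * sine_deriv m 2 y)) p) \<partial>lebesgue_on open_square) =
        gap n m * \<kappa> n m" for n
    proof -
      have eq: "k p * (tensor (sine n) (\<lambda>y. (beta lam n + a) * sine_deriv m 0 y - (sine_deriv m 4 y + lam * sine_deriv m 2 y)) p) = gap n m * (k p * sine2 (n, m) p)" for p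
        unfolding op by (simp add: tensor_def)
      show ?thesis unfolding eq \<kappa>_def coef_def by simp
    qed
    have "gap n m * \<kappa> n m / nu n = gap 0 m * \<kappa> 0 m / nu 0"
      using test'[OF derivs_sine_deriv, of m n] unfolding int_eq by (simp add: sine_deriv_simps)
    thus ?thesis using gap_nz[of n m] by (simp add: e_def field_simps)
  qed
  \<comment> \<open>The scaling by \<open>nu m\<close> brings the coefficients into the form used
    for the kernel. On the diagonal the gap is a, so D m is a multiple of the diagonal coefficient
    and tends to 0.\<close>
  define D where "D = (\<lambda>m. nu m * e m)"
  have D_eq: "D m = a * coef k (m, m)" for m
    using \<kappa>_eq[of m m] a_ne_0 by (simp add: D_def \<kappa>_def gap_def)
  have D_lim: "D \<longlonglongrightarrow> 0"
    using tendsto_mult_left[OF coef_diagonal_tendsto_0[OF k], of a] by (simp add: D_eq[abs_def])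
  have "Bseq D" by (rule convergent_imp_Bseq[OF convergentI[OF D_lim]])
  then obtain B where B: "\<And>m. \<bar>D m\<bar> \<le> B" by (metis BseqE real_norm_def)
  define Z where "Z = (\<Sum>m. e m / nu m ^ 3)"
  have e_sum: "(\<lambda>m. e m / nu m ^ 3) sums Z"
  proof -
    have "norm (e m / nu m ^ 3) \<le> B * \<bar>- 2 / nu m ^ 3\<bar>" for m
    proof -
      have "\<bar>e m\<bar> * 1 \<le> \<bar>e m\<bar> * nu m" using nu_ge_1 by (intro mult_left_mono) auto
      hence "\<bar>e m\<bar> \<le> B" using B[of m] nu_pos[of m] by (simp add: D_def abs_mult mult.commute)
      hence "\<bar>e m\<bar> * \<bar>1 / nu m ^ 3\<bar> \<le> B * \<bar>- 2 / nu m ^ 3\<bar>"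
        by (intro mult_mono) (auto simp: abs_mult divide_right_mono)
      thus ?thesis by (simp add: abs_mult)
    qed
    hence "summable (\<lambda>m. e m / nu m ^ 3)"
      by (intro summable_comparison_test'[OF summable_mult[OF cube_summable, of B]])
    thus ?thesis unfolding Z_def by (rule summable_sums)
  qed
  \<comment> \<open>Testing with \<open>cub\<close> in y, whose second derivative at 0 is not 0,
    brings in the condition k_y(x, 0) = 0 in weak form. By \<open>test'\<close> the resulting number
    is the same in every row after division by \<open>nu n\<close>.\<close>
  define T where "T = (\<integral>p. k p * (tensor (sine 0) (\<lambda>y. (beta lam 0 + a) * cub_derivs 0 y - (cub_derivs 4 y + lam * cub_derivs 2 y)) p) \<partial>lebesgue_on open_square) / nu 0"
  have D_sums: "(\<lambda>m. D m / gap n m) sums (- T / 2 - Z)" for n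
  proof -
    let ?I = "\<integral>p. k p * (tensor (sine n) (\<lambda>y. (beta lam n + a) * cub_derivs 0 y - (cub_derivs 4 y + lam * cub_derivs 2 y)) p) \<partial>lebesgue_on open_square"
    have "k p * (tensor (sine n) (\<lambda>y. (beta lam n + a) * cub_derivs 0 y - (cub_derivs 4 y + lam * cub_derivs 2 y)) p) =
        (beta lam n + a) * (k p * tensor (sine n) cub p) - lam * (k p * tensor (sine n) lin p)" for p
      by (simp add: cub_derivs_def tensor_def algebra_simps)
    hence "?I = (beta lam n + a) * (\<integral>p. k p * tensor (sine n) cub p \<partial>lebesgue_on open_square) - lam * (\<integral>p. k p * tensor (sine n) lin p \<partial>lebesgue_on open_square)"
      using int[OF sine_continuous cub_continuous(1)] int[OF sine_continuous lin_continuous] by simp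
    moreover have "?I / nu n = T"
      unfolding T_def by (rule test'[OF derivs_cub_derivs]) (simp_all add: cub_derivs_def cub_def lin_def)
    hence "?I = nu n * T" by (simp add: field_simps)
    moreover have "(\<lambda>m. (beta lam n + a) * (- 2 / nu m ^ 3 * coef k (n, m)) - lam * (2 / nu m * coef k (n, m))) sums
       ((beta lam n + a) * (\<integral>p. k p * tensor (sine n) cub p \<partial>lebesgue_on open_square) - lam * (\<integral>p. k p * tensor (sine n) lin p \<partial>lebesgue_on open_square))"
      by (intro sums_diff sums_mult cub_tensor_sums[OF k] lin_tensor_sums(2)[OF k])
    ultimately have "(\<lambda>m. (beta lam n + a) * (- 2 / nu m ^ 3 * coef k (n, m)) - lam * (2 / nu m * coef k (n, m))) sums (nu n * T)" by simp
    moreover have "(beta lam n + a) * (- 2 / nu m ^ 3 * coef k (n, m)) - lam * (2 / nu m * coef k (n, m)) =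
       (- 2 * nu n) * (e m / nu m ^ 3 + D m / gap n m)" for m
    proof -
      have "beta lam n + a = gap n m + nu m ^ 4 - lam * (nu m)\<^sup>2" by (simp add: gap_def beta_def)
      \<comment> \<open>Writing \<beta> n + a as gap plus \<beta> m isolates the dependence on n: in
        one part the gap cancels the denominator of the coefficient and leaves the row-independent
        series Z, the other part is D m / gap n m.\<close>
      hence h: "(beta lam n + a) / nu m ^ 3 + lam / nu m = gap n m / nu m ^ 3 + nu m"
        using nu_pos[of m] by (simp add: field_simps power2_eq_square power3_eq_cube power4_eq_xxxx)
      have c: "coef k (n, m) = nu n * e m / gap n m" using \<kappa>_eq by (simp add: \<kappa>_def)
      have "(beta lam n + a) * (- 2 / nu m ^ 3 * coef k (n, m)) - lam * (2 / nu m * coef k (n, m)) =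
          - 2 * (nu n * e m / gap n m) * ((beta lam n + a) / nu m ^ 3 + lam / nu m)"
        unfolding c by (simp add: algebra_simps)
      also have "\<dots> = (- 2 * nu n) * (e m / nu m ^ 3 + D m / gap n m)"
        unfolding h using gap_nz[of n m] nu_pos[of m] by (simp add: D_def field_simps)
      finally show ?thesis .
    qed
    ultimately have "(\<lambda>m. (- 2 * nu n) * (e m / nu m ^ 3 + D m / gap n m)) sums (nu n * T)" by simp
    from sums_mult[OF this, of "- 1 / (2 * nu n)"]
    have "(\<lambda>m. e m / nu m ^ 3 + D m / gap n m) sums (- T / 2)" using nu_pos[of n] by (simp add: add.commute)
    from sums_diff[OF this e_sum] show ?thesis by simp
  qed
  define S where "S = - T / 2 - Z"
  have D_S: "D l = - S * cauchy_wt l" for l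
    unfolding S_def by (rule cauchy_system_unique[OF B D_sums])
  have "(\<lambda>l. - S * cauchy_wt l) \<longlonglongrightarrow> - S * - a" by (intro tendsto_mult_left cauchy_wt_tendsto)
  hence "D \<longlonglongrightarrow> S * a" by (simp add: D_S[abs_def])
  with D_lim have "S = 0" using LIMSEQ_unique a_ne_0 by fastforce
  hence "e m = 0" for m using D_S[of m] nu_pos[of m] by (simp add: D_def)
  hence "\<kappa> n m = 0" for n m by (simp add: \<kappa>_eq)
  thus ?thesis by (intro sine_system_complete k) (simp add: \<kappa>_def coef_def)
qed

end

text \<open>Equality of two values of \<open>beta\<close> with distinct indices forces lam = nu n^2
  + nu m^2, an excluded value; a vanishing gap forces a to be a difference of two values of
  \<open>beta\<close>.\<close>

lemma nonresonantI:
  fixes lam a :: real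
  assumes lam: "lam \<notin> {(real j)\<^sup>2 * pi\<^sup>2 + (real k)\<^sup>2 * pi\<^sup>2 | j k :: nat. 1 \<le> j \<and> 1 \<le> k \<and> j \<noteq> k}"
    and a: "a \<notin> {- (real k ^ 4) * pi ^ 4 + lam * (real k)\<^sup>2 * pi\<^sup>2 + real j ^ 4 * pi ^ 4
                  - lam * (real j)\<^sup>2 * pi\<^sup>2 | j k :: nat. 1 \<le> j \<and> 1 \<le> k}"
  shows "nonresonant lam a"
proof
  fix n m :: nat
  show "beta lam n \<noteq> beta lam m" if nm: "n \<noteq> m"
  proof
    assume "beta lam n = beta lam m"
    hence "((nu n)\<^sup>2 - (nu m)\<^sup>2) * ((nu n)\<^sup>2 + (nu m)\<^sup>2 - lam) = 0"
      by (simp add: beta_def algebra_simps power4_eq_xxxx power2_eq_square)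
    moreover have "(nu n)\<^sup>2 \<noteq> (nu m)\<^sup>2" using nm nu_pos[of n] nu_pos[of m]
      by (subst power2_eq_iff_nonneg) (auto simp: nu_def)
    ultimately have "lam = (nu n)\<^sup>2 + (nu m)\<^sup>2" by simp
    also have "\<dots> = (real (Suc n))\<^sup>2 * pi\<^sup>2 + (real (Suc m))\<^sup>2 * pi\<^sup>2" by (simp only: nu_def power_mult_distrib)
    finally show False using lam nm by (smt (verit) Suc_inject Suc_le_mono le0 mem_Collect_eq One_nat_def)
  qed
  show "beta lam n - beta lam m + a \<noteq> 0"
  proof
    assume "beta lam n - beta lam m + a = 0"
    hence "a = beta lam m - beta lam n" by simp
    also have "\<dots> = - (real (Suc n) ^ 4) * pi ^ 4 + lam * (real (Suc n))\<^sup>2 * pi\<^sup>2 + real (Suc m) ^ 4 * pi ^ 4 - lam * (real (Suc m))\<^sup>2 * pi\<^sup>2"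
      by (simp add: beta_def nu_def power_mult_distrib algebra_simps del: of_nat_Suc)
    finally have *: "a = - (real (Suc n) ^ 4) * pi ^ 4 + lam * (real (Suc n))\<^sup>2 * pi\<^sup>2 + real (Suc m) ^ 4 * pi ^ 4 - lam * (real (Suc m))\<^sup>2 * pi\<^sup>2" .
    have "\<exists>j k :: nat. a = - (real k ^ 4) * pi ^ 4 + lam * (real k)\<^sup>2 * pi\<^sup>2 + real j ^ 4 * pi ^ 4
                  - lam * (real j)\<^sup>2 * pi\<^sup>2 \<and> 1 \<le> j \<and> 1 \<le> k"
      \<comment> \<open>Here a is the value of \<open>beta\<close> at m minus that at n, so j
        belongs to m and k to n, both shifted by one.\<close>
      by (rule exI[of _ "Suc m"], rule exI[of _ "Suc n"]) (use * in auto)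
    thus False using a by blast
  qed
qed

theorem theorem2p1:
  fixes lam a :: real
  assumes "lam > 0"
    and "lam \<notin> {(real j)\<^sup>2 * pi\<^sup>2 + (real k)\<^sup>2 * pi\<^sup>2 | j k :: nat. 1 \<le> j \<and> 1 \<le> k \<and> j \<noteq> k}"
    and "a \<notin> {- (real k ^ 4) * pi ^ 4 + lam * (real k)\<^sup>2 * pi\<^sup>2 + real j ^ 4 * pi ^ 4
                  - lam * (real j)\<^sup>2 * pi\<^sup>2 | j k :: nat. 1 \<le> j \<and> 1 \<le> k}"
  shows "\<exists>k. is_solution lam a k \<and>
           (\<forall>k'. is_solution lam a k' \<longrightarrow> (AE p in lebesgue_on open_square. k' p = k p))"
proof -
  interpret nonresonant lam a by (rule nonresonantI[OF assms(2,3)])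
  have G_L2: "k \<in> L2 open_square" if "k \<in> \<G>" for k
  proof -
    have "\<exists>w. has_weak_deriv 0 0 k w" using that by (simp add: \<G>_def H2_def)
    thus ?thesis by (auto simp: has_weak_deriv_def)
  qed
  show ?thesis
  proof (intro exI[of _ kernel] conjI allI impI)
    show "is_solution lam a kernel"
      unfolding is_solution_def kernel_op_def[symmetric] using kernel_in_G kernel_equation by simp
    fix k' assume k': "is_solution lam a k'"
    hence L: "k' \<in> L2 open_square" using G_L2 by (simp add: is_solution_def)
    have "AE p in lebesgue_on open_square. k' p - kernel p = 0"
    proof (rule homogeneous_solution_zero[OF L2_diff[OF L kernel_L2(1)]])
      fix \<rho> assume \<rho>: "\<rho> \<in> \<E>"
      hence h: "kernel_op lam a \<rho> \<in> L2 open_square" by (intro continuous_L2_square kernel_op_continuous) (simp add: \<E>_def)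
      have "(\<integral>p. kernel_op lam a \<rho> p * k' p \<partial>lebesgue_on open_square) = (\<integral>x. a * \<rho> (x, x) \<partial>lebesgue_on unit_open)"
        using k' \<rho> unfolding is_solution_def kernel_op_def[symmetric] by simp
      thus "(\<integral>p. kernel_op lam a \<rho> p * (k' p - kernel p) \<partial>lebesgue_on open_square) = 0"
        using kernel_equation[OF \<rho>] L2_mult_integrable[OF h L] L2_mult_integrable[OF h kernel_L2(1)]
        by (simp add: right_diff_distrib)
    qed
    thus "AE p in lebesgue_on open_square. k' p = kernel p" by eventually_elim simp
  qed
qed

end
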